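(* Let $\alpha\in(1,\infty)$ and let $B:\mathbb R\setminus\{0\}\to\mathbb R$ be an even function that is positive, decreasing and convex on $(0,\infty)$ and satisfies, for some $\varepsilon>0$, $B(t)=\dfrac1{t\ln^\alpha(1/t)}$ for all $t\in(0,\varepsilon)$. For $-\infty<a<b<\infty$ let $G_{a,b}$ be the completion of (real) $L_2(a,b)$ with respect to the scalar product $$\langle f,g\rangle=\iint f(s)g(t)B(s-t)\,ds\,dt,$$ and let $U_t:G_{a,b}\to G_{a+t,b+t}$ ($t\in\mathbb R$) be the extension by continuity of $(U_tf)(s)=f(s-t)$, $f\in L_2(a,b)$. Then $\big((G_{a,b}),(U_t)\big)$ is a sum system.
   Context: "Positive" and "decreasing" are understood in the weak sense. Under the hypotheses $B$ is positively definite, so the scalar product is well defined. $G_{a,b}$ is regarded as a subspace of $G_{a',b'}$ when $(a,b)\subset(a',b')$, the global space $G_{-\infty,+\infty}$ is the union of all $G_{a,b}$, and each $G_{a,b}$ is an FHS-space whose admissible norms are all norms FHS-equivalent to its Hilbert norm. **FHS-spaces.** Two norms $\|\cdot\|_1,\|\cdot\|_2$ on a real linear space $H$, each turning $H$ into a separable Hilbert space, are FHS-equivalent if they define the same topology and there is a (finite or countable) sequence $(e_k)$ that is an orthogonal basis for both norms with $\sum_k(\lambda_k-1)^2<\infty$, where $\lambda_k=\|e_k\|_2/\|e_k\|_1$. An FHS-space is a real linear space $H$ with a full FHS-equivalence class of such norms, called admissible norms. Subspaces are closed linear subspaces, with the inherited FHS structure. $H=H_1\oplus H_2$ (FHS sense)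 means: the subspaces $H_1,H_2$ span $H$ and are orthogonal in some admissible norm. An FHS-isomorphism is a linear bijection carrying admissible norms to admissible norms. **Sum system.** It consists of FHS-spaces $G_{a,b}$ ($-\infty<a<b<\infty$) embedded into a single linear space $G_{-\infty,+\infty}$ and a one-parameter group $(U_t)_{t\in\mathbb R}$ of linear maps of $G_{-\infty,+\infty}$ such that: (a) $G_{a,c}=G_{a,b}\oplus G_{b,c}$ in the FHS sense whenever $a<b<c$ (in particular $G_{a,b},G_{b,c}$ are subspaces of $G_{a,c}$ with inherited FHS structures); (b) $U_t:G_{a,b}\to G_{a+t,b+t}$ is an FHS-isomorphism for all $a<b$ and $t$; (c) $\|U_tx-x\|\to0$ as $t\to0$ whenever $a<b<c<d$ and $x\in G_{b,c}$, the norm being taken in $G_{a,d}$ (meaningful for small $t$). *)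

theory Defs
  imports "HOL-Analysis.Analysis" "HOL-Library.Function_Algebras"
begin

section \<open>FHS-spaces\<close>

text \<open>
  All spaces are linear subspaces of one ambient real vector space type, and a norm on the
  carrier \<open>H\<close> is a real function on the type of which only the restriction to \<open>H\<close> matters.
\<close>

definition inner_product_on :: "'v::real_vector set \<Rightarrow> ('v \<Rightarrow> 'v \<Rightarrow> real) \<Rightarrow> bool" where
  "inner_product_on H ip \<longleftrightarrow>
     (\<forall>x\<in>H. \<forall>y\<in>H. ip x y = ip y x) \<and>
     (\<forall>x\<in>H. \<forall>y\<in>H. \<forall>z\<in>H. ip (x + y) z = ip x z + ip y z) \<and>
     (\<forall>x\<in>H. \<forall>y\<in>H. \<forall>c. ip (c *\<^sub>R x) y = c * ip x y) \<and>
     (\<forall>x\<in>H. x \<noteq> 0 \<longrightarrow> ip x x > 0)"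

text \<open>The value outside \<open>H\<close> is set to 0 because \<^locale>\<open>Metric_space\<close> requires a metric to be
  nonnegative and symmetric on the whole type.\<close>

definition norm_dist :: "'v::real_vector set \<Rightarrow> ('v \<Rightarrow> real) \<Rightarrow> 'v \<Rightarrow> 'v \<Rightarrow> real" where
  "norm_dist H N x y = (if x \<in> H \<and> y \<in> H then N (x - y) else 0)"

definition norm_topology :: "'v::real_vector set \<Rightarrow> ('v \<Rightarrow> real) \<Rightarrow> 'v topology" where
  "norm_topology H N = Metric_space.mtopology H (norm_dist H N)"

definition separable_hilbert_norm :: "'v::real_vector set \<Rightarrow> ('v \<Rightarrow> real) \<Rightarrow> bool" where
  "separable_hilbert_norm H N \<longleftrightarrow>
     subspace H \<and>
     (\<exists>ip. inner_product_on H ip \<and> (\<forall>x\<in>H. N x = sqrt (ip x x))) \<and>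
     Metric_space.mcomplete H (norm_dist H N) \<and>
     separable_space (norm_topology H N)"

text \<open>The scalar product belonging to a Hilbert norm, recovered by polarization.\<close>

definition norm_ip :: "('v::real_vector \<Rightarrow> real) \<Rightarrow> 'v \<Rightarrow> 'v \<Rightarrow> real" where
  "norm_ip N x y = ((N (x + y))\<^sup>2 - (N (x - y))\<^sup>2) / 4"

text \<open>The index set \<open>I\<close> may be any set of natural numbers, so that finite bases (also the
  empty basis of the zero space) and countably infinite ones are covered.\<close>

definition orthogonal_basis ::
    "'v::real_vector set \<Rightarrow> ('v \<Rightarrow> real) \<Rightarrow> nat set \<Rightarrow> (nat \<Rightarrow> 'v) \<Rightarrow> bool" where
  "orthogonal_basis H N I e \<longleftrightarrow>
     e ` I \<subseteq> H - {0} \<and>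
     (\<forall>j\<in>I. \<forall>k\<in>I. j \<noteq> k \<longrightarrow> norm_ip N (e j) (e k) = 0) \<and>
     norm_topology H N closure_of span (e ` I) = H"

definition fhs_equiv :: "'v::real_vector set \<Rightarrow> (('v \<Rightarrow> real) \<times> ('v \<Rightarrow> real)) set" where
  "fhs_equiv H = {(N1, N2).
     separable_hilbert_norm H N1 \<and> separable_hilbert_norm H N2 \<and>
     norm_topology H N1 = norm_topology H N2 \<and>
     (\<exists>I e. orthogonal_basis H N1 I e \<and> orthogonal_basis H N2 I e \<and>
        (\<lambda>k. (N2 (e k) / N1 (e k) - 1)\<^sup>2) summable_on I)}"

text \<open>\<open>fhs_space H A\<close>: the linear space \<open>H\<close> with \<open>A\<close> as its set of admissible norms.\<close>

definition fhs_space :: "'v::real_vector set \<Rightarrow> ('v \<Rightarrow> real) set \<Rightarrow> bool" where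
  "fhs_space H A \<longleftrightarrow> A \<in> {N. separable_hilbert_norm H N} // fhs_equiv H"

definition fhs_subspace :: "'v::real_vector set \<Rightarrow> ('v \<Rightarrow> real) set \<Rightarrow> 'v set \<Rightarrow> bool" where
  "fhs_subspace H A K \<longleftrightarrow>
     subspace K \<and> K \<subseteq> H \<and> (\<forall>N\<in>A. closedin (norm_topology H N) K)"

definition fhs_inherited :: "('v::real_vector \<Rightarrow> real) set \<Rightarrow> 'v set \<Rightarrow> ('v \<Rightarrow> real) set" where
  "fhs_inherited A K = {M. \<exists>N\<in>A. \<forall>x\<in>K. M x = N x}"

text \<open>Orthogonal closed subspaces of a Hilbert space have a closed sum, so the algebraic and
  the closed span agree here.\<close>

definition fhs_direct_sum ::
    "'v::real_vector set \<Rightarrow> ('v \<Rightarrow> real) set \<Rightarrow> 'v set \<Rightarrow> 'v set \<Rightarrow> bool" where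
  "fhs_direct_sum H A H1 H2 \<longleftrightarrow>
     fhs_subspace H A H1 \<and> fhs_subspace H A H2 \<and>
     span (H1 \<union> H2) = H \<and>
     (\<exists>N\<in>A. \<forall>x\<in>H1. \<forall>y\<in>H2. norm_ip N x y = 0)"

definition linear_map_on :: "'v::real_vector set \<Rightarrow> ('v \<Rightarrow> 'w::real_vector) \<Rightarrow> bool" where
  "linear_map_on H f \<longleftrightarrow>
     (\<forall>x\<in>H. \<forall>y\<in>H. f (x + y) = f x + f y) \<and> (\<forall>x\<in>H. \<forall>c. f (c *\<^sub>R x) = c *\<^sub>R f x)"

text \<open>Every function on \<open>H\<close> is, on \<open>H\<close>, of the form \<open>N \<circ> f\<close>, so the last clause says that
  pulling back along \<open>f\<close> is a bijective correspondence between the admissible norms of both spaces.\<close>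

definition fhs_isomorphism ::
    "'v::real_vector set \<Rightarrow> ('v \<Rightarrow> real) set \<Rightarrow>
     'w::real_vector set \<Rightarrow> ('w \<Rightarrow> real) set \<Rightarrow> ('v \<Rightarrow> 'w) \<Rightarrow> bool" where
  "fhs_isomorphism H A H' A' f \<longleftrightarrow>
     linear_map_on H f \<and> bij_betw f H H' \<and> (\<forall>N. N \<in> A' \<longleftrightarrow> N \<circ> f \<in> A)"


section \<open>Sum systems\<close>

text \<open>\<open>V\<close> is the global space and \<open>A a b\<close> the set of admissible norms of \<open>G a b\<close>.\<close>

definition sum_system ::
    "'v::real_vector set \<Rightarrow> (real \<Rightarrow> real \<Rightarrow> 'v set) \<Rightarrow> (real \<Rightarrow> real \<Rightarrow> ('v \<Rightarrow> real) set) \<Rightarrow>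
     (real \<Rightarrow> 'v \<Rightarrow> 'v) \<Rightarrow> bool" where
  "sum_system V G A U \<longleftrightarrow>
     subspace V \<and>
     (\<forall>a b. a < b \<longrightarrow> fhs_space (G a b) (A a b) \<and> G a b \<subseteq> V) \<and>
     (\<forall>t. linear_map_on V (U t) \<and> U t ` V \<subseteq> V) \<and>
     (\<forall>x\<in>V. U 0 x = x) \<and>
     (\<forall>s t. \<forall>x\<in>V. U (s + t) x = U s (U t x)) \<and>
     (\<forall>a b c. a < b \<and> b < c \<longrightarrow>
        fhs_direct_sum (G a c) (A a c) (G a b) (G b c) \<and>
        A a b = fhs_inherited (A a c) (G a b) \<and>
        A b c = fhs_inherited (A a c) (G b c)) \<and>
     (\<forall>a b t. a < b \<longrightarrow>
        fhs_isomorphism (G a b) (A a b) (G (a + t) (b + t)) (A (a + t) (b + t)) (U t)) \<and>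
     (\<forall>a b c d. a < b \<and> b < c \<and> c < d \<longrightarrow>
        (\<forall>x\<in>G b c. \<forall>N\<in>A a d. ((\<lambda>t. N (U t x - x)) \<longlongrightarrow> 0) (at 0)))"


section \<open>Completion with respect to a scalar product\<close>

instantiation "fun" :: (type, real_vector) real_vector
begin

definition scaleR_fun_def: "c *\<^sub>R f = (\<lambda>x. c *\<^sub>R f x)"

instance
  by standard (simp_all add: scaleR_fun_def fun_eq_iff scaleR_add_right scaleR_add_left)

end

lemma scaleR_fun_apply [simp]: "(c *\<^sub>R f) x = c *\<^sub>R f x"
  by (simp add: scaleR_fun_def)

text \<open>
  Let \<open>ip\<close> be a symmetric positive semidefinite bilinear form on a linear space \<open>D\<close>. The completion
  of a subspace \<open>S\<close> of \<open>D\<close> consists of the Cauchy sequences in \<open>S\<close> modulo the null sequences.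
  The class of \<open>f\<close> is represented by the functional \<open>g \<mapsto> lim (ip (f n) g)\<close> on \<open>D\<close>
  (put to 0 outside \<open>D\<close>), which depends only on the class and determines it; this places the
  completions of all subspaces of \<open>D\<close> inside one real vector space, with the completion of
  a smaller subspace contained in that of a larger one. That this is the completion
  (well-defined norm, linear isometric dense embedding, completeness) is proved below.
\<close>

definition ip_norm :: "('a \<Rightarrow> 'a \<Rightarrow> real) \<Rightarrow> 'a \<Rightarrow> real" where
  "ip_norm ip x = sqrt (ip x x)"

definition ip_Cauchy :: "('a::real_vector \<Rightarrow> 'a \<Rightarrow> real) \<Rightarrow> (nat \<Rightarrow> 'a) \<Rightarrow> bool" where
  "ip_Cauchy ip f \<longleftrightarrow> (\<forall>e>0. \<exists>M. \<forall>m\<ge>M. \<forall>n\<ge>M. ip_norm ip (f m - f n) < e)"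

definition completion_point ::
    "'a::real_vector set \<Rightarrow> ('a \<Rightarrow> 'a \<Rightarrow> real) \<Rightarrow> (nat \<Rightarrow> 'a) \<Rightarrow> 'a \<Rightarrow> real" where
  "completion_point D ip f = (\<lambda>g. if g \<in> D then lim (\<lambda>n. ip (f n) g) else 0)"

definition ip_completion ::
    "'a::real_vector set \<Rightarrow> ('a \<Rightarrow> 'a \<Rightarrow> real) \<Rightarrow> 'a set \<Rightarrow> ('a \<Rightarrow> real) set" where
  "ip_completion D ip S = {completion_point D ip f | f. range f \<subseteq> S \<and> ip_Cauchy ip f}"

definition completion_norm ::
    "'a::real_vector set \<Rightarrow> ('a \<Rightarrow> 'a \<Rightarrow> real) \<Rightarrow> ('a \<Rightarrow> real) \<Rightarrow> real" where
  "completion_norm D ip x =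
     (THE r. \<exists>f. range f \<subseteq> D \<and> ip_Cauchy ip f \<and> x = completion_point D ip f \<and>
        (\<lambda>n. ip_norm ip (f n)) \<longlonglongrightarrow> r)"

text \<open>The extension by continuity of a map \<open>T\<close> of \<open>D\<close> to the completion: the class of \<open>(f n)\<close>
  goes to the class of \<open>(T (f n))\<close>, which for a linear isometry \<open>T\<close> does not depend on the
  choice of \<open>(f n)\<close> (lemma \<open>completion_map_point\<close> below).\<close>

definition completion_map ::
    "'a::real_vector set \<Rightarrow> ('a \<Rightarrow> 'a \<Rightarrow> real) \<Rightarrow> ('a \<Rightarrow> 'a) \<Rightarrow> ('a \<Rightarrow> real) \<Rightarrow> ('a \<Rightarrow> real)" where
  "completion_map D ip T x =
     (THE y. \<exists>f. range f \<subseteq> D \<and> ip_Cauchy ip f \<and> x = completion_point D ip f \<and>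
        y = completion_point D ip (\<lambda>n. T (f n)))"


locale psd_form =
  fixes D :: "'a::real_vector set" and ip :: "'a \<Rightarrow> 'a \<Rightarrow> real"
  assumes D: "subspace D"
    and sym: "x \<in> D \<Longrightarrow> y \<in> D \<Longrightarrow> ip x y = ip y x"
    and add: "x \<in> D \<Longrightarrow> y \<in> D \<Longrightarrow> z \<in> D \<Longrightarrow> ip (x + y) z = ip x z + ip y z"
    and scale: "x \<in> D \<Longrightarrow> y \<in> D \<Longrightarrow> ip (c *\<^sub>R x) y = c * ip x y"
    and nonneg: "x \<in> D \<Longrightarrow> 0 \<le> ip x x"
begin

lemmas D_simps [simp] = subspace_add[OF D] subspace_diff[OF D] subspace_scale[OF D] subspace_0[OF D]
  subspace_neg[OF D]

lemma rangeD: "range f \<subseteq> X \<Longrightarrow> f n \<in> X"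
  by auto

lemma diff: "x \<in> D \<Longrightarrow> y \<in> D \<Longrightarrow> z \<in> D \<Longrightarrow> ip (x - y) z = ip x z - ip y z"
  using add[of x "(-1) *\<^sub>R y" z] scale[of y z "-1"] by simp

lemma ip_sum_sq: "x \<in> D \<Longrightarrow> y \<in> D \<Longrightarrow> ip (x + c *\<^sub>R y) (x + c *\<^sub>R y) = ip x x + 2 * c * ip x y + c\<^sup>2 * ip y y"
proof -
  assume xy: "x \<in> D" "y \<in> D"
  have "ip (x + c *\<^sub>R y) (x + c *\<^sub>R y) = ip (x + c *\<^sub>R y) x + c * ip (x + c *\<^sub>R y) y"
    using xy add[of x "c *\<^sub>R y" "x + c *\<^sub>R y"] scale[of y "x + c *\<^sub>R y" c]
      sym[of x "x + c *\<^sub>R y"] sym[of y "x + c *\<^sub>R y"] by simp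
  also have "\<dots> = ip x x + 2 * c * ip x y + c\<^sup>2 * ip y y"
    using xy by (simp add: add scale sym[of y x] algebra_simps power2_eq_square)
  finally show ?thesis .
qed

lemma norm_sq: "x \<in> D \<Longrightarrow> (ip_norm ip x)\<^sup>2 = ip x x"
  by (simp add: ip_norm_def nonneg)

lemma norm_nonneg [simp]: "x \<in> D \<Longrightarrow> 0 \<le> ip_norm ip x"
  by (simp add: ip_norm_def nonneg)

lemma Cauchy_Schwarz: "x \<in> D \<Longrightarrow> y \<in> D \<Longrightarrow> \<bar>ip x y\<bar> \<le> ip_norm ip x * ip_norm ip y"
proof -
  assume xy: "x \<in> D" "y \<in> D"
  have q: "0 \<le> ip x x + 2 * c * ip x y + c\<^sup>2 * ip y y" for c
    using nonneg[of "x + c *\<^sub>R y"] xy by (simp add: ip_sum_sq)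
  have "(ip x y)\<^sup>2 \<le> ip x x * ip y y"
  proof (cases "ip y y = 0")
    case True
    have "ip x y = 0"
    proof (rule ccontr)
      assume n: "ip x y \<noteq> 0"
      show False using q[of "- (ip x x + 1) / (2 * ip x y)"] n True by (simp add: field_simps)
    qed
    then show ?thesis by (simp add: nonneg xy)
  next
    case False
    then have p: "ip y y > 0" using nonneg[of y] xy by simp
    have "0 \<le> (ip x x + 2 * (- ip x y / ip y y) * ip x y + (- ip x y / ip y y)\<^sup>2 * ip y y) * ip y y"
      using q p by (metis mult_nonneg_nonneg less_imp_le)
    also have "\<dots> = ip x x * ip y y - (ip x y)\<^sup>2"
      using p by (simp add: field_simps power2_eq_square)
    finally show ?thesis by simp
  qed
  then have "sqrt ((ip x y)\<^sup>2) \<le> sqrt (ip x x * ip y y)" by (rule real_sqrt_le_mono)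
  then show ?thesis by (simp add: ip_norm_def real_sqrt_mult)
qed

lemma triangle: "x \<in> D \<Longrightarrow> y \<in> D \<Longrightarrow> ip_norm ip (x + y) \<le> ip_norm ip x + ip_norm ip y"
proof -
  assume xy: "x \<in> D" "y \<in> D"
  have "(ip_norm ip (x + y))\<^sup>2 = ip x x + 2 * ip x y + ip y y"
    using xy ip_sum_sq[of x y 1] by (simp add: norm_sq)
  also have "\<dots> \<le> (ip_norm ip x)\<^sup>2 + 2 * (ip_norm ip x * ip_norm ip y) + (ip_norm ip y)\<^sup>2"
    using Cauchy_Schwarz[of x y] xy by (simp add: norm_sq)
  also have "\<dots> = (ip_norm ip x + ip_norm ip y)\<^sup>2" by (simp add: power2_eq_square algebra_simps)
  finally have "(ip_norm ip (x + y))\<^sup>2 \<le> (ip_norm ip x + ip_norm ip y)\<^sup>2" .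
  then show ?thesis by (rule power2_le_imp_le) (use xy in simp)
qed

lemma norm_scale: "x \<in> D \<Longrightarrow> ip_norm ip (c *\<^sub>R x) = \<bar>c\<bar> * ip_norm ip x"
  using ip_sum_sq[of 0 x c] scale[of 0 x 0] scale[of 0 0 0]
  by (simp add: ip_norm_def real_sqrt_mult)

lemma norm_minus: "x \<in> D \<Longrightarrow> y \<in> D \<Longrightarrow> ip_norm ip (x - y) = ip_norm ip (y - x)"
  using norm_scale[of "y - x" "-1"] by (simp del: D_simps add: subspace_diff[OF D])

lemma norm_diff_triangle:
  "x \<in> D \<Longrightarrow> y \<in> D \<Longrightarrow> z \<in> D \<Longrightarrow> ip_norm ip (x - z) \<le> ip_norm ip (x - y) + ip_norm ip (y - z)"
  using triangle[of "x - y" "y - z"] by simp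

lemma norm_diff_abs: "x \<in> D \<Longrightarrow> y \<in> D \<Longrightarrow> \<bar>ip_norm ip x - ip_norm ip y\<bar> \<le> ip_norm ip (x - y)"
  using triangle[of "x - y" y] triangle[of "y - x" x] norm_minus[of x y] by simp

lemma Cauchy_norm_convergent:
  assumes "range f \<subseteq> D" "ip_Cauchy ip f"
  shows "convergent (\<lambda>n. ip_norm ip (f n))"
proof -
  have "Cauchy (\<lambda>n. ip_norm ip (f n))"
  proof (unfold Cauchy_def dist_real_def, intro allI impI)
    fix e :: real assume "e > 0"
    then obtain M where M: "\<And>m n. m \<ge> M \<Longrightarrow> n \<ge> M \<Longrightarrow> ip_norm ip (f m - f n) < e"
      using assms(2) unfolding ip_Cauchy_def by blast
    have "\<bar>ip_norm ip (f m) - ip_norm ip (f n)\<bar> < e" if "m \<ge> M" "n \<ge> M" for m n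
      using norm_diff_abs[of "f m" "f n"] M[OF that] assms(1) by force
    then show "\<exists>M. \<forall>m\<ge>M. \<forall>n\<ge>M. \<bar>ip_norm ip (f m) - ip_norm ip (f n)\<bar> < e" by blast
  qed
  then show ?thesis by (simp add: Cauchy_convergent)
qed

lemma Cauchy_ip_convergent:
  assumes f: "range f \<subseteq> D" "ip_Cauchy ip f" and g: "g \<in> D"
  shows "convergent (\<lambda>n. ip (f n) g)"
proof -
  have "Cauchy (\<lambda>n. ip (f n) g)"
  proof (unfold Cauchy_def dist_real_def, intro allI impI)
    fix e :: real assume e: "e > 0"
    define C where "C = ip_norm ip g + 1"
    have C: "C > 0" "ip_norm ip g \<le> C" using norm_nonneg[OF g] unfolding C_def by linarith+
    obtain M where M: "\<And>m n. m \<ge> M \<Longrightarrow> n \<ge> M \<Longrightarrow> ip_norm ip (f m - f n) < e / C"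
      using f(2) divide_pos_pos[OF e C(1)] unfolding ip_Cauchy_def by blast
    have "\<bar>ip (f m) g - ip (f n) g\<bar> < e" if "m \<ge> M" "n \<ge> M" for m n
    proof -
      have fm: "f m \<in> D" "f n \<in> D" using f(1) by auto
      have "\<bar>ip (f m) g - ip (f n) g\<bar> \<le> ip_norm ip (f m - f n) * ip_norm ip g"
        using Cauchy_Schwarz[of "f m - f n" g] fm g by (simp add: diff)
      also have "\<dots> \<le> ip_norm ip (f m - f n) * C"
        by (rule mult_left_mono[OF C(2)]) (use fm in simp)
      also have "\<dots> < e" using M[OF that] C(1) by (simp add: pos_less_divide_eq)
      finally show ?thesis .
    qed
    then show "\<exists>M. \<forall>m\<ge>M. \<forall>n\<ge>M. \<bar>ip (f m) g - ip (f n) g\<bar> < e" by blast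
  qed
  then show ?thesis by (simp add: Cauchy_convergent)
qed

lemma completion_point_lim:
  assumes "range f \<subseteq> D" "ip_Cauchy ip f" "g \<in> D"
  shows "(\<lambda>n. ip (f n) g) \<longlonglongrightarrow> completion_point D ip f g"
  using Cauchy_ip_convergent[OF assms] assms(3)
  by (simp add: completion_point_def convergent_LIMSEQ_iff)

lemma Cauchy_add:
  assumes "range f \<subseteq> D" "ip_Cauchy ip f" "range g \<subseteq> D" "ip_Cauchy ip g"
  shows "ip_Cauchy ip (\<lambda>n. f n + g n)"
  unfolding ip_Cauchy_def
proof (intro allI impI)
  fix e :: real assume "e > 0"
  then have e: "e / 2 > 0" by simp
  obtain M1 where M1: "\<And>m n. m \<ge> M1 \<Longrightarrow> n \<ge> M1 \<Longrightarrow> ip_norm ip (f m - f n) < e / 2"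
    using assms(2) e unfolding ip_Cauchy_def by blast
  obtain M2 where M2: "\<And>m n. m \<ge> M2 \<Longrightarrow> n \<ge> M2 \<Longrightarrow> ip_norm ip (g m - g n) < e / 2"
    using assms(4) e unfolding ip_Cauchy_def by blast
  have "ip_norm ip (f m + g m - (f n + g n)) < e" if "m \<ge> max M1 M2" "n \<ge> max M1 M2" for m n
  proof -
    have "f m - f n \<in> D" "g m - g n \<in> D" using rangeD[OF assms(1)] rangeD[OF assms(3)] by auto
    then have "ip_norm ip (f m + g m - (f n + g n)) \<le> ip_norm ip (f m - f n) + ip_norm ip (g m - g n)"
      unfolding add_diff_add by (rule triangle)
    also have "\<dots> < e" using M1[of m n] M2[of m n] that by simp
    finally show ?thesis .
  qed
  then show "\<exists>M. \<forall>m\<ge>M. \<forall>n\<ge>M. ip_norm ip (f m + g m - (f n + g n)) < e" by blast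
qed

lemma Cauchy_scale:
  assumes "range f \<subseteq> D" "ip_Cauchy ip f"
  shows "ip_Cauchy ip (\<lambda>n. c *\<^sub>R f n)"
  unfolding ip_Cauchy_def
proof (intro allI impI)
  fix e :: real assume e: "e > 0"
  have "e / (\<bar>c\<bar> + 1) > 0" using e by simp
  then obtain M where M: "\<And>m n. m \<ge> M \<Longrightarrow> n \<ge> M \<Longrightarrow> ip_norm ip (f m - f n) < e / (\<bar>c\<bar> + 1)"
    using assms(2) unfolding ip_Cauchy_def by blast
  have "ip_norm ip (c *\<^sub>R f m - c *\<^sub>R f n) < e" if "m \<ge> M" "n \<ge> M" for m n
  proof -
    have d: "f m - f n \<in> D" using rangeD[OF assms(1)] by simp
    have "ip_norm ip (c *\<^sub>R f m - c *\<^sub>R f n) = \<bar>c\<bar> * ip_norm ip (f m - f n)"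
      unfolding scaleR_right_diff_distrib[symmetric] by (rule norm_scale[OF d])
    also have "\<dots> \<le> (\<bar>c\<bar> + 1) * ip_norm ip (f m - f n)"
      by (rule mult_right_mono) (use norm_nonneg[OF d] in simp_all)
    also have "\<dots> < e"
      using M[OF that] pos_less_divide_eq[of "\<bar>c\<bar> + 1" "ip_norm ip (f m - f n)" e]
      by (simp add: mult.commute)
    finally show ?thesis .
  qed
  then show "\<exists>M. \<forall>m\<ge>M. \<forall>n\<ge>M. ip_norm ip (c *\<^sub>R f m - c *\<^sub>R f n) < e" by blast
qed

lemma Cauchy_const: "x \<in> D \<Longrightarrow> ip_Cauchy ip (\<lambda>_. x)"
  using norm_scale[of 0 0] by (simp add: ip_Cauchy_def)

lemma point_add:
  assumes "range f \<subseteq> D" "ip_Cauchy ip f" "range g \<subseteq> D" "ip_Cauchy ip g"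
  shows "completion_point D ip (\<lambda>n. f n + g n) = completion_point D ip f + completion_point D ip g"
proof
  fix h
  show "completion_point D ip (\<lambda>n. f n + g n) h = (completion_point D ip f + completion_point D ip g) h"
  proof (cases "h \<in> D")
    case True
    have "(\<lambda>n. ip (f n + g n) h) = (\<lambda>n. ip (f n) h + ip (g n) h)"
      using assms True by (intro ext add) auto
    with tendsto_add[OF completion_point_lim[OF assms(1,2) True] completion_point_lim[OF assms(3,4) True]]
    show ?thesis using True by (simp add: completion_point_def limI)
  qed (simp add: completion_point_def)
qed

lemma point_scale:
  assumes "range f \<subseteq> D" "ip_Cauchy ip f"
  shows "completion_point D ip (\<lambda>n. c *\<^sub>R f n) = c *\<^sub>R completion_point D ip f"
proof
  fix h
  show "completion_point D ip (\<lambda>n. c *\<^sub>R f n) h = (c *\<^sub>R completion_point D ip f) h"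
  proof (cases "h \<in> D")
    case True
    have "(\<lambda>n. ip (c *\<^sub>R f n) h) = (\<lambda>n. c * ip (f n) h)"
      using assms True by (intro ext scale) auto
    with tendsto_mult_left[OF completion_point_lim[OF assms True], of c]
    show ?thesis using True by (simp add: completion_point_def limI)
  qed (simp add: completion_point_def)
qed

lemma point_diff:
  assumes "range f \<subseteq> D" "ip_Cauchy ip f" "range g \<subseteq> D" "ip_Cauchy ip g"
  shows "ip_Cauchy ip (\<lambda>n. f n - g n)"
    "completion_point D ip (\<lambda>n. f n - g n) = completion_point D ip f - completion_point D ip g"
proof -
  have r: "range (\<lambda>n. (-1) *\<^sub>R g n) \<subseteq> D" "ip_Cauchy ip (\<lambda>n. (-1) *\<^sub>R g n)"
    using rangeD[OF assms(3)] Cauchy_scale[OF assms(3,4), of "-1"] by auto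
  show "ip_Cauchy ip (\<lambda>n. f n - g n)" using Cauchy_add[OF assms(1,2) r] by simp
  show "completion_point D ip (\<lambda>n. f n - g n) = completion_point D ip f - completion_point D ip g"
    using point_add[OF assms(1,2) r] point_scale[OF assms(3,4), of "-1"] by simp
qed

text \<open>The functional vanishes exactly for null sequences.\<close>

lemma point_zero_iff:
  assumes f: "range f \<subseteq> D" "ip_Cauchy ip f"
  shows "completion_point D ip f = 0 \<longleftrightarrow> (\<lambda>n. ip_norm ip (f n)) \<longlonglongrightarrow> 0"
proof
  assume z: "completion_point D ip f = 0"
  have "Bseq (\<lambda>n. ip_norm ip (f n))"
    using Cauchy_norm_convergent[OF f] by (rule convergent_imp_Bseq)
  then obtain C where C: "C > 0" "\<And>n. \<bar>ip_norm ip (f n)\<bar> \<le> C"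
    by (auto simp: Bseq_def)
  then have C2: "ip_norm ip (f n) \<le> C" for n
    using abs_le_D1 by blast
  have fD: "f n \<in> D" for n using f by auto
  have "(\<lambda>n. ip (f n) (f n)) \<longlonglongrightarrow> 0"
  proof (rule LIMSEQ_I)
    fix e :: real assume e: "e > 0"
    have "e / (2 * C) > 0" using e C by simp
    then obtain M where M: "\<And>m n. m \<ge> M \<Longrightarrow> n \<ge> M \<Longrightarrow> ip_norm ip (f m - f n) < e / (2 * C)"
      using f(2) unfolding ip_Cauchy_def by blast
    have "(\<lambda>n. ip (f n) (f M)) \<longlonglongrightarrow> 0"
      using completion_point_lim[OF f fD[of M]] z by simp
    then obtain K where K: "\<And>n. n \<ge> K \<Longrightarrow> \<bar>ip (f n) (f M)\<bar> < e / 2"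
      using e LIMSEQ_D[of "\<lambda>n. ip (f n) (f M)" 0 "e / 2"] by auto
    have "norm (ip (f n) (f n) - 0) < e" if n: "n \<ge> max M K" for n
    proof -
      have "ip (f n) (f n) = ip (f n - f M) (f n) + ip (f n) (f M)"
        using fD by (simp add: diff sym[of "f M"])
      moreover have "\<bar>ip (f n - f M) (f n)\<bar> \<le> ip_norm ip (f n - f M) * C"
        using Cauchy_Schwarz[of "f n - f M" "f n"] mult_left_mono[OF C2[of n], of "ip_norm ip (f n - f M)"] fD
        by (simp del: D_simps add: subspace_diff[OF D])
      moreover have "ip_norm ip (f n - f M) * C < e / 2"
        using M[of n M] n C(1) by (simp add: field_simps)
      ultimately show ?thesis using K[of n] n by simp
    qed
    then show "\<exists>no. \<forall>n\<ge>no. norm (ip (f n) (f n) - 0) < e" by blast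
  qed
  from tendsto_real_sqrt[OF this] show "(\<lambda>n. ip_norm ip (f n)) \<longlonglongrightarrow> 0"
    by (simp add: ip_norm_def)
next
  assume l: "(\<lambda>n. ip_norm ip (f n)) \<longlonglongrightarrow> 0"
  have "completion_point D ip f g = 0" for g
  proof (cases "g \<in> D")
    case True
    have "(\<lambda>n. ip_norm ip (f n) * ip_norm ip g) \<longlonglongrightarrow> 0"
      using tendsto_mult_right[OF l, of "ip_norm ip g"] by simp
    then have "(\<lambda>n. ip (f n) g) \<longlonglongrightarrow> 0"
      by (rule Lim_null_comparison[rotated])
        (use Cauchy_Schwarz[OF rangeD[OF f(1)] True] in simp)
    then show ?thesis using completion_point_lim[OF f True] LIMSEQ_unique by blast
  qed (simp add: completion_point_def)
  then show "completion_point D ip f = 0" by (simp add: fun_eq_iff)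
qed

lemma completion_point_eq_iff:
  assumes "range f \<subseteq> D" "ip_Cauchy ip f" "range g \<subseteq> D" "ip_Cauchy ip g"
  shows "completion_point D ip f = completion_point D ip g \<longleftrightarrow>
    (\<lambda>n. ip_norm ip (f n - g n)) \<longlonglongrightarrow> 0"
proof -
  have "range (\<lambda>n. f n - g n) \<subseteq> D" using rangeD[OF assms(1)] rangeD[OF assms(3)] by auto
  from point_zero_iff[OF this point_diff(1)[OF assms]] show ?thesis
    by (simp add: point_diff(2)[OF assms])
qed

lemma completion_norm_lim:
  assumes f: "range f \<subseteq> D" "ip_Cauchy ip f"
  shows "(\<lambda>n. ip_norm ip (f n)) \<longlonglongrightarrow> completion_norm D ip (completion_point D ip f)"
proof -
  obtain r where r: "(\<lambda>n. ip_norm ip (f n)) \<longlonglongrightarrow> r"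
    using Cauchy_norm_convergent[OF f] by (auto simp: convergent_def)
  have "completion_norm D ip (completion_point D ip f) = r"
    unfolding completion_norm_def
  proof (rule the_equality)
    show "\<exists>g. range g \<subseteq> D \<and> ip_Cauchy ip g \<and> completion_point D ip f = completion_point D ip g \<and>
        (\<lambda>n. ip_norm ip (g n)) \<longlonglongrightarrow> r"
      using f r by blast
  next
    fix s
    assume "\<exists>g. range g \<subseteq> D \<and> ip_Cauchy ip g \<and> completion_point D ip f = completion_point D ip g \<and>
        (\<lambda>n. ip_norm ip (g n)) \<longlonglongrightarrow> s"
    then obtain g where g: "range g \<subseteq> D" "ip_Cauchy ip g"
      "completion_point D ip f = completion_point D ip g" "(\<lambda>n. ip_norm ip (g n)) \<longlonglongrightarrow> s"
      by blast
    have d: "(\<lambda>n. ip_norm ip (f n - g n)) \<longlonglongrightarrow> 0"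
      using completion_point_eq_iff[OF f g(1,2)] g(3) by simp
    have "(\<lambda>n. ip_norm ip (f n) - ip_norm ip (g n)) \<longlonglongrightarrow> 0"
      by (rule Lim_null_comparison[OF _ d])
        (use norm_diff_abs[OF rangeD[OF f(1)] rangeD[OF g(1)]] in simp)
    moreover have "(\<lambda>n. ip_norm ip (f n) - ip_norm ip (g n)) \<longlonglongrightarrow> r - s"
      using r g(4) by (rule tendsto_diff)
    ultimately show "s = r" using LIMSEQ_unique by fastforce
  qed
  with r show ?thesis by simp
qed

lemma completionE:
  assumes "x \<in> ip_completion D ip S" "S \<subseteq> D"
  obtains f where "range f \<subseteq> S" "range f \<subseteq> D" "ip_Cauchy ip f" "x = completion_point D ip f"
  using assms unfolding ip_completion_def by blast

lemma completion_add:
  assumes S: "subspace S" "S \<subseteq> D" and x: "x \<in> ip_completion D ip S" "y \<in> ip_completion D ip S"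
  shows "x + y \<in> ip_completion D ip S"
proof -
  obtain f where f: "range f \<subseteq> S" "range f \<subseteq> D" "ip_Cauchy ip f" "x = completion_point D ip f"
    using completionE[OF x(1) S(2)] .
  obtain g where g: "range g \<subseteq> S" "range g \<subseteq> D" "ip_Cauchy ip g" "y = completion_point D ip g"
    using completionE[OF x(2) S(2)] .
  have "range (\<lambda>n. f n + g n) \<subseteq> S"
    using subspace_add[OF S(1) rangeD[OF f(1)] rangeD[OF g(1)]] by auto
  moreover have "x + y = completion_point D ip (\<lambda>n. f n + g n)"
    by (simp only: point_add[OF f(2,3) g(2,3)] f(4) g(4))
  ultimately show ?thesis
    unfolding ip_completion_def using Cauchy_add[OF f(2,3) g(2,3)] by blast
qed

lemma completion_scale:
  assumes S: "subspace S" "S \<subseteq> D" and x: "x \<in> ip_completion D ip S"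
  shows "c *\<^sub>R x \<in> ip_completion D ip S"
proof -
  obtain f where f: "range f \<subseteq> S" "range f \<subseteq> D" "ip_Cauchy ip f" "x = completion_point D ip f"
    using completionE[OF x(1) S(2)] .
  have "range (\<lambda>n. c *\<^sub>R f n) \<subseteq> S"
    using subspace_scale[OF S(1) rangeD[OF f(1)]] by auto
  moreover have "c *\<^sub>R x = completion_point D ip (\<lambda>n. c *\<^sub>R f n)"
    by (simp only: point_scale[OF f(2,3)] f(4))
  ultimately show ?thesis
    unfolding ip_completion_def using Cauchy_scale[OF f(2,3)] by blast
qed

lemma completion_embed_in:
  assumes "S \<subseteq> D" "x \<in> S"
  shows "completion_point D ip (\<lambda>_. x) \<in> ip_completion D ip S"
proof -
  have "range (\<lambda>_::nat. x) \<subseteq> S" "ip_Cauchy ip (\<lambda>_. x)" using assms Cauchy_const[of x] by auto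
  then show ?thesis unfolding ip_completion_def by blast
qed

lemma completion_subspace:
  assumes S: "subspace S" "S \<subseteq> D"
  shows "subspace (ip_completion D ip S)"
proof (rule subspaceI)
  have "completion_point D ip (\<lambda>_. 0) \<in> ip_completion D ip S"
    using completion_embed_in[OF S(2)] subspace_0[OF S(1)] by blast
  from completion_scale[OF S this, of 0] show "0 \<in> ip_completion D ip S" by simp
qed (use completion_add[OF S] completion_scale[OF S] in blast)+

lemma completion_mono: "S \<subseteq> T \<Longrightarrow> ip_completion D ip S \<subseteq> ip_completion D ip T"
  unfolding ip_completion_def by blast

text \<open>The embedding of \<open>D\<close> is linear and preserves the norm.\<close>

lemma completion_embed_linear: "linear_map_on D (\<lambda>x. completion_point D ip (\<lambda>_. x))"
  unfolding linear_map_on_def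
proof (intro conjI ballI allI)
  fix x y assume x: "x \<in> D" "y \<in> D"
  show "completion_point D ip (\<lambda>_. x + y) = completion_point D ip (\<lambda>_. x) + completion_point D ip (\<lambda>_. y)"
    using point_add[OF _ Cauchy_const[OF x(1)] _ Cauchy_const[OF x(2)]] x by auto
next
  fix x c assume x: "x \<in> D"
  show "completion_point D ip (\<lambda>_. c *\<^sub>R x) = c *\<^sub>R completion_point D ip (\<lambda>_. x)"
    using point_scale[OF _ Cauchy_const[OF x]] x by auto
qed

lemma completion_embed_norm:
  assumes x: "x \<in> D" shows "completion_norm D ip (completion_point D ip (\<lambda>_. x)) = ip_norm ip x"
proof -
  have "range (\<lambda>_::nat. x) \<subseteq> D" using x by auto
  from completion_norm_lim[OF this Cauchy_const[OF x]] show ?thesis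
    by (simp add: LIMSEQ_const_iff)
qed

text \<open>The norm of the completion is a Hilbert norm.\<close>

lemma ip_polar:
  assumes "x \<in> D" "y \<in> D"
  shows "((ip_norm ip (x + y))\<^sup>2 - (ip_norm ip (x - y))\<^sup>2) / 4 = ip x y"
  using ip_sum_sq[of x y 1] ip_sum_sq[of x y "-1"] assms by (simp add: norm_sq)

lemma completion_ip_lim:
  assumes f: "range f \<subseteq> D" "ip_Cauchy ip f" and g: "range g \<subseteq> D" "ip_Cauchy ip g"
  shows "(\<lambda>n. ip (f n) (g n)) \<longlonglongrightarrow>
    norm_ip (completion_norm D ip) (completion_point D ip f) (completion_point D ip g)"
proof -
  have r: "range (\<lambda>n. f n + g n) \<subseteq> D" "range (\<lambda>n. f n - g n) \<subseteq> D"
    using rangeD[OF f(1)] rangeD[OF g(1)] by auto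
  have a: "(\<lambda>n. ip_norm ip (f n + g n)) \<longlonglongrightarrow>
      completion_norm D ip (completion_point D ip f + completion_point D ip g)"
    using completion_norm_lim[OF r(1) Cauchy_add[OF f g]] by (simp add: point_add[OF f g])
  have b: "(\<lambda>n. ip_norm ip (f n - g n)) \<longlonglongrightarrow>
      completion_norm D ip (completion_point D ip f - completion_point D ip g)"
    using completion_norm_lim[OF r(2) point_diff(1)[OF f g]] by (simp add: point_diff(2)[OF f g])
  have "(\<lambda>n. ((ip_norm ip (f n + g n))\<^sup>2 - (ip_norm ip (f n - g n))\<^sup>2) / 4) \<longlonglongrightarrow>
      norm_ip (completion_norm D ip) (completion_point D ip f) (completion_point D ip g)"
    unfolding norm_ip_def
    by (rule tendsto_divide[OF tendsto_diff[OF tendsto_power[OF a] tendsto_power[OF b]] tendsto_const])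
      simp
  then show ?thesis by (simp only: ip_polar[OF rangeD[OF f(1)] rangeD[OF g(1)]])
qed

lemma completion_norm_sq:
  assumes x: "x \<in> ip_completion D ip D"
  shows "completion_norm D ip x = sqrt (norm_ip (completion_norm D ip) x x)"
proof -
  obtain f where f: "range f \<subseteq> D" "ip_Cauchy ip f" "x = completion_point D ip f"
    using x unfolding ip_completion_def by blast
  from tendsto_real_sqrt[OF completion_ip_lim[OF f(1,2) f(1,2)]]
  have "(\<lambda>n. ip_norm ip (f n)) \<longlonglongrightarrow> sqrt (norm_ip (completion_norm D ip) x x)"
    by (simp only: ip_norm_def f(3))
  then show ?thesis
    using completion_norm_lim[OF f(1,2)] unfolding f(3) by (rule LIMSEQ_unique[rotated])
qed

lemma completion_inner_product:
  "inner_product_on (ip_completion D ip D) (norm_ip (completion_norm D ip))"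
  unfolding inner_product_on_def
proof (intro conjI ballI allI impI)
  let ?I = "norm_ip (completion_norm D ip)" and ?P = "completion_point D ip"
  fix x assume x: "x \<in> ip_completion D ip D"
  then obtain f where f: "range f \<subseteq> D" "ip_Cauchy ip f" "x = ?P f"
    unfolding ip_completion_def by blast
  {
    assume "x \<noteq> 0"
    have nn: "0 \<le> ip_norm ip (f n)" for n using rangeD[OF f(1)] by simp
    have "completion_norm D ip x \<noteq> 0"
      using completion_norm_lim[OF f(1,2)] point_zero_iff[OF f(1,2)] \<open>x \<noteq> 0\<close> f(3) by auto
    moreover have "completion_norm D ip x \<ge> 0"
      using LIMSEQ_le_const[OF completion_norm_lim[OF f(1,2)]] nn f(3) by blast
    ultimately have "sqrt (?I x x) > 0"
      using completion_norm_sq[OF x] by simp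
    then show "?I x x > 0" by simp
  }
  fix y assume "y \<in> ip_completion D ip D"
  then obtain g where g: "range g \<subseteq> D" "ip_Cauchy ip g" "y = ?P g"
    unfolding ip_completion_def by blast
  have fg: "f n \<in> D" "g n \<in> D" for n using f g by auto
  show "?I x y = ?I y x"
    using completion_ip_lim[OF f(1,2) g(1,2)] completion_ip_lim[OF g(1,2) f(1,2)]
    unfolding sym[OF fg] f(3) g(3) by (rule LIMSEQ_unique)
  {
    fix c
    have r: "range (\<lambda>n. c *\<^sub>R f n) \<subseteq> D" using fg by auto
    from completion_ip_lim[OF r Cauchy_scale[OF f(1,2)] g(1,2)]
    have "(\<lambda>n. c * ip (f n) (g n)) \<longlonglongrightarrow> ?I (c *\<^sub>R x) y"
      by (simp add: scale fg point_scale[OF f(1,2)] f(3) g(3))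
    moreover have "(\<lambda>n. c * ip (f n) (g n)) \<longlonglongrightarrow> c * ?I x y"
      unfolding f(3) g(3) by (rule tendsto_mult_left[OF completion_ip_lim[OF f(1,2) g(1,2)]])
    ultimately show "?I (c *\<^sub>R x) y = c * ?I x y" by (rule LIMSEQ_unique)
  next
    fix z assume "z \<in> ip_completion D ip D"
    then obtain h where h: "range h \<subseteq> D" "ip_Cauchy ip h" "z = ?P h"
      unfolding ip_completion_def by blast
    have hD: "h n \<in> D" for n using h by auto
    have r: "range (\<lambda>n. f n + g n) \<subseteq> D" using fg by auto
    from completion_ip_lim[OF r Cauchy_add[OF f(1,2) g(1,2)] h(1,2)]
    have "(\<lambda>n. ip (f n) (h n) + ip (g n) (h n)) \<longlonglongrightarrow> ?I (x + y) z"
      by (simp add: add fg hD point_add[OF f(1,2) g(1,2)] f(3) g(3) h(3))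
    moreover have "(\<lambda>n. ip (f n) (h n) + ip (g n) (h n)) \<longlonglongrightarrow> ?I x z + ?I y z"
      unfolding f(3) g(3) h(3)
      by (rule tendsto_add[OF completion_ip_lim[OF f(1,2) h(1,2)] completion_ip_lim[OF g(1,2) h(1,2)]])
    ultimately show "?I (x + y) z = ?I x z + ?I y z" by (rule LIMSEQ_unique)
  }
qed

lemma completion_norm_triangle:
  assumes "x \<in> ip_completion D ip D" "y \<in> ip_completion D ip D"
  shows "completion_norm D ip (x + y) \<le> completion_norm D ip x + completion_norm D ip y"
proof -
  obtain f where f: "range f \<subseteq> D" "ip_Cauchy ip f" "x = completion_point D ip f"
    using assms unfolding ip_completion_def by blast
  obtain g where g: "range g \<subseteq> D" "ip_Cauchy ip g" "y = completion_point D ip g"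
    using assms unfolding ip_completion_def by blast
  have r: "range (\<lambda>n. f n + g n) \<subseteq> D" using rangeD[OF f(1)] rangeD[OF g(1)] by auto
  have "(\<lambda>n. ip_norm ip (f n + g n)) \<longlonglongrightarrow> completion_norm D ip (x + y)"
    using completion_norm_lim[OF r Cauchy_add[OF f(1,2) g(1,2)]]
    by (simp add: point_add[OF f(1,2) g(1,2)] f(3) g(3))
  moreover have "(\<lambda>n. ip_norm ip (f n) + ip_norm ip (g n)) \<longlonglongrightarrow>
      completion_norm D ip x + completion_norm D ip y"
    unfolding f(3) g(3)
    by (rule tendsto_add[OF completion_norm_lim[OF f(1,2)] completion_norm_lim[OF g(1,2)]])
  ultimately show ?thesis
    by (rule LIMSEQ_le) (use triangle[OF rangeD[OF f(1)] rangeD[OF g(1)]] in blast)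
qed

lemma completion_norm_nonneg:
  assumes "x \<in> ip_completion D ip D" shows "0 \<le> completion_norm D ip x"
proof -
  obtain f where f: "range f \<subseteq> D" "ip_Cauchy ip f" "x = completion_point D ip f"
    using assms unfolding ip_completion_def by blast
  have "0 \<le> ip_norm ip (f n)" for n using rangeD[OF f(1)] by simp
  with LIMSEQ_le_const[OF completion_norm_lim[OF f(1,2)]] show ?thesis unfolding f(3) by blast
qed

lemma completion_norm_zero_iff:
  assumes "x \<in> ip_completion D ip D" shows "completion_norm D ip x = 0 \<longleftrightarrow> x = 0"
proof -
  obtain f where f: "range f \<subseteq> D" "ip_Cauchy ip f" "x = completion_point D ip f"
    using assms unfolding ip_completion_def by blast
  show ?thesis
    using completion_norm_lim[OF f(1,2)] point_zero_iff[OF f(1,2)] LIMSEQ_unique unfolding f(3) by metis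
qed

lemma completion_norm_minus:
  assumes "x \<in> ip_completion D ip D" "y \<in> ip_completion D ip D"
  shows "completion_norm D ip (x - y) = completion_norm D ip (y - x)"
proof -
  obtain f where f: "range f \<subseteq> D" "ip_Cauchy ip f" "x = completion_point D ip f"
    using assms unfolding ip_completion_def by blast
  obtain g where g: "range g \<subseteq> D" "ip_Cauchy ip g" "y = completion_point D ip g"
    using assms unfolding ip_completion_def by blast
  have fg: "f n \<in> D" "g n \<in> D" for n using f g by auto
  have r: "range (\<lambda>n. f n - g n) \<subseteq> D" "range (\<lambda>n. g n - f n) \<subseteq> D" using fg by auto
  have "(\<lambda>n. ip_norm ip (f n - g n)) \<longlonglongrightarrow> completion_norm D ip (x - y)"
    using completion_norm_lim[OF r(1) point_diff(1)[OF f(1,2) g(1,2)]]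
    by (simp only: point_diff(2)[OF f(1,2) g(1,2)] f(3) g(3))
  moreover have "(\<lambda>n. ip_norm ip (g n - f n)) \<longlonglongrightarrow> completion_norm D ip (y - x)"
    using completion_norm_lim[OF r(2) point_diff(1)[OF g(1,2) f(1,2)]]
    by (simp only: point_diff(2)[OF g(1,2) f(1,2)] f(3) g(3))
  ultimately show ?thesis
    unfolding norm_minus[OF fg] by (rule LIMSEQ_unique)
qed

lemma completion_metric_space:
  assumes S: "subspace S" "S \<subseteq> D"
  shows "Metric_space (ip_completion D ip S) (norm_dist (ip_completion D ip S) (completion_norm D ip))"
proof
  let ?H = "ip_completion D ip S" and ?N = "completion_norm D ip"
  note H = subspace_diff[OF completion_subspace[OF D subset_refl]]
  have HD: "x \<in> ?H \<Longrightarrow> x \<in> ip_completion D ip D" for x using completion_mono[OF S(2)] by blast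
  fix x y
  show "0 \<le> norm_dist ?H ?N x y"
    using completion_norm_nonneg[OF H] HD by (simp add: norm_dist_def)
  show "norm_dist ?H ?N x y = norm_dist ?H ?N y x"
    using completion_norm_minus HD by (simp add: norm_dist_def)
  {
    assume "x \<in> ?H" "y \<in> ?H"
    then show "norm_dist ?H ?N x y = 0 \<longleftrightarrow> x = y"
      using completion_norm_zero_iff[OF H] HD by (simp add: norm_dist_def)
  }
  {
    fix z assume z: "x \<in> ?H" "y \<in> ?H" "z \<in> ?H"
    have "?N (x - y + (y - z)) \<le> ?N (x - y) + ?N (y - z)"
      by (rule completion_norm_triangle[OF H H]) (use z HD in auto)
    then show "norm_dist ?H ?N x z \<le> norm_dist ?H ?N x y + norm_dist ?H ?N y z"
      using z by (simp add: norm_dist_def)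
  }
qed

lemma completion_approx:
  assumes f: "range f \<subseteq> D" "ip_Cauchy ip f"
  shows "(\<lambda>m. completion_norm D ip (completion_point D ip f - completion_point D ip (\<lambda>_. f m))) \<longlonglongrightarrow> 0"
proof (rule LIMSEQ_I)
  fix e :: real assume "e > 0"
  then have e: "e / 2 > 0" by simp
  obtain M where M: "\<And>m n. m \<ge> M \<Longrightarrow> n \<ge> M \<Longrightarrow> ip_norm ip (f m - f n) < e / 2"
    using f(2) e unfolding ip_Cauchy_def by blast
  have "norm (completion_norm D ip (completion_point D ip f - completion_point D ip (\<lambda>_. f m)) - 0) < e"
    if m: "m \<ge> M" for m
  proof -
    have g: "range (\<lambda>_::nat. f m) \<subseteq> D" "ip_Cauchy ip (\<lambda>_. f m)"
      using rangeD[OF f(1)] Cauchy_const by auto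
    have r: "range (\<lambda>n. f n - f m) \<subseteq> D" using rangeD[OF f(1)] by auto
    have l: "(\<lambda>n. ip_norm ip (f n - f m)) \<longlonglongrightarrow>
        completion_norm D ip (completion_point D ip f - completion_point D ip (\<lambda>_. f m))" (is "_ \<longlonglongrightarrow> ?c")
      using completion_norm_lim[OF r point_diff(1)[OF f g]] by (simp only: point_diff(2)[OF f g])
    have "?c \<le> e / 2"
      by (rule LIMSEQ_le_const2[OF l]) (use M m less_imp_le in blast)
    moreover have "0 \<le> ?c"
      by (rule LIMSEQ_le_const[OF l]) (use norm_nonneg rangeD[OF r] in blast)
    ultimately show ?thesis using \<open>e > 0\<close> by simp
  qed
  then show "\<exists>no. \<forall>m\<ge>no. norm (completion_norm D ip
      (completion_point D ip f - completion_point D ip (\<lambda>_. f m)) - 0) < e" by blast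
qed

lemma completion_dense:
  assumes S: "subspace S" "S \<subseteq> D"
  shows "norm_topology (ip_completion D ip S) (completion_norm D ip) closure_of
    ((\<lambda>x. completion_point D ip (\<lambda>_. x)) ` S) = ip_completion D ip S"
proof -
  let ?H = "ip_completion D ip S"
  interpret Metric_space ?H "norm_dist ?H (completion_norm D ip)"
    by (rule completion_metric_space[OF S])
  have "\<exists>y\<in>(\<lambda>x. completion_point D ip (\<lambda>_. x)) ` S. y \<in> mball x r" if x: "x \<in> ?H" and r: "r > 0" for x r
  proof -
    obtain f where f: "range f \<subseteq> S" "range f \<subseteq> D" "ip_Cauchy ip f" "x = completion_point D ip f"
      using completionE[OF x S(2)] .
    obtain m0 where m0: "\<forall>m\<ge>m0. norm (completion_norm D ip (x - completion_point D ip (\<lambda>_. f m)) - 0) < r"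
      using LIMSEQ_D[OF completion_approx[OF f(2,3)] r] unfolding f(4) by blast
    have "norm (completion_norm D ip (x - completion_point D ip (\<lambda>_. f m0)) - 0) < r"
      using m0[rule_format, of m0] by simp
    then have m: "completion_norm D ip (x - completion_point D ip (\<lambda>_. f m0)) < r"
      unfolding real_norm_def by linarith
    have "completion_point D ip (\<lambda>_. f m0) \<in> ?H"
      using completion_embed_in[OF S(2) rangeD[OF f(1)]] .
    with m x have "completion_point D ip (\<lambda>_. f m0) \<in> mball x r"
      by (simp add: norm_dist_def)
    then show ?thesis using rangeD[OF f(1)] by blast
  qed
  then show ?thesis unfolding norm_topology_def metric_closure_of by blast
qed

lemma completion_complete:
  assumes S: "subspace S" "S \<subseteq> D"
  shows "Metric_space.mcomplete (ip_completion D ip S)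
    (norm_dist (ip_completion D ip S) (completion_norm D ip))"
proof -
  let ?H = "ip_completion D ip S" and ?N = "completion_norm D ip"
  let ?E = "\<lambda>x. completion_point D ip (\<lambda>_. x)"
  interpret Metric_space ?H "norm_dist ?H ?N"
    by (rule completion_metric_space[OF S])
  have dH: "norm_dist ?H ?N x y = ?N (x - y)" if "x \<in> ?H" "y \<in> ?H" for x y
    using that by (simp add: norm_dist_def)
  show ?thesis unfolding mcomplete_def
  proof (intro allI impI)
    fix \<sigma> assume c: "MCauchy \<sigma>"
    then have sH: "\<sigma> n \<in> ?H" for n unfolding MCauchy_def by blast
    have "\<exists>y\<in>S. norm_dist ?H ?N (\<sigma> n) (?E y) < 1 / (real n + 1)" for n
    proof -
      have p: "1 / (real n + 1) > 0" by simp
      have "\<sigma> n \<in> mtopology closure_of (?E ` S)"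
        using completion_dense[OF S] sH unfolding norm_topology_def by blast
      then obtain y where "y \<in> ?E ` S" "y \<in> mball (\<sigma> n) (1 / (real n + 1))"
        unfolding metric_closure_of using p by blast
      then show ?thesis by auto
    qed
    then obtain s where s: "\<And>n. s n \<in> S" "\<And>n. norm_dist ?H ?N (\<sigma> n) (?E (s n)) < 1 / (real n + 1)"
      by metis
    have EH: "?E (s n) \<in> ?H" for n using completion_embed_in[OF S(2) s(1)] .
    have sS: "range s \<subseteq> S" and sD: "range s \<subseteq> D" using s(1) S(2) by auto
    have E: "ip_norm ip (s m - s n) = norm_dist ?H ?N (?E (s m)) (?E (s n))" for m n
    proof -
      have d: "s m \<in> D" "s n \<in> D" using sD by auto
      have "?E (s m - s n) = ?E (s m) - ?E (s n)"
        by (rule point_diff(2)) (use d Cauchy_const in auto)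
      then show ?thesis using completion_embed_norm[of "s m - s n"] d dH[OF EH EH] by simp
    qed
    have sC: "ip_Cauchy ip s"
      unfolding ip_Cauchy_def
    proof (intro allI impI)
      fix e :: real assume "e > 0"
      then have e: "e / 3 > 0" by simp
      obtain M1 where M1: "\<And>m n. m \<ge> M1 \<Longrightarrow> n \<ge> M1 \<Longrightarrow> norm_dist ?H ?N (\<sigma> m) (\<sigma> n) < e / 3"
        using c e unfolding MCauchy_def by blast
      obtain M2 where M2: "1 / (real M2 + 1) < e / 3"
        using reals_Archimedean[OF e] by (auto simp: inverse_eq_divide add.commute)
      have M2': "1 / (real n + 1) < e / 3" if "n \<ge> M2" for n
        by (rule le_less_trans[OF _ M2]) (use that in \<open>simp add: frac_le\<close>)
      have "ip_norm ip (s m - s n) < e" if mn: "m \<ge> max M1 M2" "n \<ge> max M1 M2" for m n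
      proof -
        have "norm_dist ?H ?N (?E (s m)) (?E (s n)) \<le>
            norm_dist ?H ?N (?E (s m)) (\<sigma> m) + norm_dist ?H ?N (\<sigma> m) (?E (s n))"
          by (rule triangle[OF EH sH EH])
        also have "norm_dist ?H ?N (\<sigma> m) (?E (s n)) \<le>
            norm_dist ?H ?N (\<sigma> m) (\<sigma> n) + norm_dist ?H ?N (\<sigma> n) (?E (s n))"
          by (rule triangle[OF sH sH EH])
        finally show ?thesis
          using M1[of m n] M2'[of m] M2'[of n] s(2)[of m] s(2)[of n] mn
          unfolding E commute[of "?E (s m)" "\<sigma> m"] by simp
      qed
      then show "\<exists>M. \<forall>m\<ge>M. \<forall>n\<ge>M. ip_norm ip (s m - s n) < e" by blast
    qed
    define x where "x = completion_point D ip s"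
    have xH: "x \<in> ?H" unfolding x_def ip_completion_def using sS sC by blast
    have l1: "(\<lambda>n. norm_dist ?H ?N x (?E (s n))) \<longlonglongrightarrow> 0"
      using completion_approx[OF sD sC] unfolding x_def[symmetric] by (simp only: dH[OF xH EH])
    have l2: "(\<lambda>n. 1 / (real n + 1)) \<longlonglongrightarrow> 0"
      using LIMSEQ_inverse_real_of_nat by (simp add: inverse_eq_divide add.commute)
    have "(\<lambda>n. norm_dist ?H ?N (\<sigma> n) x) \<longlonglongrightarrow> 0"
    proof (rule Lim_null_comparison)
      show "(\<lambda>n. 1 / (real n + 1) + norm_dist ?H ?N x (?E (s n))) \<longlonglongrightarrow> 0"
        using tendsto_add[OF l2 l1] by simp
      have "norm (norm_dist ?H ?N (\<sigma> n) x) \<le> 1 / (real n + 1) + norm_dist ?H ?N x (?E (s n))" for n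
        using triangle[OF sH EH xH, of n n] s(2)[of n] unfolding commute[of "?E (s n)" x] by simp
      then show "\<forall>\<^sub>F n in sequentially. norm (norm_dist ?H ?N (\<sigma> n) x)
          \<le> 1 / (real n + 1) + norm_dist ?H ?N x (?E (s n))" by simp
    qed
    then have "limitin mtopology \<sigma> x sequentially"
      unfolding limitin_metric_dist_null using xH sH by simp
    then show "\<exists>x. limitin mtopology \<sigma> x sequentially" by blast
  qed
qed

lemma completion_map_point:
  assumes T: "linear_map_on D T" "T ` D \<subseteq> D" "\<And>x. x \<in> D \<Longrightarrow> ip_norm ip (T x) = ip_norm ip x"
    and f: "range f \<subseteq> D" "ip_Cauchy ip f"
  shows "completion_map D ip T (completion_point D ip f) = completion_point D ip (\<lambda>n. T (f n))"
proof -
  have neg: "T (- x) = - T x" if "x \<in> D" for x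
    using T(1) that unfolding linear_map_on_def by (metis scaleR_minus1_left)
  have Td: "T (x - y) = T x - T y" if "x \<in> D" "y \<in> D" for x y
  proof -
    have "T (x + - y) = T x + T (- y)"
      using T(1) that subspace_neg[OF D that(2)] unfolding linear_map_on_def by blast
    then show ?thesis using neg[OF that(2)] by simp
  qed
  have iso: "ip_norm ip (T x - T y) = ip_norm ip (x - y)" if "x \<in> D" "y \<in> D" for x y
    using T(3)[of "x - y"] Td[OF that] that by simp
  have TC: "range (\<lambda>n. T (g n)) \<subseteq> D" "ip_Cauchy ip (\<lambda>n. T (g n))"
    if g: "range g \<subseteq> D" "ip_Cauchy ip g" for g
  proof -
    show "range (\<lambda>n. T (g n)) \<subseteq> D" using g(1) T(2) by blast
    show "ip_Cauchy ip (\<lambda>n. T (g n))"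
      using g(2) unfolding ip_Cauchy_def iso[OF rangeD[OF g(1)] rangeD[OF g(1)]] .
  qed
  show ?thesis unfolding completion_map_def
  proof (rule the_equality)
    show "\<exists>g. range g \<subseteq> D \<and> ip_Cauchy ip g \<and> completion_point D ip f = completion_point D ip g \<and>
        completion_point D ip (\<lambda>n. T (f n)) = completion_point D ip (\<lambda>n. T (g n))"
      using f by (intro exI[of _ f]) simp
  next
    fix y
    assume "\<exists>g. range g \<subseteq> D \<and> ip_Cauchy ip g \<and> completion_point D ip f = completion_point D ip g \<and>
        y = completion_point D ip (\<lambda>n. T (g n))"
    then obtain g where g: "range g \<subseteq> D" "ip_Cauchy ip g"
      "completion_point D ip f = completion_point D ip g" "y = completion_point D ip (\<lambda>n. T (g n))"
      by blast
    have "(\<lambda>n. ip_norm ip (g n - f n)) \<longlonglongrightarrow> 0"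
      using completion_point_eq_iff[OF g(1,2) f] g(3) by simp
    then have "(\<lambda>n. ip_norm ip (T (g n) - T (f n))) \<longlonglongrightarrow> 0"
      unfolding iso[OF rangeD[OF g(1)] rangeD[OF f(1)]] .
    then show "y = completion_point D ip (\<lambda>n. T (f n))"
      using completion_point_eq_iff[OF TC[OF g(1,2)] TC[OF f]] g(4) by simp
  qed
qed

end


section \<open>The spaces generated by a covariance kernel\<close>

text \<open>Functions on \<open>(a, b)\<close> are extended by 0. Functions equal almost everywhere are not
  identified here; they become equal in the completion.\<close>

definition L2_on :: "real \<Rightarrow> real \<Rightarrow> (real \<Rightarrow> real) set" where
  "L2_on a b = {f. f \<in> borel_measurable lborel \<and> integrable lborel (\<lambda>s. (f s)\<^sup>2) \<and>
     (\<forall>s. s \<notin> {a<..<b} \<longrightarrow> f s = 0)}"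

definition L2_bounded_support :: "(real \<Rightarrow> real) set" where
  "L2_bounded_support = (\<Union>a. \<Union>b\<in>{a<..}. L2_on a b)"

definition kernel_form :: "(real \<Rightarrow> real) \<Rightarrow> (real \<Rightarrow> real) \<Rightarrow> (real \<Rightarrow> real) \<Rightarrow> real" where
  "kernel_form B f g =
     (\<integral>p. f (fst p) * g (snd p) * B (fst p - snd p) \<partial>(lborel \<Otimes>\<^sub>M lborel))"

definition kernel_space :: "(real \<Rightarrow> real) \<Rightarrow> real \<Rightarrow> real \<Rightarrow> ((real \<Rightarrow> real) \<Rightarrow> real) set" where
  "kernel_space B a b = ip_completion L2_bounded_support (kernel_form B) (L2_on a b)"

definition kernel_norm :: "(real \<Rightarrow> real) \<Rightarrow> ((real \<Rightarrow> real) \<Rightarrow> real) \<Rightarrow> real" where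
  "kernel_norm B = completion_norm L2_bounded_support (kernel_form B)"

definition kernel_admissible ::
    "(real \<Rightarrow> real) \<Rightarrow> real \<Rightarrow> real \<Rightarrow> (((real \<Rightarrow> real) \<Rightarrow> real) \<Rightarrow> real) set" where
  "kernel_admissible B a b = fhs_equiv (kernel_space B a b) `` {kernel_norm B}"

definition kernel_global_space :: "(real \<Rightarrow> real) \<Rightarrow> ((real \<Rightarrow> real) \<Rightarrow> real) set" where
  "kernel_global_space B = (\<Union>a. \<Union>b\<in>{a<..}. kernel_space B a b)"

definition kernel_shift ::
    "(real \<Rightarrow> real) \<Rightarrow> real \<Rightarrow> ((real \<Rightarrow> real) \<Rightarrow> real) \<Rightarrow> ((real \<Rightarrow> real) \<Rightarrow> real)" where
  "kernel_shift B t = completion_map L2_bounded_support (kernel_form B) (\<lambda>f s. f (s - t))"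

end

theory Submission
  imports Defs
begin

text \<open>
  Two Hilbert norms on a space are FHS-equivalent iff they are equivalent and the sums
  \<open>\<Sum>\<^sub>i (\<parallel>x\<^sub>i\<parallel>\<^sub>2\<^sup>2 - \<parallel>x\<^sub>i\<parallel>\<^sub>1\<^sup>2)\<^sup>2\<close> over Bessel families \<open>(x\<^sub>i)\<close> of the first norm are bounded; the
  eigenbasis of the difference of the two forms is the required common orthogonal basis. Hence two
  closed subspaces that span the space, meet only in 0 and between which the form is Hilbert-Schmidt
  become orthogonal in some admissible norm: the Hilbert-Schmidt property turns trivial intersection
  into a positive angle, and dropping the cross terms is a Hilbert-Schmidt perturbation.

  For the kernel, let \<open>F\<close> be the indefinite integral of \<open>f\<close>. Taylor's formula writes a convex
  decreasing kernel as a mixture of triangle kernels with weight \<open>B''(r)\<close>, and the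
  triangle kernel of width \<open>r\<close> gives \<open>\<integral> (F(x + r) - F(x))\<^sup>2 dx\<close>. Near 0 one has
  \<open>B''(r) \<approx> r\<^sup>-\<^sup>3 (ln 1/r)\<^sup>-\<^sup>\<alpha>\<close>, so a Hardy inequality bounds
  \<open>\<integral> F(p + u)\<^sup>2 u\<^sup>-\<^sup>2 (ln 1/u)\<^sup>1\<^sup>-\<^sup>\<alpha> du\<close> by the norm of \<open>f\<close> supported on the right of \<open>p\<close>, and
  likewise on the left. The form between the left and the right of \<open>p\<close> is given by the kernel
  \<open>B''(u + v)\<close>; with respect to these weights it is Hilbert-Schmidt, because
  \<open>\<integral> r\<^sup>-\<^sup>1 (ln 1/r)\<^sup>-\<^sup>2 dr\<close> converges at 0. The second derivative exists only near 0, so \<open>B\<close>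
  is approximated from below by smoothed kernels.
\<close>

text \<open>Points of the completion need not be functions, so the trivial intersection of the
  spaces left and right of \<open>p\<close> is not a matter of supports. What survives completion is
  the indefinite integral: \<open>cum f x\<close> is bounded by the norm of \<open>f\<close>. Hence
  two sequences, one from each side, with the same limit have indefinite integrals tending to 0
  uniformly, and the form against the indicator of an interval sees only these integrals.

  The condition \<alpha> > 1 makes \<open>B\<close> integrable at 0 and gives the weight its
  logarithmic power 1 - \<alpha>, which arises by adding up Hardy inequalities over all widths
  \<open>r < u\<close>. One such weight is available on each side of \<open>p\<close>; they enter
  the Hilbert-Schmidt norm through the square of \<open>\<rho> / weight\<close>, in which the powers
  depending on \<alpha> cancel.

  Hilbert-Schmidt bounds are phrased as sums over finite Bessel families and not with operators:
  such sums are estimated for smoothed kernels and square integrable functions and then pass through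
  both limits, from smoothed kernels to \<open>B\<close> and from functions to the
  completion.\<close>

abbreviation (input) sequence_limit :: "(nat \<Rightarrow> 'a::topological_space) \<Rightarrow> 'a \<Rightarrow> bool" (infixr "---->" 60) where
 "X ----> L \<equiv> X \<longlonglongrightarrow> L"

abbreviation (input) lborel2 :: "(real \<times> real) measure" where "lborel2 \<equiv> lborel \<Otimes>\<^sub>M lborel"

section \<open>Positive semidefinite forms and compact forms on Hilbert spaces\<close>

text \<open>Bolzano-Weierstrass one coordinate after the other, thinning out the subsequence each
  time. It makes the coordinates of a maximizing sequence along a finite orthonormal family
  converge.\<close>

lemma subsequence_convergent_finite:
 fixes c :: "'i => nat => real"
 assumes "finite A" "!!i n. i \<in> A ==> \<bar>c i n\<bar> <= K"
 shows "\<exists>r. strict_mono r & (\<forall>i\<in>A. convergent (%n. c i (r n)))"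
 using assms
proof (induction A)
 case empty
 show ?case by (intro exI[of _ id]) (simp add: strict_mono_def)
next
 case (insert j A)
 obtain r where r: "strict_mono r" "\<forall>i\<in>A. convergent (%n. c i (r n))"
  using insert.IH insert.prems by auto
 have "\<forall>n. c j (r n) \<in> {-K..K}"
 proof
  fix n show "c j (r n) \<in> {-K..K}" using insert.prems[of j "r n"] by (simp add: abs_le_iff)
 qed
 then obtain l s where s: "strict_mono s" "((%n. c j (r n)) \<circ> s) ----> l"
  using compact_imp_seq_compact[OF compact_Icc[of "-K" K]] by (metis seq_compactE)
 have "convergent (%n. c i (r (s n)))" if "i \<in> insert j A" for i
 proof (cases "i = j")
  case True
  then show ?thesis using s(2) by (auto simp: convergent_def o_def)
 next
  case False
  then have "convergent (%n. c i (r n))" using r that by auto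
  from convergent_subseq_convergent[OF this s(1)] show ?thesis by (simp add: o_def)
 qed
 moreover have "strict_mono (r \<circ> s)" using r(1) s(1) by (rule strict_mono_o)
 ultimately show ?case by (intro exI[of _ "r \<circ> s"]) (simp add: o_def)
qed

lemma inner_product_onD:
 assumes "inner_product_on H ip"
 shows "x \<in> H ==> y \<in> H ==> ip x y = ip y x"
  and "x \<in> H ==> y \<in> H ==> z \<in> H ==> ip (x + y) z = ip x z + ip y z"
  and "x \<in> H ==> y \<in> H ==> ip (c *\<^sub>R x) y = c * ip x y"
  and "x \<in> H ==> x ~= 0 ==> 0 < ip x x"
 using assms unfolding inner_product_on_def by (elim conjE, simp only: not_False_eq_True simp_thms)+

lemma psd_form_inner_product:
 assumes "subspace H" "inner_product_on H ip"
 shows "psd_form H ip"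
proof (rule psd_form.intro)
 show "subspace H" by fact
 note ip = inner_product_onD[OF assms(2)]
 show "ip x y = ip y x" if "x \<in> H" "y \<in> H" for x y using that by (rule ip(1))
 show "ip (x + y) z = ip x z + ip y z" if "x \<in> H" "y \<in> H" "z \<in> H" for x y z
  using that by (rule ip(2))
 show "ip (c *\<^sub>R x) y = c * ip x y" if "x \<in> H" "y \<in> H" for x y c using that by (rule ip(3))
 show "0 <= ip x x" if "x \<in> H" for x
  using ip(4)[OF that] ip(3)[OF that that, of 0] by (cases "x = 0") (simp_all add: less_imp_le)
qed

definition orthonormal :: "('v => 'v => real) => 'i set => ('i => 'v) => bool" where
 "orthonormal ip A e \<longleftrightarrow> (\<forall>i\<in>A. \<forall>j\<in>A. ip (e i) (e j) = (if i = j then 1 else 0))"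

context psd_form
begin

lemma add_right: "x \<in> D ==> y \<in> D ==> z \<in> D ==> ip z (x + y) = ip z x + ip z y"
 by (simp add: sym[of z] add)

lemma scale_right: "x \<in> D ==> y \<in> D ==> ip y (c *\<^sub>R x) = c * ip y x"
 by (simp add: sym[of y] scale)

lemma diff_right: "x \<in> D ==> y \<in> D ==> z \<in> D ==> ip z (x - y) = ip z x - ip z y"
 by (simp add: sym[of z] diff)

lemma zero_left: "x \<in> D ==> ip 0 x = 0"
 using scale[of 0 x 0] by simp

lemma zero_right: "x \<in> D ==> ip x 0 = 0"
 by (simp add: sym[of x] zero_left)

lemma norm_zero: "ip_norm ip 0 = 0"
 by (simp add: ip_norm_def zero_left)

lemma sum_in: "(!!i. i \<in> A ==> x i \<in> D) ==> (\<Sum>i\<in>A. c i *\<^sub>R x i) \<in> D"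
 by (intro subspace_sum[OF D]) simp

lemma ip_sum_left:
 assumes "!!i. i \<in> A ==> x i \<in> D" "y \<in> D"
 shows "ip (\<Sum>i\<in>A. c i *\<^sub>R x i) y = (\<Sum>i\<in>A. c i * ip (x i) y)"
 using assms(1)
proof (induction A rule: infinite_finite_induct)
 case (insert i A)
 have "(\<Sum>i\<in>A. c i *\<^sub>R x i) \<in> D" by (rule sum_in) (use insert in auto)
 then show ?case using insert assms(2) by (simp add: add scale)
qed (simp_all add: zero_left assms(2))

lemma ip_sum_right:
 assumes "!!i. i \<in> A ==> x i \<in> D" "y \<in> D"
 shows "ip y (\<Sum>i\<in>A. c i *\<^sub>R x i) = (\<Sum>i\<in>A. c i * ip y (x i))"
 using ip_sum_left[OF assms, where c = c] sum_in[OF assms(1), where c = c] assms(1)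
 by (simp add: sym[OF assms(2)])

lemma norm_diff_sq: "x \<in> D ==> y \<in> D ==> ip (x - y) (x - y) = ip x x - 2 * ip x y + ip y y"
 using ip_sum_sq[of x y "-1"] by simp

lemma orthonormal_combination:
 assumes "finite A" "!!i. i \<in> A ==> e i \<in> D" "orthonormal ip A e"
 shows "ip (\<Sum>i\<in>A. c i *\<^sub>R e i) (\<Sum>i\<in>A. d i *\<^sub>R e i) = (\<Sum>i\<in>A. c i * d i)"
proof -
 have "ip (\<Sum>i\<in>A. c i *\<^sub>R e i) (\<Sum>i\<in>A. d i *\<^sub>R e i) = (\<Sum>i\<in>A. c i * (\<Sum>j\<in>A. d j * ip (e i) (e j)))"
  using assms sum_in[of A e d] by (simp add: ip_sum_left ip_sum_right)
 also have "\<dots> = (\<Sum>i\<in>A. c i * d i)"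
 proof (rule sum.cong[OF refl])
  fix i assume i: "i \<in> A"
  have "(\<Sum>j\<in>A. d j * ip (e i) (e j)) = (\<Sum>j\<in>A. if j = i then d j else 0)"
   using i assms(3) by (intro sum.cong) (auto simp: orthonormal_def)
  then show "c i * (\<Sum>j\<in>A. d j * ip (e i) (e j)) = c i * d i"
   using i assms(1) by simp
 qed
 finally show ?thesis .
qed

lemma orthonormal_coeff:
 assumes "finite A" "!!i. i \<in> A ==> e i \<in> D" "orthonormal ip A e" "j \<in> A"
 shows "ip (\<Sum>i\<in>A. c i *\<^sub>R e i) (e j) = c j"
proof -
 have "ip (\<Sum>i\<in>A. c i *\<^sub>R e i) (e j) = (\<Sum>i\<in>A. c i * ip (e i) (e j))"
  using assms by (simp add: ip_sum_left)
 also have "\<dots> = (\<Sum>i\<in>A. if i = j then c i else 0)"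
  using assms(3,4) by (intro sum.cong) (auto simp: orthonormal_def)
 finally show ?thesis using assms by simp
qed

lemma tendsto_ip:
 assumes "range f <= D" "range g <= D" "x \<in> D" "y \<in> D"
  "(%n. ip_norm ip (f n - x)) ----> 0" "(%n. ip_norm ip (g n - y)) ----> 0"
 shows "(%n. ip (f n) (g n)) ----> ip x y"
proof -
 have "(%n. ip (f n) (g n) - ip x y) ----> 0"
 proof (rule Lim_null_comparison)
  show "\<forall>\<^sub>F n in sequentially. norm (ip (f n) (g n) - ip x y) <=
   ip_norm ip (f n - x) * ip_norm ip (g n - y) + ip_norm ip (f n - x) * ip_norm ip y +
   ip_norm ip x * ip_norm ip (g n - y)"
  proof (intro always_eventually allI)
   fix n
   have D: "f n \<in> D" "g n \<in> D" using assms by auto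
   have "ip (f n) (g n) - ip x y = ip (f n - x) (g n - y) + ip (f n - x) y + ip x (g n - y)"
    using D assms by (simp add: diff diff_right)
   then show "norm (ip (f n) (g n) - ip x y) <=
     ip_norm ip (f n - x) * ip_norm ip (g n - y) + ip_norm ip (f n - x) * ip_norm ip y +
     ip_norm ip x * ip_norm ip (g n - y)"
    using Cauchy_Schwarz[of "f n - x" "g n - y"] Cauchy_Schwarz[of "f n - x" y]
     Cauchy_Schwarz[of x "g n - y"] D assms(3,4) by simp
  qed
  show "(%n. ip_norm ip (f n - x) * ip_norm ip (g n - y) + ip_norm ip (f n - x) * ip_norm ip y +
   ip_norm ip x * ip_norm ip (g n - y)) ----> 0"
   by (rule tendsto_eq_intros assms(5,6) refl)+ simp
 qed
 then show ?thesis by (simp add: LIM_zero_iff)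
qed

end

text \<open>Completeness is phrased with sequences and the form alone, so that the spectral argument
  works without a topology; \<open>mcomplete_iff\<close> links it to the metric notion. The form is
  a function on the whole type, so the same form serves all closed subspaces.\<close>

locale hilbert_form = psd_form +
 assumes definite: "x \<in> D ==> ip x x = 0 ==> x = 0"
  and complete: "range f <= D ==> ip_Cauchy ip f ==>
   \<exists>x\<in>D. (%n. ip_norm ip (f n - x)) ----> 0"
begin

lemma closed_subspace_hilbert_form:
 assumes "subspace W" "W <= D"
  "!!f x. range f <= W ==> x \<in> D ==> (%n. ip_norm ip (f n - x)) ----> 0 ==> x \<in> W"
 shows "hilbert_form W ip"
proof (rule hilbert_form.intro[OF psd_form.intro hilbert_form_axioms.intro])
 fix f :: "nat => 'a" assume f: "range f <= W" "ip_Cauchy ip f"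
 then obtain x where "x \<in> D" "(%n. ip_norm ip (f n - x)) ----> 0"
  using complete assms(2) by (meson order_trans)
 then show "\<exists>x\<in>W. (%n. ip_norm ip (f n - x)) ----> 0" using assms(3) f by blast
next
 show "subspace W" by (rule assms)
 show "ip x y = ip y x" if "x \<in> W" "y \<in> W" for x y using sym that assms(2) by blast
 show "ip (x + y) z = ip x z + ip y z" if "x \<in> W" "y \<in> W" "z \<in> W" for x y z
  using add that assms(2) by blast
 show "ip (c *\<^sub>R x) y = c * ip x y" if "x \<in> W" "y \<in> W" for x y c using scale that assms(2) by blast
 show "0 <= ip x x" if "x \<in> W" for x using nonneg that assms(2) by blast
 show "x = 0" if "x \<in> W" "ip x x = 0" for x using definite that assms(2) by blast
qed

text \<open>A minimizing sequence for the distance from \<open>x\<close> to \<open>W\<close> is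
  Cauchy by the parallelogram identity, because midpoints stay in \<open>W\<close>; completeness of
  \<open>W\<close> provides the minimizer. There the first variation of the distance vanishes, which
  is orthogonality.\<close>

lemma projection:
 assumes W: "hilbert_form W ip" "W <= D" and x: "x \<in> D"
 shows "\<exists>p\<in>W. \<forall>w\<in>W. ip (x - p) w = 0"
proof -
 interpret W: hilbert_form W ip by (rule W)
 define S where "S = (%w. ip (x - w) (x - w)) ` W"
 have WD: "w \<in> W ==> w \<in> D" for w using W by auto
 have bdd: "bdd_below S" "S ~= {}"
  unfolding S_def using nonneg x WD W.D_simps(4) by (auto intro!: bdd_belowI[of _ 0] simp del: W.D_simps)
 define d where "d = Inf S"
 have d: "d <= ip (x - w) (x - w)" if "w \<in> W" for w
  unfolding d_def S_def by (rule cINF_lower) (use bdd that in \<open>auto simp: S_def\<close>)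
 have "\<exists>w\<in>W. ip (x - w) (x - w) < d + 1 / (real n + 1)" for n
  using cInf_lessD[OF bdd(2), of "d + 1 / (real n + 1)"] unfolding d_def S_def by auto
 then obtain f where f: "!!n. f n \<in> W" "!!n. ip (x - f n) (x - f n) < d + 1 / (real n + 1)"
  by metis
 have par: "ip (f m - f n) (f m - f n) <= 2 * (1 / (real m + 1)) + 2 * (1 / (real n + 1))" for m n
 proof -
  have D: "f m \<in> D" "f n \<in> D" using f WD by auto
  have "(1/2) *\<^sub>R (f m + f n) \<in> W" using f by simp
  from d[OF this] have "d <= ip (x - (1/2) *\<^sub>R (f m + f n)) (x - (1/2) *\<^sub>R (f m + f n))" .
  also have "\<dots> = (1/2) * ip (x - f m) (x - f m) + (1/2) * ip (x - f n) (x - f n)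
    - (1/4) * ip (f m - f n) (f m - f n)"
   using D x by (simp add: diff diff_right add add_right scale scale_right sym[of "f n" "f m"]
     sym[of "f n" x] sym[of "f m" x] field_simps)
  finally show ?thesis using f(2)[of m] f(2)[of n] by linarith
 qed
 have "ip_Cauchy ip f"
  unfolding ip_Cauchy_def
 proof (intro allI impI)
  fix e :: real assume e: "e > 0"
  then have "e\<^sup>2 / 4 > 0" by simp
  from reals_Archimedean[OF this] obtain M where M: "1 / (real M + 1) < e\<^sup>2 / 4"
   by (auto simp: inverse_eq_divide add.commute)
  have M': "1 / (real n + 1) < e\<^sup>2 / 4" if "n \<ge> M" for n
   by (rule le_less_trans[OF _ M]) (use that in \<open>simp add: frac_le\<close>)
  have "ip_norm ip (f m - f n) < e" if "m \<ge> M" "n \<ge> M" for m n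
  proof -
   have "ip (f m - f n) (f m - f n) < e\<^sup>2"
    using par[of m n] M'[OF that(1)] M'[OF that(2)] by linarith
   then show ?thesis unfolding ip_norm_def using e real_sqrt_less_iff[of _ "e\<^sup>2"] by simp
  qed
  then show "\<exists>M. \<forall>m\<ge>M. \<forall>n\<ge>M. ip_norm ip (f m - f n) < e" by blast
 qed
 then obtain p where p: "p \<in> W" "(%n. ip_norm ip (f n - p)) ----> 0"
  using W.complete[of f] f(1) by (auto simp: image_subset_iff)
 have le: "ip (x - p) (x - p) <= d"
 proof (rule LIMSEQ_le)
  have n: "(%n. ip_norm ip ((x - f n) - (x - p))) ----> 0"
  proof -
   have "ip_norm ip ((x - f n) - (x - p)) = ip_norm ip (f n - p)" for n
    using norm_minus[of p "f n"] f p WD by simp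
   then show ?thesis using p(2) by simp
  qed
  show "(%n. ip (x - f n) (x - f n)) ----> ip (x - p) (x - p)"
   by (rule tendsto_ip[OF _ _ _ _ n n]) (use f x p WD in auto)
  have "(%n. d + 1 / (real n + 1)) ----> d + 0"
   using LIMSEQ_inverse_real_of_nat by (intro tendsto_add) (auto simp: inverse_eq_divide add.commute)
  then show "(%n. d + 1 / (real n + 1)) ----> d" by simp
  show "\<exists>N. \<forall>n\<ge>N. ip (x - f n) (x - f n) <= d + 1 / (real n + 1)" using f(2) less_imp_le by blast
 qed
 have "ip (x - p) w = 0" if w: "w \<in> W" for w
 proof -
  have D: "x - p \<in> D" "w \<in> D" using x p w WD by auto
  \<comment> \<open>A quadratic polynomial in \<open>c\<close> without constant term that is never
    negative has no linear term; below it is evaluated at its minimum.\<close>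
  have q: "0 <= 2 * c * ip (x - p) w + c\<^sup>2 * ip w w" for c
  proof -
   have "p - c *\<^sub>R w \<in> W" using p w by simp
   from d[OF this] have "d <= ip (x - p + c *\<^sub>R w) (x - p + c *\<^sub>R w)" by (simp add: algebra_simps)
   then show ?thesis using le ip_sum_sq[OF D, of c] by simp
  qed
  show ?thesis
  proof (cases "ip w w = 0")
   case True
   then show ?thesis using q[of 1] q[of "-1"] by simp
  next
   case False
   then have p0: "ip w w > 0" using nonneg[OF D(2)] by simp
   have "0 <= - ((ip (x - p) w)^2 / ip w w)"
    using q[of "- ip (x - p) w / ip w w"] p0 by (simp add: field_simps power2_eq_square)
   then show ?thesis using p0 by (simp add: divide_le_0_iff)
  qed
 qed
 then show ?thesis using p by blast
qed

end

section \<open>Eigenvectors of Hilbert-Schmidt forms\<close>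

definition symmetric_bilinear_on :: "'v::real_vector set => ('v => 'v => real) => bool" where
 "symmetric_bilinear_on H b \<longleftrightarrow>
  (\<forall>x\<in>H. \<forall>y\<in>H. b x y = b y x) \<and>
  (\<forall>x\<in>H. \<forall>y\<in>H. \<forall>z\<in>H. b (x + y) z = b x z + b y z) \<and>
  (\<forall>x\<in>H. \<forall>y\<in>H. \<forall>c. b (c *\<^sub>R x) y = c * b x y)"

lemma symmetric_bilinear_onD:
 assumes "symmetric_bilinear_on H b"
 shows "x \<in> H ==> y \<in> H ==> b x y = b y x"
  and "x \<in> H ==> y \<in> H ==> z \<in> H ==> b (x + y) z = b x z + b y z"
  and "x \<in> H ==> y \<in> H ==> b (c *\<^sub>R x) y = c * b x y"
 using assms unfolding symmetric_bilinear_on_def by (elim conjE, simp only:)+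

lemma symmetric_bilinear_on_subset:
 "symmetric_bilinear_on H b ==> K <= H ==> symmetric_bilinear_on K b"
 unfolding symmetric_bilinear_on_def by (meson subset_iff)

context psd_form
begin

text \<open>Makes Cauchy-Schwarz available for \<open>m * ip - s * b\<close>. This is how one-sided
  information about the diagonal of \<open>b\<close> is turned into statements off the
  diagonal.\<close>

lemma psd_form_combination:
 assumes b: "symmetric_bilinear_on D b" and nn: "!!x. x \<in> D ==> s * b x x <= m * ip x x"
 shows "psd_form D (%x y. m * ip x y - s * b x y)"
proof (rule psd_form.intro)
 note b = symmetric_bilinear_onD[OF b]
 show "subspace D" by (rule D)
 show "m * ip x y - s * b x y = m * ip y x - s * b y x" if "x \<in> D" "y \<in> D" for x y
  by (simp only: sym[OF that] b(1)[OF that])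
 show "m * ip (x + y) z - s * b (x + y) z = m * ip x z - s * b x z + (m * ip y z - s * b y z)"
  if "x \<in> D" "y \<in> D" "z \<in> D" for x y z
  by (simp add: add[OF that] b(2)[OF that] algebra_simps)
 show "m * ip (c *\<^sub>R x) y - s * b (c *\<^sub>R x) y = c * (m * ip x y - s * b x y)"
  if "x \<in> D" "y \<in> D" for x y c
  by (simp add: scale[OF that] b(3)[OF that] algebra_simps)
 show "0 <= m * ip x x - s * b x x" if "x \<in> D" for x using nn[OF that] by simp
qed

lemma orthonormal_insert:
 assumes e: "orthonormal ip A e" "!!i. i \<in> A ==> e i \<in> D" "j \<notin> A"
  and z: "z \<in> D" "ip z z = 1" "!!i. i \<in> A ==> ip z (e i) = 0"
 shows "orthonormal ip (insert j A) (e(j := z))"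
 unfolding orthonormal_def
proof (intro ballI)
 fix i k assume ik: "i \<in> insert j A" "k \<in> insert j A"
 consider "i = j" "k = j" | "i = j" "k \<in> A" "k ~= j" | "k = j" "i \<in> A" "i ~= j" | "i \<in> A" "k \<in> A" "i ~= j" "k ~= j"
  using ik e(3) by blast
 then show "ip ((e(j := z)) i) ((e(j := z)) k) = (if i = k then 1 else 0)"
 proof cases
  case 3
  have "ip (e i) z = 0" using sym[OF z(1) e(2)[OF 3(2)]] z(3)[OF 3(2)] by simp
  with 3 show ?thesis by simp
 next
  case 4
  then show ?thesis using e(1) unfolding orthonormal_def by simp
 qed (use z in simp_all)
qed

end

context hilbert_form
begin

lemma normalize: "x \<in> D ==> x ~= 0 ==> ip ((1 / ip_norm ip x) *\<^sub>R x) ((1 / ip_norm ip x) *\<^sub>R x) = 1"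
proof -
 assume x: "x \<in> D" "x ~= 0"
 then have "ip x x > 0" using definite nonneg[of x] by (metis less_eq_real_def)
 then show ?thesis using x norm_sq[of x]
  by (simp add: scale scale_right power2_eq_square[symmetric] power_divide ip_norm_def)
qed

text \<open>A near-optimal orthonormal family absorbs all of the Hilbert--Schmidt norm but a small rest;
  orthogonally to it the form is small, which makes a maximizing sequence Cauchy once its finitely
  many remaining coordinates converge.\<close>

lemma maximum_attained:
 assumes b: "symmetric_bilinear_on D b" and bdd: "!!x. x \<in> D ==> \<bar>b x x\<bar> <= C * ip x x"
  and hs: "!!(A :: nat set) e. finite A ==> e ` A <= D ==> orthonormal ip A e ==>
   (\<Sum>i\<in>A. (b (e i) (e i))^2) <= M"
  and x0: "x0 \<in> D" "b x0 x0 > 0"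
 shows "\<exists>e\<in>D. ip e e = 1 & (\<forall>x\<in>D. b x x <= b e e * ip x x)"
proof -
 note bD = symmetric_bilinear_onD[OF b]
 have bs: "b (c *\<^sub>R x) (c *\<^sub>R x) = c\<^sup>2 * b x x" if "x \<in> D" for c x
  using bD(3)[OF that, of "c *\<^sub>R x" c] bD(3)[OF that that, of c] bD(1)[of x "c *\<^sub>R x"] that
  by (simp add: power2_eq_square)
 define S where "S = (%x. b x x) ` {x\<in>D. ip x x = 1}"
 have b00: "b 0 0 = 0" using bD(3)[of 0 0 0] D_simps(4) by simp
 then have "x0 ~= 0" using x0 by auto
 define x1 where "x1 = (1 / ip_norm ip x0) *\<^sub>R x0"
 have nx0: "ip_norm ip x0 > 0" using definite[OF x0(1)] \<open>x0 ~= 0\<close> nonneg[OF x0(1)]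
  unfolding ip_norm_def by (auto simp: less_le)
 have x1: "x1 \<in> D" "ip x1 x1 = 1" "b x1 x1 > 0"
  using x0 normalize[OF x0(1) \<open>x0 ~= 0\<close>] nx0 unfolding x1_def by (simp_all add: bs)
 have bddS: "bdd_above S" unfolding S_def using bdd by (intro bdd_aboveI[of _ C]) force
 define \<mu> where "\<mu> = Sup S"
 have mu: "b x x <= \<mu>" if "x \<in> D" "ip x x = 1" for x
  unfolding \<mu>_def using bddS that by (intro cSup_upper) (auto simp: S_def)
 have mu0: "\<mu> > 0" using mu[OF x1(1,2)] x1(3) by simp
 have mu': "b x x <= \<mu> * ip x x" if x: "x \<in> D" for x
 proof (cases "x = 0")
  case False
  have p: "ip x x > 0" using definite[OF x] False nonneg[OF x] by (auto simp: less_le)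
  have "b x x / ip x x <= \<mu>"
   using mu[of "(1 / ip_norm ip x) *\<^sub>R x"] normalize[OF x False] x
   by (simp add: bs power_divide norm_sq)
  then show ?thesis using p by (simp add: field_simps)
 qed (simp add: b00 zero_left)
 \<comment> \<open>\<open>Q\<close> is positive semidefinite, and a unit vector maximizes
   \<open>b\<close> exactly when \<open>Q\<close> vanishes on it. The sequence below is small for
   \<open>Q\<close>; what has to be found is a limit in the original norm.\<close>
 define Q where "Q = (%x y. \<mu> * ip x y - 1 * b x y)"
 interpret Q: psd_form D Q unfolding Q_def by (rule psd_form_combination[OF b]) (simp add: mu')
 have "\<exists>x\<in>D. ip x x = 1 & \<mu> - 1 / (real n + 1) < b x x" for n
  using less_cSupD[of S "\<mu> - 1 / (real n + 1)"] x1 unfolding \<mu>_def[symmetric]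
  by (auto simp: S_def)
 then obtain x where x: "!!n. x n \<in> D" "!!n. ip (x n) (x n) = 1" "!!n. \<mu> - 1 / (real n + 1) < b (x n) (x n)"
  by metis
 define T where "T = {(\<Sum>i\<in>A. (b (e i) (e i))^2) | (A :: nat set) e.
   finite A & e ` A <= D & orthonormal ip A e}"
 have "(\<Sum>i\<in>{}. (b (x i) (x i))^2) \<in> T" unfolding T_def by (intro CollectI exI[of _ "{}"] exI[of _ x])
   (simp add: orthonormal_def)
 then have Tne: "T ~= {}" by blast
 have bddT: "bdd_above T" unfolding T_def using hs by (intro bdd_aboveI[of _ M]) auto
 \<comment> \<open>The deficit is chosen so that adjoining a unit vector \<open>z\<close> orthogonal
   to the family with \<open>b z z\<close> above \<open>\<mu> / 2\<close> would push the sum of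
   squares beyond its supremum.\<close>
 have "Sup T - (\<mu> / 2)^2 < Sup T" using mu0 by simp
 then obtain t where "t \<in> T" "Sup T - (\<mu> / 2)^2 < t" using less_cSupD[OF Tne] by blast
 then obtain A e where A: "finite (A :: nat set)" "e ` A <= D" "orthonormal ip A e"
  "Sup T - (\<mu> / 2)^2 < (\<Sum>i\<in>A. (b (e i) (e i))^2)" unfolding T_def by blast
 have eD: "i \<in> A ==> e i \<in> D" for i using A by auto
 have small1: "b z z <= \<mu> / 2" if z: "z \<in> D" "ip z z = 1" "!!i. i \<in> A ==> ip z (e i) = 0" for z
 proof -
  obtain j where j: "j \<notin> A" using A(1) by (metis ex_new_if_finite infinite_UNIV_nat)
  have "(\<Sum>i\<in>insert j A. (b ((e(j := z)) i) ((e(j := z)) i))^2) \<in> T"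
   unfolding T_def using orthonormal_insert[OF A(3) eD j z] A(1,2) z(1) j
   by (intro CollectI exI[of _ "insert j A"] exI[of _ "e(j := z)"]) auto
  from cSup_upper[OF this bddT]
  have "(b z z)^2 + (\<Sum>i\<in>A. (b ((e(j := z)) i) ((e(j := z)) i))^2) <= Sup T"
   using A(1) j by simp
  also have "(\<Sum>i\<in>A. (b ((e(j := z)) i) ((e(j := z)) i))^2) = (\<Sum>i\<in>A. (b (e i) (e i))^2)"
   using j by (intro sum.cong) auto
  finally have "(b z z)^2 <= (\<mu> / 2)^2" using A(4) by linarith
  then show ?thesis using mu0 by (simp add: power2_le_iff_abs_le)
 qed
 \<comment> \<open>On the orthogonal complement of the family \<open>Q\<close> therefore controls
   the norm from above, so smallness for \<open>Q\<close> there is smallness in norm.\<close>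
 have small: "\<mu> / 2 * ip z z <= Q z z" if z: "z \<in> D" "!!i. i \<in> A ==> ip z (e i) = 0" for z
 proof (cases "z = 0")
  case False
  have p: "ip z z > 0" using definite[OF z(1)] False nonneg[OF z(1)] by (auto simp: less_le)
  have "b z z / ip z z <= \<mu> / 2"
   using small1[of "(1 / ip_norm ip z) *\<^sub>R z"] normalize[OF z(1) False] z eD
   by (simp add: bs scale power_divide norm_sq)
  then show ?thesis using p by (simp add: Q_def field_simps)
 qed (simp add: Q.zero_left zero_left)
 have cb: "\<bar>ip (x n) (e i)\<bar> <= 1" if "i \<in> A" for i n
  using Cauchy_Schwarz[OF x(1)[of n] eD[OF that]] x(2)[of n] A(3) that
  by (simp add: ip_norm_def orthonormal_def)
 obtain r where r: "strict_mono r" "\<forall>i\<in>A. convergent (%n. ip (x (r n)) (e i))"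
  using subsequence_convergent_finite[OF A(1), of "%i n. ip (x n) (e i)" 1] cb by blast
 define y where "y = (%n. x (r n))"
 define p where "p = (%n. \<Sum>i\<in>A. ip (y n) (e i) *\<^sub>R e i)"
 define z where "z = (%n. y n - p n)"
 have yD: "y n \<in> D" for n unfolding y_def using x by simp
 have pD: "p n \<in> D" for n unfolding p_def by (rule sum_in) (rule eD)
 have zD: "z n \<in> D" for n unfolding z_def using yD pD by simp
 have zorth: "ip (z n) (e i) = 0" if "i \<in> A" for i n
  unfolding z_def using orthonormal_coeff[OF A(1) eD A(3) that] yD[of n] pD[of n] eD[OF that]
  by (simp add: diff p_def)
 have Qy: "(%n. Q (y n) (y n)) ----> 0"
 proof (rule tendsto_sandwich[of "%_. 0" _ _ "%n. 1 / (real n + 1)"])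
  have "Q (y n) (y n) <= 1 / (real n + 1)" for n
  proof -
   have "Q (y n) (y n) <= 1 / (real (r n) + 1)"
    unfolding Q_def y_def using x(2)[of "r n"] x(3)[of "r n"] by simp
   also have "\<dots> <= 1 / (real n + 1)" using seq_suble[OF r(1), of n] by (simp add: frac_le)
   finally show ?thesis .
  qed
  then show "\<forall>\<^sub>F n in sequentially. Q (y n) (y n) <= 1 / (real n + 1)" by simp
  show "(%n. 1 / (real n + 1)) ----> 0"
   using LIMSEQ_inverse_real_of_nat by (simp add: inverse_eq_divide add.commute)
 qed (use Q.nonneg yD in auto)
 have pdiff: "ip (p m - p n) (p m - p n) = (\<Sum>i\<in>A. (ip (y m) (e i) - ip (y n) (e i))^2)" for m n
 proof -
  have "p m - p n = (\<Sum>i\<in>A. (ip (y m) (e i) - ip (y n) (e i)) *\<^sub>R e i)"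
   unfolding p_def by (simp add: sum_subtractf scaleR_left_diff_distrib)
  then show ?thesis using orthonormal_combination[OF A(1) eD A(3)] by (simp add: power2_eq_square)
 qed
 have pC: "ip_Cauchy ip p"
  unfolding ip_Cauchy_def
 proof (intro allI impI)
  fix \<epsilon> :: real assume eps: "\<epsilon> > 0"
  define \<delta> where "\<delta> = \<epsilon>\<^sup>2 / (real (card A) + 1)"
  have d: "\<delta> > 0" unfolding \<delta>_def using eps by simp
  have "\<forall>\<^sub>F N in sequentially. \<forall>i\<in>A. \<forall>m\<ge>N. \<forall>n\<ge>N. (ip (y m) (e i) - ip (y n) (e i))^2 < \<delta>"
   unfolding eventually_ball_finite_distrib[OF A(1)]
  proof
   fix i assume "i \<in> A"
   then have "Cauchy (%n. ip (y n) (e i))" using r(2) unfolding y_def by (simp add: convergent_Cauchy)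
   then obtain N where N: "!!m n. m \<ge> N ==> n \<ge> N ==> \<bar>ip (y m) (e i) - ip (y n) (e i)\<bar> < sqrt \<delta>"
    unfolding Cauchy_def dist_real_def using d by (meson real_sqrt_gt_zero)
   have "(ip (y m) (e i) - ip (y n) (e i))^2 < \<delta>" if "m \<ge> N" "n \<ge> N" for m n
    using N[OF that] d by (metis abs_ge_zero less_imp_le power2_abs power2_strict_mono abs_less_iff real_sqrt_pow2 power_strict_mono zero_less_numeral)
   then show "\<forall>\<^sub>F N in sequentially. \<forall>m\<ge>N. \<forall>n\<ge>N. (ip (y m) (e i) - ip (y n) (e i))^2 < \<delta>"
    unfolding eventually_sequentially by (meson order_trans)
  qed
  then obtain N where N: "\<forall>i\<in>A. \<forall>m\<ge>N. \<forall>n\<ge>N. (ip (y m) (e i) - ip (y n) (e i))^2 < \<delta>"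
   unfolding eventually_sequentially by blast
  have "ip_norm ip (p m - p n) < \<epsilon>" if "m \<ge> N" "n \<ge> N" for m n
  proof -
   have "ip (p m - p n) (p m - p n) <= (\<Sum>i\<in>A. \<delta>)"
    unfolding pdiff using N that less_imp_le by (intro sum_mono) blast
   also have "\<dots> < (real (card A) + 1) * \<delta>" using d by (simp add: algebra_simps)
   also have "\<dots> = \<epsilon>\<^sup>2" unfolding \<delta>_def by simp
   finally show ?thesis unfolding ip_norm_def using eps by (simp add: real_less_lsqrt)
  qed
  then show "\<exists>M. \<forall>m\<ge>M. \<forall>n\<ge>M. ip_norm ip (p m - p n) < \<epsilon>" by blast
 qed
 have C: "C \<ge> 0" using bdd[OF x1(1)] x1 by simp
 have Qp: "ip_norm Q w <= sqrt (\<mu> + C) * ip_norm ip w" if "w \<in> D" for w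
 proof -
  have "Q w w <= (\<mu> + C) * ip w w"
   using bdd[OF that] by (simp add: Q_def abs_le_iff algebra_simps)
  then show ?thesis unfolding ip_norm_def real_sqrt_mult[symmetric] by (rule real_sqrt_le_mono)
 qed
 \<comment> \<open>For the norm of \<open>Q\<close> the sequence \<open>y\<close> tends to 0 and its
   projections \<open>p\<close> form a Cauchy sequence, hence so do the differences
   \<open>z\<close>; these are orthogonal to the family, where \<open>small\<close> applies.\<close>
 have zC: "ip_Cauchy ip z"
  unfolding ip_Cauchy_def
 proof (intro allI impI)
  fix \<epsilon> :: real assume eps: "\<epsilon> > 0"
  define \<delta> where "\<delta> = sqrt (\<mu> / 2) * \<epsilon> / 4"
  have d: "\<delta> > 0" unfolding \<delta>_def using eps mu0 by simp
  have "(%n. ip_norm Q (y n)) ----> sqrt 0"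
   unfolding ip_norm_def by (rule tendsto_real_sqrt[OF Qy])
  then obtain N1 where N1: "!!n. n \<ge> N1 ==> ip_norm Q (y n) < \<delta>"
   using d LIMSEQ_D[of _ "sqrt 0" \<delta>] by (force simp: yD)
  have d': "\<delta> / (sqrt (\<mu> + C) + 1) > 0" using d mu0 C by (simp add: add_nonneg_pos)
  then obtain N2 where N2: "!!m n. m \<ge> N2 ==> n \<ge> N2 ==> ip_norm ip (p m - p n) < \<delta> / (sqrt (\<mu> + C) + 1)"
   using pC unfolding ip_Cauchy_def by blast
  have "ip_norm ip (z m - z n) < \<epsilon>" if mn: "m \<ge> max N1 N2" "n \<ge> max N1 N2" for m n
  proof -
   have "sqrt (\<mu> / 2) * ip_norm ip (z m - z n) <= ip_norm Q (z m - z n)"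
    unfolding ip_norm_def real_sqrt_mult[symmetric]
    using small[of "z m - z n"] zD eD zorth by (simp add: diff)
   also have "ip_norm Q (z m - z n) = ip_norm Q ((y m - y n) - (p m - p n))" unfolding z_def by (simp add: algebra_simps)
   also have "\<dots> <= ip_norm Q (y m - y n) + ip_norm Q (p m - p n)"
    using Q.norm_diff_triangle[of "y m - y n" 0 "p m - p n"] Q.norm_minus[of 0 "p m - p n"] yD pD by simp
   also have "ip_norm Q (y m - y n) <= ip_norm Q (y m) + ip_norm Q (y n)"
    using Q.norm_diff_triangle[of "y m" 0 "y n"] Q.norm_minus[of 0 "y n"] yD by simp
   also have "ip_norm Q (p m - p n) <= \<delta>"
   proof -
    have "ip_norm Q (p m - p n) <= sqrt (\<mu> + C) * ip_norm ip (p m - p n)"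
     using Qp pD by simp
    also have "\<dots> <= (sqrt (\<mu> + C) + 1) * ip_norm ip (p m - p n)"
     using pD by (intro mult_right_mono) simp_all
    also have "\<dots> <= \<delta>"
     using N2[of m n] mn mu0 C by (simp add: pos_less_divide_eq add_nonneg_pos mult.commute)
    finally show ?thesis .
   qed
   finally have "sqrt (\<mu> / 2) * ip_norm ip (z m - z n) < sqrt (\<mu> / 2) * \<epsilon>"
    using N1[of m] N1[of n] mn d unfolding \<delta>_def by simp
   then show ?thesis using mu0 by simp
  qed
  then show "\<exists>M. \<forall>m\<ge>M. \<forall>n\<ge>M. ip_norm ip (z m - z n) < \<epsilon>" by blast
 qed
 have yC: "ip_Cauchy ip y"
  using Cauchy_add[OF _ pC _ zC] pD zD unfolding z_def by (simp add: image_subset_iff)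
 then obtain v where v: "v \<in> D" "(%n. ip_norm ip (y n - v)) ----> 0"
  using complete[of y] yD by (auto simp: image_subset_iff)
 have "(%n. ip (y n) (y n)) ----> ip v v"
  by (rule tendsto_ip[OF _ _ v(1) v(1) v(2) v(2)]) (use yD in auto)
 then have v1: "ip v v = 1" using x(2) unfolding y_def by (simp add: LIMSEQ_const_iff)
 have "ip_norm Q v <= 0"
 proof (rule LIMSEQ_le)
  show "(%n. ip_norm Q v) ----> ip_norm Q v" by simp
  have "(%n. ip_norm Q (y n) + sqrt (\<mu> + C) * ip_norm ip (y n - v)) ----> sqrt 0 + sqrt (\<mu> + C) * 0"
   unfolding ip_norm_def[of Q] by (intro tendsto_add tendsto_mult tendsto_const tendsto_real_sqrt Qy v(2))
  then show "(%n. ip_norm Q (y n) + sqrt (\<mu> + C) * ip_norm ip (y n - v)) ----> 0" by simp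
  have "ip_norm Q v <= ip_norm Q (y n) + sqrt (\<mu> + C) * ip_norm ip (y n - v)" for n
   using Q.norm_diff_abs[OF yD v(1), of n] Qp[of "y n - v"] yD[of n] v(1) by simp
  then show "\<exists>N. \<forall>n\<ge>N. ip_norm Q v <= ip_norm Q (y n) + sqrt (\<mu> + C) * ip_norm ip (y n - v)" by blast
 qed
 then have "Q v v = 0" using Q.norm_nonneg[OF v(1)] Q.nonneg[OF v(1)] by (simp add: ip_norm_def)
 then have "b v v = \<mu>" using v1 by (simp add: Q_def)
 with v v1 mu' show ?thesis by auto
qed

text \<open>At a maximizer \<open>e\<close> of \<open>s * b\<close>, with the sign \<open>s\<close>
  chosen so that positive values occur, the form \<open>Q\<close> vanishes on \<open>e\<close>,
  hence by Cauchy-Schwarz against every vector. This is the eigenvector equation, written without an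
  operator: whatever is orthogonal to \<open>e\<close> is orthogonal to it for \<open>b\<close> too.
  If \<open>b\<close> vanishes on the diagonal, polarization gives \<open>b = 0\<close> and any unit
  vector will do.\<close>

lemma eigenvector_exists:
 assumes b: "symmetric_bilinear_on D b" and bdd: "!!x. x \<in> D ==> \<bar>b x x\<bar> <= C * ip x x"
  and hs: "!!(A :: nat set) e. finite A ==> e ` A <= D ==> orthonormal ip A e ==>
   (\<Sum>i\<in>A. (b (e i) (e i))^2) <= M"
  and ne: "D ~= {0}"
 shows "\<exists>e\<in>D. ip e e = 1 & (\<forall>y\<in>D. ip e y = 0 --> b e y = 0)"
proof -
 note bD = symmetric_bilinear_onD[OF b]
 have main: "\<exists>e\<in>D. ip e e = 1 & (\<forall>y\<in>D. ip e y = 0 --> b e y = 0)"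
  if s: "s = 1 \<or> s = -1" and x0: "x0 \<in> D" "s * b x0 x0 > 0" for s x0
 proof -
  have "symmetric_bilinear_on D (%x y. s * b x y)"
   unfolding symmetric_bilinear_on_def
  proof (intro conjI ballI allI)
   show "s * b x y = s * b y x" if "x \<in> D" "y \<in> D" for x y by (simp only: bD(1)[OF that])
  qed (simp_all add: bD(2,3) algebra_simps)
  moreover have "\<bar>s * b x x\<bar> <= C * ip x x" if "x \<in> D" for x using bdd[OF that] s by auto
  moreover have "(s * b x x)^2 = (b x x)^2" for x using s by auto
  ultimately obtain e where e: "e \<in> D" "ip e e = 1" "!!x. x \<in> D ==> s * b x x <= s * b e e * ip x x"
   using maximum_attained[of "%x y. s * b x y" C M x0] hs x0 by auto
  define Q where "Q = (%x y. (s * b e e) * ip x y - s * b x y)"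
  interpret Q: psd_form D Q unfolding Q_def by (rule psd_form_combination[OF b e(3)])
  have "Q e e = 0" by (simp add: Q_def e)
  then have Qe: "Q e y = 0" if "y \<in> D" for y
   using Q.Cauchy_Schwarz[OF e(1) that] by (simp add: ip_norm_def)
  have "b e y = 0" if "y \<in> D" "ip e y = 0" for y
   using Qe[OF that(1)] that(2) s by (auto simp: Q_def)
  with e show ?thesis by blast
 qed
 show ?thesis
 proof (cases "\<exists>x\<in>D. b x x ~= 0")
  case True
  then obtain x where x: "x \<in> D" "b x x ~= 0" by blast
  show ?thesis
   using main[of 1 x] main[of "-1" x] x by (cases "b x x > 0") auto
 next
  case False
  obtain x where x: "x \<in> D" "x ~= 0" using ne subspace_0[OF D] by blast
  have "b u v = 0" if uv: "u \<in> D" "v \<in> D" for u v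
  proof -
   have "b (u + v) (u + v) = b u (u + v) + b v (u + v)" using uv by (intro bD(2)) simp_all
   also have "\<dots> = b (u + v) u + b (u + v) v"
    using bD(1)[of u "u + v"] bD(1)[of v "u + v"] uv by simp
   also have "\<dots> = b u u + b v v + 2 * b u v"
    using bD(2)[of u v u] bD(2)[of u v v] bD(1)[of v u] uv by simp
   finally show ?thesis using False uv by simp
  qed
  then show ?thesis
   using x normalize[OF x] by (intro bexI[of _ "(1 / ip_norm ip x) *\<^sub>R x"]) auto
 qed
qed

end

context psd_form
begin

text \<open>Of the factor 3, the share 2 comes from Cauchy-Schwarz for the form
  \<open>\<bar>C\<bar> * ip - b\<close>, whose norm is at most
  \<open>sqrt (2 * \<bar>C\<bar>)\<close> times the original one, and the share 1 from taking
  \<open>\<bar>C\<bar> * ip\<close> away again.\<close>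

lemma bilinear_bound:
 assumes b: "symmetric_bilinear_on D b" and bdd: "!!x. x \<in> D ==> \<bar>b x x\<bar> <= C * ip x x"
  and x: "x \<in> D" "y \<in> D"
 shows "\<bar>b x y\<bar> <= 3 * \<bar>C\<bar> * ip_norm ip x * ip_norm ip y"
proof -
 have bdd': "\<bar>b x x\<bar> <= \<bar>C\<bar> * ip x x" if "x \<in> D" for x
  using bdd[OF that] mult_right_mono[OF abs_ge_self[of C] nonneg[OF that]] by linarith
 define Q where "Q = (%x y. \<bar>C\<bar> * ip x y - 1 * b x y)"
 interpret Q: psd_form D Q unfolding Q_def
  by (rule psd_form_combination[OF b]) (use bdd' in \<open>simp add: abs_le_iff\<close>)
 have Qn: "ip_norm Q w <= sqrt (2 * \<bar>C\<bar>) * ip_norm ip w" if "w \<in> D" for w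
  unfolding ip_norm_def real_sqrt_mult[symmetric] using bdd'[OF that] by (simp add: Q_def abs_le_iff)
 have "\<bar>Q x y\<bar> <= ip_norm Q x * ip_norm Q y" by (rule Q.Cauchy_Schwarz[OF x])
 also have "\<dots> <= (sqrt (2 * \<bar>C\<bar>) * ip_norm ip x) * (sqrt (2 * \<bar>C\<bar>) * ip_norm ip y)"
  by (intro mult_mono Qn x Q.norm_nonneg) (simp_all add: x)
 also have "\<dots> = 2 * \<bar>C\<bar> * (ip_norm ip x * ip_norm ip y)" by simp
 finally have "\<bar>Q x y\<bar> <= 2 * \<bar>C\<bar> * (ip_norm ip x * ip_norm ip y)" .
 moreover have "\<bar>\<bar>C\<bar> * ip x y\<bar> <= \<bar>C\<bar> * (ip_norm ip x * ip_norm ip y)"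
  unfolding abs_mult using Cauchy_Schwarz[OF x] by (simp add: mult_left_mono)
 ultimately show ?thesis unfolding Q_def by (simp add: abs_le_iff algebra_simps)
qed

lemma ip_zero_of_dense:
 assumes x: "x \<in> D" and y: "y \<in> D" and bd: "!!y. y \<in> D ==> \<bar>f y\<bar> <= K * ip_norm ip y"
  and lin: "!!y z. y \<in> D ==> z \<in> D ==> f (y - z) = f y - f z"
  and S: "S <= D" "!!s. s \<in> S ==> f s = 0" "!!r. r > 0 ==> \<exists>s\<in>S. ip_norm ip (y - s) < r"
 shows "f y = (0 :: real)"
proof (rule ccontr)
 assume "f y ~= 0"
 then have "\<bar>f y\<bar> / (\<bar>K\<bar> + 1) > 0" by simp
 then obtain s where s: "s \<in> S" "ip_norm ip (y - s) < \<bar>f y\<bar> / (\<bar>K\<bar> + 1)" using S(3) by blast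
 have sD: "s \<in> D" using s S by blast
 have "\<bar>f y\<bar> = \<bar>f (y - s)\<bar>" using lin[OF y sD] S(2)[OF s(1)] by simp
 also have "\<dots> <= K * ip_norm ip (y - s)" using y sD by (intro bd) simp
 also have "\<dots> <= (\<bar>K\<bar> + 1) * ip_norm ip (y - s)" using y sD by (intro mult_right_mono) simp_all
 also have "\<dots> < \<bar>f y\<bar>" using s(2) by (simp add: pos_less_divide_eq mult.commute add_nonneg_pos)
 finally show False by simp
qed

end

context hilbert_form
begin

definition norm_closure :: "'a set => 'a set" where
 "norm_closure S = {x\<in>D. \<forall>r>0. \<exists>s\<in>S. ip_norm ip (x - s) < r}"

lemma subset_norm_closure: "S <= D ==> S <= norm_closure S"
 unfolding norm_closure_def by (auto intro!: bexI simp: norm_zero)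

lemma norm_closure_subspace:
 assumes S: "subspace S" "S <= D"
 shows "subspace (norm_closure S)"
proof (rule subspaceI)
 show "0 \<in> norm_closure S" using subset_norm_closure[OF S(2)] subspace_0[OF S(1)] by blast
next
 fix x y assume x: "x \<in> norm_closure S" and y: "y \<in> norm_closure S"
 show "x + y \<in> norm_closure S"
  unfolding norm_closure_def
 proof (intro CollectI conjI allI impI)
  show "x + y \<in> D" using x y unfolding norm_closure_def by simp
  fix r :: real assume "r > 0"
  then have r: "r / 2 > 0" by simp
  obtain s t where s: "s \<in> S" "ip_norm ip (x - s) < r / 2" and t: "t \<in> S" "ip_norm ip (y - t) < r / 2"
   using x y r unfolding norm_closure_def by blast
  have "ip_norm ip (x + y - (s + t)) = ip_norm ip ((x - s) + (y - t))" by (simp add: algebra_simps)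
  moreover have "ip_norm ip ((x - s) + (y - t)) <= ip_norm ip (x - s) + ip_norm ip (y - t)"
   using x y s t S(2) by (intro triangle) (auto simp: norm_closure_def)
  ultimately show "\<exists>s\<in>S. ip_norm ip (x + y - s) < r"
   using subspace_add[OF S(1) s(1) t(1)] s(2) t(2) by (intro bexI[of _ "s + t"]) simp_all
 qed
next
 fix c :: real and x assume x: "x \<in> norm_closure S"
 show "c *\<^sub>R x \<in> norm_closure S"
  unfolding norm_closure_def
 proof (intro CollectI conjI allI impI)
  show "c *\<^sub>R x \<in> D" using x unfolding norm_closure_def by simp
  fix r :: real assume r: "r > 0"
  have "r / (\<bar>c\<bar> + 1) > 0" using r by simp
  then obtain s where s: "s \<in> S" "ip_norm ip (x - s) < r / (\<bar>c\<bar> + 1)"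
   using x unfolding norm_closure_def by blast
  have D: "x - s \<in> D" using x s S(2) by (auto simp: norm_closure_def)
  have "ip_norm ip (c *\<^sub>R x - c *\<^sub>R s) = \<bar>c\<bar> * ip_norm ip (x - s)"
   unfolding scaleR_right_diff_distrib[symmetric] by (rule norm_scale[OF D])
  also have "\<dots> <= (\<bar>c\<bar> + 1) * ip_norm ip (x - s)" using D by (intro mult_right_mono) simp_all
  also have "\<dots> < r" using s(2) by (simp add: pos_less_divide_eq mult.commute add_nonneg_pos)
  finally show "\<exists>s\<in>S. ip_norm ip (c *\<^sub>R x - s) < r" using subspace_scale[OF S(1) s(1)] by blast
 qed
qed

lemma norm_closure_hilbert_form:
 assumes S: "subspace S" "S <= D"
 shows "hilbert_form (norm_closure S) ip"
proof (rule closed_subspace_hilbert_form[OF norm_closure_subspace[OF S]])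
 show "norm_closure S <= D" unfolding norm_closure_def by blast
 fix f x assume f: "range f <= norm_closure S" "x \<in> D" "(%n. ip_norm ip (f n - x)) ----> 0"
 show "x \<in> norm_closure S"
  unfolding norm_closure_def
 proof (intro CollectI conjI allI impI)
  fix r :: real assume "r > 0"
  then have r: "r / 2 > 0" by simp
  obtain n where n: "\<bar>ip_norm ip (f n - x)\<bar> < r / 2" using LIMSEQ_D[OF f(3) r] by force
  have fn: "f n \<in> norm_closure S" using f(1) by auto
  then obtain s where s: "s \<in> S" "ip_norm ip (f n - s) < r / 2"
   using r unfolding norm_closure_def by blast
  have D: "f n \<in> D" "s \<in> D" using fn s S(2) unfolding norm_closure_def by auto
  have "ip_norm ip (x - s) <= ip_norm ip (x - f n) + ip_norm ip (f n - s)"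
   using D f(2) by (intro norm_diff_triangle)
  then show "\<exists>s\<in>S. ip_norm ip (x - s) < r"
   using s n norm_minus[OF D(1) f(2)] by (intro bexI[OF _ s(1)]) linarith
 qed (rule f(2))
qed

lemma orthogonal_complement_hilbert_form:
 assumes "V <= D"
 shows "hilbert_form {x\<in>D. \<forall>v\<in>V. ip x v = 0} ip"
proof (rule closed_subspace_hilbert_form)
 show "subspace {x\<in>D. \<forall>v\<in>V. ip x v = 0}"
  using assms by (intro subspaceI) (auto simp: subset_iff zero_left add scale)
 fix f x assume f: "range f <= {x\<in>D. \<forall>v\<in>V. ip x v = 0}" "x \<in> D" "(%n. ip_norm ip (f n - x)) ----> 0"
 have "ip x v = 0" if v: "v \<in> V" for v
 proof -
  have vD: "v \<in> D" using v assms by blast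
  have "(%n. ip (f n) v) ----> ip x v"
   by (rule tendsto_ip[OF _ _ f(2) vD f(3)]) (use f(1) vD norm_zero in auto)
  moreover have "ip (f n) v = 0" for n using f(1) v by auto
  ultimately show ?thesis by (simp add: LIMSEQ_const_iff)
 qed
 then show "x \<in> {x\<in>D. \<forall>v\<in>V. ip x v = 0}" using f(2) by simp
qed auto

text \<open>Zorn's lemma for orthonormal sets of eigenvectors. If the closed span \<open>V\<close>
  of a maximal one were not everything, its orthogonal complement would contain an eigenvector of
  the restricted form, and this would be an eigenvector on the whole space. A set and not a sequence
  is produced, since countability needs separability.\<close>

lemma eigenbasis_set_exists:
 assumes b: "symmetric_bilinear_on D b" and bdd: "!!x. x \<in> D ==> \<bar>b x x\<bar> <= C * ip x x"
  and hs: "!!(A :: nat set) e. finite A ==> e ` A <= D ==> orthonormal ip A e ==>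
   (\<Sum>i\<in>A. (b (e i) (e i))^2) <= M"
 shows "\<exists>S\<subseteq>D. orthonormal ip S id & (\<forall>e\<in>S. \<forall>y\<in>D. ip e y = 0 --> b e y = 0) & norm_closure (span S) = D"
proof -
 note bD = symmetric_bilinear_onD[OF b]
 define F where "F = {S. S <= D & orthonormal ip S id & (\<forall>e\<in>S. \<forall>y\<in>D. ip e y = 0 --> b e y = 0)}"
 have "\<exists>S\<in>F. \<forall>X\<in>F. S <= X --> X = S"
 proof (rule subset_Zorn')
  fix \<C> assume c: "subset.chain F \<C>"
  then have cF: "!!S. S \<in> \<C> ==> S \<in> F" and ch: "!!S T. S \<in> \<C> ==> T \<in> \<C> ==> S <= T \<or> T <= S"
   unfolding subset.chain_def by blast+
  have "ip x y = (if x = y then 1 else 0)" if xy: "x \<in> \<Union>\<C>" "y \<in> \<Union>\<C>" for x y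
  proof -
   obtain S where "S \<in> \<C>" "x \<in> S" "y \<in> S" using xy ch by blast
   then show ?thesis using cF unfolding F_def orthonormal_def by auto
  qed
  moreover have "\<Union>\<C> <= D" using cF unfolding F_def by blast
  moreover have "\<forall>e\<in>\<Union>\<C>. \<forall>y\<in>D. ip e y = 0 --> b e y = 0" using cF unfolding F_def by blast
  ultimately show "\<Union>\<C> \<in> F" unfolding F_def orthonormal_def by simp
 qed
 then obtain S where SF: "S \<in> F" and max: "!!X. X \<in> F ==> S <= X ==> X = S" by metis
 have S: "S <= D" "orthonormal ip S id" using SF unfolding F_def by simp_all
 have S3: "b e y = 0" if "e \<in> S" "y \<in> D" "ip e y = 0" for e y
  using SF that unfolding F_def by simp
 have spD: "span S <= D" using S(1) D by (simp add: span_minimal)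
 define V where "V = norm_closure (span S)"
 have V: "hilbert_form V ip" "V <= D" "S <= V"
  unfolding V_def using norm_closure_hilbert_form[OF subspace_span spD] subset_norm_closure[OF spD] span_superset[of S]
  by (auto simp: norm_closure_def)
 define W where "W = {x\<in>D. \<forall>v\<in>V. ip x v = 0}"
 interpret W: hilbert_form W ip unfolding W_def by (rule orthogonal_complement_hilbert_form[OF V(2)])
 have WD: "W <= D" unfolding W_def by blast
 have "W = {0}"
 proof (rule ccontr)
  assume "W ~= {0}"
  have "\<exists>e\<in>W. ip e e = 1 & (\<forall>y\<in>W. ip e y = 0 --> b e y = 0)"
  proof (rule W.eigenvector_exists[OF symmetric_bilinear_on_subset[OF b WD]])
   show "\<bar>b x x\<bar> <= C * ip x x" if "x \<in> W" for x using bdd that WD by blast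
   show "(\<Sum>i\<in>A. (b (e i) (e i))^2) <= M"
    if "finite A" "e ` A <= W" "orthonormal ip A e" for A :: "nat set" and e
    using hs[OF that(1) order_trans[OF that(2) WD] that(3)] .
  qed fact
  then obtain e where e: "e \<in> W" "ip e e = 1" "!!y. y \<in> W ==> ip e y = 0 ==> b e y = 0"
   by (elim bexE conjE) simp
  have eD: "e \<in> D" using e WD by blast
  \<comment> \<open>The members of \<open>S\<close> are eigenvectors orthogonal to \<open>e\<close>,
    so \<open>b e\<close> vanishes on them, on their span by linearity and on its closure by
    boundedness.\<close>
  have bep: "b e p = 0" if p: "p \<in> V" for p
  proof (rule ip_zero_of_dense[of e p "b e" "3 * \<bar>C\<bar> * ip_norm ip e" "span S"])
   show "\<bar>b e y\<bar> <= 3 * \<bar>C\<bar> * ip_norm ip e * ip_norm ip y" if "y \<in> D" for y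
    by (rule bilinear_bound[OF b bdd eD that])
   show "b e (y - z) = b e y - b e z" if "y \<in> D" "z \<in> D" for y z
   proof -
    have "b e (y - z) = b (y + (-1) *\<^sub>R z) e" using bD(1)[of e "y - z"] that eD by simp
    also have "\<dots> = b y e + (-1) * b z e" using bD(2)[of y "(-1) *\<^sub>R z" e] bD(3)[of z e "-1"] that eD by simp
    finally show ?thesis using bD(1)[OF eD] that by simp
   qed
   show "b e s = 0" if "s \<in> span S" for s
   proof -
    have "subspace {x\<in>D. b x e = 0}"
     using bD(3)[of 0 e 0] eD D_simps(4) by (intro subspaceI) (simp_all add: bD(2,3))
    moreover have "S <= {x\<in>D. b x e = 0}"
    proof
     fix x assume x: "x \<in> S"
     then have xD: "x \<in> D" using S(1) by blast
     have "ip x e = 0" using e(1) x V(3) sym[OF eD xD] unfolding W_def by auto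
     then show "x \<in> {x\<in>D. b x e = 0}" using S3[OF x eD] xD by simp
    qed
    ultimately have "span S <= {x\<in>D. b x e = 0}" by (rule span_minimal[rotated])
    then show ?thesis using that bD(1)[OF eD, of s] by auto
   qed
   show "\<exists>s\<in>span S. ip_norm ip (p - s) < r" if "r > 0" for r
    using p that unfolding V_def norm_closure_def by blast
  qed (use eD p V spD in auto)
  \<comment> \<open>So far \<open>e\<close> is an eigenvector only inside \<open>W\<close>; a
    general \<open>y\<close> is split into its parts in \<open>V\<close> and in
    \<open>W\<close>.\<close>
  have eig: "b e y = 0" if y: "y \<in> D" "ip e y = 0" for y
  proof -
   obtain p where p: "p \<in> V" "\<forall>w\<in>V. ip (y - p) w = 0" using projection[OF V(1,2) y(1)] by blast
   have pD: "p \<in> D" using p V by blast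
   have w: "y - p \<in> W" unfolding W_def using p y pD by simp
   have "ip e p = 0" using e(1) p(1) unfolding W_def by blast
   then have "ip e (y - p) = 0" using y eD pD by (simp add: diff_right)
   then have "b e (y - p) = 0" using e(3)[OF w] by simp
   moreover have "b e y = b e (y - p) + b e p"
    using bD(2)[of "y - p" p e] bD(1)[OF eD, of y] bD(1)[OF eD, of p] bD(1)[OF eD, of "y - p"] y pD eD by simp
   ultimately show ?thesis using bep[OF p(1)] by simp
  qed
  have eS: "ip e x = 0" if "x \<in> S" for x using e(1) that V(3) unfolding W_def by auto
  then have "e \<notin> S" using e(2) by force
  have "orthonormal ip (insert e S) (id(e := e))"
   by (rule orthonormal_insert[OF S(2) _ \<open>e \<notin> S\<close> eD e(2)]) (use S(1) eS in auto)
  moreover have "id(e := e) = id" by (auto simp: fun_eq_iff)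
  ultimately have "orthonormal ip (insert e S) id" by simp
  then have "insert e S \<in> F" unfolding F_def using S S3 eD eig by simp
  from max[OF this] \<open>e \<notin> S\<close> show False by blast
 qed
 have "x \<in> V" if x: "x \<in> D" for x
 proof -
  obtain p where p: "p \<in> V" "\<forall>w\<in>V. ip (x - p) w = 0" using projection[OF V(1,2) x] by blast
  then have "x - p \<in> W" unfolding W_def using x V by auto
  then show ?thesis using \<open>W = {0}\<close> p by auto
 qed
 then have "V = D" using V by blast
 then show ?thesis using S S3 unfolding V_def by (intro exI[of _ S]) simp
qed

text \<open>Distinct orthonormal vectors are \<open>sqrt 2\<close> apart, so points of
  \<open>T\<close> within 1/2 of them are distinct.\<close>

lemma orthonormal_set_countable:
 assumes S: "S <= D" "orthonormal ip S id" and T: "countable T" "T <= D"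
  "!!x r. x \<in> D ==> r > 0 ==> \<exists>s\<in>T. ip_norm ip (x - s) < r"
 shows "countable S"
proof -
 have "\<exists>s\<in>T. ip_norm ip (e - s) < 1 / 2" if "e \<in> S" for e using S(1) T(3)[of e "1/2"] that by auto
 then obtain c where c: "!!e. e \<in> S ==> c e \<in> T" "!!e. e \<in> S ==> ip_norm ip (e - c e) < 1 / 2" by metis
 have "inj_on c S"
 proof (rule inj_onI, rule ccontr)
  fix e f assume ef: "e \<in> S" "f \<in> S" "c e = c f" "e ~= f"
  have D: "e \<in> D" "f \<in> D" "c e \<in> D" using ef S(1) c(1) T(2) by auto
  have "ip (e - f) (e - f) = 2" using norm_diff_sq[OF D(1,2)] S(2) ef unfolding orthonormal_def by simp
  moreover have "ip_norm ip (e - f) < 1"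
   using norm_diff_triangle[OF D(1,3,2)] c(2)[OF ef(1)] c(2)[OF ef(2)] ef(3) norm_minus[OF D(2,3)] by simp
  ultimately show False unfolding ip_norm_def by (simp add: real_sqrt_lt_1_iff)
 qed
 moreover have "countable (c ` S)" using T(1) c(1) by (meson countable_subset image_subsetI)
 ultimately show ?thesis using countable_image_inj_on by blast
qed

end

section \<open>Dictionary between norm topologies and scalar products\<close>

lemma norm_dist_cong:
 "subspace H ==> (!!x. x \<in> H ==> N x = N' x) ==> norm_dist H N = norm_dist H N'"
 unfolding norm_dist_def by (intro ext) (simp add: subspace_diff)

lemma norm_topology_cong:
 "subspace H ==> (!!x. x \<in> H ==> N x = N' x) ==> norm_topology H N = norm_topology H N'"
 unfolding norm_topology_def using norm_dist_cong[of H N N'] by simp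

lemma norm_ip_cong:
 "subspace H ==> (!!x. x \<in> H ==> N x = N' x) ==> x \<in> H ==> y \<in> H ==> norm_ip N x y = norm_ip N' x y"
 unfolding norm_ip_def by (simp add: subspace_add subspace_diff)

lemma (in psd_form) norm_ip_ip_norm: "x \<in> D ==> y \<in> D ==> norm_ip (ip_norm ip) x y = ip x y"
 unfolding norm_ip_def by (rule ip_polar)

locale inner_product_form = psd_form +
 assumes definite: "x \<in> D ==> ip x x = 0 ==> x = 0"
begin

lemma metric_space: "Metric_space D (norm_dist D (ip_norm ip))"
proof
 fix x y
 show "0 <= norm_dist D (ip_norm ip) x y" by (simp add: norm_dist_def)
 show "norm_dist D (ip_norm ip) x y = norm_dist D (ip_norm ip) y x"
  using norm_minus by (simp add: norm_dist_def)
 show "norm_dist D (ip_norm ip) x y = 0 \<longleftrightarrow> x = y" if "x \<in> D" "y \<in> D"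
  using that definite[of "x - y"] norm_zero by (auto simp: norm_dist_def ip_norm_def nonneg)
 show "norm_dist D (ip_norm ip) x z <= norm_dist D (ip_norm ip) x y + norm_dist D (ip_norm ip) y z"
  if "x \<in> D" "y \<in> D" "z \<in> D" for z
  using norm_diff_triangle[OF that] that by (simp add: norm_dist_def)
qed

lemma topspace_norm_topology: "topspace (norm_topology D (ip_norm ip)) = D"
 unfolding norm_topology_def by (rule Metric_space.topspace_mtopology[OF metric_space])

lemma limitin_iff:
 assumes "range f <= D" "x \<in> D"
 shows "limitin (norm_topology D (ip_norm ip)) f x sequentially \<longleftrightarrow> (%n. ip_norm ip (f n - x)) ----> 0"
proof -
 interpret Metric_space D "norm_dist D (ip_norm ip)" by (rule metric_space)
 have "norm_dist D (ip_norm ip) (f n) x = ip_norm ip (f n - x)" for n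
  using assms by (auto simp: norm_dist_def)
 moreover have "\<forall>\<^sub>F n in sequentially. f n \<in> D" using assms(1) by (auto intro!: always_eventually)
 ultimately show ?thesis unfolding norm_topology_def limitin_metric_dist_null using assms(2) by simp
qed

lemma MCauchy_iff:
 assumes "range f <= D"
 shows "Metric_space.MCauchy D (norm_dist D (ip_norm ip)) f \<longleftrightarrow> ip_Cauchy ip f"
proof -
 interpret Metric_space D "norm_dist D (ip_norm ip)" by (rule metric_space)
 have "norm_dist D (ip_norm ip) (f m) (f n) = ip_norm ip (f m - f n)" for m n
  using assms by (auto simp: norm_dist_def)
 then show ?thesis unfolding MCauchy_def ip_Cauchy_def using assms by auto
qed

lemma mcomplete_iff:
 "Metric_space.mcomplete D (norm_dist D (ip_norm ip)) \<longleftrightarrow>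
  (\<forall>f. range f <= D --> ip_Cauchy ip f --> (\<exists>x\<in>D. (%n. ip_norm ip (f n - x)) ----> 0))"
proof -
 interpret Metric_space D "norm_dist D (ip_norm ip)" by (rule metric_space)
 have "(\<exists>x. limitin mtopology f x sequentially) \<longleftrightarrow> (\<exists>x\<in>D. (%n. ip_norm ip (f n - x)) ----> 0)"
  if f: "range f <= D" for f
 proof -
  have "limitin mtopology f x sequentially ==> x \<in> D" for x
   by (metis limitin_topspace topspace_mtopology)
  then show ?thesis using limitin_iff[OF f] unfolding norm_topology_def by blast
 qed
 moreover have "MCauchy f \<longleftrightarrow> range f <= D & ip_Cauchy ip f" for f
  using MCauchy_iff[of f] unfolding MCauchy_def by blast
 ultimately show ?thesis unfolding mcomplete_def by blast
qed

lemma closure_of_eq: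
 "S <= D ==> norm_topology D (ip_norm ip) closure_of S = {x\<in>D. \<forall>r>0. \<exists>s\<in>S. ip_norm ip (x - s) < r}"
proof -
 assume S: "S <= D"
 interpret Metric_space D "norm_dist D (ip_norm ip)" by (rule metric_space)
 have "s \<in> mball x r \<longleftrightarrow> ip_norm ip (x - s) < r" if "x \<in> D" "s \<in> S" for x s r
  using that S by (auto simp: norm_dist_def)
 then show ?thesis unfolding norm_topology_def metric_closure_of by blast
qed

lemma closedin_of_limits:
 assumes "W <= D" "!!f x. range f <= W ==> x \<in> D ==> (%n. ip_norm ip (f n - x)) ----> 0 ==> x \<in> W"
 shows "closedin (norm_topology D (ip_norm ip)) W"
proof -
 interpret Metric_space D "norm_dist D (ip_norm ip)" by (rule metric_space)
 have "\<exists>r>0. disjnt W (mball x r)" if x: "x \<in> D - W" for x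
 proof (rule ccontr)
  assume "\<not> ?thesis"
  then have "\<exists>y\<in>W. y \<in> mball x (1 / (real n + 1))" for n
   unfolding disjnt_def by (metis (no_types, lifting) disjoint_iff of_nat_0_le_iff add_nonneg_pos zero_less_divide_1_iff zero_less_one)
  then obtain f where f: "!!n. f n \<in> W" "!!n. f n \<in> mball x (1 / (real n + 1))" by metis
  have "norm (ip_norm ip (f n - x)) <= 1 / (real n + 1)" for n
  proof -
   have "f n \<in> D" using f(1) assms(1) by blast
   then show ?thesis using f(2)[of n] x norm_minus[of x "f n"] by (simp add: norm_dist_def split: if_splits)
  qed
  moreover have "(%n. 1 / (real n + 1)) ----> 0"
   using LIMSEQ_inverse_real_of_nat by (simp add: inverse_eq_divide add.commute)
  ultimately have "(%n. ip_norm ip (f n - x)) ----> 0"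
   by (rule Lim_null_comparison[OF always_eventually, OF allI])
  then show False using assms(2)[of f x] f(1) x by blast
 qed
 then show ?thesis unfolding norm_topology_def closedin_metric using assms(1) by blast
qed

end

sublocale hilbert_form \<subseteq> inner_product_form
 by unfold_locales (rule definite)

lemma inner_product_form_of_inner_product:
 assumes "subspace H" "inner_product_on H ip"
 shows "inner_product_form H ip"
proof (intro inner_product_form.intro inner_product_form_axioms.intro psd_form_inner_product assms)
 show "x = 0" if "x \<in> H" "ip x x = 0" for x
  using inner_product_onD(4)[OF assms(2) that(1)] that(2) by auto
qed

lemma (in inner_product_form) inner_product_on: "inner_product_on D ip"
proof -
 have "0 < ip x x" if "x \<in> D" "x ~= 0" for x
  using that nonneg[of x] definite[of x] by (auto simp: less_le)
 moreover have "\<forall>x\<in>D. \<forall>y\<in>D. ip x y = ip y x" by (intro ballI sym)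
 ultimately show ?thesis unfolding inner_product_on_def using add scale by simp
qed

lemma separable_hilbert_normE:
 assumes "separable_hilbert_norm H N"
 obtains ip T where "subspace H" "hilbert_form H ip" "!!x. x \<in> H ==> N x = ip_norm ip x"
  "norm_topology H N = norm_topology H (ip_norm ip)"
  "countable T" "T <= H" "!!x r. x \<in> H ==> r > 0 ==> \<exists>s\<in>T. ip_norm ip (x - s) < r"
proof -
 obtain ip where H: "subspace H" and ip: "inner_product_on H ip" "\<forall>x\<in>H. N x = sqrt (ip x x)"
  and c: "Metric_space.mcomplete H (norm_dist H N)" and s: "separable_space (norm_topology H N)"
  using assms unfolding separable_hilbert_norm_def by blast
 have N: "N x = ip_norm ip x" if "x \<in> H" for x using ip that by (simp add: ip_norm_def)
 interpret I: inner_product_form H ip by (rule inner_product_form_of_inner_product[OF H ip(1)])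
 have top: "norm_topology H N = norm_topology H (ip_norm ip)" by (rule norm_topology_cong[OF H N])
 have "hilbert_form H ip"
 proof unfold_locales
  show "ip x x = 0 ==> x = 0" if "x \<in> H" for x using I.definite that by blast
  show "\<exists>x\<in>H. (%n. ip_norm ip (f n - x)) ----> 0" if "range f <= H" "ip_Cauchy ip f" for f
   using c I.mcomplete_iff norm_dist_cong[OF H N] that by simp
 qed
 moreover obtain T where T: "countable T" "T <= H" "norm_topology H (ip_norm ip) closure_of T = H"
  using s unfolding top separable_space_def I.topspace_norm_topology by blast
 moreover have "\<exists>s\<in>T. ip_norm ip (x - s) < r" if "x \<in> H" "r > 0" for x r
  using T(3) that unfolding I.closure_of_eq[OF T(2)] by blast
 ultimately show ?thesis using that[OF H _ N top] by blast
qed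

lemma separable_hilbert_normI:
 assumes "hilbert_form H ip" "!!x. x \<in> H ==> N x = ip_norm ip x"
  "countable T" "T <= H" "!!x r. x \<in> H ==> r > 0 ==> \<exists>s\<in>T. ip_norm ip (x - s) < r"
 shows "separable_hilbert_norm H N"
proof -
 interpret hilbert_form H ip by (rule assms)
 have top: "norm_topology H N = norm_topology H (ip_norm ip)" by (rule norm_topology_cong[OF D assms(2)])
 have dist: "norm_dist H N = norm_dist H (ip_norm ip)" by (rule norm_dist_cong[OF D assms(2)])
 have "norm_topology H (ip_norm ip) closure_of T = H"
  using assms(5) unfolding closure_of_eq[OF assms(4)] by blast
 then have "separable_space (norm_topology H N)"
  unfolding top separable_space_def topspace_norm_topology using assms(3,4) by blast
 moreover have "Metric_space.mcomplete H (norm_dist H N)"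
  unfolding dist mcomplete_iff using complete by blast
 ultimately show ?thesis unfolding separable_hilbert_norm_def
  using D inner_product_on assms(2) by (auto simp: ip_norm_def)
qed

lemma mtopology_finer:
 assumes "Metric_space M d1" "Metric_space M d2" "!!x y. x \<in> M ==> y \<in> M ==> d2 x y <= C * d1 x y"
  and U: "openin (Metric_space.mtopology M d2) U"
 shows "openin (Metric_space.mtopology M d1) U"
proof -
 interpret M1: Metric_space M d1 by fact
 interpret M2: Metric_space M d2 by fact
 define K where "K = \<bar>C\<bar> + 1"
 have K: "d2 x y <= K * d1 x y" if "x \<in> M" "y \<in> M" for x y
  using assms(3)[OF that] mult_right_mono[of C K "d1 x y"] M1.nonneg[of x y] unfolding K_def by linarith
 have K0: "K > 0" unfolding K_def by simp
 show ?thesis unfolding M1.openin_mtopology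
 proof (intro conjI allI impI)
  show UM: "U <= M" using U unfolding M2.openin_mtopology by blast
  fix x assume x: "x \<in> U"
  then obtain r where r: "r > 0" "M2.mball x r <= U" using U unfolding M2.openin_mtopology by blast
  have "M1.mball x (r / K) <= M2.mball x r"
  proof
   fix y assume y: "y \<in> M1.mball x (r / K)"
   then have "K * d1 x y < r" using K0 by (simp add: field_simps)
   with y K[of x y] show "y \<in> M2.mball x r" by auto
  qed
  then show "\<exists>r>0. M1.mball x r <= U" using r K0 by (intro exI[of _ "r / K"]) auto
 qed
qed

lemma norm_topology_eqI:
 assumes "inner_product_form H ip1" "inner_product_form H ip2"
  and c: "c > 0" "!!x. x \<in> H ==> c * ip_norm ip1 x <= ip_norm ip2 x"
  and C: "!!x. x \<in> H ==> ip_norm ip2 x <= C * ip_norm ip1 x"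
 shows "norm_topology H (ip_norm ip1) = norm_topology H (ip_norm ip2)"
proof -
 interpret I1: inner_product_form H ip1 by fact
 interpret I2: inner_product_form H ip2 by fact
 have a: "norm_dist H (ip_norm ip2) x y <= C * norm_dist H (ip_norm ip1) x y" if "x \<in> H" "y \<in> H" for x y
  using that C[of "x - y"] by (simp add: norm_dist_def)
 have b: "norm_dist H (ip_norm ip1) x y <= (1 / c) * norm_dist H (ip_norm ip2) x y" if "x \<in> H" "y \<in> H" for x y
  using that c(2)[of "x - y"] c(1) by (simp add: norm_dist_def field_simps)
 show ?thesis unfolding norm_topology_def topology_eq
  using mtopology_finer[OF I1.metric_space I2.metric_space a] mtopology_finer[OF I2.metric_space I1.metric_space b]
  by blast
qed

text \<open>The unit ball of the second norm is open for the first one and contains a ball of some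
  radius \<open>r\<close> around 0. The factor 2 arises because a vector is scaled to length
  \<open>r / 2\<close>, safely inside this open ball.\<close>

lemma norm_bound_of_topology_eq:
 assumes "inner_product_form H ip1" "inner_product_form H ip2"
  and top: "norm_topology H (ip_norm ip1) = norm_topology H (ip_norm ip2)"
 shows "\<exists>C>0. \<forall>x\<in>H. ip_norm ip2 x <= C * ip_norm ip1 x"
proof -
 interpret I1: inner_product_form H ip1 by fact
 interpret I2: inner_product_form H ip2 by fact
 interpret M1: Metric_space H "norm_dist H (ip_norm ip1)" by (rule I1.metric_space)
 interpret M2: Metric_space H "norm_dist H (ip_norm ip2)" by (rule I2.metric_space)
 have H0: "0 \<in> H" by (rule subspace_0[OF I1.D])
 have "openin M1.mtopology (M2.mball 0 1)" using top M2.openin_mball unfolding norm_topology_def by simp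
 moreover have "0 \<in> M2.mball 0 1" using H0 by simp
 ultimately obtain r where r: "r > 0" "M1.mball 0 r <= M2.mball 0 1" unfolding M1.openin_mtopology by blast
 have "ip_norm ip2 x <= (2 / r) * ip_norm ip1 x" if x: "x \<in> H" for x
 proof (cases "ip_norm ip1 x = 0")
  case True
  then have "x = 0" using I1.definite[OF x] I1.norm_sq[OF x] by simp
  then show ?thesis by (simp add: I1.norm_zero I2.norm_zero)
 next
  case False
  then have p: "ip_norm ip1 x > 0" using I1.norm_nonneg[OF x] by simp
  define k where "k = r / 2 / ip_norm ip1 x"
  have k: "k > 0" unfolding k_def using p r by simp
  have kx: "k *\<^sub>R x \<in> H" using x by simp
  have "ip_norm ip1 (0 - k *\<^sub>R x) = k * ip_norm ip1 x"
   using I1.norm_minus[OF H0 kx] I1.norm_scale[OF x, of k] k by simp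
  also have "\<dots> = r / 2" using p unfolding k_def by simp
  finally have "ip_norm ip1 (0 - k *\<^sub>R x) = r / 2" .
  then have "k *\<^sub>R x \<in> M1.mball 0 r" using kx H0 r(1) by (simp add: norm_dist_def)
  then have "k *\<^sub>R x \<in> M2.mball 0 1" using r(2) by blast
  then have "k * ip_norm ip2 x < 1"
   using I2.norm_minus[OF H0 kx] I2.norm_scale[OF x, of k] kx H0 k by (simp add: norm_dist_def)
  then show ?thesis using p r(1) unfolding k_def by (simp add: field_simps)
 qed
 then show ?thesis using r(1) by (intro exI[of _ "2 / r"]) simp
qed

section \<open>Quadratic closeness of Hilbert norms\<close>

text \<open>A Bessel family is the image of an orthonormal family under a contraction; unlike
  orthonormality, this survives projections, restrictions and approximation.\<close>

definition bessel :: "('v::real_vector => real) => nat set => (nat => 'v) => bool" where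
 "bessel N A x \<longleftrightarrow> finite A & (\<forall>c. (N (\<Sum>i\<in>A. c i *\<^sub>R x i))^2 <= (\<Sum>i\<in>A. (c i)^2))"

text \<open>Such a uniform bound says that the difference of the two quadratic forms is
  Hilbert-Schmidt relative to the first norm. Finiteness of \<open>A\<close> is part of
  \<open>bessel\<close>.\<close>

definition hs_close :: "'v::real_vector set => ('v => real) => ('v => real) => bool" where
 "hs_close H N1 N2 \<longleftrightarrow> (\<exists>M. \<forall>A x. x ` A <= H --> bessel N1 A x \<longrightarrow>
  (\<Sum>i\<in>A. ((N2 (x i))^2 - (N1 (x i))^2)^2) <= M)"

lemma bessel_cong:
 assumes "subspace H" "!!x. x \<in> H ==> N x = N' x" "x ` A <= H"
 shows "bessel N A x \<longleftrightarrow> bessel N' A x"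
proof -
 have "(\<Sum>i\<in>A. c i *\<^sub>R x i) \<in> H" for c
  using assms(1,3) by (intro subspace_sum subspace_scale) auto
 then show ?thesis unfolding bessel_def using assms(2) by simp
qed

lemma hs_close_cong:
 assumes H: "subspace H" and 1: "!!x. x \<in> H ==> N1 x = N1' x" and 2: "!!x. x \<in> H ==> N2 x = N2' x"
  and hs: "hs_close H N1 N2"
 shows "hs_close H N1' N2'"
proof -
 obtain M where M: "!!A x. x ` A <= H ==> bessel N1 A x ==> (\<Sum>i\<in>A. ((N2 (x i))^2 - (N1 (x i))^2)^2) <= M"
  using hs unfolding hs_close_def by blast
 have "(\<Sum>i\<in>A. ((N2' (x i))^2 - (N1' (x i))^2)^2) <= M" if x: "x ` A <= H" "bessel N1' A x" for A x
 proof -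
  have "bessel N1 A x" using bessel_cong[OF H 1 x(1)] x(2) by simp
  moreover have "(\<Sum>i\<in>A. ((N2 (x i))^2 - (N1 (x i))^2)^2) = (\<Sum>i\<in>A. ((N2' (x i))^2 - (N1' (x i))^2)^2)"
  proof (rule sum.cong[OF refl])
   fix i assume "i \<in> A"
   then have "x i \<in> H" using x(1) by blast
   then show "((N2 (x i))^2 - (N1 (x i))^2)^2 = ((N2' (x i))^2 - (N1' (x i))^2)^2" by (simp only: 1 2)
  qed
  ultimately show ?thesis using M[OF x(1)] by simp
 qed
 then show ?thesis unfolding hs_close_def by blast
qed

context psd_form
begin

lemma orthonormal_bessel:
 "finite A ==> e ` A <= D ==> orthonormal ip A e ==> bessel (ip_norm ip) A e"
 unfolding bessel_def
proof (intro conjI allI)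
 fix c assume e: "finite A" "e ` A <= D" "orthonormal ip A e"
 have eD: "i \<in> A ==> e i \<in> D" for i using e by auto
 have "(ip_norm ip (\<Sum>i\<in>A. c i *\<^sub>R e i))^2 = ip (\<Sum>i\<in>A. c i *\<^sub>R e i) (\<Sum>i\<in>A. c i *\<^sub>R e i)"
  by (rule norm_sq[OF sum_in]) (rule eD)
 then show "(ip_norm ip (\<Sum>i\<in>A. c i *\<^sub>R e i))^2 <= (\<Sum>i\<in>A. (c i)^2)"
  using orthonormal_combination[OF e(1) eD e(3), of c c] by (simp add: power2_eq_square)
qed

text \<open>The adjoint of a contraction is a contraction: the Bessel bound is tested on the
  combination with coefficients \<open>ip (x i) y\<close>.\<close>

lemma bessel_analysis:
 assumes x: "bessel (ip_norm ip) A x" "x ` A <= D" and y: "y \<in> D"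
 shows "(\<Sum>i\<in>A. (ip (x i) y)^2) <= ip y y"
proof -
 define S where "S = (\<Sum>i\<in>A. (ip (x i) y)^2)"
 define z where "z = (\<Sum>i\<in>A. ip (x i) y *\<^sub>R x i)"
 have xD: "i \<in> A ==> x i \<in> D" for i using x by auto
 have zD: "z \<in> D" unfolding z_def by (rule sum_in) (rule xD)
 have "S = ip z y" unfolding z_def S_def using ip_sum_left[of A x y "%i. ip (x i) y"] xD y by (simp add: power2_eq_square)
 then have "S\<^sup>2 <= (ip_norm ip z * ip_norm ip y)^2"
  using Cauchy_Schwarz[OF zD y] abs_le_square_iff[of S "ip_norm ip z * ip_norm ip y"]
   norm_nonneg[OF zD] norm_nonneg[OF y] by simp
 also have "\<dots> <= S * ip y y"
  unfolding power_mult_distrib norm_sq[OF y]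
  using x(1) nonneg[OF y] unfolding bessel_def z_def S_def by (intro mult_right_mono) simp_all
 finally have "S * S <= S * ip y y" by (simp add: power2_eq_square)
 moreover have "0 <= S" unfolding S_def by (simp add: sum_nonneg)
 ultimately show ?thesis unfolding S_def[symmetric] using nonneg[OF y]
  by (cases "S = 0") (simp_all add: mult_le_cancel_left)
qed

lemma bessel_member:
 assumes x: "bessel (ip_norm ip) A x" "x ` A <= D" and i: "i \<in> A"
 shows "ip (x i) (x i) <= 1"
proof -
 have A: "finite A" using x unfolding bessel_def by blast
 have "(\<Sum>j\<in>A. (if j = i then 1 else 0) *\<^sub>R x j) = (\<Sum>j\<in>A. if j = i then x j else 0)"
  by (intro sum.cong) auto
 then have s: "(\<Sum>j\<in>A. (if j = i then 1 else 0) *\<^sub>R x j) = x i" using i A by simp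
 have "(\<Sum>j\<in>A. (if j = i then 1 else 0 :: real)^2) = (\<Sum>j\<in>A. if j = i then 1 else 0)"
  by (intro sum.cong) auto
 then have "(ip_norm ip (x i))^2 <= 1"
  using x(1)[unfolded bessel_def, THEN conjunct2, THEN spec, of "%j. if j = i then 1 else 0"] i A
  unfolding s by simp
 moreover have "x i \<in> D" using i x(2) by auto
 ultimately show ?thesis by (simp add: norm_sq)
qed

end

context hilbert_form
begin

text \<open>The matrix of the numbers \<open>(ip (x i) (u k))^2\<close> has row sums and column sums
  at most 1. Cauchy-Schwarz within each row, followed by summation over the columns, therefore does
  not enlarge the sum of squares of a diagonal form.\<close>

lemma bessel_sum_diagonal:
 assumes x: "bessel (ip_norm ip) A x" "x ` A <= D"
  and F: "finite (F :: nat set)" "u ` F <= D" "orthonormal ip F u"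
 shows "(\<Sum>i\<in>A. (\<Sum>k\<in>F. \<beta> k * (ip (x i) (u k))^2)^2) <= (\<Sum>k\<in>F. (\<beta> k)^2)"
proof -
 have uD: "k \<in> F ==> u k \<in> D" and xD: "i \<in> A ==> x i \<in> D" for k i using F x by auto
 have "(\<Sum>k\<in>F. \<beta> k * (ip (x i) (u k))^2)^2 <= (\<Sum>k\<in>F. (\<beta> k)^2 * (ip (x i) (u k))^2)" if i: "i \<in> A" for i
 proof -
  have "(\<Sum>k\<in>F. \<beta> k * (ip (x i) (u k))^2)^2 = (\<Sum>k\<in>F. (\<beta> k * ip (x i) (u k)) * ip (x i) (u k))^2"
   by (simp add: power2_eq_square mult.assoc)
  also have "\<dots> <= (\<Sum>k\<in>F. (\<beta> k * ip (x i) (u k))^2) * (\<Sum>k\<in>F. (ip (x i) (u k))^2)"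
   by (rule Cauchy_Schwarz_ineq_sum)
  also have "\<dots> <= (\<Sum>k\<in>F. (\<beta> k * ip (x i) (u k))^2) * 1"
  proof (rule mult_left_mono)
   have "(\<Sum>k\<in>F. (ip (x i) (u k))^2) = (\<Sum>k\<in>F. (ip (u k) (x i))^2)"
    by (intro sum.cong refl) (simp only: sym[OF xD[OF i] uD])
   also have "\<dots> <= ip (x i) (x i)"
    by (rule bessel_analysis[OF orthonormal_bessel[OF F] F(2) xD[OF i]])
   also have "\<dots> <= 1" by (rule bessel_member[OF x i])
   finally show "(\<Sum>k\<in>F. (ip (x i) (u k))^2) <= 1" .
  qed (simp add: sum_nonneg)
  finally show ?thesis by (simp add: power_mult_distrib)
 qed
 then have "(\<Sum>i\<in>A. (\<Sum>k\<in>F. \<beta> k * (ip (x i) (u k))^2)^2) <= (\<Sum>i\<in>A. \<Sum>k\<in>F. (\<beta> k)^2 * (ip (x i) (u k))^2)"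
  by (intro sum_mono)
 also have "\<dots> = (\<Sum>k\<in>F. (\<beta> k)^2 * (\<Sum>i\<in>A. (ip (x i) (u k))^2))"
  by (subst sum.swap) (simp add: sum_distrib_left)
 also have "\<dots> <= (\<Sum>k\<in>F. (\<beta> k)^2 * 1)"
 proof (intro sum_mono mult_left_mono)
  fix k assume k: "k \<in> F"
  have "(\<Sum>i\<in>A. (ip (x i) (u k))^2) <= ip (u k) (u k)" by (rule bessel_analysis[OF x uD[OF k]])
  also have "\<dots> = 1" using F(3) k unfolding orthonormal_def by simp
  finally show "(\<Sum>i\<in>A. (ip (x i) (u k))^2) <= 1" .
 qed simp
 finally show ?thesis by simp
qed

lemma best_approximation:
 assumes F: "finite F" "u ` F <= D" "orthonormal ip F u" and x: "x \<in> D" and s: "s \<in> span (u ` F)"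
 shows "ip_norm ip (x - (\<Sum>k\<in>F. ip x (u k) *\<^sub>R u k)) <= ip_norm ip (x - s)"
proof -
 define p where "p = (\<Sum>k\<in>F. ip x (u k) *\<^sub>R u k)"
 have uD: "k \<in> F ==> u k \<in> D" for k using F by auto
 have pD: "p \<in> D" unfolding p_def by (rule sum_in) (rule uD)
 have zD: "x - p \<in> D" using x pD by simp
 have "subspace {y\<in>D. ip (x - p) y = 0}"
  using zD by (intro subspaceI) (simp_all add: zero_right add_right scale_right)
 moreover have "u ` F <= {y\<in>D. ip (x - p) y = 0}"
 proof clarify
  fix k assume k: "k \<in> F"
  have "ip p (u k) = ip x (u k)" unfolding p_def by (rule orthonormal_coeff[OF F(1) uD F(3) k])
  then show "u k \<in> D & ip (x - p) (u k) = 0" using uD[OF k] x pD by (simp add: diff)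
 qed
 ultimately have span: "span (u ` F) <= {y\<in>D. ip (x - p) y = 0}" by (rule span_minimal[rotated])
 have "p \<in> span (u ` F)" unfolding p_def by (intro span_sum span_scale span_base) auto
 then have ps: "p - s \<in> span (u ` F)" using s by (rule span_diff)
 then have o: "ip (x - p) (p - s) = 0" and psD: "p - s \<in> D" using span by auto
 have "x - s = (x - p) + 1 *\<^sub>R (p - s)" by simp
 then have "ip (x - s) (x - s) = ip (x - p) (x - p) + ip (p - s) (p - s)"
  using ip_sum_sq[OF zD psD, of 1] o by (simp only:) simp
 then show ?thesis unfolding p_def[symmetric] ip_norm_def using nonneg[OF psD] by simp
qed

end

text \<open>Equivalence of the norms carries completeness and separability over to
  \<open>N2\<close>. The basis consists of the eigenvectors of \<open>ip2 - ip1\<close>: they are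
  orthonormal for \<open>ip1\<close>, and since the difference vanishes between different ones they
  are also orthogonal for \<open>ip2\<close>.\<close>

lemma fhs_equivI:
 fixes H :: "'v::real_vector set"
 assumes N1: "separable_hilbert_norm H N1"
  and ip2: "inner_product_on H ip2" "!!x. x \<in> H ==> N2 x = sqrt (ip2 x x)"
  and c: "c > 0" "!!x. x \<in> H ==> c * N1 x <= N2 x"
  and C: "!!x. x \<in> H ==> N2 x <= C * N1 x"
  and hs: "hs_close H N1 N2"
 shows "(N1, N2) \<in> fhs_equiv H"
proof -
 obtain ip1 T where H: "subspace H" and h1: "hilbert_form H ip1" and n1: "!!x. x \<in> H ==> N1 x = ip_norm ip1 x"
  and t1: "norm_topology H N1 = norm_topology H (ip_norm ip1)"
  and T: "countable T" "T <= H" "!!x r. x \<in> H ==> r > 0 ==> \<exists>s\<in>T. ip_norm ip1 (x - s) < r"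
  using separable_hilbert_normE[OF N1] by metis
 interpret I1: hilbert_form H ip1 by fact
 interpret I2: inner_product_form H ip2 by (rule inner_product_form_of_inner_product[OF H ip2(1)])
 have n2: "N2 x = ip_norm ip2 x" if "x \<in> H" for x using ip2(2)[OF that] by (simp add: ip_norm_def)
 have c': "c * ip_norm ip1 x <= ip_norm ip2 x" and C': "ip_norm ip2 x <= C * ip_norm ip1 x" if "x \<in> H" for x
  using c(2)[OF that] C[OF that] n1[OF that] n2[OF that] by simp_all
 have C0: "ip_norm ip2 x <= (\<bar>C\<bar> + 1) * ip_norm ip1 x" if "x \<in> H" for x
  using C'[OF that] mult_right_mono[of C "\<bar>C\<bar> + 1" "ip_norm ip1 x"] I1.norm_nonneg[OF that] by linarith
 have t2: "norm_topology H N2 = norm_topology H (ip_norm ip2)" by (rule norm_topology_cong[OF H n2])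
 have t12: "norm_topology H N1 = norm_topology H N2"
  unfolding t1 t2
  by (rule norm_topology_eqI[OF I1.inner_product_form_axioms I2.inner_product_form_axioms c(1) c' C'])
 have N2: "separable_hilbert_norm H N2"
 proof (rule separable_hilbert_normI[OF _ n2 T(1,2)])
  show "hilbert_form H ip2"
  proof unfold_locales
   show "ip2 x x = 0 ==> x = 0" if "x \<in> H" for x using I2.definite that by blast
   fix f :: "nat => 'v" assume f: "range f <= H" "ip_Cauchy ip2 f"
   have fH: "f n \<in> H" for n using f by auto
   have "ip_Cauchy ip1 f" unfolding ip_Cauchy_def
   proof (intro allI impI)
    fix e :: real assume "e > 0"
    then obtain M where M: "!!m n. m \<ge> M ==> n \<ge> M ==> ip_norm ip2 (f m - f n) < c * e"
     using f(2) c(1) unfolding ip_Cauchy_def by (meson mult_pos_pos)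
    have "ip_norm ip1 (f m - f n) < e" if "m \<ge> M" "n \<ge> M" for m n
    proof -
     have "f m - f n \<in> H" using fH by simp
     from c'[OF this] M[OF that] have "c * ip_norm ip1 (f m - f n) < c * e" by linarith
     then show ?thesis using c(1) by simp
    qed
    then show "\<exists>M. \<forall>m\<ge>M. \<forall>n\<ge>M. ip_norm ip1 (f m - f n) < e" by blast
   qed
   then obtain x where x: "x \<in> H" "(%n. ip_norm ip1 (f n - x)) ----> 0" using I1.complete f(1) by blast
   have "(%n. ip_norm ip2 (f n - x)) ----> 0"
   proof (rule Lim_null_comparison[OF always_eventually, OF allI])
    show "norm (ip_norm ip2 (f n - x)) <= (\<bar>C\<bar> + 1) * ip_norm ip1 (f n - x)" for n
     using C0[of "f n - x"] fH[of n] x(1) by simp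
    show "(%n. (\<bar>C\<bar> + 1) * ip_norm ip1 (f n - x)) ----> 0"
     using tendsto_mult_left[OF x(2), of "\<bar>C\<bar> + 1"] by simp
   qed
   with x show "\<exists>x\<in>H. (%n. ip_norm ip2 (f n - x)) ----> 0" by blast
  qed
  show "\<exists>s\<in>T. ip_norm ip2 (x - s) < r" if x: "x \<in> H" and r: "r > 0" for x r
  proof -
   have "r / (\<bar>C\<bar> + 1) > 0" using r by simp
   then obtain s where s: "s \<in> T" "ip_norm ip1 (x - s) < r / (\<bar>C\<bar> + 1)" using T(3)[OF x] by blast
   have "x - s \<in> H" using x s T(2) by auto
   from C0[OF this] have "ip_norm ip2 (x - s) <= (\<bar>C\<bar> + 1) * ip_norm ip1 (x - s)" .
   also have "\<dots> < r" using s(2) by (simp add: pos_less_divide_eq add_nonneg_pos mult.commute)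
   finally show ?thesis using s by blast
  qed
 qed
 define b where "b = (%x y. ip2 x y - ip1 x y)"
 have b: "symmetric_bilinear_on H b"
  unfolding symmetric_bilinear_on_def b_def
 proof (intro conjI ballI allI)
  show "ip2 x y - ip1 x y = ip2 y x - ip1 y x" if "x \<in> H" "y \<in> H" for x y
   by (simp only: I1.sym[OF that] I2.sym[OF that])
 qed (simp_all add: I1.add I2.add I1.scale I2.scale algebra_simps)
 have bq: "b x x = (N2 x)^2 - (N1 x)^2" if "x \<in> H" for x
  using n1[OF that] n2[OF that] I1.norm_sq[OF that] I2.norm_sq[OF that] by (simp add: b_def)
 have bdd: "\<bar>b x x\<bar> <= ((\<bar>C\<bar> + 1)^2 + 1) * ip1 x x" if x: "x \<in> H" for x
 proof -
  have "ip2 x x <= ((\<bar>C\<bar> + 1) * ip_norm ip1 x)^2"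
   unfolding I2.norm_sq[OF x, symmetric] by (rule power_mono[OF C0[OF x] I2.norm_nonneg[OF x]])
  then have "ip2 x x <= (\<bar>C\<bar> + 1)^2 * ip1 x x" by (simp add: power_mult_distrib I1.norm_sq[OF x])
  moreover have "0 <= (\<bar>C\<bar> + 1)^2 * ip1 x x" using I1.nonneg[OF x] by simp
  ultimately show ?thesis using I2.nonneg[OF x] I1.nonneg[OF x]
   unfolding b_def distrib_right abs_le_iff by linarith
 qed
 obtain M where M: "!!A x. x ` A <= H ==> bessel N1 A x ==> (\<Sum>i\<in>A. ((N2 (x i))^2 - (N1 (x i))^2)^2) <= M"
  using hs unfolding hs_close_def by blast
 have M': "(\<Sum>i\<in>A. (b (e i) (e i))^2) <= M" if e: "finite A" "e ` A <= H" "orthonormal ip1 A e"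
  for A :: "nat set" and e
 proof -
  have "bessel N1 A e" using I1.orthonormal_bessel[OF e] bessel_cong[OF H n1 e(2)] by simp
  from M[OF e(2) this] show ?thesis using e(2) bq by (auto simp: image_subset_iff)
 qed
 obtain S where S: "S <= H" "orthonormal ip1 S id" "\<forall>e\<in>S. \<forall>y\<in>H. ip1 e y = 0 --> b e y = 0"
  "I1.norm_closure (span S) = H"
  using I1.eigenbasis_set_exists[OF b bdd M'] by blast
 have cS: "countable S" by (rule I1.orthonormal_set_countable[OF S(1,2) T])
 \<comment> \<open>The countable eigenbasis \<open>S\<close> is numbered by its image under an
   injection into \<open>nat\<close>, which covers finite and infinite bases alike.\<close>
 define I where "I = to_nat_on S ` S"
 define e where "e = from_nat_into S"
 have eI: "e ` I = S" unfolding e_def I_def using cS by (auto simp: image_image)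
 have inj: "inj_on e I" unfolding e_def I_def
  by (rule inj_onI) (use cS in auto)
 have on: "orthonormal ip1 I e"
  unfolding orthonormal_def
 proof (intro ballI)
  fix i j assume ij: "i \<in> I" "j \<in> I"
  then have "e i \<in> S" "e j \<in> S" "e i = e j \<longleftrightarrow> i = j" using eI inj by (auto simp: inj_on_eq_iff)
  then show "ip1 (e i) (e j) = (if i = j then 1 else 0)" using S(2) unfolding orthonormal_def by simp
 qed
 have eH: "k \<in> I ==> e k \<in> H" for k using eI S(1) by blast
 have spH: "span S <= H" using S(1) H by (rule span_minimal)
 have e1: "N1 (e k) = 1" if "k \<in> I" for k
  using n1[OF eH[OF that]] on that unfolding orthonormal_def ip_norm_def by simp
 have ne: "e ` I <= H - {0}" using eH e1 n1[OF subspace_0[OF H]] I1.norm_zero by force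
 have closure: "norm_topology H N1 closure_of span (e ` I) = H"
  using S(4) unfolding t1 eI I1.closure_of_eq[OF spH] I1.norm_closure_def .
 have o1: "norm_ip N1 (e j) (e k) = 0" and o2: "norm_ip N2 (e j) (e k) = 0"
  if jk: "j \<in> I" "k \<in> I" "j ~= k" for j k
 proof -
  have z: "ip1 (e j) (e k) = 0" using on jk unfolding orthonormal_def by simp
  then show "norm_ip N1 (e j) (e k) = 0"
   using norm_ip_cong[OF H n1 eH[OF jk(1)] eH[OF jk(2)]] I1.norm_ip_ip_norm eH jk by simp
  have "b (e j) (e k) = 0" using S(3) z jk eH eI by blast
  then show "norm_ip N2 (e j) (e k) = 0"
   using norm_ip_cong[OF H n2 eH[OF jk(1)] eH[OF jk(2)]] I2.norm_ip_ip_norm eH jk z by (simp add: b_def)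
 qed
 \<comment> \<open>As \<open>N1 (e k)\<close> is 1, the quotient is \<open>l = N2 (e k)\<close>, and
   \<open>\<bar>l - 1\<bar> <= \<bar>l^2 - 1\<bar>\<close> for \<open>l\<close> nonnegative, where
   \<open>l^2 - 1\<close> is the eigenvalue.\<close>
 have sq: "(N2 (e k) / N1 (e k) - 1)^2 <= (b (e k) (e k))^2" if k: "k \<in> I" for k
 proof -
  have p: "N2 (e k) \<ge> 0" using n2[OF eH[OF k]] I2.norm_nonneg[OF eH[OF k]] by simp
  have "b (e k) (e k) = (N2 (e k) - 1) * (N2 (e k) + 1)"
   using bq[OF eH[OF k]] e1[OF k] by (simp add: power2_eq_square algebra_simps)
  moreover have "\<bar>N2 (e k) - 1\<bar> * 1 <= \<bar>N2 (e k) - 1\<bar> * \<bar>N2 (e k) + 1\<bar>"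
   using p by (intro mult_left_mono) auto
  ultimately have "\<bar>N2 (e k) - 1\<bar> <= \<bar>b (e k) (e k)\<bar>" by (simp add: abs_mult)
  then show ?thesis using e1[OF k] by (simp add: abs_le_square_iff)
 qed
 have "(%k. (N2 (e k) / N1 (e k) - 1)^2) summable_on I"
 proof (rule nonneg_bdd_above_summable_on)
  show "bdd_above (sum (%k. (N2 (e k) / N1 (e k) - 1)^2) ` {F. F <= I & finite F})"
  proof (rule bdd_aboveI2)
   fix F assume "F \<in> {F. F <= I & finite F}"
   then have F: "F <= I" "finite F" by auto
   have "(\<Sum>k\<in>F. (N2 (e k) / N1 (e k) - 1)^2) <= (\<Sum>k\<in>F. (b (e k) (e k))^2)"
    using sq F by (intro sum_mono) auto
   also have "\<dots> <= M"
   proof (rule M'[OF F(2)])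
    show "e ` F <= H" using F(1) eH by blast
    show "orthonormal ip1 F e" using F(1) on unfolding orthonormal_def by blast
   qed
   finally show "(\<Sum>k\<in>F. (N2 (e k) / N1 (e k) - 1)^2) <= M" .
  qed
 qed simp
 moreover have "orthogonal_basis H N1 I e"
  unfolding orthogonal_basis_def using ne o1 closure by blast
 moreover have "orthogonal_basis H N2 I e"
  unfolding orthogonal_basis_def using ne o2 closure t12 by auto
 ultimately show ?thesis unfolding fhs_equiv_def using N1 N2 t12 by blast
qed

lemma finite_common_span:
 assumes "finite A" "!!i. i \<in> A ==> s i \<in> span (u ` I)"
 shows "\<exists>F\<subseteq>I. finite F & (\<forall>i\<in>A. s i \<in> span (u ` F))"
 using assms
proof (induction A)
 case empty
 show ?case by (intro exI[of _ "{}"]) simp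
next
 case (insert j A)
 obtain F where F: "F <= I" "finite F" "\<forall>i\<in>A. s i \<in> span (u ` F)" using insert by auto
 obtain t r where t: "finite t" "t <= u ` I" "s j = (\<Sum>a\<in>t. r a *\<^sub>R a)"
  using insert.prems[of j] unfolding span_explicit by auto
 obtain F' where F': "F' <= I" "finite F'" "t = u ` F'" using finite_subset_image[OF t(1,2)] by auto
 have "s j \<in> span (u ` (F \<union> F'))"
  unfolding t(3) using F'(3) by (intro span_sum span_scale span_base) auto
 moreover have "span (u ` F) <= span (u ` (F \<union> F'))" by (intro span_mono) auto
 ultimately show ?case using F F' by (intro exI[of _ "F \<union> F'"]) auto
qed

text \<open>In the normalized common basis the difference of the forms is diagonal. A Bessel family
  is replaced by its projections onto finitely many basis vectors, where
  \<open>bessel_sum_diagonal\<close> applies with a bound free of the number of vectors, and the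
  projections then tend to the family in both norms.\<close>

lemma hs_close_of_fhs_equiv:
 fixes H :: "'v::real_vector set"
 assumes H: "subspace H" and h1: "hilbert_form H ip1" and h2: "hilbert_form H ip2"
  and C: "!!x. x \<in> H ==> ip_norm ip2 x <= C * ip_norm ip1 x"
  and o1: "orthogonal_basis H (ip_norm ip1) I e" and o2: "orthogonal_basis H (ip_norm ip2) I e"
  and sm: "(%k. (ip_norm ip2 (e k) / ip_norm ip1 (e k) - 1)^2) summable_on I"
 shows "hs_close H (ip_norm ip1) (ip_norm ip2)"
proof -
 interpret I1: hilbert_form H ip1 by fact
 interpret I2: hilbert_form H ip2 by fact
 define n where "n = (%k. ip_norm ip1 (e k))"
 define u where "u = (%k. (1 / n k) *\<^sub>R e k)"
 have eH: "e k \<in> H" and e0: "e k ~= 0" if "k \<in> I" for k using o1 that unfolding orthogonal_basis_def by auto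
 have n: "n k > 0" if "k \<in> I" for k
  using I1.norm_nonneg[OF eH[OF that]] I1.definite[OF eH[OF that]] e0[OF that] I1.norm_sq[OF eH[OF that]]
  unfolding n_def by (auto simp: less_le)
 have uH: "u k \<in> H" if "k \<in> I" for k unfolding u_def using eH[OF that] by simp
 have e1: "ip1 (e j) (e k) = 0" if jk: "j \<in> I" "k \<in> I" "j ~= k" for j k
 proof -
  have "norm_ip (ip_norm ip1) (e j) (e k) = 0" using o1 jk unfolding orthogonal_basis_def by (elim conjE) simp
  then show ?thesis unfolding I1.norm_ip_ip_norm[OF eH[OF jk(1)] eH[OF jk(2)]] .
 qed
 have e2: "ip2 (e j) (e k) = 0" if jk: "j \<in> I" "k \<in> I" "j ~= k" for j k
 proof -
  have "norm_ip (ip_norm ip2) (e j) (e k) = 0" using o2 jk unfolding orthogonal_basis_def by (elim conjE) simp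
  then show ?thesis unfolding I2.norm_ip_ip_norm[OF eH[OF jk(1)] eH[OF jk(2)]] .
 qed
 have u1: "ip1 (u j) (u k) = (if j = k then 1 else 0)" if jk: "j \<in> I" "k \<in> I" for j k
 proof (cases "j = k")
  case True
  have "ip1 (u k) (u k) = 1" unfolding u_def n_def by (rule I1.normalize[OF eH[OF jk(2)] e0[OF jk(2)]])
  with True show ?thesis by simp
 next
  case False
  then show ?thesis unfolding u_def using e1[OF jk False] eH jk by (simp add: I1.scale I1.scale_right)
 qed
 have on: "orthonormal ip1 F u" if "F <= I" for F
  unfolding orthonormal_def by (intro ballI u1) (use that in blast)+
 have u2: "ip2 (u j) (u k) = 0" if jk: "j \<in> I" "k \<in> I" "j ~= k" for j k
  unfolding u_def using e2[OF jk] eH jk by (simp add: I2.scale I2.scale_right)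
 define \<beta> where "\<beta> = (%k. ip2 (u k) (u k) - 1)"
 define S where "S = (\<Sum>\<^sub>\<infinity>k\<in>I. (ip_norm ip2 (e k) / ip_norm ip1 (e k) - 1)^2)"
 define M where "M = (\<bar>C\<bar> + 1)^2 * S"
 have C': "ip_norm ip2 x <= \<bar>C\<bar> * ip_norm ip1 x" if "x \<in> H" for x
  using C[OF that] mult_right_mono[of C "\<bar>C\<bar>" "ip_norm ip1 x"] I1.norm_nonneg[OF that] by linarith
 \<comment> \<open>With \<open>l\<close> the quotient of the norms, the diagonal entry is
   \<open>l^2 - 1 = (l + 1) * (l - 1)\<close>, and \<open>l\<close> is at most
   \<open>\<bar>C\<bar>\<close>.\<close>
 have beta: "(\<beta> k)^2 <= (\<bar>C\<bar> + 1)^2 * (ip_norm ip2 (e k) / ip_norm ip1 (e k) - 1)^2" if k: "k \<in> I" for k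
 proof -
  define l where "l = ip_norm ip2 (e k) / ip_norm ip1 (e k)"
  have l: "ip_norm ip2 (u k) = l"
   unfolding u_def l_def using I2.norm_scale[OF eH[OF k]] n[OF k] by (simp add: n_def)
  have "l <= \<bar>C\<bar>" "0 <= l"
   using C'[OF uH[OF k]] u1[OF k k] I2.norm_nonneg[OF uH[OF k]] unfolding l[symmetric] by (simp_all add: ip_norm_def)
  then have "(l + 1)^2 <= (\<bar>C\<bar> + 1)^2" by (intro power_mono) auto
  then have "(l + 1)^2 * (l - 1)^2 <= (\<bar>C\<bar> + 1)^2 * (l - 1)^2" by (intro mult_right_mono) auto
  moreover have "\<beta> k = (l + 1) * (l - 1)"
   unfolding \<beta>_def using I2.norm_sq[OF uH[OF k]] l by (simp add: power2_eq_square algebra_simps)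
  ultimately show ?thesis unfolding l_def by (simp add: power_mult_distrib)
 qed
 have sumbeta: "(\<Sum>k\<in>F. (\<beta> k)^2) <= M" if F: "finite F" "F <= I" for F
 proof -
  have "(\<Sum>k\<in>F. (\<beta> k)^2) <= (\<Sum>k\<in>F. (\<bar>C\<bar> + 1)^2 * (ip_norm ip2 (e k) / ip_norm ip1 (e k) - 1)^2)"
   using beta F by (intro sum_mono) auto
  also have "\<dots> = (\<bar>C\<bar> + 1)^2 * (\<Sum>k\<in>F. (ip_norm ip2 (e k) / ip_norm ip1 (e k) - 1)^2)"
   by (simp add: sum_distrib_left)
  also have "\<dots> <= M"
   unfolding M_def S_def using finite_sum_le_infsum[OF sm F] by (intro mult_left_mono) auto
  finally show ?thesis .
 qed
 have spanu: "span (e ` I) <= span (u ` I)"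
 proof (rule span_minimal)
  have "e k \<in> span (u ` I)" if k: "k \<in> I" for k
  proof -
   have "e k = n k *\<^sub>R u k" unfolding u_def using n[OF k] by simp
   then show ?thesis using span_scale[OF span_base, of "u k" "u ` I" "n k"] k by auto
  qed
  then show "e ` I <= span (u ` I)" by blast
 qed simp
 have spH: "span (e ` I) <= H" using H eH by (intro span_minimal) auto
 have cl: "{x\<in>H. \<forall>r>0. \<exists>s\<in>span (e ` I). ip_norm ip1 (x - s) < r} = H"
  using o1 unfolding orthogonal_basis_def I1.closure_of_eq[OF spH] by blast
 have dense: "\<exists>s\<in>span (u ` I). ip_norm ip1 (x - s) < r" if x: "x \<in> H" and r: "r > 0" for x r
 proof -
  have "x \<in> {x\<in>H. \<forall>r>0. \<exists>s\<in>span (e ` I). ip_norm ip1 (x - s) < r}" using cl x by simp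
  then show ?thesis using r spanu by blast
 qed
 show ?thesis unfolding hs_close_def
 proof (intro exI allI impI)
  fix A and x :: "nat => 'v" assume x: "x ` A <= H" "bessel (ip_norm ip1) A x"
  have A: "finite A" using x(2) unfolding bessel_def by blast
  have xH: "i \<in> A ==> x i \<in> H" for i using x(1) by auto
  \<comment> \<open>One finite set \<open>F\<close> must serve all members of the family: good
    approximants in the span are chosen first, then all basis vectors used in them are collected;
    the projection is at least as close.\<close>
  have "\<exists>F\<subseteq>I. finite F & (\<forall>i\<in>A. ip_norm ip1 (x i - (\<Sum>k\<in>F. ip1 (x i) (u k) *\<^sub>R u k)) <= 1 / (real m + 1))" for m
  proof -
   have "\<forall>i\<in>A. \<exists>s\<in>span (u ` I). ip_norm ip1 (x i - s) < 1 / (real m + 1)" using dense xH by simp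
   then obtain s where s: "!!i. i \<in> A ==> s i \<in> span (u ` I)"
    "!!i. i \<in> A ==> ip_norm ip1 (x i - s i) < 1 / (real m + 1)" by metis
   have "\<exists>F\<subseteq>I. finite F & (\<forall>i\<in>A. s i \<in> span (u ` F))" by (rule finite_common_span[OF A s(1)])
   then obtain F where F: "F <= I" "finite F" "\<forall>i\<in>A. s i \<in> span (u ` F)" by (elim exE conjE)
   have uF: "u ` F <= H" using F(1) uH by auto
   have "ip_norm ip1 (x i - (\<Sum>k\<in>F. ip1 (x i) (u k) *\<^sub>R u k)) <= 1 / (real m + 1)" if i: "i \<in> A" for i
    using I1.best_approximation[OF F(2) uF on[OF F(1)] xH[OF i] F(3)[rule_format, OF i]] s(2)[OF i] by linarith
   then show ?thesis using F(1,2) by (intro exI[of _ F]) simp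
  qed
  then obtain F where F: "!!m. F m <= I" "!!m. finite (F m)"
   "!!m i. i \<in> A ==> ip_norm ip1 (x i - (\<Sum>k\<in>F m. ip1 (x i) (u k) *\<^sub>R u k)) <= 1 / (real m + 1)"
   by metis
  define p where "p = (%i m. \<Sum>k\<in>F m. ip1 (x i) (u k) *\<^sub>R u k)"
  have uF: "u ` F m <= H" for m using F(1) uH by blast
  have pH: "p i m \<in> H" for i m unfolding p_def using uF by (intro I1.sum_in) auto
  have l0: "(%n. 1 / (real n + 1)) ----> 0"
   using LIMSEQ_inverse_real_of_nat by (simp add: inverse_eq_divide add.commute)
  have l1: "(%m. ip_norm ip1 (p i m - x i)) ----> 0" if i: "i \<in> A" for i
  proof (rule Lim_null_comparison[OF always_eventually l0], rule allI)
   show "norm (ip_norm ip1 (p i m - x i)) <= 1 / (real m + 1)" for m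
    using F(3)[OF i, of m] I1.norm_minus[OF pH[of i m] xH[OF i]] I1.norm_nonneg[of "p i m - x i"] pH[of i m] xH[OF i]
    unfolding p_def by simp
  qed
  have l2: "(%m. ip_norm ip2 (p i m - x i)) ----> 0" if i: "i \<in> A" for i
  proof (rule Lim_null_comparison[OF always_eventually], rule allI)
   show "norm (ip_norm ip2 (p i m - x i)) <= \<bar>C\<bar> * ip_norm ip1 (p i m - x i)" for m
    using C'[of "p i m - x i"] I2.norm_nonneg[of "p i m - x i"] pH[of i m] xH[OF i] by simp
   show "(%m. \<bar>C\<bar> * ip_norm ip1 (p i m - x i)) ----> 0" using tendsto_mult_left[OF l1[OF i], of "\<bar>C\<bar>"] by simp
  qed
  have q: "(%m. (ip2 (p i m) (p i m) - ip1 (p i m) (p i m))^2) ----> ((ip_norm ip2 (x i))^2 - (ip_norm ip1 (x i))^2)\<^sup>2"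
   if i: "i \<in> A" for i
   unfolding I1.norm_sq[OF xH[OF i]] I2.norm_sq[OF xH[OF i]]
   by (intro tendsto_power tendsto_diff I1.tendsto_ip I2.tendsto_ip l1 l2 i xH) (use pH in auto)
  have pq: "ip2 (p i m) (p i m) - ip1 (p i m) (p i m) = (\<Sum>k\<in>F m. \<beta> k * (ip1 (x i) (u k))^2)" if i: "i \<in> A" for i m
  proof -
   have uD: "k \<in> F m ==> u k \<in> H" for k using uF by auto
   have kI: "k \<in> F m ==> k \<in> I" for k using F(1) by blast
   have "ip2 (p i m) (p i m) = (\<Sum>k\<in>F m. ip1 (x i) (u k) * ip2 (u k) (p i m))"
    using I2.ip_sum_left[of "F m" u "p i m" "%k. ip1 (x i) (u k)"] uD pH unfolding p_def by simp
   also have "\<dots> = (\<Sum>k\<in>F m. ip1 (x i) (u k) * (ip1 (x i) (u k) * ip2 (u k) (u k)))"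
   proof (rule sum.cong[OF refl])
    fix k assume k: "k \<in> F m"
    have "ip2 (u k) (p i m) = (\<Sum>j\<in>F m. ip1 (x i) (u j) * ip2 (u k) (u j))"
     using I2.ip_sum_right[of "F m" u "u k" "%k. ip1 (x i) (u k)"] uD k unfolding p_def by simp
    also have "\<dots> = (\<Sum>j\<in>F m. if j = k then ip1 (x i) (u k) * ip2 (u k) (u k) else 0)"
     using u2[OF kI[OF k] kI] by (intro sum.cong) auto
    also have "\<dots> = ip1 (x i) (u k) * ip2 (u k) (u k)" using F(2) k by simp
    finally show "ip1 (x i) (u k) * ip2 (u k) (p i m) = ip1 (x i) (u k) * (ip1 (x i) (u k) * ip2 (u k) (u k))" by simp
   qed
   finally have a: "ip2 (p i m) (p i m) = \<dots>" .
   have "ip1 (p i m) (p i m) = (\<Sum>k\<in>F m. ip1 (x i) (u k) * ip1 (x i) (u k))"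
    unfolding p_def by (rule I1.orthonormal_combination[OF F(2) uD on[OF F(1)]])
   with a show ?thesis
    by (simp add: sum_subtractf[symmetric] \<beta>_def power2_eq_square algebra_simps)
  qed
  show "(\<Sum>i\<in>A. ((ip_norm ip2 (x i))^2 - (ip_norm ip1 (x i))^2)^2) <= M"
  proof (rule LIMSEQ_le_const2)
   show "(%m. \<Sum>i\<in>A. (ip2 (p i m) (p i m) - ip1 (p i m) (p i m))^2)
     ----> (\<Sum>i\<in>A. ((ip_norm ip2 (x i))^2 - (ip_norm ip1 (x i))^2)^2)"
    by (intro tendsto_sum q)
   have "(\<Sum>i\<in>A. (ip2 (p i m) (p i m) - ip1 (p i m) (p i m))^2) <= M" for m
   proof -
    have "(\<Sum>i\<in>A. (ip2 (p i m) (p i m) - ip1 (p i m) (p i m))^2)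
      = (\<Sum>i\<in>A. (\<Sum>k\<in>F m. \<beta> k * (ip1 (x i) (u k))^2)^2)"
     by (intro sum.cong) (simp_all add: pq)
    also have "\<dots> <= (\<Sum>k\<in>F m. (\<beta> k)^2)"
     by (rule I1.bessel_sum_diagonal[OF x(2,1) F(2) uF on[OF F(1)]])
    also have "\<dots> <= M" by (rule sumbeta[OF F(2,1)])
    finally show ?thesis .
   qed
   then show "\<exists>N. \<forall>m\<ge>N. (\<Sum>i\<in>A. (ip2 (p i m) (p i m) - ip1 (p i m) (p i m))^2) <= M" by blast
  qed
 qed
qed

lemma fhs_equivD:
 fixes H :: "'v::real_vector set"
 assumes "(N1, N2) \<in> fhs_equiv H"
 shows "\<exists>ip2. inner_product_on H ip2 & (\<forall>x\<in>H. N2 x = sqrt (ip2 x x))"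
  and "\<exists>c>0. \<forall>x\<in>H. c * N1 x <= N2 x" and "\<exists>C. \<forall>x\<in>H. N2 x <= C * N1 x" and "hs_close H N1 N2"
proof -
 have s: "separable_hilbert_norm H N1" "separable_hilbert_norm H N2"
  and top: "norm_topology H N1 = norm_topology H N2"
  using assms unfolding fhs_equiv_def by auto
 obtain I e where o: "orthogonal_basis H N1 I e" "orthogonal_basis H N2 I e"
  and sm: "(%k. (N2 (e k) / N1 (e k) - 1)^2) summable_on I"
  using assms unfolding fhs_equiv_def by auto
 show "\<exists>ip2. inner_product_on H ip2 & (\<forall>x\<in>H. N2 x = sqrt (ip2 x x))"
  using s(2) unfolding separable_hilbert_norm_def by blast
 obtain ip1 where H: "subspace H" and h1: "hilbert_form H ip1" and n1: "!!x. x \<in> H ==> N1 x = ip_norm ip1 x"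
  and t1: "norm_topology H N1 = norm_topology H (ip_norm ip1)" using separable_hilbert_normE[OF s(1)] by metis
 obtain ip2 where h2: "hilbert_form H ip2" and n2: "!!x. x \<in> H ==> N2 x = ip_norm ip2 x"
  and t2: "norm_topology H N2 = norm_topology H (ip_norm ip2)" using separable_hilbert_normE[OF s(2)] by metis
 interpret I1: hilbert_form H ip1 by fact
 interpret I2: hilbert_form H ip2 by fact
 note f = I1.inner_product_form_axioms I2.inner_product_form_axioms
 have t12: "norm_topology H (ip_norm ip1) = norm_topology H (ip_norm ip2)" using top t1 t2 by simp
 obtain C where C: "!!x. x \<in> H ==> ip_norm ip2 x <= C * ip_norm ip1 x"
  using norm_bound_of_topology_eq[OF f t12] by blast
 then show "\<exists>C. \<forall>x\<in>H. N2 x <= C * N1 x" using n1 n2 by auto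
 obtain c where c: "c > 0" "!!x. x \<in> H ==> ip_norm ip1 x <= c * ip_norm ip2 x"
  using norm_bound_of_topology_eq[OF f(2,1) t12[symmetric]] by blast
 then show "\<exists>c>0. \<forall>x\<in>H. c * N1 x <= N2 x"
  using n1 n2 by (intro exI[of _ "1 / c"]) (auto simp: field_simps)
 have ob: "orthogonal_basis H N' I e" if "orthogonal_basis H N I e" "!!x. x \<in> H ==> N x = N' x" for N N'
 proof -
  have "k \<in> I ==> e k \<in> H" for k using that(1) unfolding orthogonal_basis_def by auto
  then show ?thesis
   using that(1) norm_topology_cong[OF H that(2)] norm_ip_cong[OF H that(2)]
   unfolding orthogonal_basis_def by simp
 qed
 have eH: "k \<in> I ==> e k \<in> H" for k using o(1) unfolding orthogonal_basis_def by auto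
 have sm': "(%k. (ip_norm ip2 (e k) / ip_norm ip1 (e k) - 1)^2) summable_on I"
  using sm by (rule summable_on_cong[THEN iffD1, rotated]) (simp add: n1 n2 eH)
 have "hs_close H (ip_norm ip1) (ip_norm ip2)"
  by (rule hs_close_of_fhs_equiv[OF H h1 h2 C ob[OF o(1) n1] ob[OF o(2) n2] sm'])
 then show "hs_close H N1 N2" by (rule hs_close_cong[OF H, rotated 2]) (simp_all add: n1 n2)
qed

text \<open>The characterization without a basis. Restriction, extension and pullback would be
  awkward with bases, since a basis adapted to a pair of norms need not be adapted to a
  subspace.\<close>

lemma fhs_equiv_iff:
 assumes "separable_hilbert_norm H N1"
 shows "(N1, N2) \<in> fhs_equiv H \<longleftrightarrow>
  (\<exists>ip2. inner_product_on H ip2 & (\<forall>x\<in>H. N2 x = sqrt (ip2 x x))) \<and>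
  (\<exists>c>0. \<forall>x\<in>H. c * N1 x <= N2 x) & (\<exists>C. \<forall>x\<in>H. N2 x <= C * N1 x) & hs_close H N1 N2"
 (is "?L \<longleftrightarrow> ?R")
proof
 show "?L ==> ?R" by (intro conjI fhs_equivD)
 assume ?R
 then obtain ip2 c C where "inner_product_on H ip2" "\<forall>x\<in>H. N2 x = sqrt (ip2 x x)"
  "c > 0" "\<forall>x\<in>H. c * N1 x <= N2 x" "\<forall>x\<in>H. N2 x <= C * N1 x" "hs_close H N1 N2"
  by blast
 then show ?L using fhs_equivI[OF assms, of ip2 N2 c C] by simp
qed

section \<open>Restriction, pullback and extension of admissible norms\<close>

lemma inner_product_on_subset: "inner_product_on H ip ==> K <= H ==> inner_product_on K ip"
 unfolding inner_product_on_def by (meson subset_iff)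

lemma fhs_equiv_restrict:
 assumes N: "(N1, N2) \<in> fhs_equiv H" and K: "separable_hilbert_norm K N1" "K <= H"
 shows "(N1, N2) \<in> fhs_equiv K"
proof -
 have "separable_hilbert_norm H N1" using N unfolding fhs_equiv_def by blast
 from N[unfolded fhs_equiv_iff[OF this]]
 obtain ip2 c C where *: "inner_product_on H ip2" "\<forall>x\<in>H. N2 x = sqrt (ip2 x x)"
  "c > 0" "\<forall>x\<in>H. c * N1 x <= N2 x" "\<forall>x\<in>H. N2 x <= C * N1 x" "hs_close H N1 N2"
  by blast
 show ?thesis
 proof (rule fhs_equivI[OF K(1) inner_product_on_subset[OF *(1) K(2)], where c = c and C = C])
  show "hs_close K N1 N2" using *(6) K(2) unfolding hs_close_def by (meson order_trans)
 qed (use * K in auto)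
qed

lemma fhs_equiv_cong:
 assumes N: "(N1, N2) \<in> fhs_equiv H" and eq: "!!x. x \<in> H ==> N2 x = N2' x"
 shows "(N1, N2') \<in> fhs_equiv H"
proof -
 have s: "separable_hilbert_norm H N1" using N unfolding fhs_equiv_def by blast
 then have H: "subspace H" unfolding separable_hilbert_norm_def by blast
 from N[unfolded fhs_equiv_iff[OF s]]
 obtain ip2 c C where *: "inner_product_on H ip2" "\<forall>x\<in>H. N2 x = sqrt (ip2 x x)"
  "c > 0" "\<forall>x\<in>H. c * N1 x <= N2 x" "\<forall>x\<in>H. N2 x <= C * N1 x" "hs_close H N1 N2"
  by blast
 show ?thesis
  by (rule fhs_equivI[OF s *(1) _ *(3) _ _ hs_close_cong[OF H refl eq *(6)], where C = C]) (use *(2,4,5) eq in auto)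
qed

lemma linear_map_on_sum:
 assumes f: "linear_map_on H f" and H: "subspace H" and x: "x ` A <= H"
 shows "f (\<Sum>i\<in>A. c i *\<^sub>R x i) = (\<Sum>i\<in>A. c i *\<^sub>R f (x i))"
proof -
 have f0: "f 0 = 0" using f subspace_0[OF H] unfolding linear_map_on_def by (metis scaleR_zero_left)
 have "f (\<Sum>i\<in>A. c i *\<^sub>R x i) = (\<Sum>i\<in>A. c i *\<^sub>R f (x i))" if "x ` A <= H"
  using that
 proof (induction A rule: infinite_finite_induct)
  case (insert i A)
  have "(\<Sum>i\<in>A. c i *\<^sub>R x i) \<in> H" using insert.prems H by (intro subspace_sum subspace_scale) auto
  then show ?case using insert f subspace_scale[OF H] unfolding linear_map_on_def by simp
 qed (simp_all add: f0)
 then show ?thesis using x .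
qed

text \<open>A linear isometry maps Bessel families to Bessel families, so the bound for the pulled
  back pair is the old one. It is used for shifts and, with the identity, for exchanging functions
  that agree on the carrier.\<close>

lemma fhs_equiv_pullback:
 assumes K: "separable_hilbert_norm H K" and f: "linear_map_on H f" "f ` H <= H'"
  and iso: "!!x. x \<in> H ==> K' (f x) = K x" and N: "(K', N) \<in> fhs_equiv H'"
 shows "(K, N \<circ> f) \<in> fhs_equiv H"
proof -
 have H: "subspace H" using K unfolding separable_hilbert_norm_def by blast
 obtain ip1 where i1: "hilbert_form H ip1" and k1: "!!x. x \<in> H ==> K x = ip_norm ip1 x"
  using separable_hilbert_normE[OF K] by metis
 interpret I1: hilbert_form H ip1 by fact
 have s: "separable_hilbert_norm H' K'" using N unfolding fhs_equiv_def by blast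
 then have H': "subspace H'" unfolding separable_hilbert_norm_def by blast
 obtain ip3 where i3: "hilbert_form H' ip3" and k3: "!!x. x \<in> H' ==> K' x = ip_norm ip3 x"
  using separable_hilbert_normE[OF s] by metis
 interpret I3: hilbert_form H' ip3 by fact
 from N[unfolded fhs_equiv_iff[OF s]]
 obtain ip2 c C where *: "inner_product_on H' ip2" "\<forall>x\<in>H'. N x = sqrt (ip2 x x)"
  "c > 0" "\<forall>x\<in>H'. c * K' x <= N x" "\<forall>x\<in>H'. N x <= C * K' x" "hs_close H' K' N"
  by blast
 have fH: "f x \<in> H'" if "x \<in> H" for x using f(2) that by blast
 note ip2 = inner_product_onD[OF *(1)]
 have fa: "f (x + y) = f x + f y" if "x \<in> H" "y \<in> H" for x y using f(1) that unfolding linear_map_on_def by blast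
 have fs: "f (c *\<^sub>R x) = c *\<^sub>R f x" if "x \<in> H" for x c using f(1) that unfolding linear_map_on_def by blast
 have "inner_product_on H (%x y. ip2 (f x) (f y))"
  unfolding inner_product_on_def
 proof (intro conjI ballI allI impI)
  show "ip2 (f x) (f y) = ip2 (f y) (f x)" if "x \<in> H" "y \<in> H" for x y using ip2(1)[OF fH[OF that(1)] fH[OF that(2)]] .
  show "ip2 (f (x + y)) (f z) = ip2 (f x) (f z) + ip2 (f y) (f z)" if "x \<in> H" "y \<in> H" "z \<in> H" for x y z
   using ip2(2)[OF fH[OF that(1)] fH[OF that(2)] fH[OF that(3)]] fa[OF that(1,2)] by simp
  show "ip2 (f (c *\<^sub>R x)) (f y) = c * ip2 (f x) (f y)" if "x \<in> H" "y \<in> H" for x y c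
   using ip2(3)[OF fH[OF that(1)] fH[OF that(2)]] fs[OF that(1)] by simp
  show "0 < ip2 (f x) (f x)" if x: "x \<in> H" "x ~= 0" for x
  proof (rule ip2(4)[OF fH[OF x(1)]], rule notI)
   assume "f x = 0"
   then have "ip_norm ip1 x = 0" using iso[OF x(1)] k1[OF x(1)] k3[OF fH[OF x(1)]] I3.norm_zero by simp
   then show False using I1.definite[OF x(1)] I1.norm_sq[OF x(1)] x(2) by simp
  qed
 qed
 moreover have "hs_close H K (N \<circ> f)"
 proof -
  obtain M where M: "!!A x. x ` A <= H' ==> bessel K' A x ==> (\<Sum>i\<in>A. ((N (x i))^2 - (K' (x i))^2)^2) <= M"
   using *(6) unfolding hs_close_def by blast
  have "(\<Sum>i\<in>A. (((N \<circ> f) (x i))^2 - (K (x i))^2)^2) <= M" if x: "x ` A <= H" "bessel K A x" for A x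
  proof -
   have "(K' (\<Sum>i\<in>A. c i *\<^sub>R f (x i)))^2 <= (\<Sum>i\<in>A. (c i)^2)" for c
   proof -
    have "(\<Sum>i\<in>A. c i *\<^sub>R x i) \<in> H" using x(1) H by (intro subspace_sum subspace_scale) auto
    from iso[OF this] show ?thesis using x(2) unfolding linear_map_on_sum[OF f(1) H x(1)] bessel_def by simp
   qed
   then have "bessel K' A (%i. f (x i))" using x(2) unfolding bessel_def by simp
   moreover have "(%i. f (x i)) ` A <= H'" using x(1) fH by blast
   ultimately have "(\<Sum>i\<in>A. ((N (f (x i)))^2 - (K' (f (x i)))^2)^2) <= M" using M[of "%i. f (x i)" A] by simp
   also have "(\<Sum>i\<in>A. ((N (f (x i)))^2 - (K' (f (x i)))^2)^2) = (\<Sum>i\<in>A. (((N \<circ> f) (x i))^2 - (K (x i))^2)^2)"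
    using x(1) iso by (intro sum.cong refl) (auto simp: image_subset_iff)
   finally show ?thesis .
  qed
  then show ?thesis unfolding hs_close_def by blast
 qed
 ultimately show ?thesis
  using *(2-5) fH iso by (intro fhs_equivI[OF K, where c = c and C = C]) (auto; metis)+
qed

context hilbert_form
begin

lemma projection_map:
 assumes K: "hilbert_form K ip" "K <= D"
 shows "\<exists>P. linear_map_on D P & (\<forall>x\<in>D. P x \<in> K) & (\<forall>x\<in>D. \<forall>w\<in>K. ip (P x) w = ip x w) \<and>
  (\<forall>x\<in>K. P x = x) & (\<forall>x\<in>D. ip x x = ip (P x) (P x) + ip (x - P x) (x - P x))"
proof -
 interpret K: hilbert_form K ip by fact
 have KD: "x \<in> K ==> x \<in> D" for x using K by blast
 obtain P where P: "!!x. x \<in> D ==> P x \<in> K" "!!x w. x \<in> D ==> w \<in> K ==> ip (x - P x) w = 0"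
  using projection[OF K] by metis
 have Pw: "ip (P x) w = ip x w" if "x \<in> D" "w \<in> K" for x w
  using P(2)[OF that] diff[OF that(1) KD[OF P(1)[OF that(1)]] KD[OF that(2)]] by simp
 have uniq: "p = q" if "p \<in> K" "q \<in> K" "!!w. w \<in> K ==> ip p w = ip q w" for p q
 proof -
  have "ip (p - q) (p - q) = 0" using that K.diff[OF that(1,2), of "p - q"] by simp
  then show ?thesis using K.definite[of "p - q"] that by simp
 qed
 have "linear_map_on D P" unfolding linear_map_on_def
 proof (intro conjI ballI allI)
  show "P (x + y) = P x + P y" if "x \<in> D" "y \<in> D" for x y
   by (rule uniq) (use that P(1) Pw KD in \<open>simp_all add: add\<close>)
  show "P (c *\<^sub>R x) = c *\<^sub>R P x" if "x \<in> D" for x c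
   by (rule uniq) (use that P(1) Pw KD in \<open>simp_all add: scale\<close>)
 qed
 moreover have "P x = x" if "x \<in> K" for x by (rule uniq) (use that P(1) Pw KD in simp_all)
 moreover have "ip x x = ip (P x) (P x) + ip (x - P x) (x - P x)" if "x \<in> D" for x
  using norm_diff_sq[OF that KD[OF P(1)[OF that]]] Pw[OF that P(1)[OF that]] by simp
 ultimately show ?thesis using P(1) Pw by blast
qed

text \<open>The extension takes \<open>M\<close> on \<open>K\<close> and keeps the given norm on the
  orthogonal complement, with the two parts orthogonal to each other. The difference of the squared
  norms then sees only the projection to \<open>K\<close>, and projections of Bessel families are
  Bessel families.\<close>

lemma fhs_equiv_extend:
 assumes N1: "separable_hilbert_norm D (ip_norm ip)" and K: "hilbert_form K ip" "K <= D"
  and M: "(ip_norm ip, M) \<in> fhs_equiv K"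
 shows "\<exists>N. (ip_norm ip, N) \<in> fhs_equiv D & (\<forall>x\<in>K. M x = N x)"
proof -
 interpret K: hilbert_form K ip by fact
 have KD: "x \<in> K ==> x \<in> D" for x using K by blast
 obtain P where P: "linear_map_on D P" "!!x. x \<in> D ==> P x \<in> K" "!!x. x \<in> K ==> P x = x"
  "!!x. x \<in> D ==> ip x x = ip (P x) (P x) + ip (x - P x) (x - P x)"
  using projection_map[OF K] by blast
 have PD: "x \<in> D ==> P x \<in> D" for x using P(2) KD by blast
 have Pa: "P (x + y) = P x + P y" if "x \<in> D" "y \<in> D" for x y using P(1) that unfolding linear_map_on_def by blast
 have Ps: "P (c *\<^sub>R x) = c *\<^sub>R P x" if "x \<in> D" for x c using P(1) that unfolding linear_map_on_def by blast
 have "separable_hilbert_norm K (ip_norm ip)" using M unfolding fhs_equiv_def by blast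
 from M[unfolded fhs_equiv_iff[OF this]]
 obtain ip2 c C where *: "inner_product_on K ip2" "\<forall>x\<in>K. M x = sqrt (ip2 x x)"
  "c > 0" "\<forall>x\<in>K. c * ip_norm ip x <= M x" "\<forall>x\<in>K. M x <= C * ip_norm ip x" "hs_close K (ip_norm ip) M"
  by blast
 interpret I2: inner_product_form K ip2 by (rule inner_product_form_of_inner_product[OF K.D *(1)])
 define ip3 where "ip3 = (%x y. ip2 (P x) (P y) + ip (x - P x) (y - P y))"
 define N where "N = (%x. sqrt (ip3 x x))"
 have M2: "(M x)^2 = ip2 x x" if "x \<in> K" for x using *(2) that I2.nonneg[OF that] by simp
 have N2: "(N x)^2 = (M (P x))^2 + ip (x - P x) (x - P x)" and Npos: "0 <= N x" if "x \<in> D" for x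
  using M2[OF P(2)[OF that]] I2.nonneg[OF P(2)[OF that]] nonneg[of "x - P x"] that PD[OF that]
  unfolding N_def ip3_def by simp_all
 have NK: "N x = M x" if "x \<in> K" for x
  unfolding N_def ip3_def using P(3)[OF that] *(2) that zero_left[OF D_simps(4)] by simp
 have ip3: "inner_product_on D ip3"
  unfolding inner_product_on_def
 proof (intro conjI ballI allI impI)
  fix x y assume xy: "x \<in> D" "y \<in> D"
  have d: "x - P x \<in> D" "y - P y \<in> D" using xy PD by simp_all
  show "ip3 x y = ip3 y x" unfolding ip3_def by (simp only: I2.sym[OF P(2)[OF xy(1)] P(2)[OF xy(2)]] sym[OF d])
  show "ip3 (c *\<^sub>R x) y = c * ip3 x y" for c
   unfolding ip3_def Ps[OF xy(1)] scaleR_right_diff_distrib[symmetric]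
   by (simp only: I2.scale[OF P(2)[OF xy(1)] P(2)[OF xy(2)]] scale[OF d] distrib_left)
  show "ip3 (x + y) z = ip3 x z + ip3 y z" if z: "z \<in> D" for z
  proof -
   have "x + y - P (x + y) = (x - P x) + (y - P y)" by (simp add: Pa[OF xy])
   then have "ip (x + y - P (x + y)) (z - P z) = ip ((x - P x) + (y - P y)) (z - P z)" by (simp only:)
   then show ?thesis unfolding ip3_def
    using I2.add[OF P(2)[OF xy(1)] P(2)[OF xy(2)] P(2)[OF z]] add[OF d, of "z - P z"] z PD[OF z] by (simp add: Pa[OF xy])
  qed
 next
  fix x assume x: "x \<in> D" "x ~= 0"
  show "0 < ip3 x x"
  proof (cases "P x = 0")
   case True
   then have "ip3 x x = ip x x" unfolding ip3_def using I2.zero_left[OF K.D_simps(4)] by simp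
   then show ?thesis using definite[OF x(1)] x(2) nonneg[OF x(1)] by (auto simp: less_le)
  next
   case False
   then have "0 < ip2 (P x) (P x)" using inner_product_onD(4)[OF *(1) P(2)[OF x(1)]] by simp
   then show ?thesis unfolding ip3_def using nonneg[of "x - P x"] x PD by (simp add: add_pos_nonneg)
  qed
 qed
 have "(ip_norm ip, N) \<in> fhs_equiv D"
 proof (rule fhs_equivI[OF N1 ip3])
  show "N x = sqrt (ip3 x x)" for x unfolding N_def ..
  \<comment> \<open>On the complement the ratio of the norms is 1, hence both constants have to be
    compared with 1.\<close>
  show "min c 1 > 0" using *(3) by simp
  fix x assume x: "x \<in> D"
  have z: "0 <= ip (x - P x) (x - P x)" using nonneg[of "x - P x"] x PD by simp
  have px: "0 <= ip (P x) (P x)" by (rule nonneg[OF PD[OF x]])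
  have c1: "(min c 1)^2 * ip (P x) (P x) <= (M (P x))^2"
  proof -
   have "(min c 1 * ip_norm ip (P x))^2 <= (M (P x))^2"
   proof (rule power_mono)
    have "min c 1 * ip_norm ip (P x) <= c * ip_norm ip (P x)" by (rule mult_right_mono) (use norm_nonneg[OF PD[OF x]] in auto)
    then show "min c 1 * ip_norm ip (P x) <= M (P x)" using *(4) P(2)[OF x] by fastforce
    show "0 <= min c 1 * ip_norm ip (P x)" using *(3) norm_nonneg[OF PD[OF x]] by simp
   qed
   then show ?thesis by (simp only: power_mult_distrib norm_sq[OF PD[OF x]])
  qed
  have c2: "(M (P x))^2 <= (\<bar>C\<bar> + 1)^2 * ip (P x) (P x)"
  proof -
   have "(M (P x))^2 <= ((\<bar>C\<bar> + 1) * ip_norm ip (P x))^2"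
   proof (rule power_mono)
    have "C * ip_norm ip (P x) <= (\<bar>C\<bar> + 1) * ip_norm ip (P x)" by (rule mult_right_mono) (use norm_nonneg[OF PD[OF x]] in auto)
    then show "M (P x) <= (\<bar>C\<bar> + 1) * ip_norm ip (P x)" using *(5) P(2)[OF x] by fastforce
    show "0 <= M (P x)" using *(2) P(2)[OF x] I2.nonneg[OF P(2)[OF x]] by simp
   qed
   then show ?thesis by (simp only: power_mult_distrib norm_sq[OF PD[OF x]])
  qed
  have "(min c 1)^2 * ip (x - P x) (x - P x) <= 1 * ip (x - P x) (x - P x)"
   using *(3) z by (intro mult_right_mono power_le_one) auto
  then have "(min c 1 * ip_norm ip x)^2 <= (N x)^2"
   using c1 by (simp add: power_mult_distrib norm_sq[OF x] N2[OF x] P(4)[OF x] distrib_left)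
  then show "min c 1 * ip_norm ip x <= N x" using Npos[OF x] by (rule power2_le_imp_le)
  have "1 * ip (x - P x) (x - P x) <= (\<bar>C\<bar> + 1)^2 * ip (x - P x) (x - P x)"
   using z by (intro mult_right_mono) (auto intro: one_le_power)
  then have "(N x)^2 <= ((\<bar>C\<bar> + 1) * ip_norm ip x)^2"
   using c2 by (simp add: power_mult_distrib norm_sq[OF x] N2[OF x] P(4)[OF x] distrib_left)
  then show "N x <= (\<bar>C\<bar> + 1) * ip_norm ip x" by (rule power2_le_imp_le) (use norm_nonneg[OF x] in simp)
 next
  obtain M0 where M0: "!!A x. x ` A <= K ==> bessel (ip_norm ip) A x ==>
    (\<Sum>i\<in>A. ((M (x i))^2 - (ip_norm ip (x i))^2)^2) <= M0"
   using *(6) unfolding hs_close_def by blast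
  have "(\<Sum>i\<in>A. ((N (x i))^2 - (ip_norm ip (x i))^2)^2) <= M0" if x: "x ` A <= D" "bessel (ip_norm ip) A x" for A x
  proof -
   have "(ip_norm ip (\<Sum>i\<in>A. c i *\<^sub>R P (x i)))^2 <= (\<Sum>i\<in>A. (c i)^2)" for c
   proof -
    have zD: "(\<Sum>i\<in>A. c i *\<^sub>R x i) \<in> D" using x(1) by (intro sum_in) auto
    have "(ip_norm ip (\<Sum>i\<in>A. c i *\<^sub>R P (x i)))^2 <= (ip_norm ip (\<Sum>i\<in>A. c i *\<^sub>R x i))^2"
     unfolding linear_map_on_sum[OF P(1) D x(1), symmetric] norm_sq[OF zD] norm_sq[OF PD[OF zD]]
     using P(4)[OF zD] nonneg[OF subspace_diff[OF D zD PD[OF zD]]] by simp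
    also have "\<dots> <= (\<Sum>i\<in>A. (c i)^2)" using x(2) unfolding bessel_def by blast
    finally show ?thesis .
   qed
   then have "bessel (ip_norm ip) A (%i. P (x i))" using x(2) unfolding bessel_def by simp
   moreover have "(%i. P (x i)) ` A <= K" using x(1) P(2) by blast
   ultimately have "(\<Sum>i\<in>A. ((M (P (x i)))^2 - (ip_norm ip (P (x i)))^2)^2) <= M0" using M0[of "%i. P (x i)" A] by simp
   also have "(\<Sum>i\<in>A. ((M (P (x i)))^2 - (ip_norm ip (P (x i)))^2)^2) = (\<Sum>i\<in>A. ((N (x i))^2 - (ip_norm ip (x i))^2)^2)"
   proof (rule sum.cong[OF refl])
    fix i assume "i \<in> A"
    then have "x i \<in> D" using x(1) by blast
    then show "((M (P (x i)))^2 - (ip_norm ip (P (x i)))^2)^2 = ((N (x i))^2 - (ip_norm ip (x i))^2)^2"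
     by (simp only: N2 norm_sq PD P(4)) simp
   qed
   finally show ?thesis .
  qed
  then show "hs_close D (ip_norm ip) N" unfolding hs_close_def by blast
 qed
 then show ?thesis using NK by (intro exI[of _ N]) simp
qed

text \<open>Applied to \<open>H1\<close> and \<open>H2\<close>, compactness turns a trivial intersection into a positive angle.\<close>

lemma positive_angle:
 assumes H1: "hilbert_form H1 ip" "H1 <= D" and H2: "hilbert_form H2 ip" "H2 <= D"
  and int: "H1 \<inter> H2 <= {0}"
  and hs: "!!A x y. x ` A <= H1 ==> y ` A <= H2 ==> bessel (ip_norm ip) A x ==> bessel (ip_norm ip) A y ==>
   (\<Sum>i\<in>A. (ip (x i) (y i))^2) <= M"
 shows "\<exists>\<rho>\<ge>0. \<rho> < 1 & (\<forall>x\<in>H1. \<forall>y\<in>H2. \<bar>ip x y\<bar> <= \<rho> * ip_norm ip x * ip_norm ip y)"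
proof -
 interpret I1: hilbert_form H1 ip by fact
 interpret I2: hilbert_form H2 ip by fact
 obtain P where P: "linear_map_on D P" "!!x. x \<in> D ==> P x \<in> H2" "!!x w. x \<in> D ==> w \<in> H2 ==> ip (P x) w = ip x w"
  "!!x. x \<in> D ==> ip x x = ip (P x) (P x) + ip (x - P x) (x - P x)"
  using projection_map[OF H2] by blast
 have D1: "x \<in> H1 ==> x \<in> D" and D2: "x \<in> H2 ==> x \<in> D" for x using H1 H2 by auto
 have PD: "x \<in> D ==> P x \<in> D" for x using P(2) D2 by blast
 have Pa: "P (x + y) = P x + P y" if "x \<in> D" "y \<in> D" for x y using P(1) that unfolding linear_map_on_def by blast
 have Ps: "P (c *\<^sub>R x) = c *\<^sub>R P x" if "x \<in> D" for x c using P(1) that unfolding linear_map_on_def by blast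
 have Ple: "ip (P x) (P x) <= ip x x" if "x \<in> D" for x
  using P(4)[OF that] nonneg[OF subspace_diff[OF D that PD[OF that]]] by simp
 \<comment> \<open>With \<open>P\<close> the projection onto \<open>H2\<close>, the largest value of
   \<open>b\<close> on unit vectors of \<open>H1\<close> is the squared cosine of the angle between
   the subspaces.\<close>
 define b where "b = (%x y. ip (P x) (P y))"
 have b: "symmetric_bilinear_on H1 b"
  unfolding symmetric_bilinear_on_def b_def
 proof (intro conjI ballI allI)
  fix x y assume xy: "x \<in> H1" "y \<in> H1"
  show "ip (P x) (P y) = ip (P y) (P x)" by (rule sym) (use xy D1 PD in auto)
  show "ip (P (c *\<^sub>R x)) (P y) = c * ip (P x) (P y)" for c
   by (simp add: Ps[OF D1[OF xy(1)]] scale[OF PD[OF D1[OF xy(1)]] PD[OF D1[OF xy(2)]]])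
  show "ip (P (x + y)) (P z) = ip (P x) (P z) + ip (P y) (P z)" if "z \<in> H1" for z
   by (simp add: Pa[OF D1[OF xy(1)] D1[OF xy(2)]] add[OF PD[OF D1[OF xy(1)]] PD[OF D1[OF xy(2)]] PD[OF D1[OF that]]])
 qed
 have ipP: "\<bar>ip x y\<bar> <= ip_norm ip (P x) * ip_norm ip y" if "x \<in> H1" "y \<in> H2" for x y
  using Cauchy_Schwarz[OF PD[OF D1[OF that(1)]] D2[OF that(2)]] P(3)[OF D1[OF that(1)] that(2)] by simp
 show ?thesis
 proof (cases "\<exists>x\<in>H1. b x x > 0")
  case False
  have "\<bar>ip x y\<bar> <= 0 * ip_norm ip x * ip_norm ip y" if "x \<in> H1" "y \<in> H2" for x y
  proof -
   have "ip (P x) (P x) = 0" using False that(1) nonneg[OF PD[OF D1[OF that(1)]]] unfolding b_def by force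
   then show ?thesis using ipP[OF that] by (simp add: ip_norm_def)
  qed
  then show ?thesis by (intro exI[of _ 0]) simp
 next
  case True
  then obtain x0 where x0: "x0 \<in> H1" "b x0 x0 > 0" by blast
  have "\<bar>b x x\<bar> <= 1 * ip x x" if "x \<in> H1" for x
   using Ple[OF D1[OF that]] nonneg[OF PD[OF D1[OF that]]] unfolding b_def by simp
  \<comment> \<open>\<open>b (e i) (e i)\<close> is the scalar product of \<open>e i\<close> with
    its projection \<open>P (e i)\<close>, and both families are Bessel; here Bessel families are
    required, as the projections need not be orthonormal.\<close>
  moreover have "(\<Sum>i\<in>A. (b (e i) (e i))^2) <= M" if e: "finite A" "e ` A <= H1" "orthonormal ip A e"
   for A :: "nat set" and e
  proof -
   have be: "bessel (ip_norm ip) A e" by (rule I1.orthonormal_bessel[OF e])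
   have eD: "e ` A <= D" using e(2) H1 by blast
   have "(ip_norm ip (\<Sum>i\<in>A. c i *\<^sub>R P (e i)))^2 <= (\<Sum>i\<in>A. (c i)^2)" for c
   proof -
    have zD: "(\<Sum>i\<in>A. c i *\<^sub>R e i) \<in> D" using eD by (intro sum_in) auto
    have "(ip_norm ip (\<Sum>i\<in>A. c i *\<^sub>R P (e i)))^2 <= (ip_norm ip (\<Sum>i\<in>A. c i *\<^sub>R e i))^2"
     unfolding linear_map_on_sum[OF P(1) D eD, symmetric] norm_sq[OF zD] norm_sq[OF PD[OF zD]] by (rule Ple[OF zD])
    also have "\<dots> <= (\<Sum>i\<in>A. (c i)^2)" using be unfolding bessel_def by blast
    finally show ?thesis .
   qed
   then have "bessel (ip_norm ip) A (%i. P (e i))" using e(1) unfolding bessel_def by simp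
   moreover have "(%i. P (e i)) ` A <= H2" using eD P(2) by blast
   ultimately have "(\<Sum>i\<in>A. (ip (e i) (P (e i)))^2) <= M" using hs[OF e(2) _ be] by simp
   moreover have "ip (e i) (P (e i)) = b (e i) (e i)" if "i \<in> A" for i
    unfolding b_def using P(3)[of "e i" "P (e i)"] P(2)[of "e i"] eD that by auto
   ultimately show ?thesis by simp
  qed
  ultimately obtain e where e: "e \<in> H1" "ip e e = 1" "!!x. x \<in> H1 ==> b x x <= b e e * ip x x"
   using I1.maximum_attained[OF b, of 1 M x0] x0 by blast
  \<comment> \<open>Because the maximum is attained, the value 1 would yield a unit vector equal to
    its own projection, that is, one in both subspaces.\<close>
  have lt: "b e e < 1"
  proof (rule ccontr)
   assume "\<not> b e e < 1"
   then have "ip (e - P e) (e - P e) <= 0" using P(4)[OF D1[OF e(1)]] e(2) unfolding b_def by simp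
   then have "e - P e = 0"
    using definite[of "e - P e"] nonneg[of "e - P e"] D1[OF e(1)] PD[OF D1[OF e(1)]] by simp
   then have "e \<in> H1 \<inter> H2" using P(2)[OF D1[OF e(1)]] e(1) by simp
   then have "e = 0" using int by blast
   then show False using e(2) zero_left[OF D_simps(4)] by simp
  qed
  have ge: "0 <= b e e" unfolding b_def by (rule nonneg[OF PD[OF D1[OF e(1)]]])
  have "\<bar>ip x y\<bar> <= sqrt (b e e) * ip_norm ip x * ip_norm ip y" if "x \<in> H1" "y \<in> H2" for x y
  proof -
   have "ip_norm ip (P x) <= sqrt (b e e) * ip_norm ip x"
    unfolding ip_norm_def real_sqrt_mult[symmetric] using e(3)[OF that(1)] unfolding b_def by simp
   then have "ip_norm ip (P x) * ip_norm ip y <= sqrt (b e e) * ip_norm ip x * ip_norm ip y"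
    using norm_nonneg[OF D2[OF that(2)]] by (rule mult_right_mono)
   with ipP[OF that] show ?thesis by simp
  qed
  then show ?thesis using lt ge by (intro exI[of _ "sqrt (b e e)"]) simp
 qed
qed

end

context hilbert_form
begin

text \<open>The new norm drops the mixed term between the components in \<open>H1\<close> and
  \<open>H2\<close>. The angle bound compares it with the old one, with factors 2 and
  \<open>1 - \<rho>\<close> for the squares, and the difference of the squares is minus twice the
  mixed term, which is Hilbert-Schmidt by assumption.\<close>

lemma orthogonal_sum_norm:
 assumes N1: "separable_hilbert_norm D (ip_norm ip)"
  and H1: "subspace H1" "H1 <= D" and H2: "subspace H2" "H2 <= D"
  and angle: "0 <= \<rho>" "\<rho> < 1" "!!x y. x \<in> H1 ==> y \<in> H2 ==> \<bar>ip x y\<bar> <= \<rho> * ip_norm ip x * ip_norm ip y"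
  and sum: "!!x. x \<in> D ==> \<exists>x1\<in>H1. \<exists>x2\<in>H2. x = x1 + x2"
  and hs: "!!A x y. x ` A <= H1 ==> y ` A <= H2 ==> bessel (ip_norm ip) A x ==> bessel (ip_norm ip) A y ==>
   (\<Sum>i\<in>A. (ip (x i) (y i))^2) <= M"
 shows "\<exists>N. (ip_norm ip, N) \<in> fhs_equiv D & (\<forall>x\<in>H1. \<forall>y\<in>H2. norm_ip N x y = 0)"
proof -
 have D1: "x \<in> H1 ==> x \<in> D" and D2: "x \<in> H2 ==> x \<in> D" for x using H1 H2 by auto
 obtain P Q where PQ: "!!x. x \<in> D ==> P x \<in> H1" "!!x. x \<in> D ==> Q x \<in> H2" "!!x. x \<in> D ==> x = P x + Q x"
  using sum by metis
 have PD: "P x \<in> D" and QD: "Q x \<in> D" if "x \<in> D" for x using PQ(1,2)[OF that] D1 D2 by auto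
 have int: "x = 0" if "x \<in> H1" "x \<in> H2" for x
 proof -
  have "ip x x <= \<rho> * ip x x" using angle(3)[OF that] norm_sq[OF D1[OF that(1)]] by (simp add: power2_eq_square mult.assoc)
  then have "ip x x * (1 - \<rho>) <= 0" by (simp add: algebra_simps)
  then have "ip x x <= 0" using angle(2) by (simp add: mult_le_0_iff)
  then show ?thesis using definite[OF D1[OF that(1)]] nonneg[OF D1[OF that(1)]] by simp
 qed
 have uniq: "p = p' & q = q'" if "p \<in> H1" "p' \<in> H1" "q \<in> H2" "q' \<in> H2" "p + q = p' + q'" for p p' q q'
 proof -
  have e: "p - p' = q' - q" using that(5) by (simp add: algebra_simps)
  have "p - p' \<in> H1" by (rule subspace_diff[OF H1(1) that(1,2)])
  moreover have "p - p' \<in> H2" unfolding e by (rule subspace_diff[OF H2(1) that(4,3)])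
  ultimately have "p - p' = 0" by (rule int)
  then show ?thesis using e by simp
 qed
 have Pa: "P (x + y) = P x + P y & Q (x + y) = Q x + Q y" if "x \<in> D" "y \<in> D" for x y
 proof (rule uniq)
  have xy: "x + y \<in> D" using that by simp
  show "P (x + y) \<in> H1" "Q (x + y) \<in> H2" using PQ xy by auto
  show "P x + P y \<in> H1" "Q x + Q y \<in> H2" using PQ that subspace_add[OF H1(1)] subspace_add[OF H2(1)] by auto
  have "P x + P y + (Q x + Q y) = (P x + Q x) + (P y + Q y)" by simp
  then show "P (x + y) + Q (x + y) = P x + P y + (Q x + Q y)"
   using PQ(3)[OF that(1)] PQ(3)[OF that(2)] PQ(3)[OF xy] by metis
 qed
 have Ps: "P (c *\<^sub>R x) = c *\<^sub>R P x & Q (c *\<^sub>R x) = c *\<^sub>R Q x" if "x \<in> D" for x c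
 proof (rule uniq)
  have cx: "c *\<^sub>R x \<in> D" using that by simp
  show "P (c *\<^sub>R x) \<in> H1" "Q (c *\<^sub>R x) \<in> H2" using PQ cx by auto
  show "c *\<^sub>R P x \<in> H1" "c *\<^sub>R Q x \<in> H2" using PQ that subspace_scale[OF H1(1)] subspace_scale[OF H2(1)] by auto
  show "P (c *\<^sub>R x) + Q (c *\<^sub>R x) = c *\<^sub>R P x + c *\<^sub>R Q x"
   using PQ(3)[OF that] PQ(3)[OF cx] by (metis scaleR_right_distrib)
 qed
 have P: "linear_map_on D P" and Q: "linear_map_on D Q" unfolding linear_map_on_def using Pa Ps by blast+
 define ip3 where "ip3 = (%x y. ip (P x) (P y) + ip (Q x) (Q y))"
 define N where "N = (%x. sqrt (ip3 x x))"
 have N2: "(N x)^2 = ip (P x) (P x) + ip (Q x) (Q x)" and Npos: "0 <= N x" if "x \<in> D" for x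
  using nonneg[OF PD[OF that]] nonneg[OF QD[OF that]] unfolding N_def ip3_def by simp_all
 have expand: "ip x x = ip (P x) (P x) + 2 * ip (P x) (Q x) + ip (Q x) (Q x)" if "x \<in> D" for x
  using ip_sum_sq[OF PD[OF that] QD[OF that], of 1] PQ(3)[OF that] by simp
 have cross: "2 * \<bar>ip (P x) (Q x)\<bar> <= \<rho> * (N x)^2" if x: "x \<in> D" for x
 proof -
  have "2 * (ip_norm ip (P x) * ip_norm ip (Q x)) <= (N x)^2"
   unfolding N2[OF x] norm_sq[OF PD[OF x], symmetric] norm_sq[OF QD[OF x], symmetric]
   using sum_squares_bound[of "ip_norm ip (P x)" "ip_norm ip (Q x)"] by simp
  then have "\<rho> * (2 * (ip_norm ip (P x) * ip_norm ip (Q x))) <= \<rho> * (N x)^2" using angle(1) by (rule mult_left_mono)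
  then show ?thesis using angle(3)[OF PQ(1)[OF x] PQ(2)[OF x]] by (simp add: mult.assoc)
 qed
 have up: "ip x x <= 2 * (N x)^2" and low: "(1 - \<rho>) * (N x)^2 <= ip x x" if x: "x \<in> D" for x
 proof -
  have "\<rho> * (N x)^2 <= 1 * (N x)^2" using angle by (intro mult_right_mono) auto
  then show "ip x x <= 2 * (N x)^2" using expand[OF x] N2[OF x] cross[OF x] by linarith
  show "(1 - \<rho>) * (N x)^2 <= ip x x" using expand[OF x] N2[OF x] cross[OF x] by (simp add: left_diff_distrib)
 qed
 have ip3: "inner_product_on D ip3"
  unfolding inner_product_on_def
 proof (intro conjI ballI allI impI)
  fix x y assume xy: "x \<in> D" "y \<in> D"
  show "ip3 x y = ip3 y x"
   unfolding ip3_def by (simp only: sym[OF PD[OF xy(1)] PD[OF xy(2)]] sym[OF QD[OF xy(1)] QD[OF xy(2)]])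
  show "ip3 (c *\<^sub>R x) y = c * ip3 x y" for c
   unfolding ip3_def using Ps[OF xy(1), of c] xy by (simp add: scale PD QD algebra_simps)
  show "ip3 (x + y) z = ip3 x z + ip3 y z" if z: "z \<in> D" for z
   unfolding ip3_def using Pa[OF xy] xy z by (simp add: add PD QD algebra_simps)
 next
  fix x assume x: "x \<in> D" "x ~= 0"
  then have "0 < ip x x" using definite[OF x(1)] nonneg[OF x(1)] by (auto simp: less_le)
  then have "0 < (N x)\<^sup>2" using up[OF x(1)] by linarith
  then show "0 < ip3 x x" using N2[OF x(1)] unfolding ip3_def by simp
 qed
 \<comment> \<open>The components of a unit vector may be long, but multiplied by \<open>s\<close>
   they define contractions; so the rescaled components of a Bessel family are again Bessel
   families.\<close>
 define s where "s = sqrt (1 - \<rho>)"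
 have s: "s > 0" "s\<^sup>2 = 1 - \<rho>" unfolding s_def using angle by simp_all
 have "(ip_norm ip, N) \<in> fhs_equiv D"
 proof (rule fhs_equivI[OF N1 ip3])
  show "N x = sqrt (ip3 x x)" for x unfolding N_def ..
  show "0 < 1 / sqrt 2" by simp
  fix x assume x: "x \<in> D"
  have "(1 / sqrt 2 * ip_norm ip x)^2 <= (N x)^2" using up[OF x] by (simp add: power_divide norm_sq[OF x])
  then show "1 / sqrt 2 * ip_norm ip x <= N x" using Npos[OF x] by (rule power2_le_imp_le)
  have "(s * N x)^2 <= (ip_norm ip x)^2" using low[OF x] by (simp add: power_mult_distrib norm_sq[OF x] s)
  then have "s * N x <= ip_norm ip x" using norm_nonneg[OF x] by (rule power2_le_imp_le)
  then show "N x <= 1 / s * ip_norm ip x" using s(1) by (simp add: field_simps)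
 next
  have half: "bessel (ip_norm ip) A (%i. s *\<^sub>R R (x i))"
   if x: "x ` A <= D" "bessel (ip_norm ip) A x" and R: "linear_map_on D R" "!!x. x \<in> D ==> R x \<in> D"
    "!!x. x \<in> D ==> ip (R x) (R x) <= (N x)^2" for A x R
  proof -
   have "(ip_norm ip (\<Sum>i\<in>A. c i *\<^sub>R s *\<^sub>R R (x i)))^2 <= (\<Sum>i\<in>A. (c i)^2)" for c
   proof -
    define z where "z = (\<Sum>i\<in>A. c i *\<^sub>R x i)"
    have zD: "z \<in> D" unfolding z_def using x(1) by (intro sum_in) auto
    have "(\<Sum>i\<in>A. c i *\<^sub>R s *\<^sub>R R (x i)) = s *\<^sub>R R z"
     unfolding z_def linear_map_on_sum[OF R(1) D x(1)] scaleR_sum_right by (simp add: mult.commute)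
    then have "(ip_norm ip (\<Sum>i\<in>A. c i *\<^sub>R s *\<^sub>R R (x i)))^2 = s\<^sup>2 * ip (R z) (R z)"
     using norm_scale[OF R(2)[OF zD], of s] by (simp add: power_mult_distrib norm_sq[OF R(2)[OF zD]])
    also have "\<dots> <= s\<^sup>2 * (N z)^2" by (intro mult_left_mono R(3) zD) simp
    also have "\<dots> <= ip z z" using low[OF zD] s(2) by simp
    also have "\<dots> <= (\<Sum>i\<in>A. (c i)^2)" using x(2) norm_sq[OF zD] unfolding bessel_def z_def by metis
    finally show ?thesis .
   qed
   then show ?thesis using x(2) unfolding bessel_def by simp
  qed
  have "(\<Sum>i\<in>A. ((N (x i))^2 - (ip_norm ip (x i))^2)^2) <= 4 / s ^ 4 * M" if x: "x ` A <= D" "bessel (ip_norm ip) A x" for A x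
  proof -
   have "bessel (ip_norm ip) A (%i. s *\<^sub>R P (x i))"
    by (rule half[OF x P PD]) (use N2 nonneg QD in auto)
   moreover have "bessel (ip_norm ip) A (%i. s *\<^sub>R Q (x i))"
    by (rule half[OF x Q QD]) (use N2 nonneg PD in auto)
   moreover have "(%i. s *\<^sub>R P (x i)) ` A <= H1" "(%i. s *\<^sub>R Q (x i)) ` A <= H2"
    using x(1) PQ(1,2) subspace_scale[OF H1(1)] subspace_scale[OF H2(1)] by (auto simp: image_subset_iff)
   ultimately have "(\<Sum>i\<in>A. (ip (s *\<^sub>R P (x i)) (s *\<^sub>R Q (x i)))^2) <= M" using hs by blast
   \<comment> \<open>Each component carries a factor \<open>s\<close>, so the mixed term has a
     factor \<open>s^2\<close> and its square has \<open>s^4\<close>; the 4 is the square of the 2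
     in front of the mixed term.\<close>
   moreover have "((N (x i))^2 - (ip_norm ip (x i))^2)^2 = 4 / s ^ 4 * (ip (s *\<^sub>R P (x i)) (s *\<^sub>R Q (x i)))^2"
    if i: "i \<in> A" for i
   proof -
    have xi: "x i \<in> D" using x(1) i by auto
    have "ip (s *\<^sub>R P (x i)) (s *\<^sub>R Q (x i)) = s\<^sup>2 * ip (P (x i)) (Q (x i))"
     using PD[OF xi] QD[OF xi] by (simp add: scale scale_right power2_eq_square)
    moreover have "(N (x i))^2 - (ip_norm ip (x i))^2 = - 2 * ip (P (x i)) (Q (x i))"
     unfolding norm_sq[OF xi] N2[OF xi] expand[OF xi] by simp
    ultimately show ?thesis using s(1) by (simp only: power_mult_distrib) (simp add: field_simps)
   qed
   ultimately have eq: "(\<Sum>i\<in>A. ((N (x i))^2 - (ip_norm ip (x i))^2)^2) =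
     4 / s ^ 4 * (\<Sum>i\<in>A. (ip (s *\<^sub>R P (x i)) (s *\<^sub>R Q (x i)))^2)"
    and le: "(\<Sum>i\<in>A. (ip (s *\<^sub>R P (x i)) (s *\<^sub>R Q (x i)))^2) <= M"
    unfolding sum_distrib_left by (simp_all cong: sum.cong)
   show ?thesis unfolding eq using s(1) by (intro mult_left_mono le) simp
  qed
  then show "hs_close D (ip_norm ip) N" unfolding hs_close_def by blast
 qed
 moreover have "norm_ip N x y = 0" if xy: "x \<in> H1" "y \<in> H2" for x y
 proof -
  have D: "x + y \<in> D" "x - y \<in> D" "x + y = x + y" "x - y = x + - y" using D1[OF xy(1)] D2[OF xy(2)] by simp_all
  have "P (x + y) = x & Q (x + y) = y"
   by (rule uniq) (use PQ[OF D(1)] xy in auto)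
  moreover have "P (x - y) = x & Q (x - y) = - y"
   by (rule uniq) (use PQ[OF D(2)] xy subspace_neg[OF H2(1)] in auto)
  moreover have "ip (- y) (- y) = ip y y"
   using scale[of y "-y" "-1"] scale_right[of y y "-1"] D2[OF xy(2)] by simp
  ultimately have "(N (x + y))^2 = (N (x - y))^2" using N2[OF D(1)] N2[OF D(2)] by simp
  then show ?thesis unfolding norm_ip_def by simp
 qed
 ultimately show ?thesis by blast
qed

end

section \<open>Kernel forms\<close>

lemma fun_sum_apply: "(\<Sum>i\<in>A. f i :: real => real) x = (\<Sum>i\<in>A. f i x)"
 by (induction A rule: infinite_finite_induct) simp_all

lemma L2_onD:
 assumes "f \<in> L2_on a b"
 shows "f \<in> borel_measurable borel" "integrable lborel (%s. (f s)^2)" "!!s. s \<notin> {a<..<b} ==> f s = 0"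
 using assms unfolding L2_on_def by auto

lemma L2_on_mono: "a' <= a ==> b <= b' ==> L2_on a b <= L2_on a' b'"
 unfolding L2_on_def by auto

lemma L2_on_integrable:
 assumes f: "f \<in> L2_on a b"
 shows "integrable lborel f"
proof (rule Bochner_Integration.integrable_bound)
 show "integrable lborel (%s. indicator {a<..<b} s + (f s)^2)"
  using L2_onD(2)[OF f] by (intro Bochner_Integration.integrable_add integrable_real_indicator) (cases "a <= b"; simp)+
 show "f \<in> borel_measurable lborel" using L2_onD(1)[OF f] by simp
 have "\<bar>f s\<bar> <= \<bar>indicator {a<..<b} s + (f s)^2\<bar>" for s
 proof (cases "s \<in> {a<..<b}")
  case True
  have "0 <= (\<bar>f s\<bar> - 1)^2" by simp
  then have "2 * \<bar>f s\<bar> <= 1 + (f s)^2" by (simp add: power2_eq_square algebra_simps)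
  with True show ?thesis by simp
 qed (use L2_onD(3)[OF f] in simp)
 then show "AE s in lborel. norm (f s) <= norm (indicator {a<..<b} s + (f s)^2)" by simp
qed

lemma L2_on_add: 
 assumes "f \<in> L2_on a b" "g \<in> L2_on a b" shows "f + g \<in> L2_on a b"
proof -
 note [measurable] = L2_onD(1)[OF assms(1)] L2_onD(1)[OF assms(2)]
 have "integrable lborel (%s. (f s + g s)^2)"
 proof (rule Bochner_Integration.integrable_bound)
  show "integrable lborel (%s. 2 * (f s)^2 + 2 * (g s)^2)" using assms L2_onD(2) by auto
  have "(f s + g s)^2 <= 2 * (f s)^2 + 2 * (g s)^2" for s
   using sum_squares_bound[of "f s" "g s"] by (simp add: power2_sum)
  then show "AE s in lborel. norm ((f s + g s)^2) <= norm (2 * (f s)^2 + 2 * (g s)^2)" by simp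
 qed simp
 moreover have "(%s. f s + g s) \<in> borel_measurable borel" by measurable
 moreover have "f s + g s = 0" if "s \<notin> {a<..<b}" for s
  using L2_onD(3)[OF assms(1) that] L2_onD(3)[OF assms(2) that] by simp
 ultimately show ?thesis unfolding L2_on_def plus_fun_def by simp
qed

lemma L2_on_subspace: "subspace (L2_on a b)"
proof (rule subspaceI)
 show "0 \<in> L2_on a b" unfolding L2_on_def by (auto simp: zero_fun_def)
 fix c :: real and f assume f: "f \<in> L2_on a b"
 have "(%s. c * f s) \<in> borel_measurable borel" using L2_onD(1)[OF f] by measurable
 then show "c *\<^sub>R f \<in> L2_on a b"
  using L2_onD[OF f] unfolding L2_on_def by (auto simp: power_mult_distrib scaleR_fun_def)
qed (rule L2_on_add)

lemma L2_on_subset_bounded_support: "L2_on a b <= L2_bounded_support"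
proof -
 have "L2_on a b <= L2_on a (max b (a + 1))" by (rule L2_on_mono) auto
 then show ?thesis unfolding L2_bounded_support_def by fastforce
qed

lemma L2_bounded_supportE:
 assumes "f \<in> L2_bounded_support"
 obtains R where "R > 0" "f \<in> L2_on (-R) R"
proof -
 obtain a b where ab: "f \<in> L2_on a b" using assms unfolding L2_bounded_support_def by blast
 have "- (\<bar>a\<bar> + \<bar>b\<bar> + 1) <= a" "b <= \<bar>a\<bar> + \<bar>b\<bar> + 1" by auto
 from subsetD[OF L2_on_mono[OF this] ab] have "f \<in> L2_on (- (\<bar>a\<bar> + \<bar>b\<bar> + 1)) (\<bar>a\<bar> + \<bar>b\<bar> + 1)" .
 then show ?thesis using that[of "\<bar>a\<bar> + \<bar>b\<bar> + 1"] by simp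
qed

lemma L2_bounded_support_common:
 assumes "f \<in> L2_bounded_support" "g \<in> L2_bounded_support"
 obtains R where "R > 0" "f \<in> L2_on (-R) R" "g \<in> L2_on (-R) R"
proof -
 obtain R S where R: "R > 0" "f \<in> L2_on (-R) R" "S > 0" "g \<in> L2_on (-S) S"
  using L2_bounded_supportE[OF assms(1)] L2_bounded_supportE[OF assms(2)] by metis
 have "L2_on (-R) R <= L2_on (- max R S) (max R S)" "L2_on (-S) S <= L2_on (- max R S) (max R S)"
  by (intro L2_on_mono; simp)+
 then show ?thesis using that[of "max R S"] R by (auto simp: less_max_iff_disj)
qed

lemma L2_bounded_support_subspace: "subspace L2_bounded_support"
proof (rule subspaceI)
 show "0 \<in> L2_bounded_support"
  using subspace_0[OF L2_on_subspace[of 0 1]] L2_on_subset_bounded_support by blast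
 show "f + g \<in> L2_bounded_support" if fg: "f \<in> L2_bounded_support" "g \<in> L2_bounded_support" for f g
  using L2_bounded_support_common[OF fg] subspace_add[OF L2_on_subspace] L2_on_subset_bounded_support by (metis subsetD)
 show "c *\<^sub>R f \<in> L2_bounded_support" if f: "f \<in> L2_bounded_support" for c f
  using L2_bounded_supportE[OF f] subspace_scale[OF L2_on_subspace] L2_on_subset_bounded_support by (metis subsetD)
qed

lemma integrable_convolution_fst:
 fixes u h :: "real => real"
 assumes u: "integrable lborel u" and h: "integrable lborel h"
 shows "integrable lborel2 (%p. u (fst p) * h (fst p - snd p))"
  and "(\<integral>p. u (fst p) * h (fst p - snd p) \<partial>lborel2) = (\<integral>x. u x \<partial>lborel) * (\<integral>x. h x \<partial>lborel)"
proof -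
 note [measurable] = borel_measurable_integrable[OF u] borel_measurable_integrable[OF h]
 have hx: "integrable lborel (%y. h (x - y))" for x
  using lborel_integrable_real_affine[OF h, of "-1" x] by simp
 have hi: "(\<integral>y. h (x - y) \<partial>lborel) = (\<integral>y. h y \<partial>lborel)" for x
  using lborel_integral_real_affine[of "-1" h x] by simp
 have hn: "(\<integral>y. \<bar>h (x - y)\<bar> \<partial>lborel) = (\<integral>y. \<bar>h y\<bar> \<partial>lborel)" for x
  using lborel_integral_real_affine[of "-1" "%y. \<bar>h y\<bar>" x] by simp
 show i: "integrable lborel2 (%p. u (fst p) * h (fst p - snd p))"
  by (rule lborel_pair.Fubini_integrable) (use u hx in \<open>simp_all add: abs_mult hn\<close>)
 show "(\<integral>p. u (fst p) * h (fst p - snd p) \<partial>lborel2) = (\<integral>x. u x \<partial>lborel) * (\<integral>x. h x \<partial>lborel)"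
  using lborel_pair.integral_fst'[OF i] by (simp add: hi)
qed

lemma integrable_convolution_snd:
 fixes u h :: "real => real"
 assumes u: "integrable lborel u" and h: "integrable lborel h"
 shows "integrable lborel2 (%p. u (snd p) * h (fst p - snd p))"
  and "(\<integral>p. u (snd p) * h (fst p - snd p) \<partial>lborel2) = (\<integral>x. u x \<partial>lborel) * (\<integral>x. h x \<partial>lborel)"
proof -
 have h': "integrable lborel (%x. h (- x))" using lborel_integrable_real_affine[OF h, of "-1" 0] by simp
 have hi: "(\<integral>x. h (- x) \<partial>lborel) = (\<integral>x. h x \<partial>lborel)" using lborel_integral_real_affine[of "-1" h 0] by simp
 note i = integrable_convolution_fst[OF u h']
 note [measurable] = borel_measurable_integrable[OF u] borel_measurable_integrable[OF h]
 have e: "(%(x, y). u (fst (y, x)) * h (- (fst (y, x) - snd (y, x)))) = (%p. u (snd p) * h (fst p - snd p))"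
  by (auto simp: fun_eq_iff)
 show "integrable lborel2 (%p. u (snd p) * h (fst p - snd p))"
  using lborel_pair.integrable_product_swap[OF i(1)] unfolding e .
 show "(\<integral>p. u (snd p) * h (fst p - snd p) \<partial>lborel2) = (\<integral>x. u x \<partial>lborel) * (\<integral>x. h x \<partial>lborel)"
  using lborel_pair.integral_product_swap[OF borel_measurable_integrable[OF i(1)]] i(2) unfolding e hi by simp
qed

definition locally_integrable :: "(real => real) => bool" where
 "locally_integrable k \<longleftrightarrow> k \<in> borel_measurable borel & (\<forall>l. set_integrable lborel {-l..l} k)"

text \<open>Bounding the product \<open>f g\<close> by the mean of the squares leaves two integrals
  of a square against a translate of the absolute kernel, cut off at the largest distance
  \<open>l\<close> between points of the supports. So the form exists and is bounded for the norm of
  square integrable functions.\<close>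

lemma kernel_form_integrable:
 assumes k: "locally_integrable k" and f: "f \<in> L2_on a b" and g: "g \<in> L2_on c d"
  and l: "!!s t. s \<in> {a<..<b} ==> t \<in> {c<..<d} ==> \<bar>s - t\<bar> <= l"
 shows "integrable lborel2 (%p. f (fst p) * g (snd p) * k (fst p - snd p))"
  and "\<bar>kernel_form k f g\<bar> <= ((\<integral>s. (f s)^2 \<partial>lborel) + (\<integral>s. (g s)^2 \<partial>lborel)) / 2 * (\<integral>t. indicator {-l..l} t * \<bar>k t\<bar> \<partial>lborel)"
proof -
 define h where "h = (%t. indicator {-l..l} t * \<bar>k t\<bar>)"
 have h: "integrable lborel h"
  using integrable_abs[of lborel "%t. indicator {-l..l} t *\<^sub>R k t"] k
  unfolding locally_integrable_def set_integrable_def h_def by (simp add: abs_mult)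
 note [measurable] = L2_onD(1)[OF f] L2_onD(1)[OF g]
 have [measurable]: "k \<in> borel_measurable borel" using k unfolding locally_integrable_def by simp
 define G where "G = (%p. 1 / 2 * ((f (fst p))^2 * h (fst p - snd p)) + 1 / 2 * ((g (snd p))^2 * h (fst p - snd p)))"
 note i1 = integrable_convolution_fst[OF L2_onD(2)[OF f] h] and i2 = integrable_convolution_snd[OF L2_onD(2)[OF g] h]
 have G: "integrable lborel2 G"
  unfolding G_def using i1(1) i2(1) by (intro Bochner_Integration.integrable_add integrable_mult_right)
 have le: "\<bar>f (fst p) * g (snd p) * k (fst p - snd p)\<bar> <= G p" for p
 proof (cases "fst p \<in> {a<..<b} & snd p \<in> {c<..<d}")
  case True
  then have hk: "h (fst p - snd p) = \<bar>k (fst p - snd p)\<bar>" using l[of "fst p" "snd p"] unfolding h_def by (simp add: indicator_def abs_le_iff)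
  have "\<bar>f (fst p) * g (snd p)\<bar> <= ((f (fst p))^2 + (g (snd p))^2) / 2"
   using sum_squares_bound[of "\<bar>f (fst p)\<bar>" "\<bar>g (snd p)\<bar>"] by (simp add: abs_mult)
  then have "\<bar>f (fst p) * g (snd p)\<bar> * \<bar>k (fst p - snd p)\<bar> <= ((f (fst p))^2 + (g (snd p))^2) / 2 * \<bar>k (fst p - snd p)\<bar>"
   by (rule mult_right_mono) simp
  then show ?thesis unfolding G_def hk by (simp add: abs_mult algebra_simps)
 next
  case False
  then have "f (fst p) * g (snd p) * k (fst p - snd p) = 0" using L2_onD(3)[OF f] L2_onD(3)[OF g] by auto
  moreover have "0 <= G p" unfolding G_def h_def by (intro add_nonneg_nonneg mult_nonneg_nonneg) simp_all
  ultimately show ?thesis by (simp only: abs_zero)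
 qed
 show i: "integrable lborel2 (%p. f (fst p) * g (snd p) * k (fst p - snd p))"
 proof (rule Bochner_Integration.integrable_bound[OF G])
  show "AE p in lborel2. norm (f (fst p) * g (snd p) * k (fst p - snd p)) <= norm (G p)"
  proof (intro AE_I2)
   fix p show "norm (f (fst p) * g (snd p) * k (fst p - snd p)) <= norm (G p)" using le[of p] by simp
  qed
 qed simp
 have "\<bar>kernel_form k f g\<bar> <= (\<integral>p. \<bar>f (fst p) * g (snd p) * k (fst p - snd p)\<bar> \<partial>lborel2)"
  unfolding kernel_form_def using integral_norm_bound[of "lborel2" "%p. f (fst p) * g (snd p) * k (fst p - snd p)"] by simp
 also have "\<dots> <= (\<integral>p. G p \<partial>lborel2)"
  using i G le by (intro integral_mono) auto
 also have "\<dots> = ((\<integral>s. (f s)^2 \<partial>lborel) + (\<integral>s. (g s)^2 \<partial>lborel)) / 2 * (\<integral>t. h t \<partial>lborel)"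
  unfolding G_def using i1 i2 by (subst Bochner_Integration.integral_add) (simp_all add: algebra_simps)
 finally show "\<bar>kernel_form k f g\<bar> <= ((\<integral>s. (f s)^2 \<partial>lborel) + (\<integral>s. (g s)^2 \<partial>lborel)) / 2 * (\<integral>t. indicator {-l..l} t * \<bar>k t\<bar> \<partial>lborel)"
  unfolding h_def .
qed

lemma kernel_form_bounded_support_integrable:
 assumes k: "locally_integrable k" and f: "f \<in> L2_bounded_support" and g: "g \<in> L2_bounded_support"
 shows "integrable lborel2 (%p. f (fst p) * g (snd p) * k (fst p - snd p))"
proof -
 obtain R where R: "f \<in> L2_on (-R) R" "g \<in> L2_on (-R) R" using L2_bounded_support_common[OF f g] by metis
 show ?thesis by (rule kernel_form_integrable(1)[OF k R, of "2 * R"]) auto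
qed

lemma kernel_form_add:
 assumes k: "locally_integrable k" and "f \<in> L2_bounded_support" "g \<in> L2_bounded_support" "h \<in> L2_bounded_support"
 shows "kernel_form k (f + g) h = kernel_form k f h + kernel_form k g h"
 unfolding kernel_form_def
 using kernel_form_bounded_support_integrable[OF k assms(2,4)] kernel_form_bounded_support_integrable[OF k assms(3,4)]
 by (subst Bochner_Integration.integral_add[symmetric]) (simp_all add: algebra_simps)

lemma kernel_form_scale: "kernel_form k (c *\<^sub>R f) h = c * kernel_form k f h"
 unfolding kernel_form_def by (simp add: mult.assoc)

lemma kernel_form_sym:
 assumes k: "locally_integrable k" "!!t. t ~= 0 ==> k (- t) = k t" and f: "f \<in> L2_bounded_support" "g \<in> L2_bounded_support"
 shows "kernel_form k f g = kernel_form k g f"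
proof -
 have "kernel_form k f g = (\<integral>(x, y). f (fst (y, x)) * g (snd (y, x)) * k (fst (y, x) - snd (y, x)) \<partial>lborel2)"
  unfolding kernel_form_def
  using lborel_pair.integral_product_swap[OF borel_measurable_integrable[OF kernel_form_bounded_support_integrable[OF k(1) f]]] by simp
 also have "\<dots> = kernel_form k g f"
  unfolding kernel_form_def
 proof (rule Bochner_Integration.integral_cong[OF refl])
  fix p :: "real \<times> real"
  show "(case p of (x, y) => f (fst (y, x)) * g (snd (y, x)) * k (fst (y, x) - snd (y, x))) = g (fst p) * f (snd p) * k (fst p - snd p)"
   using k(2)[of "fst p - snd p"] by (cases "fst p = snd p") (auto simp: case_prod_beta)
 qed
 finally show ?thesis .
qed

text \<open>The diagonal is a null set, so the value of a kernel at 0 never matters.\<close>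

lemma AE_lborel_pair_neq: "AE p in lborel2. fst p ~= (snd p :: real)"
proof (rule lborel_pair.AE_pair_measure)
 show "{p \<in> space lborel2. fst p ~= (snd p :: real)} \<in> sets lborel2" by measurable
 show "AE x in lborel. AE y in lborel. fst (x, y) ~= (snd (x, y) :: real)"
 proof (rule AE_I2)
  fix x :: real
  show "AE y in lborel. fst (x, y) ~= (snd (x, y) :: real)"
   using AE_lborel_singleton[of x] by eventually_elim simp
 qed
qed

text \<open>A kernel which is a mixture of products gives a form which is the same mixture of products
  of linear functionals.\<close>

lemma kernel_form_mixture:
 fixes a a' :: "'z => real => real" and k :: "real => real"
 assumes M: "sigma_finite_measure M"
  and [measurable]: "case_prod a \<in> borel_measurable (M \<Otimes>\<^sub>M borel)" "case_prod a' \<in> borel_measurable (M \<Otimes>\<^sub>M borel)"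
   "f \<in> borel_measurable borel" "g \<in> borel_measurable borel"
  and nn: "!!z s. 0 <= a z s" "!!z s. 0 <= a' z s"
  and ia: "!!z. integrable lborel (%s. f s * a z s)" "!!z. integrable lborel (%s. g s * a' z s)"
  and k: "!!s t. s ~= t ==> f s ~= 0 ==> g t ~= 0 ==> ennreal (k (s - t)) = (\<integral>\<^sup>+ z. ennreal (a z s * a' z t) \<partial>M)"
  and kn: "!!s t. s ~= t ==> f s ~= 0 ==> g t ~= 0 ==> 0 <= k (s - t)"
  and i: "integrable lborel2 (%p. f (fst p) * g (snd p) * k (fst p - snd p))"
 shows "integrable M (%z. (\<integral>s. f s * a z s \<partial>lborel) * (\<integral>t. g t * a' z t \<partial>lborel)) \<and>
  kernel_form k f g = (\<integral>z. (\<integral>s. f s * a z s \<partial>lborel) * (\<integral>t. g t * a' z t \<partial>lborel) \<partial>M)"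
proof -
 interpret M: sigma_finite_measure M by fact
 interpret LL: sigma_finite_measure "lborel2 :: (real \<times> real) measure"
  unfolding lborel_prod by (rule lborel.sigma_finite_measure_axioms)
 interpret P: pair_sigma_finite "lborel2 :: (real \<times> real) measure" M ..
 define F where "F = (%p z. f (fst p) * a z (fst p) * (g (snd p) * a' z (snd p)))"
 have Fm [measurable]: "case_prod F \<in> borel_measurable (lborel2 \<Otimes>\<^sub>M M)"
  unfolding F_def by measurable
 \<comment> \<open>The factors are nonnegative, so integrating the absolute integrand over
   \<open>z\<close> gives the absolute integrand of the form. Tonelli then yields integrability in
   all three variables from that of the form.\<close>
 have k': "AE p in lborel2. (\<integral>\<^sup>+ z. ennreal (norm (F p z)) \<partial>M) = ennreal (norm (f (fst p) * g (snd p) * k (fst p - snd p)))"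
  using AE_lborel_pair_neq
 proof (eventually_elim)
  case (elim p)
  show ?case
  proof (cases "f (fst p) = 0 \<or> g (snd p) = 0")
   case True then show ?thesis unfolding F_def by auto
  next
   case False
   have "(\<integral>\<^sup>+ z. ennreal (norm (F p z)) \<partial>M) = (\<integral>\<^sup>+ z. ennreal \<bar>f (fst p) * g (snd p)\<bar> * ennreal (a z (fst p) * a' z (snd p)) \<partial>M)"
    unfolding F_def using nn by (intro nn_integral_cong) (simp add: abs_mult ennreal_mult'[symmetric] algebra_simps)
   also have "\<dots> = ennreal \<bar>f (fst p) * g (snd p)\<bar> * ennreal (k (fst p - snd p))"
    using k[of "fst p" "snd p"] elim False by (subst nn_integral_cmult) auto
   also have "\<dots> = ennreal (norm (f (fst p) * g (snd p) * k (fst p - snd p)))"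
    using kn[of "fst p" "snd p"] elim False by (simp add: ennreal_mult'[symmetric] abs_mult)
   finally show ?thesis .
  qed
 qed
 have Fi: "integrable (lborel2 \<Otimes>\<^sub>M M) (case_prod F)"
 proof (rule integrableI_bounded)
  have "(\<integral>\<^sup>+ q. ennreal (norm (case_prod F q)) \<partial>(lborel2 \<Otimes>\<^sub>M M))
    = (\<integral>\<^sup>+ p. (\<integral>\<^sup>+ z. ennreal (norm (F p z)) \<partial>M) \<partial>lborel2)"
   by (subst M.nn_integral_fst[symmetric]) (simp_all add: case_prod_beta)
  also have "\<dots> = (\<integral>\<^sup>+ p. ennreal (norm (f (fst p) * g (snd p) * k (fst p - snd p))) \<partial>lborel2)"
   by (rule nn_integral_cong_AE[OF k'])
  also have "\<dots> < \<infinity>" using i unfolding integrable_iff_bounded by simp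
  finally show "(\<integral>\<^sup>+ q. ennreal (norm (case_prod F q)) \<partial>(lborel2 \<Otimes>\<^sub>M M)) < \<infinity>" .
 qed simp
 have inner1: "AE p in lborel2. (\<integral>z. F p z \<partial>M) = f (fst p) * g (snd p) * k (fst p - snd p)"
  using AE_lborel_pair_neq
 proof (eventually_elim)
  case (elim p)
  show ?case
  proof (cases "f (fst p) = 0 \<or> g (snd p) = 0")
   case True then show ?thesis unfolding F_def by auto
  next
   case False
   have "(\<integral>z. F p z \<partial>M) = f (fst p) * g (snd p) * (\<integral>z. a z (fst p) * a' z (snd p) \<partial>M)"
    unfolding F_def by (subst integral_mult_right_zero[symmetric]) (simp add: algebra_simps)
   also have "(\<integral>z. a z (fst p) * a' z (snd p) \<partial>M) = enn2real (\<integral>\<^sup>+ z. ennreal (a z (fst p) * a' z (snd p)) \<partial>M)"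
    using nn by (intro integral_eq_nn_integral) auto
   also have "\<dots> = k (fst p - snd p)"
    using k[of "fst p" "snd p"] kn[of "fst p" "snd p"] elim False by (simp flip: k)
   finally show ?thesis .
  qed
 qed
 have inner2: "(\<integral>p. F p z \<partial>lborel2) = (\<integral>s. f s * a z s \<partial>lborel) * (\<integral>t. g t * a' z t \<partial>lborel)" for z
 proof -
  have "integrable lborel2 (%p. f (fst p) * a z (fst p) * (g (snd p) * a' z (snd p)))"
  proof (rule lborel_pair.Fubini_integrable)
   show "(%p. f (fst p) * a z (fst p) * (g (snd p) * a' z (snd p))) \<in> borel_measurable lborel2"
    using borel_measurable_integrable[OF ia(1)[of z]] borel_measurable_integrable[OF ia(2)[of z]] by measurable
  qed (use ia[of z] in \<open>simp_all add: abs_mult[of "f _ * a z _"]\<close>)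
  from lborel_pair.integral_fst'[OF this] show ?thesis unfolding F_def by simp
 qed
 have I: "integrable M (%z. (\<integral>s. f s * a z s \<partial>lborel) * (\<integral>t. g t * a' z t \<partial>lborel))"
  using P.integrable_snd[OF Fi] unfolding inner2 .
 have "kernel_form k f g = (\<integral>p. (\<integral>z. F p z \<partial>M) \<partial>lborel2)"
  unfolding kernel_form_def using inner1 i by (intro integral_cong_AE) (auto elim!: eventually_mono)
 also have "\<dots> = (\<integral>z. (\<integral>p. F p z \<partial>lborel2) \<partial>M)"
  by (rule P.Fubini_integral[OF Fi, symmetric])
 finally show ?thesis using I unfolding inner2 by simp
qed

section \<open>Window representation of the form of a convex kernel\<close>

definition cum :: "(real => real) => real => real" where
 "cum f x = (\<integral>s. (if s <= x then f s else 0) \<partial>lborel)"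

lemma integrable_if:
 fixes f :: "real => real"
 assumes f: "integrable lborel f" and [measurable]: "Measurable.pred borel P"
 shows "integrable lborel (%s. if P s then f s else 0)"
proof (rule Bochner_Integration.integrable_bound[OF f])
 note [measurable] = borel_measurable_integrable[OF f]
 show "(%s. if P s then f s else 0) \<in> borel_measurable lborel" by measurable
qed auto

lemma cum_measurable [measurable]: "f \<in> borel_measurable borel ==> cum f \<in> borel_measurable borel"
proof -
 assume [measurable]: "f \<in> borel_measurable borel"
 have "(%(x, s). if s <= x then f s else 0) \<in> borel_measurable (borel \<Otimes>\<^sub>M lborel)" by measurable
 then show ?thesis unfolding cum_def[abs_def] by (intro lborel.borel_measurable_lebesgue_integral) simp
qed

lemma cum_diff:
 assumes f: "integrable lborel f" and "x <= y"
 shows "cum f y - cum f x = (\<integral>s. f s * (if x < s & s <= y then 1 else 0) \<partial>lborel)"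
proof -
 have "cum f y - cum f x = (\<integral>s. (if s <= y then f s else 0) - (if s <= x then f s else 0) \<partial>lborel)"
  unfolding cum_def by (subst Bochner_Integration.integral_diff) (auto intro!: integrable_if f)
 also have "\<dots> = (\<integral>s. f s * (if x < s & s <= y then 1 else 0) \<partial>lborel)"
  using assms(2) by (intro Bochner_Integration.integral_cong) auto
 finally show ?thesis .
qed

lemma cum_isCont:
 assumes f: "integrable lborel f"
 shows "isCont (cum f) x"
 unfolding continuous_at_sequentially comp_def
proof (intro allI impI)
 fix u :: "nat => real" assume u: "u ----> x"
 note [measurable] = borel_measurable_integrable[OF f]
 show "(%n. cum f (u n)) ----> cum f x"
  unfolding cum_def
 proof (rule integral_dominated_convergence[where w = "%s. norm (f s)"])
  show "AE s in lborel. (%n. if s <= u n then f s else 0) ----> (if s <= x then f s else 0)"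
   using AE_lborel_singleton[of x]
  proof eventually_elim
   case (elim s)
   have "\<forall>\<^sub>F n in sequentially. (s <= u n) = (s <= x)"
   proof (cases "s < x")
    case True
    then have "\<forall>\<^sub>F n in sequentially. s < u n" using order_tendstoD(1)[OF u] by blast
    then show ?thesis by eventually_elim (use True in auto)
   next
    case False
    then have "x < s" using elim by simp
    then have "\<forall>\<^sub>F n in sequentially. u n < s" using order_tendstoD(2)[OF u] by blast
    then show ?thesis by eventually_elim (use \<open>x < s\<close> in auto)
   qed
   then have "\<forall>\<^sub>F n in sequentially. (if s <= u n then f s else 0) = (if s <= x then f s else 0)"
    by eventually_elim simp
   then show ?case by (rule tendsto_eventually)
  qed
 qed (use f in auto)
qed

lemma cum_left:
 assumes "f \<in> L2_on a c" "x <= a" shows "cum f x = 0"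
proof -
 have "(%s. if s <= x then f s else 0) = (%s. 0)" using L2_onD(3)[OF assms(1)] assms(2) by auto
 then show ?thesis unfolding cum_def by simp
qed

lemma cum_right:
 assumes "f \<in> L2_on a c" "c <= x" shows "cum f x = integral\<^sup>L lborel f"
proof -
 have "(%s. if s <= x then f s else 0) = f" using L2_onD(3)[OF assms(1)] assms(2) by fastforce
 then show ?thesis unfolding cum_def by simp
qed

text \<open>The value is extended so that it can be integrated against weights in \<open>r\<close>
  and compared before any integrability is known.\<close>

definition window_energy :: "(real => real) => real => ennreal" where
 "window_energy f r = (\<integral>\<^sup>+ x. ennreal ((cum f (x + r) - cum f x)^2) \<partial>lborel)"

lemma window_energy_measurable [measurable]:
 assumes [measurable]: "f \<in> borel_measurable borel"
 shows "window_energy f \<in> borel_measurable borel"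
 unfolding window_energy_def[abs_def] by measurable

text \<open>The positions \<open>x\<close> whose window from \<open>x\<close> to
  \<open>x + r\<close> contains both \<open>s\<close> and \<open>t\<close> form an interval of
  length \<open>r - \<bar>s - t\<bar>\<close>, or the empty set.\<close>

lemma triangle_nn_integral:
 "(\<integral>\<^sup>+ x. ennreal ((if x < s & s <= x + r then 1 else 0) * (if x < t & t <= x + r then 1 else 0)) \<partial>lborel)
  = ennreal (max 0 (r - \<bar>s - t\<bar>))"
proof -
 have "(%x. ennreal ((if x < s & s <= x + r then 1 else 0) * (if x < t & t <= x + r then 1 else 0)))
   = indicator {max s t - r..<min s t}"
  by (auto simp: fun_eq_iff indicator_def)
 then have "(\<integral>\<^sup>+ x. ennreal ((if x < s & s <= x + r then 1 else 0) * (if x < t & t <= x + r then 1 else 0)) \<partial>lborel)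
   = emeasure lborel {max s t - r..<min s t}" by simp
 also have "\<dots> = ennreal (max 0 (r - \<bar>s - t\<bar>))"
 proof -
  have m: "min s t - (max s t - r) = r - \<bar>s - t\<bar>" by (auto simp: max_def min_def abs_if)
  show ?thesis
  proof (cases "0 <= r - \<bar>s - t\<bar>")
   case True
   then have "max s t - r <= min s t" using m by linarith
   then show ?thesis using True m by (simp del: max_less_iff_conj)
  next
   case False
   then have "min s t < max s t - r" using m by linarith
   then have e: "{max s t - r..<min s t} = {}" by (intro atLeastLessThan_empty less_imp_le)
   show ?thesis unfolding e using False by simp
  qed
 qed
 finally show ?thesis .
qed

lemma integrable_window:
 fixes f :: "real => real"
 assumes f: "integrable lborel f"
 shows "integrable lborel (%s. f s * (if x < s & s <= y then c else 0 :: real))"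
proof -
 have "(%s. f s * (if x < s & s <= y then c else 0)) = (%s. c * (if x < s & s <= y then f s else 0))" by auto
 then show ?thesis using integrable_if[OF f, of "%s. x < s & s <= y"] by simp
qed

lemma locally_integrable_continuous:
 "continuous_on UNIV k ==> locally_integrable k"
 unfolding locally_integrable_def
 by (auto intro!: borel_measurable_continuous_onI borel_integrable_atLeastAtMost' intro: continuous_on_subset)

text \<open>The triangle kernel is a mixture over \<open>x\<close> of products of two window
  indicators, and the integral of \<open>f\<close> over a window is an increment of
  \<open>cum f\<close>.\<close>

lemma kernel_form_triangle:
 assumes f: "f \<in> L2_on a c" and g: "g \<in> L2_on a c" and r: "r > 0"
 shows "integrable lborel (%x. (cum f (x + r) - cum f x) * (cum g (x + r) - cum g x))"
  and "kernel_form (%t. max 0 (r - \<bar>t\<bar>)) f g = (\<integral>x. (cum f (x + r) - cum f x) * (cum g (x + r) - cum g x) \<partial>lborel)"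
proof -
 note [measurable] = L2_onD(1)[OF f] L2_onD(1)[OF g]
 note fi = L2_on_integrable[OF f] and gi = L2_on_integrable[OF g]
 have li: "locally_integrable (%t. max 0 (r - \<bar>t\<bar>))"
  by (intro locally_integrable_continuous continuous_intros)
 have fL: "f \<in> L2_bounded_support" "g \<in> L2_bounded_support" using f g L2_on_subset_bounded_support by blast+
 define w where "w = (%x s :: real. if x < s & s <= x + r then 1 else 0 :: real)"
 have w: "(\<integral>s. f s * w x s \<partial>lborel) = cum f (x + r) - cum f x" "(\<integral>s. g s * w x s \<partial>lborel) = cum g (x + r) - cum g x" for x
  unfolding w_def using cum_diff[OF fi, of x "x + r"] cum_diff[OF gi, of x "x + r"] r by simp_all
 have wm: "case_prod w \<in> borel_measurable (lborel \<Otimes>\<^sub>M borel)" unfolding w_def by measurable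
 have "integrable lborel (%x. (\<integral>s. f s * w x s \<partial>lborel) * (\<integral>s. g s * w x s \<partial>lborel)) \<and>
  kernel_form (%t. max 0 (r - \<bar>t\<bar>)) f g = (\<integral>x. (\<integral>s. f s * w x s \<partial>lborel) * (\<integral>s. g s * w x s \<partial>lborel) \<partial>lborel)"
 proof (rule kernel_form_mixture[OF lborel.sigma_finite_measure_axioms wm wm L2_onD(1)[OF f] L2_onD(1)[OF g]])
  fix s t :: real
  show "ennreal (max 0 (r - \<bar>s - t\<bar>)) = (\<integral>\<^sup>+ z. ennreal (w z s * w z t) \<partial>lborel)"
   unfolding w_def by (rule triangle_nn_integral[symmetric])
 qed (use kernel_form_bounded_support_integrable[OF li fL] integrable_window[OF fi] integrable_window[OF gi] in \<open>auto simp: w_def\<close>)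
 then show "integrable lborel (%x. (cum f (x + r) - cum f x) * (cum g (x + r) - cum g x))"
  and "kernel_form (%t. max 0 (r - \<bar>t\<bar>)) f g = (\<integral>x. (cum f (x + r) - cum f x) * (cum g (x + r) - cum g x) \<partial>lborel)"
  unfolding w by simp_all
qed

lemma kernel_form_const:
 assumes f: "f \<in> L2_on a b" and g: "g \<in> L2_on c d"
 shows "kernel_form (%_. k) f g = k * integral\<^sup>L lborel f * integral\<^sup>L lborel g"
proof -
 have "locally_integrable (%_. k)" by (intro locally_integrable_continuous continuous_intros)
 then have "integrable lborel2 (%p. f (fst p) * g (snd p) * k)"
  using kernel_form_bounded_support_integrable[of "%_. k" f g] f g L2_on_subset_bounded_support by blast
 from lborel_pair.integral_fst'[OF this, symmetric] show ?thesis
  unfolding kernel_form_def by (simp add: mult.assoc mult.left_commute mult.commute[of k])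
qed

lemma locally_integrable_add:
 "locally_integrable k ==> locally_integrable k' ==> locally_integrable (%t. k t + k' t)"
 unfolding locally_integrable_def by (auto intro!: set_integral_add)

lemma locally_integrable_minus:
 "locally_integrable k ==> locally_integrable k' ==> locally_integrable (%t. k t - k' t)"
 unfolding locally_integrable_def by (auto intro!: set_integral_diff)

lemma kernel_form_kernel_add:
 assumes "locally_integrable k" "locally_integrable k'" "f \<in> L2_bounded_support" "g \<in> L2_bounded_support"
 shows "kernel_form (%t. k t + k' t) f g = kernel_form k f g + kernel_form k' f g"
 unfolding kernel_form_def
 using kernel_form_bounded_support_integrable[OF assms(1,3,4)] kernel_form_bounded_support_integrable[OF assms(2,3,4)]
 by (subst Bochner_Integration.integral_add[symmetric]) (simp_all add: distrib_left)

lemma kernel_form_cong: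
 assumes "!!s t. s ~= t ==> f s ~= 0 ==> g t ~= 0 ==> k (s - t) = k' (s - t)"
  and "locally_integrable k" "locally_integrable k'" "f \<in> L2_bounded_support" "g \<in> L2_bounded_support"
 shows "kernel_form k f g = kernel_form k' f g"
 unfolding kernel_form_def
proof (rule integral_cong_AE)
 show "AE p in lborel2. f (fst p) * g (snd p) * k (fst p - snd p) = f (fst p) * g (snd p) * k' (fst p - snd p)"
  using AE_lborel_pair_neq by eventually_elim (use assms(1) in force)
qed (use kernel_form_bounded_support_integrable[OF assms(2,4,5)] kernel_form_bounded_support_integrable[OF assms(3,4,5)] in auto)

lemma kernel_form_kernel_scale: "kernel_form (%t. c * k t) f g = c * kernel_form k f g"
 unfolding kernel_form_def by (subst integral_mult_right_zero[symmetric]) (simp add: mult_ac)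

text \<open>The smooth stand-in for \<open>B\<close>. Monotonicity and convexity are expressed by
  the signs of \<open>b1\<close> and \<open>b2\<close>; integrability across 0 is a separate
  condition, as the signs do not bound \<open>b\<close> near 0.\<close>

locale c2_kernel =
 fixes b b1 b2 :: "real => real"
 assumes deriv1: "t > 0 ==> (b has_real_derivative b1 t) (at t)"
  and deriv2: "t > 0 ==> (b1 has_real_derivative b2 t) (at t)"
  and cont2: "continuous_on {0<..} b2"
  and nonneg0: "t > 0 ==> 0 <= b t" and nonpos1: "t > 0 ==> b1 t <= 0" and nonneg2: "t > 0 ==> 0 <= b2 t"
  and local: "locally_integrable (%t. b \<bar>t\<bar>)"
begin

definition trunc2 :: "real => real => real" where "trunc2 R r = (if 0 < r & r < R then b2 r else 0)"

lemma trunc2_measurable [measurable]: "trunc2 R \<in> borel_measurable borel"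
proof -
 have "(%r. indicator {0<..<R} r *\<^sub>R b2 r) \<in> borel_measurable borel"
  by (rule borel_measurable_continuous_on_indicator) (auto intro: continuous_on_subset[OF cont2])
 also have "(%r. indicator {0<..<R} r *\<^sub>R b2 r) = trunc2 R" by (auto simp: trunc2_def fun_eq_iff)
 finally show ?thesis .
qed

lemma trunc2_nonneg: "0 <= trunc2 R r" unfolding trunc2_def using nonneg2 by simp

text \<open>Expansion at a finite point \<open>R\<close>, with \<open>(r - t) * b1 r - b r\<close>
  as antiderivative of \<open>(r - t) * b2 r\<close>. The boundary terms \<open>b R\<close> and
  \<open>- b1 R\<close> are nonnegative and will contribute a constant kernel and one further
  triangle kernel, so no behaviour at infinity is involved.\<close>

lemma taylor:
 assumes "0 < t" "t < R"
 shows "(\<integral>\<^sup>+ r. ennreal (trunc2 R r * max 0 (r - t)) \<partial>lborel) = ennreal (b t - b R - (R - t) * - b1 R)"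
  and "0 <= b t - b R - (R - t) * - b1 R"
proof -
 define F where "F = (%r. (r - t) * b1 r - b r)"
 have b2R: "continuous_on {t..R} b2" by (rule continuous_on_subset[OF cont2]) (use assms in auto)
 have "(%r. ennreal (trunc2 R r * max 0 (r - t))) = (%r. ennreal (trunc2 R r * max 0 (r - t)) * indicator {t..R} r)"
  by (auto simp: fun_eq_iff trunc2_def indicator_def max_def)
 then have "(\<integral>\<^sup>+ r. ennreal (trunc2 R r * max 0 (r - t)) \<partial>lborel) = (\<integral>\<^sup>+ r. ennreal (trunc2 R r * max 0 (r - t)) * indicator {t..R} r \<partial>lborel)"
  by (simp only:)
 also have "\<dots> = (\<integral>\<^sup>+ r. ennreal (indicator {t..R} r * (b2 r * (r - t))) * indicator {t..R} r \<partial>lborel)"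
 proof (rule nn_integral_cong_AE)
  show "AE r in lborel. ennreal (trunc2 R r * max 0 (r - t)) * indicator {t..R} r =
   ennreal (indicator {t..R} r * (b2 r * (r - t))) * indicator {t..R} r"
   using AE_lborel_singleton[of R] by eventually_elim (use assms in \<open>auto simp: trunc2_def indicator_def max_def\<close>)
 qed
 also have "\<dots> = ennreal (F R - F t)"
 proof (rule nn_integral_FTC_Icc[where F = F and a = t and b = R])
  have "(%r. indicator {t..R} r *\<^sub>R (b2 r * (r - t))) \<in> borel_measurable borel"
   by (rule borel_measurable_continuous_on_indicator) (auto intro!: continuous_intros b2R)
  then show "(%r. indicator {t..R} r * (b2 r * (r - t))) \<in> borel_measurable borel" by simp
  fix r assume "r \<in> {t..R}"
  then have r: "t <= r" "r <= R" by auto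
  then have r0: "r > 0" using assms by simp
  have "(F has_real_derivative (b1 r + (r - t) * b2 r - b1 r)) (at r)"
   unfolding F_def by (rule derivative_eq_intros deriv1 deriv2 r0 refl)+ (simp add: algebra_simps)
  then show "(F has_real_derivative (indicator {t..R} r * (b2 r * (r - t)))) (at r)"
   using r by (simp add: algebra_simps)
  show "0 <= indicator {t..R} r * (b2 r * (r - t))" using r nonneg2[OF r0] by simp
 qed (use assms in simp)
 also have "F R - F t = b t - b R - (R - t) * - b1 R" unfolding F_def by simp
 finally show "(\<integral>\<^sup>+ r. ennreal (trunc2 R r * max 0 (r - t)) \<partial>lborel) = ennreal (b t - b R - (R - t) * - b1 R)" .
 have "F t <= F R"
 proof (rule DERIV_nonneg_imp_nondecreasing[where f = F and a = t and b = R])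
  fix r assume r: "t <= r" "r <= R"
  then have r0: "r > 0" using assms by simp
  have "(F has_real_derivative (b1 r + (r - t) * b2 r - b1 r)) (at r)"
   unfolding F_def by (rule derivative_eq_intros deriv1 deriv2 r0 refl)+ (simp add: algebra_simps)
  then show "\<exists>y. (F has_real_derivative y) (at r) & 0 <= y" using r nonneg2[OF r0]
   by (intro exI[of _ "b1 r + (r - t) * b2 r - b1 r"] conjI) simp_all
 qed (use assms in simp)
 then show "0 <= b t - b R - (R - t) * - b1 R" unfolding F_def by simp
qed

text \<open>If \<open>R\<close> exceeds the diameter of the supports, only differences below
  \<open>R\<close> occur, and there Taylor's formula writes the kernel as a constant plus a triangle
  of width \<open>R\<close> plus a mixture of triangles of width below \<open>R\<close> with density
  \<open>b2\<close>.\<close>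

lemma kernel_form_windows:
 assumes f: "f \<in> L2_on a c" and g: "g \<in> L2_on a c" and R: "R > 0" "R > c - a"
 shows "kernel_form (%t. b \<bar>t\<bar>) f g = b R * (integral\<^sup>L lborel f * integral\<^sup>L lborel g)
   + (- b1 R) * (\<integral>x. (cum f (x + R) - cum f x) * (cum g (x + R) - cum g x) \<partial>lborel)
   + (\<integral>z. trunc2 R (snd z) * ((cum f (fst z + snd z) - cum f (fst z)) * (cum g (fst z + snd z) - cum g (fst z))) \<partial>lborel2)"
  and "integrable lborel2 (%z. trunc2 R (snd z) * ((cum f (fst z + snd z) - cum f (fst z)) * (cum g (fst z + snd z) - cum g (fst z))))"
proof -
 note [measurable] = L2_onD(1)[OF f] L2_onD(1)[OF g]
 note fi = L2_on_integrable[OF f] and gi = L2_on_integrable[OF g]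
 have fL: "f \<in> L2_bounded_support" "g \<in> L2_bounded_support" using f g L2_on_subset_bounded_support by blast+
 have st: "\<bar>s - t\<bar> < R" if "f s ~= 0" "g t ~= 0" for s t
  using that L2_onD(3)[OF f, of s] L2_onD(3)[OF g, of t] R by fastforce
 \<comment> \<open>The Taylor remainder. Beyond \<open>R\<close> it no longer agrees with the
   mixture, but there \<open>f s\<close> and \<open>g t\<close> are not both nonzero.\<close>
 define k3 where "k3 = (%t. b \<bar>t\<bar> - (b R + (- b1 R) * (R - \<bar>t\<bar>)))"
 have lc: "locally_integrable (%t. b R)" by (intro locally_integrable_continuous continuous_intros)
 have lt: "locally_integrable (%t. max 0 (R - \<bar>t\<bar>))" by (intro locally_integrable_continuous continuous_intros)
 have lt': "locally_integrable (%t. (- b1 R) * max 0 (R - \<bar>t\<bar>))" by (intro locally_integrable_continuous continuous_intros)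
 have l3: "locally_integrable k3" unfolding k3_def
  by (intro locally_integrable_minus local locally_integrable_continuous continuous_intros)
 define w where "w = (%(z :: real \<times> real) (s :: real). if fst z < s & s <= fst z + snd z then 1 else 0 :: real)"
 \<comment> \<open>The density sits entirely in the first of the two factors; this is why the
   mixture lemma admits two different ones.\<close>
 define v where "v = (%(z :: real \<times> real) (s :: real). if fst z < s & s <= fst z + snd z then trunc2 R (snd z) else 0 :: real)"
 have wm: "case_prod w \<in> borel_measurable (lborel2 \<Otimes>\<^sub>M borel)" unfolding w_def by measurable
 have vm: "case_prod v \<in> borel_measurable (lborel2 \<Otimes>\<^sub>M borel)" unfolding v_def by measurable
 have sf: "sigma_finite_measure (lborel2 :: (real \<times> real) measure)"
  unfolding lborel_prod by (rule lborel.sigma_finite_measure_axioms)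
 define I where "I = (%z. trunc2 R (snd z) * ((cum f (fst z + snd z) - cum f (fst z)) * (cum g (fst z + snd z) - cum g (fst z))))"
 have Iz: "(\<integral>s. f s * v z s \<partial>lborel) * (\<integral>s. g s * w z s \<partial>lborel) = I z" for z
 proof (cases "0 < snd z")
  case True
  have "(\<integral>s. f s * w z s \<partial>lborel) = cum f (fst z + snd z) - cum f (fst z)"
   "(\<integral>s. g s * w z s \<partial>lborel) = cum g (fst z + snd z) - cum g (fst z)"
   using cum_diff[OF fi, of "fst z" "fst z + snd z"] cum_diff[OF gi, of "fst z" "fst z + snd z"] True unfolding w_def by simp_all
  moreover have "(\<integral>s. f s * v z s \<partial>lborel) = (\<integral>s. trunc2 R (snd z) * (f s * w z s) \<partial>lborel)"
   unfolding v_def w_def by (intro Bochner_Integration.integral_cong) auto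
  ultimately show ?thesis unfolding I_def by simp
 next
  case False
  then have "trunc2 R (snd z) = 0" unfolding trunc2_def by simp
  then have "v z = (%s. 0)" unfolding v_def by (simp add: fun_eq_iff)
  then show ?thesis unfolding I_def using \<open>trunc2 R (snd z) = 0\<close> by simp
 qed
 have mix: "integrable lborel2 I" "kernel_form k3 f g = (\<integral>z. I z \<partial>lborel2)"
 proof -
  have "integrable lborel2 (%z. (\<integral>s. f s * v z s \<partial>lborel) * (\<integral>s. g s * w z s \<partial>lborel)) \<and>
   kernel_form k3 f g = (\<integral>z. (\<integral>s. f s * v z s \<partial>lborel) * (\<integral>s. g s * w z s \<partial>lborel) \<partial>lborel2)"
  proof (rule kernel_form_mixture[OF sf vm wm L2_onD(1)[OF f] L2_onD(1)[OF g]])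
   fix s t assume *: "s ~= t" "f s ~= 0" "g t ~= 0"
   have p: "0 < \<bar>s - t\<bar>" "\<bar>s - t\<bar> < R" using * st by auto
   have e: "k3 (s - t) = b \<bar>s - t\<bar> - b R - (R - \<bar>s - t\<bar>) * - b1 R" unfolding k3_def by simp
   show "0 <= k3 (s - t)" unfolding e by (rule taylor(2)[OF p])
   have "(\<integral>\<^sup>+ z. ennreal (v z s * w z t) \<partial>lborel2) =
    (\<integral>\<^sup>+ r. (\<integral>\<^sup>+ x. ennreal (v (x, r) s * w (x, r) t) \<partial>lborel) \<partial>lborel)"
    by (rule lborel_pair.nn_integral_snd[symmetric]) (use vm wm in measurable)
   also have "\<dots> = (\<integral>\<^sup>+ r. ennreal (trunc2 R r * max 0 (r - \<bar>s - t\<bar>)) \<partial>lborel)"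
   proof (rule nn_integral_cong)
    fix r :: real
    have "(\<integral>\<^sup>+ x. ennreal (v (x, r) s * w (x, r) t) \<partial>lborel) =
     (\<integral>\<^sup>+ x. ennreal (trunc2 R r) * ennreal ((if x < s & s <= x + r then 1 else 0) * (if x < t & t <= x + r then 1 else 0)) \<partial>lborel)"
     unfolding v_def w_def using trunc2_nonneg by (intro nn_integral_cong) (auto simp: ennreal_mult)
    also have "\<dots> = ennreal (trunc2 R r * max 0 (r - \<bar>s - t\<bar>))"
    proof -
     have "(\<integral>\<^sup>+ x. ennreal (trunc2 R r) * ennreal ((if x < s & s <= x + r then 1 else 0) * (if x < t & t <= x + r then 1 else 0)) \<partial>lborel)
       = ennreal (trunc2 R r) * (\<integral>\<^sup>+ x. ennreal ((if x < s & s <= x + r then 1 else 0) * (if x < t & t <= x + r then 1 else 0)) \<partial>lborel)"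
      by (rule nn_integral_cmult) measurable
     then show ?thesis unfolding triangle_nn_integral using trunc2_nonneg by (simp add: ennreal_mult)
    qed
    finally show "(\<integral>\<^sup>+ x. ennreal (v (x, r) s * w (x, r) t) \<partial>lborel) = ennreal (trunc2 R r * max 0 (r - \<bar>s - t\<bar>))" .
   qed
   also have "\<dots> = ennreal (k3 (s - t))" unfolding e by (rule taylor(1)[OF p])
   finally show "ennreal (k3 (s - t)) = (\<integral>\<^sup>+ z. ennreal (v z s * w z t) \<partial>lborel2)" ..
  qed (use kernel_form_bounded_support_integrable[OF l3 fL] integrable_window[OF fi] integrable_window[OF gi] trunc2_nonneg in \<open>auto simp: w_def v_def\<close>)
  then show "integrable lborel2 I" "kernel_form k3 f g = (\<integral>z. I z \<partial>lborel2)"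
   unfolding Iz by simp_all
 qed
 have "kernel_form (%t. b \<bar>t\<bar>) f g = kernel_form (%t. (b R + (- b1 R) * max 0 (R - \<bar>t\<bar>)) + k3 t) f g"
 proof (rule kernel_form_cong[OF _ local _ fL])
  show "locally_integrable (%t. (b R + (- b1 R) * max 0 (R - \<bar>t\<bar>)) + k3 t)"
   by (intro locally_integrable_add lc lt' l3)
  show "b \<bar>s - t\<bar> = (b R + (- b1 R) * max 0 (R - \<bar>s - t\<bar>)) + k3 (s - t)" if "f s ~= 0" "g t ~= 0" for s t
   using st[OF that] unfolding k3_def by simp
 qed
 also have "\<dots> = b R * (integral\<^sup>L lborel f * integral\<^sup>L lborel g) + (- b1 R) * (\<integral>x. (cum f (x + R) - cum f x) * (cum g (x + R) - cum g x) \<partial>lborel) + (\<integral>z. I z \<partial>lborel2)"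
  using kernel_form_kernel_add[OF locally_integrable_add[OF lc lt'] l3 fL] kernel_form_kernel_add[OF lc lt' fL]
   kernel_form_kernel_scale[of "- b1 R" "%t. max 0 (R - \<bar>t\<bar>)" f g] kernel_form_const[OF f g] kernel_form_triangle(2)[OF f g R(1)] mix(2)
  by (simp add: mult.assoc)
 finally show "kernel_form (%t. b \<bar>t\<bar>) f g = b R * (integral\<^sup>L lborel f * integral\<^sup>L lborel g)
   + (- b1 R) * (\<integral>x. (cum f (x + R) - cum f x) * (cum g (x + R) - cum g x) \<partial>lborel)
   + (\<integral>z. trunc2 R (snd z) * ((cum f (fst z + snd z) - cum f (fst z)) * (cum g (fst z + snd z) - cum g (fst z))) \<partial>lborel2)"
  unfolding I_def .
 show "integrable lborel2 (%z. trunc2 R (snd z) * ((cum f (fst z + snd z) - cum f (fst z)) * (cum g (fst z + snd z) - cum g (fst z))))"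
  using mix(1) unfolding I_def .
qed

text \<open>For \<open>f = g\<close> the three terms are nonnegative. The boundary terms and the
  windows of width at least \<open>\<eta>\<close> are discarded; \<open>R\<close> only has to exceed
  the diameter of the support and \<open>\<eta>\<close>.\<close>

lemma kernel_form_lower:
 assumes f: "f \<in> L2_on a c" and eta: "\<eta> > 0"
 shows "(\<integral>\<^sup>+ r. ennreal (trunc2 \<eta> r) * window_energy f r \<partial>lborel) <= ennreal (kernel_form (%t. b \<bar>t\<bar>) f f)"
  and "0 <= kernel_form (%t. b \<bar>t\<bar>) f f"
proof -
 note [measurable] = L2_onD(1)[OF f]
 define R where "R = \<bar>c - a\<bar> + \<eta> + 1"
 have R: "R > 0" "R > c - a" "R \<ge> \<eta>" using eta unfolding R_def by auto
 define I where "I = (%z. trunc2 R (snd z) * (cum f (fst z + snd z) - cum f (fst z))^2)"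
 have mix: "integrable lborel2 I"
  using kernel_form_windows(2)[OF f f R(1,2)] unfolding I_def by (simp add: power2_eq_square)
 have K: "kernel_form (%t. b \<bar>t\<bar>) f f = b R * (integral\<^sup>L lborel f)^2 + (- b1 R) * (\<integral>x. (cum f (x + R) - cum f x)^2 \<partial>lborel) + (\<integral>z. I z \<partial>lborel2)"
  using kernel_form_windows(1)[OF f f R(1,2)] unfolding I_def by (simp add: power2_eq_square)
 have I0: "0 <= I z" for z unfolding I_def using trunc2_nonneg by simp
 have rest: "0 <= b R * (integral\<^sup>L lborel f)^2 + (- b1 R) * (\<integral>x. (cum f (x + R) - cum f x)^2 \<partial>lborel)"
  using nonneg0[OF R(1)] nonpos1[OF R(1)] by (intro add_nonneg_nonneg mult_nonneg_nonneg Bochner_Integration.integral_nonneg) auto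
 moreover have "0 <= (\<integral>z. I z \<partial>lborel2)" by (intro Bochner_Integration.integral_nonneg I0)
 ultimately show "0 <= kernel_form (%t. b \<bar>t\<bar>) f f" unfolding K by simp
 have [measurable]: "I \<in> borel_measurable lborel2" by (rule borel_measurable_integrable[OF mix])
 have "(\<integral>\<^sup>+ r. ennreal (trunc2 \<eta> r) * window_energy f r \<partial>lborel) <= (\<integral>\<^sup>+ r. ennreal (trunc2 R r) * window_energy f r \<partial>lborel)"
  using R nonneg2 by (intro nn_integral_mono mult_right_mono ennreal_leI) (auto simp: trunc2_def)
 also have "\<dots> = (\<integral>\<^sup>+ r. (\<integral>\<^sup>+ x. ennreal (I (x, r)) \<partial>lborel) \<partial>lborel)"
  unfolding window_energy_def I_def using trunc2_nonneg
  by (intro nn_integral_cong) (subst nn_integral_cmult[symmetric], simp_all add: ennreal_mult)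
 also have "\<dots> = (\<integral>\<^sup>+ z. ennreal (I z) \<partial>lborel2)"
  by (subst lborel_pair.nn_integral_snd[symmetric]) auto
 also have "\<dots> = ennreal (\<integral>z. I z \<partial>lborel2)"
  by (rule nn_integral_eq_integral[OF mix]) (simp add: I0)
 also have "\<dots> <= ennreal (kernel_form (%t. b \<bar>t\<bar>) f f)" unfolding K using rest by (intro ennreal_leI) simp
 finally show "(\<integral>\<^sup>+ r. ennreal (trunc2 \<eta> r) * window_energy f r \<partial>lborel) <= ennreal (kernel_form (%t. b \<bar>t\<bar>) f f)" .
qed

end

section \<open>Hardy inequality for differences\<close>

lemma sqrt_sum_le:
 fixes q :: real assumes "0 <= q" "q <= 1"
 shows "sqrt (1 - q) + sqrt (1 + q) <= 2 - q\<^sup>2 / 4"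
proof -
 have q2: "q\<^sup>2 <= 1" using assms by (simp add: power_le_one)
 have "sqrt (1 - q\<^sup>2) <= 1 - q\<^sup>2 / 2"
 proof (rule real_le_lsqrt)
  have "1 - x <= (1 - x / 2)^2" for x :: real
   using zero_le_power2[of "x / 2"] by (simp add: power2_diff)
  from this[of "q\<^sup>2"] show "1 - q\<^sup>2 <= (1 - q\<^sup>2 / 2)^2" .
 qed (use q2 in auto)
 moreover have "sqrt (1 - q) * sqrt (1 + q) = sqrt (1 - q\<^sup>2)"
  unfolding real_sqrt_mult[symmetric] by (simp add: power2_eq_square algebra_simps)
 ultimately have "(sqrt (1 - q) + sqrt (1 + q))^2 <= 4 - q\<^sup>2"
  using assms by (simp add: power2_sum)
 also have "\<dots> <= (2 - q\<^sup>2 / 4)^2" using zero_le_power2[of "q\<^sup>2 / 4"] by (simp add: power2_diff)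
 finally show ?thesis by (rule power2_le_imp_le) (use q2 in simp)
qed

lemma ennreal_add_le: "0 <= a ==> 0 <= b ==> a + b <= c ==> ennreal a + ennreal b <= ennreal c"
 using ennreal_leI[of "a + b" c] by simp

lemma ennreal_le_add: "0 <= a ==> 0 <= b ==> c <= a + b ==> ennreal c <= ennreal a + ennreal b"
 using ennreal_leI[of c "a + b"] by simp

text \<open>The supersolution \<open>sqrt (u + r)\<close> of the difference operator gives a Hardy inequality: for
  positive weights, \<open>(x - y)\<^sup>2 + (h / h' - 1) y\<^sup>2 \<ge> (1 - h' / h) x\<^sup>2\<close>.\<close>

lemma hardy_difference:
 fixes \<phi> :: "real => real"
 assumes [measurable]: "\<phi> \<in> borel_measurable borel" and z: "!!u. u <= 0 ==> \<phi> u = 0"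
  and M: "!!u. \<bar>\<phi> u\<bar> <= M" and r: "r > 0"
 shows "(\<integral>\<^sup>+ u. ennreal ((\<phi> u)^2 * (r / (u + r))^2 / 4) * indicator {0<..<R} u \<partial>lborel)
  <= (\<integral>\<^sup>+ u. ennreal ((\<phi> u - \<phi> (u - r))^2) * indicator {0<..<R} u \<partial>lborel)"
proof -
 \<comment> \<open>With \<open>h u = sqrt (u + r)\<close>, \<open>A u\<close> is
   \<open>1 - h (u - r) / h u\<close> and \<open>E u\<close> is \<open>h (u + r) / h u - 1\<close>.
   Thus \<open>E (u - r)\<close> is the coefficient of \<open>(\<phi> (u - r))^2\<close> in the
   pointwise inequality at \<open>u\<close>.\<close>
 define A where "A = (%u. 1 - sqrt u / sqrt (u + r))"
 define E where "E = (%u. sqrt (u + 2 * r) / sqrt (u + r) - 1)"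
 have [measurable]: "A \<in> borel_measurable borel" "E \<in> borel_measurable borel" unfolding A_def E_def by measurable
 have E: "0 <= E u" "E u <= 1" if "0 < u" for u
 proof -
  show "0 <= E u" unfolding E_def using that r by simp
  have "sqrt (u + 2 * r) <= sqrt (4 * (u + r))" using that r by simp
  also have "\<dots> = 2 * sqrt (u + r)" using real_sqrt_mult[of 4 "u + r"] by simp
  finally show "E u <= 1" unfolding E_def using that r by (simp add: pos_divide_le_eq)
 qed
 have A1: "A u <= 1" if "0 < u" for u unfolding A_def using that r by simp
 \<comment> \<open>The strict concavity of the square root, quantified by \<open>sqrt_sum_le\<close>
   with \<open>q = r / (u + r)\<close>, is the gain in the Hardy inequality.\<close>
 have AE: "E u + (r / (u + r))^2 / 4 <= A u" if u: "0 < u" for u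
 proof -
  define q where "q = r / (u + r)"
  have q: "0 <= q" "q <= 1" unfolding q_def using u r by (auto simp: field_simps)
  have "1 - q = u / (u + r)" "1 + q = (u + 2 * r) / (u + r)" unfolding q_def using u r by (simp_all add: field_simps)
  then have "sqrt (1 - q) = sqrt u / sqrt (u + r)" "sqrt (1 + q) = sqrt (u + 2 * r) / sqrt (u + r)"
   by (simp_all add: real_sqrt_divide)
  with sqrt_sum_le[OF q] show ?thesis unfolding A_def E_def q_def[symmetric] by simp
 qed
 have A0: "0 <= A u" if "0 < u" for u using AE[OF that] E(1)[OF that] by (smt (verit) zero_le_power2 divide_nonneg_nonneg)
 have pt: "A u * (\<phi> u)^2 <= (\<phi> u - \<phi> (u - r))^2 + (if r < u then E (u - r) * (\<phi> (u - r))^2 else 0)" if u: "0 < u" for u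
 proof (cases "r < u")
  case True
  define x y where "x = \<phi> u" and "y = \<phi> (u - r)"
  define p where "p = sqrt u / sqrt (u + r)"
  have p: "p > 0" unfolding p_def using u r by simp
  have Ep: "E (u - r) = 1 / p - 1" unfolding E_def p_def by (simp add: algebra_simps)
  have "0 <= (p * x - y)^2 / p" using p by simp
  also have "\<dots> = p * x\<^sup>2 - 2 * x * y + y\<^sup>2 / p" using p by (simp add: power2_eq_square field_simps)
  finally have "(1 - p) * x\<^sup>2 <= (x - y)^2 + (1 / p - 1) * y\<^sup>2" by (simp add: power2_eq_square algebra_simps)
  then show ?thesis using True unfolding A_def Ep p_def[symmetric] x_def y_def by simp
 next
  case False
  then show ?thesis using z[of "u - r"] mult_right_mono[OF A1[OF u], of "(\<phi> u)^2"] by simp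
 qed
 \<comment> \<open>After translation by \<open>r\<close> the term with \<open>E\<close> occurs on
   both sides. Boundedness of \<open>\<phi>\<close> and the cutoff at \<open>R\<close> make it
   finite, so that it can be cancelled in \<open>ennreal\<close>.\<close>
 define c where "c = (\<integral>\<^sup>+ u. ennreal (E u * (\<phi> u)^2) * indicator {0<..<R} u \<partial>lborel)"
 have "c <= (\<integral>\<^sup>+ u. ennreal (M\<^sup>2) * indicator {0<..<R} u \<partial>lborel)"
  unfolding c_def
 proof (intro nn_integral_mono)
  fix u
  have "E u * (\<phi> u)^2 <= 1 * M\<^sup>2" if "0 < u"
   using E[OF that] power_mono[OF M[of u], of 2] by (intro mult_mono) auto
  then show "ennreal (E u * (\<phi> u)^2) * indicator {0<..<R} u <= ennreal (M\<^sup>2) * indicator {0<..<R} u"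
   by (auto simp: indicator_def intro!: ennreal_leI)
 qed
 also have "\<dots> < \<infinity>" by (subst nn_integral_cmult_indicator) (simp, cases "0 <= R", simp_all add: ennreal_mult_less_top)
 finally have cfin: "c ~= \<infinity>" by simp
 define L where "L = (\<integral>\<^sup>+ u. ennreal ((\<phi> u)^2 * (r / (u + r))^2 / 4) * indicator {0<..<R} u \<partial>lborel)"
 define S where "S = (\<integral>\<^sup>+ u. ennreal ((\<phi> u - \<phi> (u - r))^2) * indicator {0<..<R} u \<partial>lborel)"
 have "c + L = (\<integral>\<^sup>+ u. ennreal (E u * (\<phi> u)^2) * indicator {0<..<R} u + ennreal ((\<phi> u)^2 * (r / (u + r))^2 / 4) * indicator {0<..<R} u \<partial>lborel)"
  unfolding c_def L_def by (subst nn_integral_add) auto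
 also have "\<dots> <= (\<integral>\<^sup>+ u. ennreal (A u * (\<phi> u)^2) * indicator {0<..<R} u \<partial>lborel)"
 proof (intro nn_integral_mono)
  fix u :: real
  have "ennreal (E u * (\<phi> u)^2) + ennreal ((\<phi> u)^2 * (r / (u + r))^2 / 4) <= ennreal (A u * (\<phi> u)^2)" if u: "0 < u"
   using mult_right_mono[OF AE[OF u], of "(\<phi> u)^2"] E(1)[OF u]
   by (intro ennreal_add_le) (auto simp: algebra_simps)
  then show "ennreal (E u * (\<phi> u)^2) * indicator {0<..<R} u + ennreal ((\<phi> u)^2 * (r / (u + r))^2 / 4) * indicator {0<..<R} u
    <= ennreal (A u * (\<phi> u)^2) * indicator {0<..<R} u" by (auto simp: indicator_def)
 qed
 also have "\<dots> <= (\<integral>\<^sup>+ u. ennreal ((\<phi> u - \<phi> (u - r))^2) * indicator {0<..<R} u +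
   ennreal (E (u - r) * (\<phi> (u - r))^2) * indicator {0<..<R} (u - r) \<partial>lborel)"
 proof (intro nn_integral_mono)
  fix u :: real
  show "ennreal (A u * (\<phi> u)^2) * indicator {0<..<R} u <= ennreal ((\<phi> u - \<phi> (u - r))^2) * indicator {0<..<R} u +
   ennreal (E (u - r) * (\<phi> (u - r))^2) * indicator {0<..<R} (u - r)"
  proof (cases "0 < u & u < R")
   case True
   show ?thesis
   proof (cases "r < u")
    case True2: True
    then have "ennreal (A u * (\<phi> u)^2) <= ennreal ((\<phi> u - \<phi> (u - r))^2) + ennreal (E (u - r) * (\<phi> (u - r))^2)"
     using pt[of u] E(1)[of "u - r"] True by (intro ennreal_le_add) auto
    then show ?thesis using True True2 r by (simp add: indicator_def)
   next
    case False
    then have "ennreal (A u * (\<phi> u)^2) <= ennreal ((\<phi> u - \<phi> (u - r))^2)"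
     using pt[of u] True by (auto intro!: ennreal_leI)
    then show ?thesis using True by (simp add: indicator_def add_increasing2)
   qed
  qed (auto simp: indicator_def)
 qed
 also have "\<dots> = S + (\<integral>\<^sup>+ u. ennreal (E (u - r) * (\<phi> (u - r))^2) * indicator {0<..<R} (u - r) \<partial>lborel)"
  unfolding S_def by (subst nn_integral_add) auto
 also have "(\<integral>\<^sup>+ u. ennreal (E (u - r) * (\<phi> (u - r))^2) * indicator {0<..<R} (u - r) \<partial>lborel) = c"
  unfolding c_def using nn_integral_real_affine[of "%u. ennreal (E u * (\<phi> u)^2) * indicator {0<..<R} u" 1 "- r"] by (simp add: add.commute)
 finally have "c + L <= c + S" by (simp add: add.commute)
 then have "L <= S" using cfin by (simp add: ennreal_add_left_cancel_le)
 then show ?thesis unfolding L_def S_def .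
qed

lemma cum_bounded:
 assumes f: "integrable lborel f" shows "\<bar>cum f x\<bar> <= (\<integral>s. \<bar>f s\<bar> \<partial>lborel)"
proof -
 have "\<bar>cum f x\<bar> <= (\<integral>s. \<bar>if s <= x then f s else 0\<bar> \<partial>lborel)"
  unfolding cum_def using integral_norm_bound[of lborel "%s. if s <= x then f s else 0"] by simp
 also have "\<dots> <= (\<integral>s. \<bar>f s\<bar> \<partial>lborel)"
  using f by (intro integral_mono integrable_abs integrable_if) auto
 finally show ?thesis .
qed

lemma hardy_right:
 assumes f: "f \<in> L2_on p c" and r: "r > 0"
 shows "(\<integral>\<^sup>+ u. ennreal ((cum f (p + u))^2 * (r / (u + r))^2 / 4) * indicator {0<..<R} u \<partial>lborel) <= window_energy f r"
proof -
 note [measurable] = L2_onD(1)[OF f]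
 have "(\<integral>\<^sup>+ u. ennreal ((cum f (p + u))^2 * (r / (u + r))^2 / 4) * indicator {0<..<R} u \<partial>lborel)
   <= (\<integral>\<^sup>+ u. ennreal ((cum f (p + u) - cum f (p + (u - r)))^2) * indicator {0<..<R} u \<partial>lborel)"
  using cum_left[OF f] cum_bounded[OF L2_on_integrable[OF f]]
  by (intro hardy_difference[where \<phi> = "%u. cum f (p + u)"] r) auto
 also have "\<dots> <= (\<integral>\<^sup>+ u. ennreal ((cum f (p + u) - cum f (p + (u - r)))^2) \<partial>lborel)"
  by (intro nn_integral_mono) (auto simp: indicator_def)
 also have "\<dots> = window_energy f r"
  unfolding window_energy_def
  using nn_integral_real_affine[of "%x. ennreal ((cum f (x + r) - cum f x)^2)" 1 "p - r"] by (simp add: algebra_simps)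
 finally show ?thesis .
qed

lemma hardy_left:
 assumes f: "f \<in> L2_on a p" and r: "r > 0"
 shows "(\<integral>\<^sup>+ u. ennreal ((cum f p - cum f (p - u))^2 * (r / (u + r))^2 / 4) * indicator {0<..<R} u \<partial>lborel) <= window_energy f r"
proof -
 note [measurable] = L2_onD(1)[OF f]
 define \<phi> where "\<phi> = (%u. cum f p - cum f (p - u))"
 have \<phi>m: "\<phi> \<in> borel_measurable borel" unfolding \<phi>_def by measurable
 have "\<bar>\<phi> u\<bar> <= 2 * (\<integral>s. \<bar>f s\<bar> \<partial>lborel)" for u
  unfolding \<phi>_def using cum_bounded[OF L2_on_integrable[OF f], of p] cum_bounded[OF L2_on_integrable[OF f], of "p - u"] by linarith
 moreover have "\<phi> u = 0" if "u <= 0" for u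
  unfolding \<phi>_def using cum_right[OF f, of p] cum_right[OF f, of "p - u"] that by simp
 ultimately have "(\<integral>\<^sup>+ u. ennreal ((\<phi> u)^2 * (r / (u + r))^2 / 4) * indicator {0<..<R} u \<partial>lborel)
   <= (\<integral>\<^sup>+ u. ennreal ((\<phi> u - \<phi> (u - r))^2) * indicator {0<..<R} u \<partial>lborel)"
  by (intro hardy_difference \<phi>m r) auto
 also have "\<dots> <= (\<integral>\<^sup>+ u. ennreal ((\<phi> u - \<phi> (u - r))^2) \<partial>lborel)"
  by (intro nn_integral_mono) (auto simp: indicator_def)
 also have "\<dots> = window_energy f r"
  unfolding window_energy_def \<phi>_def
  using nn_integral_real_affine[of "%x. ennreal ((cum f (x + r) - cum f x)^2)" "-1" p] by (simp add: algebra_simps)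
 finally show ?thesis unfolding \<phi>_def .
qed

lemma window_energy_triangle:
 assumes [measurable]: "f \<in> borel_measurable borel"
 shows "window_energy f (r + s) <= 2 * window_energy f r + 2 * window_energy f s"
proof -
 have "window_energy f (r + s) <= (\<integral>\<^sup>+ x. 2 * ennreal ((cum f (x + s + r) - cum f (x + s))^2) + 2 * ennreal ((cum f (x + s) - cum f x)^2) \<partial>lborel)"
  unfolding window_energy_def
 proof (intro nn_integral_mono)
  fix x
  define p q where "p = cum f (x + s + r) - cum f (x + s)" and "q = cum f (x + s) - cum f x"
  have "(cum f (x + (r + s)) - cum f x)^2 = (p + q)^2" unfolding p_def q_def by (simp add: algebra_simps)
  also have "\<dots> <= 2 * p\<^sup>2 + 2 * q\<^sup>2" using sum_squares_bound[of p q] by (simp add: power2_sum)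
  finally have "ennreal ((cum f (x + (r + s)) - cum f x)^2) <= ennreal (2 * p\<^sup>2 + 2 * q\<^sup>2)" by (rule ennreal_leI)
  also have "\<dots> = 2 * ennreal (p\<^sup>2) + 2 * ennreal (q\<^sup>2)" by (simp add: ennreal_mult)
  finally show "ennreal ((cum f (x + (r + s)) - cum f x)^2) <= 2 * ennreal ((cum f (x + s + r) - cum f (x + s))^2) + 2 * ennreal ((cum f (x + s) - cum f x)^2)"
   unfolding p_def q_def .
 qed
 also have "\<dots> = 2 * (\<integral>\<^sup>+ x. ennreal ((cum f (x + s + r) - cum f (x + s))^2) \<partial>lborel) + 2 * window_energy f s"
  unfolding window_energy_def by (subst nn_integral_add) (auto simp: nn_integral_cmult)
 also have "(\<integral>\<^sup>+ x. ennreal ((cum f (x + s + r) - cum f (x + s))^2) \<partial>lborel) = window_energy f r"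
  unfolding window_energy_def
  using nn_integral_real_affine[of "%x. ennreal ((cum f (x + r) - cum f x)^2)" 1 s] by (simp add: algebra_simps)
 finally show ?thesis .
qed

text \<open>Passes from an integrated bound to one at the single width \<open>r\<close>: the
  inequality between the energies at \<open>r\<close>, \<open>s\<close> and \<open>r - s\<close> is
  averaged over \<open>s\<close> between 0 and \<open>r\<close>. Reflection makes both halves equal,
  and on this interval \<open>\<rho> r\<close> is a lower bound of the density.\<close>

lemma window_energy_bound:
 assumes [measurable]: "f \<in> borel_measurable borel" "\<rho> \<in> borel_measurable borel"
  and \<rho>: "!!s. 0 < s ==> s < r ==> \<rho> r <= \<rho> s" "0 < \<rho> r" and r: "r > 0"
  and E: "(\<integral>\<^sup>+ s. ennreal (\<rho> s) * window_energy f s \<partial>lborel) <= ennreal k" and k: "0 <= k"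
 shows "window_energy f r <= ennreal (4 * k / (r * \<rho> r))"
proof -
 define W where "W = (\<integral>\<^sup>+ s. window_energy f s * indicator {0<..<r} s \<partial>lborel)"
 have Wr: "(\<integral>\<^sup>+ s. window_energy f (r - s) * indicator {0<..<r} s \<partial>lborel) = W"
 proof -
  have "W = (\<integral>\<^sup>+ s. window_energy f (r - s) * indicator {0<..<r} (r - s) \<partial>lborel)"
   unfolding W_def using nn_integral_real_affine[of "%s. window_energy f s * indicator {0<..<r} s" "-1" r] by simp
  also have "\<dots> = (\<integral>\<^sup>+ s. window_energy f (r - s) * indicator {0<..<r} s \<partial>lborel)"
   by (intro nn_integral_cong) (auto simp: indicator_def)
  finally show ?thesis ..
 qed
 have "ennreal (\<rho> r) * W = (\<integral>\<^sup>+ s. ennreal (\<rho> r) * (window_energy f s * indicator {0<..<r} s) \<partial>lborel)"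
  unfolding W_def by (subst nn_integral_cmult) auto
 also have "\<dots> <= (\<integral>\<^sup>+ s. ennreal (\<rho> s) * window_energy f s \<partial>lborel)"
  using \<rho> by (intro nn_integral_mono) (auto simp: indicator_def intro!: mult_right_mono ennreal_leI)
 finally have rW: "ennreal (\<rho> r) * W <= ennreal k" using E by (rule order_trans)
 have "ennreal r * window_energy f r = (\<integral>\<^sup>+ s. window_energy f r * indicator {0<..<r} s \<partial>lborel)"
  using r by (subst nn_integral_cmult_indicator) (auto simp: mult.commute)
 also have "\<dots> <= (\<integral>\<^sup>+ s. (2 * (window_energy f s * indicator {0<..<r} s) + 2 * (window_energy f (r - s) * indicator {0<..<r} s)) \<partial>lborel)"
 proof (intro nn_integral_mono)
  fix s
  show "window_energy f r * indicator {0<..<r} s <= 2 * (window_energy f s * indicator {0<..<r} s) + 2 * (window_energy f (r - s) * indicator {0<..<r} s)"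
   using window_energy_triangle[of f s "r - s"] by (auto simp: indicator_def)
 qed
 also have "\<dots> = 2 * W + 2 * W"
  using Wr unfolding W_def by (subst nn_integral_add) (auto simp: nn_integral_cmult)
 also have "\<dots> = 4 * W" by (simp add: mult_2[symmetric] flip: distrib_right)
 finally have "ennreal (\<rho> r) * (ennreal r * window_energy f r) <= ennreal (\<rho> r) * (4 * W)" by (rule mult_left_mono) simp
 also have "\<dots> = 4 * (ennreal (\<rho> r) * W)" by (simp add: mult_ac)
 also have "\<dots> <= 4 * ennreal k" by (rule mult_left_mono[OF rW]) simp
 finally have *: "ennreal (r * \<rho> r) * window_energy f r <= ennreal (4 * k)"
  using r \<rho>(2) k by (simp add: ennreal_mult mult_ac)
 have p: "r * \<rho> r > 0" using r \<rho>(2) by simp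
 have "window_energy f r = ennreal (1 / (r * \<rho> r)) * (ennreal (r * \<rho> r) * window_energy f r)"
  using p r \<rho>(2) by (simp add: mult.assoc[symmetric] ennreal_mult[symmetric])
 also have "\<dots> <= ennreal (1 / (r * \<rho> r)) * ennreal (4 * k)" by (rule mult_left_mono[OF *]) simp
 also have "\<dots> = ennreal (4 * k / (r * \<rho> r))" using p k by (subst ennreal_mult[symmetric]) auto
 finally show ?thesis .
qed

section \<open>Pointwise bound of the indefinite integral by window energies\<close>

definition left_mean :: "(real => real) => real => real => real" where
 "left_mean F x r = integral {x - r..x} F / r"

text \<open>Cauchy-Schwarz in the linearized form \<open>2 * \<bar>g\<bar> <= g^2 / l + l\<close>,
  with \<open>l\<close> left open so that the user can balance the two terms.\<close>

lemma integral_abs_le_of_square: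
 fixes g :: "real => real"
 assumes g: "continuous_on UNIV g" and uv: "u <= v" and l: "l > 0" and d: "0 <= d"
  and le: "(\<integral>\<^sup>+ y. ennreal ((g y)^2) * indicator {u..v} y \<partial>lborel) <= ennreal d"
 shows "\<bar>integral {u..v} g\<bar> <= (d / l + l * (v - u)) / 2"
proof -
 note c = continuous_on_subset[OF g subset_UNIV]
 have ig: "g integrable_on {u..v}" "(%y. (g y)^2) integrable_on {u..v}"
  by (intro integrable_continuous_real continuous_intros c)+
 have "\<bar>integral {u..v} g\<bar> <= integral {u..v} (%y. ((g y)^2 / l + l) / 2)"
 proof -
  have "norm (integral {u..v} g) <= integral {u..v} (%y. ((g y)^2 / l + l) / 2)"
  proof (rule integral_norm_bound_integral[OF ig(1)])
   show "(%y. ((g y)^2 / l + l) / 2) integrable_on {u..v}"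
    by (intro integrable_continuous_real continuous_intros c) (use l in auto)
   fix y
   have "0 <= (\<bar>g y\<bar> - l)^2 / l" using l by simp
   also have "(\<bar>g y\<bar> - l)^2 / l = (g y)^2 / l + l - 2 * \<bar>g y\<bar>" using l by (simp add: power2_eq_square field_simps)
   finally show "norm (g y) <= ((g y)^2 / l + l) / 2" by simp
  qed
  then show ?thesis by simp
 qed
 also have "\<dots> = (integral {u..v} (%y. (g y)^2) / l + l * (v - u)) / 2"
 proof -
  have "((%y. ((g y)^2 / l + l) / 2) has_integral (integral {u..v} (%y. (g y)^2) / l + (v - u) * l) / 2) {u..v}"
   using has_integral_const_real[of l u v] uv
   by (intro has_integral_divide has_integral_add integrable_integral ig(2)) simp
  from integral_unique[OF this] show ?thesis by (simp only: mult.commute)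
 qed
 also have "integral {u..v} (%y. (g y)^2) <= d"
 proof -
  have [measurable]: "g \<in> borel_measurable borel" using g by (rule borel_measurable_continuous_onI)
  have "(\<integral>\<^sup>+ y. ennreal (indicator {u..v} y * (g y)^2) \<partial>lborel) = ennreal (integral {u..v} (%y. (g y)^2))"
   by (rule nn_integral_has_integral_lebesgue[OF _ integrable_integral[OF ig(2)]]) simp
  moreover have "(\<integral>\<^sup>+ y. ennreal (indicator {u..v} y * (g y)^2) \<partial>lborel) = (\<integral>\<^sup>+ y. ennreal ((g y)^2) * indicator {u..v} y \<partial>lborel)"
   by (intro nn_integral_cong) (auto simp: indicator_def)
  ultimately show ?thesis using le d by simp
 qed
 finally show ?thesis using l by (simp add: divide_right_mono)
qed

text \<open>The mean over length \<open>2 * s\<close> minus the mean over length \<open>s\<close> is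
  half the mean of \<open>F (y - s) - F y\<close> over the shorter interval, which the window energy
  at \<open>s\<close> controls.\<close>

lemma left_mean_halve:
 assumes F: "continuous_on UNIV F" and s: "s > 0" and l: "l > 0" and d: "0 <= d"
  and le: "(\<integral>\<^sup>+ y. ennreal ((F (y + s) - F y)^2) \<partial>lborel) <= ennreal d"
 shows "\<bar>left_mean F x (2 * s) - left_mean F x s\<bar> <= (d / l + l * s) / (4 * s)"
proof -
 note c = continuous_on_subset[OF F subset_UNIV]
 have iF: "F integrable_on {u..v}" for u v by (intro integrable_continuous_real c)
 have cs: "continuous_on UNIV (%y. F (y - s))"
  by (rule continuous_on_compose2[OF F]) (auto intro!: continuous_intros)
 have "integral {x - s..x} (%y. F (y - s)) = integral {x - s - s..x - s} F"
 proof -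
  have "(F has_integral integral {x - s - s..x - s} F) (cbox (x - s - s) (x - s))"
   using iF[of "x - s - s" "x - s"] by (simp add: integrable_integral)
  from has_integral_affinity[OF this, of 1 "- s"] show ?thesis
   by (simp add: integral_unique algebra_simps)
 qed
 then have "integral {x - 2 * s..x} F = integral {x - s..x} (%y. F (y - s)) + integral {x - s..x} F"
  using Henstock_Kurzweil_Integration.integral_combine[of "x - 2 * s" "x - s" x F] iF s by (simp add: algebra_simps)
 moreover have "integral {x - s..x} (%y. F (y - s) - F y) = integral {x - s..x} (%y. F (y - s)) - integral {x - s..x} F"
  by (intro Henstock_Kurzweil_Integration.integral_diff iF integrable_continuous_real continuous_on_subset[OF cs subset_UNIV])
 ultimately have e: "left_mean F x (2 * s) - left_mean F x s = integral {x - s..x} (%y. F (y - s) - F y) / (2 * s)"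
  unfolding left_mean_def using s by (simp add: add_divide_distrib diff_divide_distrib)
 have "\<bar>integral {x - s..x} (%y. F (y - s) - F y)\<bar> <= (d / l + l * (x - (x - s))) / 2"
 proof (rule integral_abs_le_of_square[OF _ _ l d])
  show "continuous_on UNIV (%y. F (y - s) - F y)" by (intro continuous_intros cs F)
  have [measurable]: "F \<in> borel_measurable borel" using F by (rule borel_measurable_continuous_onI)
  have "(\<integral>\<^sup>+ y. ennreal ((F (y - s) - F y)^2) * indicator {x - s..x} y \<partial>lborel) <= (\<integral>\<^sup>+ y. ennreal ((F (y - s) - F y)^2) \<partial>lborel)"
   by (intro nn_integral_mono) (auto simp: indicator_def)
  also have "\<dots> = (\<integral>\<^sup>+ y. ennreal ((F (y + s) - F y)^2) \<partial>lborel)"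
   using nn_integral_real_affine[of "%y. ennreal ((F (y - s) - F y)^2)" 1 s] by (simp add: power2_commute add.commute)
  finally show "(\<integral>\<^sup>+ y. ennreal ((F (y - s) - F y)^2) * indicator {x - s..x} y \<partial>lborel) <= ennreal d" using le by simp
 qed (use s in simp)
 then have "\<bar>integral {x - s..x} (%y. F (y - s) - F y)\<bar> / (2 * s) <= ((d / l + l * s) / 2) / (2 * s)"
  using s by (intro divide_right_mono) auto
 then show ?thesis unfolding e using s by (simp add: abs_divide)
qed

lemma left_mean_tendsto:
 assumes F: "continuous_on UNIV F" and r: "r ----> 0" "!!n. r n > 0"
 shows "(%n. left_mean F x (r n)) ----> F x"
proof (rule LIMSEQ_I)
 fix e :: real assume e: "e > 0"
 then have e2: "e / 2 > 0" by simp
 have "isCont F x" using F by (simp add: continuous_on_eq_continuous_at)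
 then have "\<exists>d>0. \<forall>y. \<bar>y - x\<bar> < d --> \<bar>F y - F x\<bar> < e / 2"
  unfolding continuous_at_eps_delta dist_real_def using e2 by blast
 then obtain d where d: "d > 0" "!!y. \<bar>y - x\<bar> < d ==> \<bar>F y - F x\<bar> < e / 2" by blast
 obtain N where N: "!!n. n \<ge> N ==> r n < d"
  using order_tendstoD(2)[OF r(1) d(1)] unfolding eventually_sequentially by blast
 have "norm (left_mean F x (r n) - F x) < e" if "n \<ge> N" for n
 proof -
  have rn: "r n > 0" "r n < d" using r(2) N[OF that] by auto
  have iF: "F integrable_on {x - r n..x}" by (intro integrable_continuous_real continuous_on_subset[OF F]) auto
  have "((%y. F y - F x) has_integral (integral {x - r n..x} F - (x - (x - r n)) * F x)) (cbox (x - r n) x)"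
   using has_integral_const_real[of "F x" "x - r n" x] rn iF
   by (auto intro!: has_integral_diff integrable_integral)
  from has_integral_bound[OF _ this, of "e / 2"] have "\<bar>integral {x - r n..x} F - r n * F x\<bar> <= e / 2 * r n"
   using d(2) rn e by (auto simp: less_imp_le)
  then have "\<bar>integral {x - r n..x} F / r n - F x\<bar> <= e / 2"
   using rn by (simp add: field_simps abs_le_iff)
  then show ?thesis unfolding left_mean_def using e by simp
 qed
 then show "\<exists>no. \<forall>n\<ge>no. norm (left_mean F x (r n) - F x) < e" by blast
qed

lemma geometric_telescope_bound:
 fixes a :: "nat => real"
 assumes step: "!!n. \<bar>a n - a (Suc n)\<bar> <= K * q ^ n" and q: "0 <= q" "q < 1" and K: "0 <= K"
  and a0: "\<bar>a 0\<bar> <= L" and lim: "a ----> l"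
 shows "\<bar>l\<bar> <= L + K / (1 - q)"
proof (rule LIMSEQ_le_const2[OF tendsto_rabs[OF lim]])
 have "\<bar>a n\<bar> <= L + K * (\<Sum>i<n. q ^ i)" for n
 proof (induction n)
  case (Suc n)
  then show ?case using step[of n] by (simp add: algebra_simps abs_le_iff)
 qed (use a0 in simp)
 moreover have "K * (\<Sum>i<n. q ^ i) <= K / (1 - q)" for n
 proof -
  have "(\<Sum>i<n. q ^ i) = (1 - q ^ n) / (1 - q)" using sum_gp_strict[of q n] q by simp
  also have "\<dots> <= 1 / (1 - q)" using q by (intro divide_right_mono) auto
  finally show ?thesis using mult_left_mono[OF _ K] by fastforce
 qed
 ultimately show "\<exists>N. \<forall>n\<ge>N. \<bar>a n\<bar> <= L + K / (1 - q)" by (meson add_left_mono order_trans)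
qed

text \<open>Dyadic chaining. Energies of order \<open>r powr (3/2)\<close> let means over dyadically
  shrinking intervals differ by multiples of \<open>r powr (1/4)\<close>, a geometric series with
  quotient \<open>2 powr (-1/4)\<close>. The means tend to \<open>cum f x\<close>, and the first one
  is bounded by the Hardy inequality at width \<open>\<delta>\<close>.\<close>

lemma cum_sup_bound_aux:
 assumes f: "f \<in> L2_on a c" and ac: "a < c" and \<delta>: "\<delta> > 0" and k: "k > 0"
  and W: "!!r. 0 < r ==> r <= \<delta> ==> window_energy f r <= ennreal (k * r powr (3/2))" and x: "x <= c"
 shows "\<bar>cum f x\<bar> <= (((2 * (c - a + 1 + \<delta>) / \<delta>)^2 * \<delta> powr (3/2) + \<delta>) / (2 * \<delta>) + \<delta> powr (1/4) / (1 - 2 powr (-1/4))) * sqrt k"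
proof -
 define F where "F = cum f"
 have F: "continuous_on UNIV F" unfolding F_def
  by (intro continuous_at_imp_continuous_on ballI cum_isCont L2_on_integrable[OF f])
 have [measurable]: "F \<in> borel_measurable borel" using F by (rule borel_measurable_continuous_onI)
 define r where "r = (%n::nat. \<delta> / 2 ^ n)"
 have r: "r n > 0" "r n <= \<delta>" "r n = 2 * r (Suc n)" for n unfolding r_def using \<delta> by (auto simp: field_simps)
 have sk: "sqrt k > 0" using k by simp
 define q :: real where "q = 2 powr (-1/4)"
 have q: "0 <= q" "q < 1" unfolding q_def by (auto simp: powr_less_one)
 have qn: "r n powr (1/4) = \<delta> powr (1/4) * q ^ n" for n
 proof -
  have "r n = \<delta> * (2 powr (- real n))" unfolding r_def by (simp add: powr_minus powr_realpow divide_inverse)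
  then have "r n powr (1/4) = \<delta> powr (1/4) * (2 powr (- real n)) powr (1/4)" using \<delta> by (simp add: powr_mult)
  also have "(2 powr (- real n)) powr (1/4) = q ^ n" unfolding q_def by (simp add: powr_powr powr_realpow[symmetric] mult.commute)
  finally show ?thesis .
 qed
 have step: "\<bar>left_mean F x (r n) - left_mean F x (r (Suc n))\<bar> <= (sqrt k * \<delta> powr (1/4)) * q ^ n" for n
 proof -
  define s where "s = r (Suc n)"
  have s: "s > 0" "s <= \<delta>" unfolding s_def using r(1,2) by simp_all
  \<comment> \<open>This choice makes \<open>k * s powr (3/2) / l\<close> and \<open>l * s\<close>
    equal.\<close>
  define l where "l = sqrt k * s powr (1/4)"
  have l: "l > 0" unfolding l_def using sk s by simp
  have "\<bar>left_mean F x (2 * s) - left_mean F x s\<bar> <= (k * s powr (3/2) / l + l * s) / (4 * s)"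
   using W[OF s] k unfolding window_energy_def F_def[symmetric]
   by (intro left_mean_halve F s l) auto
  also have "k * s powr (3/2) / l = sqrt k * s powr (1/4) * s"
  proof -
   have "s powr (3/2) = s powr (1/4) * s powr (1/4) * s"
    using s powr_add[of s "1/4" "1/4"] powr_add[of s "1/2" 1] by simp
   moreover have "k = sqrt k * sqrt k" using k by simp
   ultimately have e: "k * s powr (3/2) = sqrt k * sqrt k * (s powr (1/4) * s powr (1/4) * s)" by (simp only:)
   have cancel: "a * a * (p * p * s) / (a * p) = a * p * s" if "a ~= 0" "p ~= 0" for a p :: real
    using that by (simp add: field_simps)
   show ?thesis unfolding l_def e by (rule cancel) (use sk s in simp_all)
  qed
  also have "(sqrt k * s powr (1/4) * s + l * s) / (4 * s) = sqrt k * s powr (1/4) / 2"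
   unfolding l_def using s by (simp add: field_simps)
  also have "\<dots> <= sqrt k * r n powr (1/4)"
  proof -
   have "s powr (1/4) <= r n powr (1/4)" using s r(3)[of n] unfolding s_def by (intro powr_mono2) auto
   then have "sqrt k * s powr (1/4) <= sqrt k * r n powr (1/4)" using sk by (intro mult_left_mono) auto
   moreover have "0 <= sqrt k * s powr (1/4)" using sk by simp
   ultimately show ?thesis by linarith
  qed
  finally show ?thesis unfolding qn s_def r(3)[of n, symmetric] by (simp add: mult_ac)
 qed
 have "(%n. \<delta> * (1 / 2) ^ n) ----> \<delta> * 0"
  by (intro tendsto_mult_left LIMSEQ_realpow_zero) simp_all
 moreover have "r = (%n. \<delta> * (1 / 2) ^ n)" unfolding r_def by (rule ext) (simp add: power_one_over)
 ultimately have rlim: "r ----> 0" by simp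
 have lim: "(%n. left_mean F x (r n)) ----> F x" by (rule left_mean_tendsto[OF F rlim r(1)])
 \<comment> \<open>For \<open>0 < u < R\<close> the factor \<open>\<delta> / (u + \<delta>)\<close>
   of the Hardy inequality is at least \<open>\<delta> / (R + \<delta>)\<close>, whence the squared
   constant. The summand 1 in \<open>R = c - a + 1\<close> keeps all points up to \<open>c\<close>
   strictly inside the range.\<close>
 define D where "D = (2 * (c - a + 1 + \<delta>) / \<delta>)^2 * (k * \<delta> powr (3/2))"
 have D0: "0 <= D" unfolding D_def using k by simp
 have "(\<integral>\<^sup>+ y. ennreal ((F y)^2) * indicator {x - \<delta>..x} y \<partial>lborel) <= ennreal D"
 proof -
  define R where "R = c - a + 1"
  have "(\<integral>\<^sup>+ y. ennreal ((F y)^2) * indicator {x - \<delta>..x} y \<partial>lborel) <= (\<integral>\<^sup>+ y. ennreal ((F y)^2) * indicator {0<..<R} (y - a) \<partial>lborel)"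
  proof (intro nn_integral_mono)
   fix y show "ennreal ((F y)^2) * indicator {x - \<delta>..x} y <= ennreal ((F y)^2) * indicator {0<..<R} (y - a)"
    using cum_left[OF f, of y] x unfolding F_def R_def by (cases "y <= a") (auto simp: indicator_def)
  qed
  also have "\<dots> = (\<integral>\<^sup>+ u. ennreal ((F (a + u))^2) * indicator {0<..<R} u \<partial>lborel)"
   using nn_integral_real_affine[of "%y. ennreal ((F y)^2) * indicator {0<..<R} (y - a)" 1 a] by simp
  also have "\<dots> <= (\<integral>\<^sup>+ u. ennreal ((2 * (R + \<delta>) / \<delta>)^2) * (ennreal ((F (a + u))^2 * (\<delta> / (u + \<delta>))^2 / 4) * indicator {0<..<R} u) \<partial>lborel)"
  proof (intro nn_integral_mono)
   fix u :: real
   have "(F (a + u))^2 <= (2 * (R + \<delta>) / \<delta>)^2 * ((F (a + u))^2 * (\<delta> / (u + \<delta>))^2 / 4)" if u: "0 < u" "u < R"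
   proof -
    have "(R + \<delta>) / \<delta> * (\<delta> / (u + \<delta>)) = (R + \<delta>) / (u + \<delta>)" using \<delta> by simp
    moreover have "1 <= (R + \<delta>) / (u + \<delta>)" using u \<delta> by (simp add: pos_le_divide_eq)
    ultimately have "1 <= (R + \<delta>) / \<delta> * (\<delta> / (u + \<delta>))" by (simp only:)
    then have "1\<^sup>2 <= ((R + \<delta>) / \<delta> * (\<delta> / (u + \<delta>)))^2" by (intro power_mono) auto
    then have "(F (a + u))^2 * 1 <= (F (a + u))^2 * ((R + \<delta>) / \<delta> * (\<delta> / (u + \<delta>)))^2" by (intro mult_left_mono) auto
    also have "\<dots> = (2 * (R + \<delta>) / \<delta>)^2 * ((F (a + u))^2 * (\<delta> / (u + \<delta>))^2 / 4)"
     by (simp only: power_mult_distrib power_divide) simp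
    finally show ?thesis by simp
   qed
   then show "ennreal ((F (a + u))^2) * indicator {0<..<R} u <= ennreal ((2 * (R + \<delta>) / \<delta>)^2) * (ennreal ((F (a + u))^2 * (\<delta> / (u + \<delta>))^2 / 4) * indicator {0<..<R} u)"
    by (auto simp: indicator_def ennreal_mult'[symmetric] intro!: ennreal_leI)
  qed
  also have "\<dots> = ennreal ((2 * (R + \<delta>) / \<delta>)^2) * (\<integral>\<^sup>+ u. ennreal ((F (a + u))^2 * (\<delta> / (u + \<delta>))^2 / 4) * indicator {0<..<R} u \<partial>lborel)"
   by (rule nn_integral_cmult) measurable
  also have "\<dots> <= ennreal ((2 * (R + \<delta>) / \<delta>)^2) * ennreal (k * \<delta> powr (3/2))"
   using hardy_right[OF f \<delta>] W[OF \<delta> order_refl] unfolding F_def by (intro mult_left_mono) (auto intro: order_trans)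
  also have "\<dots> = ennreal D" unfolding D_def R_def using k by (subst ennreal_mult[symmetric]) (auto simp: mult.assoc)
  finally show ?thesis .
 qed
 from integral_abs_le_of_square[OF F _ sk D0 this]
 have "\<bar>integral {x - \<delta>..x} F\<bar> <= (D / sqrt k + sqrt k * \<delta>) / 2" using \<delta> by simp
 also have "D / sqrt k = (2 * (c - a + 1 + \<delta>) / \<delta>)^2 * \<delta> powr (3/2) * sqrt k"
 proof -
  have "k / sqrt k = sqrt k" using k by (simp add: real_div_sqrt)
  moreover have "y * (k * p) / q = y * p * (k / q)" for y p q :: real by simp
  ultimately show ?thesis unfolding D_def by (simp only:)
 qed
 finally have "\<bar>integral {x - \<delta>..x} F\<bar> / \<delta> <= (((2 * (c - a + 1 + \<delta>) / \<delta>)^2 * \<delta> powr (3/2) * sqrt k + sqrt k * \<delta>) / 2) / \<delta>"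
  using \<delta> by (intro divide_right_mono) auto
 then have a0: "\<bar>left_mean F x (r 0)\<bar> <= (((2 * (c - a + 1 + \<delta>) / \<delta>)^2 * \<delta> powr (3/2) + \<delta>) / (2 * \<delta>)) * sqrt k"
  unfolding left_mean_def r_def using \<delta> by (simp add: abs_divide field_simps)
 have "\<bar>F x\<bar> <= (((2 * (c - a + 1 + \<delta>) / \<delta>)^2 * \<delta> powr (3/2) + \<delta>) / (2 * \<delta>)) * sqrt k + (sqrt k * \<delta> powr (1/4)) / (1 - q)"
  by (rule geometric_telescope_bound[OF step q _ a0 lim]) (use sk in simp)
 then show ?thesis unfolding F_def q_def by (simp add: algebra_simps)
qed

lemma cum_sup_bound:
 assumes ac: "a < c" and \<delta>: "\<delta> > 0"
 shows "\<exists>C. \<forall>f k x. f \<in> L2_on a c --> 0 <= k \<longrightarrow>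
  (\<forall>r. 0 < r --> r <= \<delta> --> window_energy f r <= ennreal (k * r powr (3/2))) --> (cum f x)\<^sup>2 <= C * k"
proof -
 define C where "C = ((2 * (c - a + 1 + \<delta>) / \<delta>)^2 * \<delta> powr (3/2) + \<delta>) / (2 * \<delta>) + \<delta> powr (1/4) / (1 - 2 powr (-1/4 :: real))"
 have main: "(cum f x)^2 <= C\<^sup>2 * k" if f: "f \<in> L2_on a c" and k: "0 < k"
  and W: "!!r. 0 < r ==> r <= \<delta> ==> window_energy f r <= ennreal (k * r powr (3/2))" for f k x
 proof -
  have "\<bar>cum f (min x c)\<bar> <= C * sqrt k"
   unfolding C_def by (rule cum_sup_bound_aux[OF f ac \<delta> k W]) auto
  moreover have "cum f (min x c) = cum f x"
   using cum_right[OF f, of x] cum_right[OF f, of c] by (cases "x <= c") (auto simp: min_def)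
  ultimately have "\<bar>cum f x\<bar>\<^sup>2 <= (C * sqrt k)^2" by (intro power_mono) auto
  then show ?thesis using k by (simp add: power_mult_distrib)
 qed
 have "(cum f x)^2 <= C\<^sup>2 * k" if f: "f \<in> L2_on a c" and k: "0 <= k"
  and W: "!!r. 0 < r ==> r <= \<delta> ==> window_energy f r <= ennreal (k * r powr (3/2))" for f k x
 proof (rule field_le_epsilon)
  fix e :: real assume e: "e > 0"
  \<comment> \<open>The auxiliary bound divides by \<open>sqrt k\<close>; the case
    \<open>k = 0\<close> is reached by enlarging \<open>k\<close> a little.\<close>
  define e' where "e' = e / (C\<^sup>2 + 1)"
  have e': "e' > 0" unfolding e'_def using e by (simp add: add_nonneg_pos)
  have 1: "(cum f x)^2 <= C\<^sup>2 * (k + e')"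
  proof (rule main[OF f])
   fix r :: real assume r: "0 < r" "r <= \<delta>"
   have "window_energy f r <= ennreal (k * r powr (3/2))" by (rule W[OF r])
   also have "\<dots> <= ennreal ((k + e') * r powr (3/2))" using e' by (intro ennreal_leI mult_right_mono) auto
   finally show "window_energy f r <= ennreal ((k + e') * r powr (3/2))" .
  qed (use k e' in simp)
  have "C\<^sup>2 * e <= e * (C\<^sup>2 + 1)" using e by (simp add: algebra_simps)
  then have "C\<^sup>2 * e' <= e" unfolding e'_def by (simp add: pos_divide_le_eq add_nonneg_pos)
  then show "(cum f x)^2 <= C\<^sup>2 * k + e" using 1 by (simp add: distrib_left)
 qed
 then show ?thesis by blast
qed

section \<open>The logarithmic kernel\<close>

lemma ln_powr_deriv:
 fixes t :: real assumes "0 < t" "t < 1"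
 shows "((%t. (- ln t) powr p) has_real_derivative - p * (- ln t) powr (p - 1) / t) (at t)"
proof -
 have L: "- ln t > 0" using assms by simp
 have "((%t. - ln t) has_real_derivative - (1 / t)) (at t)"
  using assms by (auto intro!: derivative_eq_intros)
 from DERIV_chain2[OF has_real_derivative_powr[OF L, of p] this] show ?thesis by simp
qed

text \<open>The derivative has the sign of \<open>a * (- ln t) - p\<close>, which is smallest at the
  right end \<open>e\<close>.\<close>

lemma powr_ln_powr_mono:
 fixes a p s t e :: real
 assumes e: "0 < e" "e < 1" "p <= a * (- ln e)" and a: "0 < a" and st: "0 < s" "s <= t" "t <= e"
 shows "s powr a * (- ln s) powr p <= t powr a * (- ln t) powr p"
proof (rule DERIV_nonneg_imp_nondecreasing[where f = "%t. t powr a * (- ln t) powr p", OF st(2)])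
 fix x assume "s <= x" "x <= t"
 then have x: "0 < x" "x < 1" "x <= e" using st e by auto
 define L where "L = - ln x"
 have L: "L > 0" "p <= a * L"
 proof -
  show "L > 0" unfolding L_def using x by simp
  have "- ln e <= L" unfolding L_def using x e by simp
  then show "p <= a * L" using e(3) a by (meson mult_left_mono less_imp_le order_trans)
 qed
 have "((%t. t powr a * (- ln t) powr p) has_real_derivative
   (a * x powr (a - 1)) * (- ln x) powr p + (- p * (- ln x) powr (p - 1) / x) * x powr a) (at x)"
  by (rule DERIV_mult[OF has_real_derivative_powr[OF x(1)] ln_powr_deriv[OF x(1,2)]])
 moreover have "(a * x powr (a - 1)) * (- ln x) powr p + (- p * (- ln x) powr (p - 1) / x) * x powr a
   = x powr (a - 1) * L powr (p - 1) * (a * L - p)"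
 proof -
  have "L powr p = L powr (p - 1) * L" using L powr_add[of L "p - 1" 1] by simp
  moreover have "x powr a = x powr (a - 1) * x" using x powr_add[of x "a - 1" 1] by simp
  ultimately show ?thesis unfolding L_def[symmetric] using x by (simp add: algebra_simps)
 qed
 moreover have "0 <= x powr (a - 1) * L powr (p - 1) * (a * L - p)" using L by simp
 ultimately show "\<exists>y. ((%t. t powr a * (- ln t) powr p) has_real_derivative y) (at x) & 0 <= y" by metis
qed

text \<open>The antiderivative \<open>(- ln r) powr (1 - p) / (p - 1)\<close> tends to 0 at 0
  because \<open>p > 1\<close>. With exponent \<alpha> this gives integrability of the kernel and
  the Hardy weight, with exponent 2 the Hilbert-Schmidt norm.\<close>

lemma nn_integral_inverse_ln_powr:
 fixes u p :: real
 assumes p: "p > 1" and u: "0 < u" "u < 1"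
 shows "integrable lborel (%r. indicator {0<..<u} r * ((- ln r) powr (- p) / r))"
  and "(\<integral>\<^sup>+ r. ennreal ((- ln r) powr (- p) / r) * indicator {0<..<u} r \<partial>lborel) = ennreal ((- ln u) powr (1 - p) / (p - 1))"
proof -
 define F where "F = (%r::real. (- ln r) powr (1 - p) / (p - 1))"
 define f where "f = (%r::real. (- ln r) powr (- p) / r)"
 have ei: "einterval 0 (ereal u) = {0<..<u}" by (auto simp: einterval_def zero_ereal_def)
 have dF: "(F has_real_derivative f x) (at x)" if "0 < x" "x < 1" for x
 proof -
  have "(F has_real_derivative (- (1 - p) * (- ln x) powr (1 - p - 1) / x) / (p - 1)) (at x)"
   unfolding F_def by (rule DERIV_cdivide[OF ln_powr_deriv[OF that]])
  moreover have "(- (1 - p) * (- ln x) powr (1 - p - 1) / x) / (p - 1) = f x"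
  proof -
   have "- (1 - p) * y / x / (p - 1) = (p - 1) / (p - 1) * (y / x)" for y by simp
   then show ?thesis unfolding f_def using p by simp
  qed
  ultimately show ?thesis by simp
 qed
 have cf: "isCont f x" if "0 < x" "x < 1" for x
  unfolding f_def using that by (auto intro!: continuous_intros)
 have lim0: "((F \<circ> real_of_ereal) \<longlongrightarrow> 0) (at_right 0)"
  unfolding zero_ereal_def ereal_tendsto_simps1
 proof -
  have "filterlim (%x::real. - ln x) at_top (at_right 0)"
   using ln_at_0 by (simp add: filterlim_uminus_at_bot)
  then have "((%x::real. (- ln x) powr (1 - p)) \<longlongrightarrow> 0) (at_right 0)"
   using p by (intro tendsto_neg_powr) auto
  from tendsto_divide[OF this tendsto_const, of "p - 1"] show "(F \<longlongrightarrow> 0) (at_right 0)"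
   unfolding F_def using p by simp
 qed
 have limu: "((F \<circ> real_of_ereal) \<longlongrightarrow> F u) (at_left (ereal u))"
  unfolding ereal_tendsto_simps1
  using DERIV_isCont[OF dF[OF u]] by (simp add: isCont_def filterlim_at_split)
 have FTC: "set_integrable lborel (einterval 0 (ereal u)) f" "(LBINT x=0..ereal u. f x) = F u - 0"
  by (rule interval_integral_FTC_nonneg[where F = F, OF _ dF cf _ lim0 limu]; use u in \<open>auto simp: f_def zero_ereal_def intro!: AE_I2\<close>)+
 then show i: "integrable lborel (%r. indicator {0<..<u} r * ((- ln r) powr (- p) / r))"
  unfolding ei set_integrable_def f_def by simp
 have "(LBINT x=0..ereal u. f x) = (\<integral>r. indicator {0<..<u} r * f r \<partial>lborel)"
  using u unfolding interval_lebesgue_integral_def ei set_lebesgue_integral_def by (simp add: zero_ereal_def)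
 with FTC(2) have v: "(\<integral>r. indicator {0<..<u} r * f r \<partial>lborel) = F u" by simp
 have "(\<integral>\<^sup>+ r. ennreal (indicator {0<..<u} r * f r) \<partial>lborel) = ennreal (F u)"
  unfolding v[symmetric]
 proof (rule nn_integral_eq_integral)
  show "integrable lborel (%r. indicator {0<..<u} r * f r)" using FTC(1) unfolding ei set_integrable_def by simp
  show "AE r in lborel. 0 <= indicator {0<..<u} r * f r" by (auto intro!: AE_I2 simp: f_def indicator_def)
 qed
 moreover have "(\<integral>\<^sup>+ r. ennreal (f r) * indicator {0<..<u} r \<partial>lborel) = (\<integral>\<^sup>+ r. ennreal (indicator {0<..<u} r * f r) \<partial>lborel)"
  by (intro nn_integral_cong) (auto simp: indicator_def)
 ultimately show "(\<integral>\<^sup>+ r. ennreal ((- ln r) powr (- p) / r) * indicator {0<..<u} r \<partial>lborel) = ennreal ((- ln u) powr (1 - p) / (p - 1))"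
  unfolding f_def F_def by simp
qed

text \<open>The mean value theorem twice, for the first difference and then for the first
  derivative.\<close>

lemma second_difference:
 fixes f f1 f2 :: "real => real"
 assumes h: "h > 0" and d1: "!!x. t <= x ==> x <= t + 2 * h ==> (f has_real_derivative f1 x) (at x)"
  and d2: "!!x. t <= x ==> x <= t + 2 * h ==> (f1 has_real_derivative f2 x) (at x)"
 shows "\<exists>z. t < z & z < t + 2 * h & (f (t + 2 * h) - 2 * f (t + h) + f t) / h\<^sup>2 = f2 z"
proof -
 define R where "R = (%x. f (x + h) - f x)"
 have "\<exists>y>t. y < t + h & R (t + h) - R t = (t + h - t) * (f1 (y + h) - f1 y)"
 proof (rule MVT2)
  fix x assume x: "t <= x" "x <= t + h"
  have "((%x. f (x + h)) has_real_derivative f1 (x + h)) (at x)"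
   using d1[of "x + h"] x h by (simp add: DERIV_shift)
  then show "(R has_real_derivative f1 (x + h) - f1 x) (at x)"
   unfolding R_def using d1[of x] x h by (intro DERIV_diff) auto
 qed (use h in simp)
 then obtain y where y: "t < y" "y < t + h" "R (t + h) - R t = h * (f1 (y + h) - f1 y)" by auto
 have "\<exists>z>y. z < y + h & f1 (y + h) - f1 y = (y + h - y) * f2 z"
  by (rule MVT2) (use d2 y h in auto)
 then obtain z where z: "y < z" "z < y + h" "f1 (y + h) - f1 y = h * f2 z" by auto
 have "f (t + 2 * h) - 2 * f (t + h) + f t = R (t + h) - R t" unfolding R_def by (simp add: algebra_simps)
 also have "\<dots> = h\<^sup>2 * f2 z" using y z by (simp add: power2_eq_square)
 finally show ?thesis using y z h by (intro exI[of _ z]) auto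
qed

locale log_kernel =
 fixes \<alpha> :: real and B :: "real => real"
 assumes alpha: "\<alpha> > 1"
  and even: "\<forall>t. t ~= 0 --> B (- t) = B t"
  and nonneg: "\<forall>t>0. B t \<ge> 0"
  and antimono: "antimono_on {0<..} B"
  and convex: "convex_on {0<..} B"
  and near_zero: "\<exists>\<epsilon>>0. \<forall>t\<in>{0<..<\<epsilon>}. B t = 1 / (t * ln (1 / t) powr \<alpha>)"
begin

text \<open>The size of the second derivative of \<open>B\<close> near 0, without its lower order
  terms. These keep \<open>B2\<close> between \<open>\<rho>\<close> and
  \<open>3 * \<rho>\<close>.\<close>

definition \<rho> :: "real => real" where "\<rho> t = (- ln t) powr (- \<alpha>) / t ^ 3"

text \<open>\<open>B1\<close> and \<open>B2\<close> are the derivatives of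
  \<open>(- ln t) powr (- \<alpha>) / t\<close>; they are derivatives of \<open>B\<close> only near
  0.\<close>

definition B2 :: "real => real" where
 "B2 t = (2 * (- ln t) powr (- \<alpha>) - 3 * \<alpha> * (- ln t) powr (- \<alpha> - 1) + \<alpha> * (\<alpha> + 1) * (- ln t) powr (- \<alpha> - 2)) / t ^ 3"

definition B1 :: "real => real" where
 "B1 t = (\<alpha> * (- ln t) powr (- \<alpha> - 1) - (- ln t) powr (- \<alpha>)) / t\<^sup>2"

text \<open>The formula for \<open>B\<close> is secured up to \<open>2 * \<eta>\<close> because
  smoothing at a point below \<open>\<eta>\<close> looks ahead by at most \<open>\<eta>\<close>. The
  exponential makes \<open>- ln t\<close> at least \<open>6 * \<alpha> + 6\<close>, enough to
  dominate the lower order terms of \<open>B2\<close> and to make \<open>\<rho>\<close>,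
  \<open>weight\<close> and similar expressions monotone.\<close>

definition \<eta> :: real where
 "\<eta> = (SOME e. 0 < e & 2 * e <= exp (- (6 * \<alpha> + 6)) & (\<forall>t\<in>{0<..<2 * e}. B t = 1 / (t * ln (1 / t) powr \<alpha>)))"

lemma eta_props: "0 < \<eta>" "2 * \<eta> <= exp (- (6 * \<alpha> + 6))" "0 < t ==> t < 2 * \<eta> ==> B t = (- ln t) powr (- \<alpha>) / t"
proof -
 obtain e where e: "e > 0" "\<forall>t\<in>{0<..<e}. B t = 1 / (t * ln (1 / t) powr \<alpha>)" using near_zero by blast
 have "\<exists>e. 0 < e & 2 * e <= exp (- (6 * \<alpha> + 6)) & (\<forall>t\<in>{0<..<2 * e}. B t = 1 / (t * ln (1 / t) powr \<alpha>))"
  using e by (intro exI[of _ "min e (exp (- (6 * \<alpha> + 6))) / 2"]) auto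
 from someI_ex[OF this]
 have *: "0 < \<eta>" "2 * \<eta> <= exp (- (6 * \<alpha> + 6))" "\<forall>t\<in>{0<..<2 * \<eta>}. B t = 1 / (t * ln (1 / t) powr \<alpha>)"
  unfolding \<eta>_def by blast+
 then show "0 < \<eta>" "2 * \<eta> <= exp (- (6 * \<alpha> + 6))" by blast+
 show "B t = (- ln t) powr (- \<alpha>) / t" if "0 < t" "t < 2 * \<eta>"
  using *(3) that by (simp add: ln_div powr_minus field_simps)
qed

lemma eta_lt: "2 * \<eta> < 1"
proof -
 have "exp (- (6 * \<alpha> + 6)) < 1" using alpha by simp
 then show ?thesis using eta_props(2) by linarith
qed

lemma ln_ge: "0 < t ==> t <= 2 * \<eta> ==> 6 * \<alpha> + 6 <= - ln t"
proof -
 assume t: "0 < t" "t <= 2 * \<eta>"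
 then have "ln t <= ln (exp (- (6 * \<alpha> + 6)))" using eta_props(2) by (subst ln_le_cancel_iff) auto
 then show ?thesis by simp
qed

lemma B_cont: "continuous_on {0<..} B"
 by (rule convex_on_continuous[OF _ convex]) simp

lemma B_mono: "0 < s ==> s <= t ==> B t <= B s"
 using antimono unfolding monotone_on_def by auto

text \<open>Below \<open>\<eta>\<close> the kernel is dominated by
  \<open>(- ln r) powr (- \<alpha>) / r\<close>, integrable since \<alpha> > 1, and beyond by the
  constant \<open>B \<eta>\<close>. Formulated for dominated kernels so that it serves
  \<open>B\<close> and its smoothings.\<close>

lemma locally_integrable_dominated:
 assumes k: "continuous_on {0<..} k" and le: "!!t. t > 0 ==> 0 <= k t & k t <= B t"
  and k': "!!t. t ~= 0 ==> k' t = k \<bar>t\<bar>"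
 shows "locally_integrable k'"
 unfolding locally_integrable_def
proof (intro conjI allI)
 have K[measurable]: "(%t. indicator {0<..} t *\<^sub>R k t) \<in> borel_measurable borel"
  by (rule borel_measurable_continuous_on_indicator[OF _ k]) simp
 have e: "k' = (%t. (%t. indicator {0<..} t *\<^sub>R k t) t + (%t. indicator {0<..} t *\<^sub>R k t) (- t) + indicator {0} t * k' 0)"
  using k' by (auto simp: fun_eq_iff indicator_def)
 have [measurable]: "(%t. indicator {0<..} (- t) *\<^sub>R k (- t)) \<in> borel_measurable borel"
  by (rule measurable_compose[OF _ K]) simp
 show m[measurable]: "k' \<in> borel_measurable borel"
  by (subst e) measurable
 fix l :: real
 define h where "h = (%r. indicator {0<..<\<eta>} r * ((- ln r) powr (- \<alpha>) / r))"
 have hi: "integrable lborel h"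
  unfolding h_def by (rule nn_integral_inverse_ln_powr(1)) (use alpha eta_props eta_lt in auto)
 have h': "integrable lborel (%x. h (- x))" using lborel_integrable_real_affine[OF hi, of "-1" 0] by simp
 have h0: "0 <= h r" for r unfolding h_def by (auto simp: indicator_def)
 have ii: "integrable lborel (indicator {-l..l} :: real => real)"
  by (rule integrable_real_indicator) (simp, cases "- l <= l", simp_all)
 show "set_integrable lborel {-l..l} k'"
  unfolding set_integrable_def
 proof (rule Bochner_Integration.integrable_bound)
  show "integrable lborel (%t. h t + h (- t) + B \<eta> * indicator {-l..l} t)"
   using hi h' ii by auto
  show "AE t in lborel. norm (indicator {-l..l} t *\<^sub>R k' t) <= norm (h t + h (- t) + B \<eta> * indicator {-l..l} t)"
   using AE_lborel_singleton[of 0]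
  proof eventually_elim
   case (elim t)
   have t: "\<bar>t\<bar> > 0" using elim by simp
   have kt: "0 <= k' t" "k' t <= B \<bar>t\<bar>" using k'[OF elim] le[OF t] by auto
   have Be: "0 <= B \<eta>" using nonneg eta_props(1) by blast
   have "indicator {-l..l} t * k' t <= h t + h (- t) + B \<eta> * indicator {-l..l} t"
   proof (cases "\<bar>t\<bar> < \<eta>")
    case True
    then have "B \<bar>t\<bar> = h \<bar>t\<bar>" using eta_props t unfolding h_def by simp
    moreover have "h \<bar>t\<bar> <= h t + h (- t)" using h0[of t] h0[of "- t"] by (cases "t \<ge> 0") auto
    ultimately show ?thesis using kt Be h0[of t] h0[of "- t"] by (auto simp: indicator_def)
   next
    case False
    then have "B \<bar>t\<bar> <= B \<eta>" using B_mono[OF eta_props(1)] by simp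
    then show ?thesis using kt h0[of t] h0[of "- t"] by (auto simp: indicator_def)
   qed
   then show ?case using kt h0[of t] h0[of "- t"] Be by (simp add: indicator_def)
  qed
 qed simp
qed

lemma B_local: "locally_integrable B"
proof (rule locally_integrable_dominated[OF B_cont])
 show "B t = B \<bar>t\<bar>" if "t ~= 0" for t using even that by (cases "t > 0") (auto simp: abs_if)
qed (use nonneg in simp)

lemma deriv_near_zero:
 assumes "0 < t" "t < 2 * \<eta>"
 shows "(B has_real_derivative B1 t) (at t)" and "(B1 has_real_derivative B2 t) (at t)"
proof -
 have t1: "t < 1" using assms eta_lt by simp
 note d = ln_powr_deriv[OF assms(1) t1]
 have "((%t. (- ln t) powr (- \<alpha>) / t) has_real_derivative B1 t) (at t)"
 proof -
  have "((%t. (- ln t) powr (- \<alpha>) / t) has_real_derivative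
   ((- (- \<alpha>) * (- ln t) powr (- \<alpha> - 1) / t) * t - (- ln t) powr (- \<alpha>) * 1) / (t * t)) (at t)"
   using assms by (intro DERIV_divide d DERIV_ident) auto
  then show ?thesis unfolding B1_def using assms by (simp add: power2_eq_square)
 qed
 then show "(B has_real_derivative B1 t) (at t)"
 proof (rule has_field_derivative_transform_within_open[where S = "{0<..<2 * \<eta>}"])
  show "(- ln x) powr (- \<alpha>) / x = B x" if "x \<in> {0<..<2 * \<eta>}" for x using eta_props(3)[of x] that by simp
 qed (use assms in auto)
 have "(B1 has_real_derivative ((\<alpha> * (- (- \<alpha> - 1) * (- ln t) powr (- \<alpha> - 1 - 1) / t) - (- (- \<alpha>) * (- ln t) powr (- \<alpha> - 1) / t)) * t\<^sup>2
   - (\<alpha> * (- ln t) powr (- \<alpha> - 1) - (- ln t) powr (- \<alpha>)) * (2 * t)) / (t\<^sup>2 * t\<^sup>2)) (at t)"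
  unfolding B1_def[abs_def] using assms
  by (intro DERIV_divide DERIV_diff DERIV_cmult d) (auto intro!: derivative_eq_intros)
 moreover have "((\<alpha> * (- (- \<alpha> - 1) * (- ln t) powr (- \<alpha> - 1 - 1) / t) - (- (- \<alpha>) * (- ln t) powr (- \<alpha> - 1) / t)) * t\<^sup>2
   - (\<alpha> * (- ln t) powr (- \<alpha> - 1) - (- ln t) powr (- \<alpha>)) * (2 * t)) / (t\<^sup>2 * t\<^sup>2) = B2 t"
 proof -
  have gen: "((\<alpha> * (- (- \<alpha> - 1) * p / t) - (- (- \<alpha>) * q / t)) * t\<^sup>2 - (\<alpha> * q - r) * (2 * t)) / (t\<^sup>2 * t\<^sup>2)
   = (2 * r - 3 * \<alpha> * q + \<alpha> * (\<alpha> + 1) * p) / t ^ 3" for p q r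
   using assms by (simp add: field_simps power2_eq_square power3_eq_cube)
  have e: "- \<alpha> - 1 - 1 = - \<alpha> - 2" by simp
  show ?thesis unfolding B2_def e by (rule gen)
 qed
 ultimately show "(B1 has_real_derivative B2 t) (at t)" by simp
qed

lemma B2_bounds:
 assumes "0 < t" "t < 2 * \<eta>"
 shows "\<rho> t <= B2 t" "B2 t <= 3 * \<rho> t" "0 < \<rho> t"
proof -
 define L where "L = - ln t"
 have L: "6 * \<alpha> + 6 <= L" unfolding L_def using ln_ge assms by simp
 then have L0: "L > 0" using alpha by linarith
 show r0: "0 < \<rho> t" unfolding \<rho>_def using assms L0 by (simp add: L_def)
 have p1: "L powr (- \<alpha> - 1) = L powr (- \<alpha>) / L" using L0 by (simp add: powr_diff)
 have p2: "L powr (- \<alpha> - 2) = L powr (- \<alpha>) / L\<^sup>2" using L0 by (simp add: powr_diff powr_realpow[symmetric] flip: powr_numeral)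
 have e: "B2 t = \<rho> t * (2 - 3 * \<alpha> / L + \<alpha> * (\<alpha> + 1) / L\<^sup>2)"
  unfolding B2_def \<rho>_def L_def[symmetric] p1 p2 by (simp add: field_simps)
 have a1: "3 * \<alpha> / L <= 1" using L alpha L0 by (simp add: pos_divide_le_eq)
 have a2: "\<alpha> * (\<alpha> + 1) / L\<^sup>2 <= 1"
 proof -
  have "\<alpha> * (\<alpha> + 1) <= L * L" by (intro mult_mono) (use L alpha in auto)
  then show ?thesis using L0 by (simp add: pos_divide_le_eq power2_eq_square)
 qed
 have a3: "0 <= 3 * \<alpha> / L" "0 <= \<alpha> * (\<alpha> + 1) / L\<^sup>2" using L0 alpha by auto
 have "\<rho> t * 1 <= B2 t" unfolding e using a1 a3 r0 by (intro mult_left_mono) auto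
 then show "\<rho> t <= B2 t" by simp
 have "B2 t <= \<rho> t * 3" unfolding e using a2 a3 r0 by (intro mult_left_mono) linarith+
 then show "B2 t <= 3 * \<rho> t" by simp
qed

lemma rho_antimono: "0 < s ==> s <= t ==> t < 2 * \<eta> ==> \<rho> t <= \<rho> s"
proof -
 assume st: "0 < s" "s <= t" "t < 2 * \<eta>"
 have inv: "\<rho> x = 1 / (x powr 3 * (- ln x) powr \<alpha>)" if "0 < x" for x
  unfolding \<rho>_def using that by (simp add: powr_minus field_simps)
 have "s powr 3 * (- ln s) powr \<alpha> <= t powr 3 * (- ln t) powr \<alpha>"
  by (rule powr_ln_powr_mono[of t]) (use st eta_lt ln_ge[of t] alpha in auto)
 moreover have "0 < s powr 3 * (- ln s) powr \<alpha>" using st eta_lt by simp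
 ultimately show ?thesis unfolding inv[OF st(1)] using inv[of t] st by (simp add: frac_le)
qed

end

section \<open>Smoothing of the kernel and lower bounds for its form\<close>

context log_kernel
begin

lemma antiderivatives_exist:
 "\<exists>P Q. \<forall>t>0. (P has_real_derivative Q t) (at t) & (Q has_real_derivative B t) (at t)"
proof -
 have anti: "\<exists>F. \<forall>t>0. (F has_real_derivative f t) (at t)" if c: "!!t. t > 0 ==> isCont f t" for f :: "real => real"
 proof -
  have "\<exists>F. \<forall>x :: real. (0::ereal) < x --> x < \<infinity> --> (F has_vector_derivative f x) (at x)"
   by (rule einterval_antiderivative) (use c in \<open>auto simp: zero_ereal_def\<close>)
  then show ?thesis by (auto simp: zero_ereal_def has_real_derivative_iff_has_vector_derivative)
 qed
 have "isCont B t" if "t > 0" for t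
  using B_cont that by (simp add: continuous_on_eq_continuous_at open_greaterThan)
 from anti[of B, OF this] obtain Q where Q: "\<forall>t>0. (Q has_real_derivative B t) (at t)" by blast
 have "isCont Q t" if "t > 0" for t using Q that DERIV_isCont by blast
 from anti[of Q, OF this] obtain P where P: "\<forall>t>0. (P has_real_derivative Q t) (at t)" by blast
 show ?thesis using P Q by blast
qed

text \<open>Averaging \<open>B\<close> forward over \<open>[0, h]\<close> twice keeps it positive, decreasing and convex and makes
  it twice differentiable; its second derivative is a second difference of \<open>B\<close>.\<close>

lemma smoothing_exists:
 "\<exists>b b1 b2 :: nat => real => real. (\<forall>n. c2_kernel (b n) (b1 n) (b2 n)) \<and>
  (\<forall>n. \<forall>t>0. b n t <= B t) & (\<forall>t>0. (%n. b n t) ----> B t) \<and>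
  (\<forall>n r. 0 < r --> r < \<eta> --> b2 n r <= 3 * \<rho> r) \<and>
  (\<forall>r. 0 < r --> r < \<eta> --> (%n. b2 n r) ----> B2 r)"
proof -
 obtain P Q where P: "!!t. t > 0 ==> (P has_real_derivative Q t) (at t)"
  and Q: "!!t. t > 0 ==> (Q has_real_derivative B t) (at t)"
  using antiderivatives_exist by blast
 \<comment> \<open>The steps keep \<open>2 * h n\<close> at most \<open>\<eta>\<close>, so that for
   arguments below \<open>\<eta>\<close> the explicit derivatives apply at all intermediate
   points.\<close>
 define h where "h = (%n::nat. \<eta> / 2 / (real n + 1))"
 have h: "h n > 0" "2 * h n <= \<eta>" for n
 proof -
  show "h n > 0" unfolding h_def using eta_props(1) by simp
  have "h n <= \<eta> / 2 / 1" unfolding h_def using eta_props(1) by (intro divide_left_mono) auto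
  then show "2 * h n <= \<eta>" by simp
 qed
 have hlim: "h ----> 0"
 proof -
  have "(%n. \<eta> / 2 * inverse (real (Suc n))) ----> \<eta> / 2 * 0"
   by (intro tendsto_mult_left LIMSEQ_inverse_real_of_nat)
  moreover have "h = (%n. \<eta> / 2 * inverse (real (Suc n)))"
   unfolding h_def by (simp only: divide_inverse of_nat_Suc add.commute[of 1])
  ultimately show ?thesis by (simp only: mult_zero_right)
 qed
 \<comment> \<open>With \<open>P\<close> a double antiderivative of \<open>B\<close>, this second
   difference is the twofold forward average. By the mean value theorem it equals \<open>B z\<close>
   for some \<open>z\<close> between \<open>t\<close> and \<open>t + 2 * h n\<close>, which gives
   \<open>b <= B\<close> by monotonicity and convergence by continuity.\<close>
 define b where "b = (%n t. (P (t + 2 * h n) - 2 * P (t + h n) + P t) / (h n)^2)"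
 define b1 where "b1 = (%n t. (Q (t + 2 * h n) - 2 * Q (t + h n) + Q t) / (h n)^2)"
 define b2 where "b2 = (%n t. (B (t + 2 * h n) - 2 * B (t + h n) + B t) / (h n)^2)"
 have shift: "((%t. F (t + c)) has_real_derivative F' (t + c)) (at t)"
  if "(F has_real_derivative F' (t + c)) (at (t + c))" for F F' :: "real => real" and t c
  using that by (simp add: DERIV_shift)
 have bz: "\<exists>z. t < z & z < t + 2 * h n & b n t = B z" if t: "t > 0" for n t
  unfolding b_def by (rule second_difference[OF h(1) P Q]) (use t in auto)
 have b2z: "\<exists>z. r < z & z < r + 2 * h n & b2 n r = B2 z" if r: "0 < r" "r < \<eta>" for n r
  unfolding b2_def by (rule second_difference[OF h(1) deriv_near_zero]) (use r h[of n] in auto)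
 have ble: "0 <= b n t & b n t <= B t" if t: "t > 0" for n t
  using bz[OF t, of n] nonneg B_mono[of t] t by fastforce
 have d1: "(b n has_real_derivative b1 n t) (at t)" if t: "t > 0" for n t
  unfolding b_def b1_def
  by (intro DERIV_cdivide DERIV_add DERIV_diff DERIV_cmult shift P) (use t h[of n] in \<open>auto intro: add_pos_pos\<close>)
 have d2: "(b1 n has_real_derivative b2 n t) (at t)" if t: "t > 0" for n t
  unfolding b1_def b2_def
  by (intro DERIV_cdivide DERIV_add DERIV_diff DERIV_cmult shift Q) (use t h[of n] in \<open>auto intro: add_pos_pos\<close>)
 have Bsh: "continuous_on {0<..} (%t. B (t + c))" if "c \<ge> 0" for c
  by (rule continuous_on_compose2[OF B_cont]) (use that in \<open>auto intro!: continuous_intros\<close>)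
 have cont2: "continuous_on {0<..} (b2 n)" for n
  unfolding b2_def using h(1)[of n] by (intro continuous_intros Bsh B_cont) auto
 have nn2: "0 <= b2 n t" if t: "t > 0" for n t
 proof -
  have e: "(1 - 1 / 2) *\<^sub>R t + (1 / 2) *\<^sub>R (t + 2 * h n) = t + h n" by (simp add: algebra_simps)
  have "B ((1 - 1 / 2) *\<^sub>R t + (1 / 2) *\<^sub>R (t + 2 * h n)) <= (1 - 1 / 2) * B t + (1 / 2) * B (t + 2 * h n)"
   by (rule convex_onD[OF convex]) (use t h(1)[of n] in auto)
  then show ?thesis unfolding b2_def e by simp
 qed
 have np1: "b1 n t <= 0" if t: "t > 0" for n t
 proof -
  have "\<exists>y>t. y < t + h n & (Q (t + h n + h n) - Q (t + h n)) - (Q (t + h n) - Q t) = (t + h n - t) * (B (y + h n) - B y)"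
  proof (rule MVT2[where f = "%x. Q (x + h n) - Q x" and f' = "%x. B (x + h n) - B x"])
   fix x assume "t <= x" "x <= t + h n"
   then show "((%x. Q (x + h n) - Q x) has_real_derivative B (x + h n) - B x) (at x)"
    using t h(1)[of n] by (intro DERIV_diff shift Q) auto
  qed (use h(1)[of n] in simp)
  then obtain y where y: "y > t" "(Q (t + h n + h n) - Q (t + h n)) - (Q (t + h n) - Q t) = h n * (B (y + h n) - B y)" by auto
  have "h n * (B (y + h n) - B y) <= 0"
   using B_mono[of y "y + h n"] y t h(1)[of n] by (intro mult_nonneg_nonpos) auto
  then have "Q (t + 2 * h n) - 2 * Q (t + h n) + Q t <= 0" using y(2) by (simp add: algebra_simps)
  then show ?thesis unfolding b1_def by (simp add: divide_nonpos_nonneg)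
 qed
 have c2: "c2_kernel (b n) (b1 n) (b2 n)" for n
 proof (rule c2_kernel.intro)
  have "continuous_on {0<..} (b n)"
   using d1[of _ n] by (intro continuous_at_imp_continuous_on ballI DERIV_isCont) auto
  then show "locally_integrable (%t. b n \<bar>t\<bar>)"
   by (rule locally_integrable_dominated) (use ble in auto)
 qed (use d1 d2 cont2 ble np1 nn2 in auto)
 have squeeze: "z ----> t" if "!!n. t < z n" "!!n. z n < t + 2 * h n" for z t
 proof (rule tendsto_sandwich[of "%_. t" z sequentially "%n. t + 2 * h n"])
  show "(%n. t + 2 * h n) ----> t" using tendsto_add[OF tendsto_const[of t] tendsto_mult_left[OF hlim, of 2]] by simp
 qed (use that in \<open>auto intro!: always_eventually less_imp_le\<close>)
 have lim: "(%n. b n t) ----> B t" if t: "t > 0" for t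
 proof -
  obtain z where z: "!!n. t < z n" "!!n. z n < t + 2 * h n" "!!n. b n t = B (z n)" using bz[OF t] by metis
  have "isCont B t" using B_cont t by (simp add: continuous_on_eq_continuous_at open_greaterThan)
  from isCont_tendsto_compose[OF this squeeze[OF z(1,2)]] show ?thesis by (simp only: z(3))
 qed
 have lim2: "(%n. b2 n r) ----> B2 r" if r: "0 < r" "r < \<eta>" for r
 proof -
  obtain z where z: "!!n. r < z n" "!!n. z n < r + 2 * h n" "!!n. b2 n r = B2 (z n)" using b2z[OF r] by metis
  have "r < 1" "- ln r > 0" using r eta_lt eta_props(1) by auto
  then have "isCont B2 r" unfolding B2_def[abs_def] using r by (auto intro!: continuous_intros)
  from isCont_tendsto_compose[OF this squeeze[OF z(1,2)]] show ?thesis by (simp only: z(3))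
 qed
 have up: "b2 n r <= 3 * \<rho> r" if r: "0 < r" "r < \<eta>" for n r
 proof -
  obtain z where z: "r < z" "z < r + 2 * h n" "b2 n r = B2 z" using b2z[OF r] by metis
  have z2: "0 < z" "z < 2 * \<eta>" using z r h(2)[of n] by auto
  show ?thesis using B2_bounds(2)[OF z2] rho_antimono[OF r(1) less_imp_le[OF z(1)] z2(2)] z(3) by simp
 qed
 show ?thesis using c2 ble lim up lim2 by blast
qed

definition \<rho>\<eta> :: "real => real" where "\<rho>\<eta> r = (if 0 < r & r < \<eta> then \<rho> r else 0)"

lemma rho_eta_measurable [measurable]: "\<rho>\<eta> \<in> borel_measurable borel"
 unfolding \<rho>\<eta>_def[abs_def] \<rho>_def[abs_def] by measurable

lemma kernel_form_tendsto:
 assumes f: "f \<in> L2_bounded_support" "g \<in> L2_bounded_support"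
  and b: "!!n. locally_integrable (%t. b n \<bar>t\<bar>)" "!!n t. t > 0 ==> 0 <= b n t" "!!n t. t > 0 ==> b n t <= B t"
   "!!t. t > 0 ==> (%n. b n t) ----> B t"
 shows "(%n. kernel_form (%t. b n \<bar>t\<bar>) f g) ----> kernel_form B f g"
 unfolding kernel_form_def
proof (rule integral_dominated_convergence[where w = "%p. norm (f (fst p) * g (snd p) * B (fst p - snd p))"])
 note iB = kernel_form_bounded_support_integrable[OF B_local f]
 show "(%p. f (fst p) * g (snd p) * B (fst p - snd p)) \<in> borel_measurable lborel2"
  by (rule borel_measurable_integrable[OF iB])
 show "(%p. f (fst p) * g (snd p) * b n \<bar>fst p - snd p\<bar>) \<in> borel_measurable lborel2" for n
  by (rule borel_measurable_integrable[OF kernel_form_bounded_support_integrable[OF b(1) f]])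
 show "integrable lborel2 (%p. norm (f (fst p) * g (snd p) * B (fst p - snd p)))"
  by (rule integrable_norm[OF iB])
 have Babs: "B t = B \<bar>t\<bar>" if "t ~= 0" for t using even that by (cases "t > 0") (auto simp: abs_if)
 show "AE p in lborel2. (%n. f (fst p) * g (snd p) * b n \<bar>fst p - snd p\<bar>) ----> f (fst p) * g (snd p) * B (fst p - snd p)"
  using AE_lborel_pair_neq
 proof eventually_elim
  case (elim p)
  then show ?case using b(4)[of "\<bar>fst p - snd p\<bar>"] Babs[of "fst p - snd p"] by (intro tendsto_mult_left) simp
 qed
 show "AE p in lborel2. norm (f (fst p) * g (snd p) * b n \<bar>fst p - snd p\<bar>) <= norm (f (fst p) * g (snd p) * B (fst p - snd p))" for n
  using AE_lborel_pair_neq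
 proof eventually_elim
  case (elim p)
  then have "\<bar>b n \<bar>fst p - snd p\<bar>\<bar> <= \<bar>B (fst p - snd p)\<bar>"
   using b(2,3)[of "\<bar>fst p - snd p\<bar>" n] Babs[of "fst p - snd p"] by simp
  then show ?case by (simp add: abs_mult mult_left_mono)
 qed
qed

text \<open>Fatou's lemma over the smoothed kernels: their second derivatives tend to
  \<open>B2\<close>, which dominates \<open>\<rho>\<close>. Nonnegativity of the form passes to the
  limit at the same time and makes it a scalar product up to null vectors.\<close>

lemma energy_lower:
 assumes f: "f \<in> L2_on a c"
 shows "(\<integral>\<^sup>+ r. ennreal (\<rho>\<eta> r) * window_energy f r \<partial>lborel) <= ennreal (kernel_form B f f)"
  and "0 <= kernel_form B f f"
proof -
 obtain b b1 b2 where c2: "!!n. c2_kernel (b n) (b1 n) (b2 n)" and le: "!!n t. t > 0 ==> b n t <= B t"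
  and lim: "!!t. t > 0 ==> (%n. b n t) ----> B t" and lim2: "!!r. 0 < r ==> r < \<eta> ==> (%n. b2 n r) ----> B2 r"
  using smoothing_exists by metis
 have fL: "f \<in> L2_bounded_support" using f L2_on_subset_bounded_support by blast
 note [measurable] = L2_onD(1)[OF f]
 note low = c2_kernel.kernel_form_lower[OF c2 f eta_props(1)]
 have K: "(%n. kernel_form (%t. b n \<bar>t\<bar>) f f) ----> kernel_form B f f"
  by (rule kernel_form_tendsto[OF fL fL]) (use c2_kernel.local[OF c2] c2_kernel.nonneg0[OF c2] le lim in auto)
 show "0 <= kernel_form B f f" by (rule LIMSEQ_le_const[OF K]) (use low(2) in blast)
 have [measurable]: "c2_kernel.trunc2 (b2 n) \<eta> \<in> borel_measurable borel" for n
  by (rule c2_kernel.trunc2_measurable[OF c2])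
 have "(\<integral>\<^sup>+ r. ennreal (\<rho>\<eta> r) * window_energy f r \<partial>lborel)
   <= (\<integral>\<^sup>+ r. liminf (%n. ennreal (c2_kernel.trunc2 (b2 n) \<eta> r) * window_energy f r) \<partial>lborel)"
 proof (intro nn_integral_mono)
  fix r
  show "ennreal (\<rho>\<eta> r) * window_energy f r <= liminf (%n. ennreal (c2_kernel.trunc2 (b2 n) \<eta> r) * window_energy f r)"
  proof (cases "0 < r & r < \<eta>")
   case True
   \<comment> \<open>Finiteness of the energy makes multiplication by it continuous in the other
     factor.\<close>
   have "window_energy f r = ennreal (\<integral>x. (cum f (x + r) - cum f x)^2 \<partial>lborel)"
    unfolding window_energy_def by (rule nn_integral_eq_integral[OF kernel_form_triangle(1)[OF f f, folded power2_eq_square]]) (use True in auto)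
   then have fin: "window_energy f r < top" by simp
   have tr: "c2_kernel.trunc2 (b2 n) \<eta> r = b2 n r" for n using True by (simp add: c2_kernel.trunc2_def[OF c2])
   have "(%n. window_energy f r * ennreal (b2 n r)) ----> window_energy f r * ennreal (B2 r)"
    by (intro ennreal_tendsto_cmult fin tendsto_ennrealI lim2) (use True in auto)
   from lim_imp_Liminf[OF sequentially_bot this]
   have "liminf (%n. ennreal (c2_kernel.trunc2 (b2 n) \<eta> r) * window_energy f r) = ennreal (B2 r) * window_energy f r"
    unfolding tr by (simp add: mult.commute)
   moreover have "\<rho>\<eta> r <= B2 r" using True B2_bounds(1)[of r] eta_props(1) by (simp add: \<rho>\<eta>_def)
   ultimately show ?thesis by (simp add: mult_right_mono ennreal_leI)
  next
   case False
   then have "\<rho>\<eta> r = 0" unfolding \<rho>\<eta>_def by auto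
   then show ?thesis by simp
  qed
 qed
 also have "\<dots> <= liminf (%n. \<integral>\<^sup>+ r. ennreal (c2_kernel.trunc2 (b2 n) \<eta> r) * window_energy f r \<partial>lborel)"
  by (rule nn_integral_liminf) measurable
 also have "\<dots> <= liminf (%n. ennreal (kernel_form (%t. b n \<bar>t\<bar>) f f))"
  by (rule Liminf_mono) (use low(1) in \<open>auto intro!: always_eventually\<close>)
 also have "\<dots> = ennreal (kernel_form B f f)"
  by (rule lim_imp_Liminf[OF sequentially_bot tendsto_ennrealI[OF K]])
 finally show "(\<integral>\<^sup>+ r. ennreal (\<rho>\<eta> r) * window_energy f r \<partial>lborel) <= ennreal (kernel_form B f f)" .
qed

lemma kernel_psd: "psd_form L2_bounded_support (kernel_form B)"
proof (rule psd_form.intro)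
 show "kernel_form B f g = kernel_form B g f" if "f \<in> L2_bounded_support" "g \<in> L2_bounded_support" for f g
  by (rule kernel_form_sym[OF B_local _ that]) (use even in simp)
 show "0 <= kernel_form B f f" if "f \<in> L2_bounded_support" for f
  using L2_bounded_supportE[OF that] energy_lower(2) by metis
qed (simp_all add: L2_bounded_support_subspace kernel_form_add[OF B_local] kernel_form_scale)

text \<open>Evaluations of the indefinite integral are bounded for the norm of the form, so they
  make sense on the completion. The energies are in fact of order \<open>r^2\<close> up to a power
  of the logarithm; giving up half a power of \<open>r\<close> absorbs the logarithm and still
  suffices for the chaining.\<close>

lemma cum_bound:
 assumes ac: "a < c"
 shows "\<exists>C\<ge>0. \<forall>f\<in>L2_on a c. \<forall>x. (cum f x)^2 <= C * kernel_form B f f"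
proof -
 define \<delta> where "\<delta> = \<eta> / 2"
 have d: "\<delta> > 0" "\<delta> < \<eta>" unfolding \<delta>_def using eta_props(1) by auto
 \<comment> \<open>The largest value of \<open>r powr (1/2) * (- ln r) powr \<alpha>\<close> up to
   \<open>\<eta>\<close>, where this function is increasing.\<close>
 define C0 where "C0 = \<eta> powr (1/2) * (- ln \<eta>) powr \<alpha>"
 have C0: "C0 \<ge> 0" unfolding C0_def by simp
 obtain C where C: "!!f k x. f \<in> L2_on a c ==> 0 <= k ==>
  (!!r. 0 < r ==> r <= \<delta> ==> window_energy f r <= ennreal (k * r powr (3/2))) ==> (cum f x)\<^sup>2 <= C * k"
  using cum_sup_bound[OF ac d(1)] by blast
 have "(cum f x)^2 <= (\<bar>C\<bar> * 4 * C0) * kernel_form B f f" if f: "f \<in> L2_on a c" for f x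
 proof -
  define k where "k = kernel_form B f f"
  have k: "0 <= k" unfolding k_def by (rule energy_lower(2)[OF f])
  have "(cum f x)^2 <= C * (4 * C0 * k)"
  proof (rule C[OF f])
   show "0 <= 4 * C0 * k" using C0 k by simp
   fix r assume r: "0 < r" "r <= \<delta>"
   have r1: "r < \<eta>" "r < 1" using r d eta_lt eta_props(1) by auto
   have rr: "\<rho>\<eta> r = \<rho> r" unfolding \<rho>\<eta>_def using r r1 by simp
   have "window_energy f r <= ennreal (4 * k / (r * \<rho>\<eta> r))"
   proof (rule window_energy_bound[OF L2_onD(1)[OF f] rho_eta_measurable])
    show "\<rho>\<eta> r <= \<rho>\<eta> s" if "0 < s" "s < r" for s
     using rho_antimono[of s r] that r r1 eta_props(1) by (simp add: \<rho>\<eta>_def)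
    show "0 < \<rho>\<eta> r" using B2_bounds(3)[of r] rr r r1 eta_props(1) by simp
   qed (use r energy_lower(1)[OF f] k k_def in auto)
   also have "4 * k / (r * \<rho>\<eta> r) = 4 * k * (r powr (3/2) * (r powr (1/2) * (- ln r) powr \<alpha>))"
   proof -
    have "r powr (3/2) * r powr (1/2) = r\<^sup>2" using r by (simp add: powr_add[symmetric] powr_numeral)
    then have e: "r powr (3/2) * (r powr (1/2) * (- ln r) powr \<alpha>) = r\<^sup>2 * (- ln r) powr \<alpha>" by (simp add: mult.assoc[symmetric])
    have "1 / (r * \<rho> r) = r\<^sup>2 * (- ln r) powr \<alpha>"
     unfolding \<rho>_def using r r1 by (simp add: powr_minus field_simps power2_eq_square power3_eq_cube)
    then show ?thesis unfolding e rr by (metis times_divide_eq_right mult.right_neutral)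
   qed
   also have "4 * k * (r powr (3/2) * (r powr (1/2) * (- ln r) powr \<alpha>)) <= 4 * k * (r powr (3/2) * C0)"
   proof (intro mult_left_mono)
    show "r powr (1/2) * (- ln r) powr \<alpha> <= C0"
     unfolding C0_def by (rule powr_ln_powr_mono[of \<eta>]) (use r r1 eta_props(1) eta_lt ln_ge[of \<eta>] alpha in auto)
   qed (use k in auto)
   finally show "window_energy f r <= ennreal (4 * C0 * k * r powr (3/2))"
    by (simp add: mult_ac ennreal_leI)
  qed
  also have "C * (4 * C0 * k) <= \<bar>C\<bar> * (4 * C0 * k)" using C0 k by (intro mult_right_mono) auto
  finally show ?thesis unfolding k_def by (simp add: mult_ac)
 qed
 then show ?thesis using C0 by (intro exI[of _ "\<bar>C\<bar> * 4 * C0"]) auto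
qed

text \<open>For \<open>0 < u < 1\<close> this is \<open>\<alpha> - 1\<close> times the integral over
  \<open>0 < r < u\<close> of \<open>\<rho> r * (r / u)^2\<close>, which is what the Hardy
  inequalities of the single widths add up to.\<close>

definition weight :: "real => real" where "weight u = (- ln u) powr (1 - \<alpha>) / u\<^sup>2"

lemma weight_measurable [measurable]: "weight \<in> borel_measurable borel"
 unfolding weight_def[abs_def] by measurable

text \<open>The Hardy inequality at width \<open>r\<close> is integrated against
  \<open>\<rho>\<eta> r\<close>, and in \<open>u\<close> only widths \<open>r < u\<close> are kept,
  where \<open>r / (u + r)\<close> is at least \<open>r / (2 * u)\<close>. The constant collects 4
  from the inequality, 4 from this square and \<open>\<alpha> - 1\<close> from the weight. Left and
  right sides differ only in the hypothesis on \<open>\<phi>\<close>.\<close>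

lemma hardy_weight:
 assumes f: "f \<in> L2_on a c" and [measurable]: "\<phi> \<in> borel_measurable borel"
  and H: "!!r. r > 0 ==> (\<integral>\<^sup>+ u. ennreal ((\<phi> u)^2 * (r / (u + r))^2 / 4) * indicator {0<..<\<eta>} u \<partial>lborel) <= window_energy f r"
 shows "(\<integral>\<^sup>+ u. ennreal ((\<phi> u)^2 * weight u) * indicator {0<..<\<eta>} u \<partial>lborel) <= ennreal (16 * (\<alpha> - 1) * kernel_form B f f)"
proof -
 define G where "G = (%u r. ennreal (\<rho>\<eta> r) * (ennreal ((\<phi> u)^2 * (r / (u + r))^2 / 4) * indicator {0<..<\<eta>} u))"
 have [measurable]: "case_prod G \<in> borel_measurable lborel2" unfolding G_def by measurable
 have inner: "ennreal ((\<phi> u)^2 * weight u) * indicator {0<..<\<eta>} u <= ennreal (16 * (\<alpha> - 1)) * (\<integral>\<^sup>+ r. G u r \<partial>lborel)" for u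
 proof (cases "0 < u & u < \<eta>")
  case True
  have u: "0 < u" "u < 1" using True eta_lt eta_props(1) by auto
  have "ennreal ((\<phi> u)^2 / (16 * u\<^sup>2)) * ennreal ((- ln u) powr (1 - \<alpha>) / (\<alpha> - 1))
    = ennreal ((\<phi> u)^2 / (16 * u\<^sup>2)) * (\<integral>\<^sup>+ r. ennreal ((- ln r) powr (- \<alpha>) / r) * indicator {0<..<u} r \<partial>lborel)"
   using nn_integral_inverse_ln_powr(2)[OF alpha u] by simp
  also have "\<dots> = (\<integral>\<^sup>+ r. ennreal ((\<phi> u)^2 / (16 * u\<^sup>2)) * (ennreal ((- ln r) powr (- \<alpha>) / r) * indicator {0<..<u} r) \<partial>lborel)"
   by (rule nn_integral_cmult[symmetric]) measurable
  also have "\<dots> <= (\<integral>\<^sup>+ r. G u r \<partial>lborel)"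
  proof (intro nn_integral_mono)
   fix r
   show "ennreal ((\<phi> u)^2 / (16 * u\<^sup>2)) * (ennreal ((- ln r) powr (- \<alpha>) / r) * indicator {0<..<u} r) <= G u r"
   proof (cases "0 < r & r < u")
    case r: True
    have rr: "\<rho>\<eta> r = \<rho> r" "0 < \<rho> r" using r True B2_bounds(3)[of r] eta_props(1) unfolding \<rho>\<eta>_def by auto
    have "(\<phi> u)^2 / (16 * u\<^sup>2) * ((- ln r) powr (- \<alpha>) / r) = \<rho> r * ((\<phi> u)^2 * (r / (2 * u))^2 / 4)"
     unfolding \<rho>_def using r by (simp add: field_simps power2_eq_square power3_eq_cube)
    also have "\<dots> <= \<rho> r * ((\<phi> u)^2 * (r / (u + r))^2 / 4)"
    proof -
     have "r / (2 * u) <= r / (u + r)" using r u by (intro divide_left_mono) auto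
     then have "(r / (2 * u))^2 <= (r / (u + r))^2" using r u by (intro power_mono) auto
     then show ?thesis using rr by (intro mult_left_mono divide_right_mono) auto
    qed
    finally have "ennreal ((\<phi> u)^2 / (16 * u\<^sup>2) * ((- ln r) powr (- \<alpha>) / r)) <= ennreal (\<rho> r * ((\<phi> u)^2 * (r / (u + r))^2 / 4))"
     by (rule ennreal_leI)
    then show ?thesis unfolding G_def rr(1) using r True rr(2) by (simp add: ennreal_mult'[symmetric] ennreal_mult''[symmetric])
   qed simp
  qed
  finally have "ennreal (16 * (\<alpha> - 1)) * (ennreal ((\<phi> u)^2 / (16 * u\<^sup>2)) * ennreal ((- ln u) powr (1 - \<alpha>) / (\<alpha> - 1)))
   <= ennreal (16 * (\<alpha> - 1)) * (\<integral>\<^sup>+ r. G u r \<partial>lborel)" by (rule mult_left_mono) simp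
  moreover have "ennreal (16 * (\<alpha> - 1)) * (ennreal ((\<phi> u)^2 / (16 * u\<^sup>2)) * ennreal ((- ln u) powr (1 - \<alpha>) / (\<alpha> - 1))) = ennreal ((\<phi> u)^2 * weight u)"
  proof -
   have "16 * (\<alpha> - 1) * ((\<phi> u)^2 / (16 * u\<^sup>2) * ((- ln u) powr (1 - \<alpha>) / (\<alpha> - 1))) = (\<phi> u)^2 * weight u"
   proof -
    have cancel: "16 * d * (y / (16 * v) * (w / d)) = y * (w / v)" if "d ~= 0" "v ~= 0" for d y v w :: real
     using that by (simp add: field_simps)
    show ?thesis unfolding weight_def by (rule cancel) (use alpha u in simp_all)
   qed
   then show ?thesis using alpha by (subst ennreal_mult[symmetric], simp, simp, subst ennreal_mult[symmetric], simp_all)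
  qed
  ultimately show ?thesis using True by simp
 qed simp
 have "(\<integral>\<^sup>+ u. ennreal ((\<phi> u)^2 * weight u) * indicator {0<..<\<eta>} u \<partial>lborel) <= (\<integral>\<^sup>+ u. ennreal (16 * (\<alpha> - 1)) * (\<integral>\<^sup>+ r. G u r \<partial>lborel) \<partial>lborel)"
  by (intro nn_integral_mono inner)
 also have "\<dots> = ennreal (16 * (\<alpha> - 1)) * (\<integral>\<^sup>+ u. (\<integral>\<^sup>+ r. G u r \<partial>lborel) \<partial>lborel)"
  by (rule nn_integral_cmult) measurable
 also have "(\<integral>\<^sup>+ u. (\<integral>\<^sup>+ r. G u r \<partial>lborel) \<partial>lborel) = (\<integral>\<^sup>+ r. (\<integral>\<^sup>+ u. G u r \<partial>lborel) \<partial>lborel)"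
  by (rule lborel_pair.Fubini'[symmetric]) measurable
 also have "\<dots> <= (\<integral>\<^sup>+ r. ennreal (\<rho>\<eta> r) * window_energy f r \<partial>lborel)"
 proof (intro nn_integral_mono)
  fix r
  have "(\<integral>\<^sup>+ u. G u r \<partial>lborel) = ennreal (\<rho>\<eta> r) * (\<integral>\<^sup>+ u. ennreal ((\<phi> u)^2 * (r / (u + r))^2 / 4) * indicator {0<..<\<eta>} u \<partial>lborel)"
   unfolding G_def by (rule nn_integral_cmult) measurable
  also have "\<dots> <= ennreal (\<rho>\<eta> r) * window_energy f r"
   using H[of r] by (cases "r > 0") (auto intro: mult_left_mono simp: \<rho>\<eta>_def)
  finally show "(\<integral>\<^sup>+ u. G u r \<partial>lborel) <= ennreal (\<rho>\<eta> r) * window_energy f r" .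
 qed
 also have "\<dots> <= ennreal (kernel_form B f f)" by (rule energy_lower(1)[OF f])
 also have "ennreal (16 * (\<alpha> - 1)) * ennreal (kernel_form B f f) = ennreal (16 * (\<alpha> - 1) * kernel_form B f f)"
  using alpha energy_lower(2)[OF f] by (subst ennreal_mult[symmetric]) auto
 finally show ?thesis by (simp add: mult_left_mono)
qed

end

section \<open>The Hilbert-Schmidt estimate\<close>

lemma cum_add:
 assumes "h \<in> L2_on a c" "h' \<in> L2_on a c" shows "cum (h + h') y = cum h y + cum h' y"
proof -
 have "(\<integral>s. (if s <= y then h s else 0) + (if s <= y then h' s else 0) \<partial>lborel) = cum h y + cum h' y"
  unfolding cum_def by (intro Bochner_Integration.integral_add integrable_if L2_on_integrable[OF assms(1)] L2_on_integrable[OF assms(2)]) measurable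
 moreover have "(%s. (if s <= y then h s else 0) + (if s <= y then h' s else 0)) = (%s. if s <= y then (h + h') s else 0)" by auto
 ultimately show ?thesis unfolding cum_def by simp
qed

lemma cum_scale: "cum (k *\<^sub>R h) y = k * cum h y"
proof -
 have "(%s. if s <= y then (k *\<^sub>R h) s else 0) = (%s. k * (if s <= y then h s else 0))" by auto
 then show ?thesis unfolding cum_def by (simp only: integral_mult_right_zero)
qed

lemma cum_increment_linear: "linear_map_on (L2_on a c) (%h. cum h y - cum h x)"
 unfolding linear_map_on_def by (auto simp: cum_add cum_scale right_diff_distrib)

text \<open>The duality argument of \<open>bessel_analysis\<close> for a bounded functional that
  need not be given by a vector, since the space is not complete: it is tested on the combination
  with coefficients \<open>l (x i)\<close>.\<close>

lemma (in psd_form) bessel_functional: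
 fixes l :: "'a => real"
 assumes S: "subspace S" "S <= D" and x: "bessel (ip_norm ip) A x" "x ` A <= S"
  and l: "linear_map_on S l" and le: "!!y. y \<in> S ==> (l y)\<^sup>2 <= \<kappa> * ip y y" and \<kappa>: "0 <= \<kappa>"
 shows "(\<Sum>i\<in>A. (l (x i))^2) <= \<kappa>"
proof -
 define s where "s = (\<Sum>i\<in>A. (l (x i))^2)"
 define y where "y = (\<Sum>i\<in>A. l (x i) *\<^sub>R x i)"
 have yS: "y \<in> S" unfolding y_def using x(2) by (intro subspace_sum[OF S(1)] subspace_scale[OF S(1)]) auto
 have "l y = s" unfolding y_def s_def using linear_map_on_sum[OF l S(1) x(2)] by (simp add: power2_eq_square)
 then have "s\<^sup>2 <= \<kappa> * (ip_norm ip y)^2" using le[OF yS] norm_sq[of y] yS S(2) by auto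
 also have "\<dots> <= \<kappa> * s" unfolding y_def s_def using x(1) \<kappa> unfolding bessel_def by (intro mult_left_mono) auto
 finally have "s * s <= \<kappa> * s" by (simp add: power2_eq_square)
 moreover have "0 <= s" unfolding s_def by (intro sum_nonneg) simp
 ultimately show ?thesis unfolding s_def[symmetric] using \<kappa> by (cases "s = 0") (auto simp: mult_le_cancel_right)
qed

text \<open>With \<open>t\<^sub>i\<close> the integrals, the sum of their squares is the integral of \<open>\<Sum>\<^sub>i t\<^sub>i p\<^sub>i q\<^sub>i\<close>.\<close>

lemma bounded_mixture_sum:
 fixes p q :: "nat => 'z => real" and h :: "'z => real"
 assumes A: "finite A" and h: "integrable M h" "(\<integral>z. h z \<partial>M) <= H" "!!z. 0 <= h z"
  and m: "!!i. p i \<in> borel_measurable M" "!!i. q i \<in> borel_measurable M"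
  and P: "!!z. (\<Sum>i\<in>A. (p i z)^2) <= P" and Q: "!!z i. i \<in> A ==> (q i z)\<^sup>2 <= Q" "0 <= Q"
 shows "(\<Sum>i\<in>A. (\<integral>z. h z * (p i z * q i z) \<partial>M)^2) <= P * Q * H\<^sup>2"
proof -
 note [measurable] = m borel_measurable_integrable[OF h(1)]
 define t where "t = (%i. \<integral>z. h z * (p i z * q i z) \<partial>M)"
 define T where "T = (\<Sum>i\<in>A. (t i)^2)"
 have T0: "0 <= T" unfolding T_def by (intro sum_nonneg) simp
 have P0: "0 <= P" by (rule order_trans[OF _ P]) (intro sum_nonneg, simp)
 have pP: "(p i z)^2 <= P" if "i \<in> A" for i z
  by (rule order_trans[OF member_le_sum P]) (use that A in auto)
 have I: "integrable M (%z. h z * (p i z * q i z))" if i: "i \<in> A" for i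
 proof (rule Bochner_Integration.integrable_bound[where f = "%z. h z * ((P + Q) / 2)"])
  show "AE z in M. norm (h z * (p i z * q i z)) <= norm (h z * ((P + Q) / 2))"
  proof (rule AE_I2)
   fix z
   have "2 * (\<bar>p i z\<bar> * \<bar>q i z\<bar>) <= (p i z)^2 + (q i z)^2"
    using zero_le_power2[of "\<bar>p i z\<bar> - \<bar>q i z\<bar>"] by (simp add: power2_diff)
   then have "\<bar>p i z * q i z\<bar> <= (P + Q) / 2" using pP[OF i, of z] Q(1)[OF i, of z] by (simp add: abs_mult)
   then have "h z * \<bar>p i z * q i z\<bar> <= h z * ((P + Q) / 2)" by (intro mult_left_mono h(3))
   then show "norm (h z * (p i z * q i z)) <= norm (h z * ((P + Q) / 2))"
    using h(3)[of z] P0 Q(2) by (simp add: abs_mult)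
  qed
 qed (use h(1) in auto)
 have "0 <= (\<integral>z. h z \<partial>M)" by (intro Bochner_Integration.integral_nonneg h(3))
 then have H0: "0 <= H" using h(2) by linarith
 have "T = (\<integral>z. (\<Sum>i\<in>A. t i * (h z * (p i z * q i z))) \<partial>M)"
  unfolding T_def using I by (subst Bochner_Integration.integral_sum) (auto simp: power2_eq_square t_def)
 also have "\<dots> <= (\<integral>z. h z * sqrt (T * (P * Q)) \<partial>M)"
 proof (rule integral_mono)
  fix z
  have "(\<Sum>i\<in>A. t i * (p i z * q i z))^2 <= T * (\<Sum>i\<in>A. (p i z * q i z)^2)"
   unfolding T_def by (rule Cauchy_Schwarz_ineq_sum)
  also have "\<dots> <= T * (\<Sum>i\<in>A. (p i z)^2 * Q)"
   by (intro mult_left_mono sum_mono T0) (simp add: power_mult_distrib mult_left_mono Q)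
  also have "\<dots> <= T * (P * Q)" unfolding sum_distrib_right[symmetric]
   by (intro mult_left_mono mult_right_mono T0 Q(2) P)
  finally have "(\<Sum>i\<in>A. t i * (p i z * q i z)) <= sqrt (T * (P * Q))" by (intro real_le_rsqrt)
  then have "h z * (\<Sum>i\<in>A. t i * (p i z * q i z)) <= h z * sqrt (T * (P * Q))" by (intro mult_left_mono h(3))
  then show "(\<Sum>i\<in>A. t i * (h z * (p i z * q i z))) <= h z * sqrt (T * (P * Q))"
   by (simp add: sum_distrib_left algebra_simps)
 qed (use I h(1) in \<open>auto intro!: Bochner_Integration.integrable_sum\<close>)
 also have "\<dots> = (\<integral>z. h z \<partial>M) * sqrt (T * (P * Q))" by simp
 also have "\<dots> <= H * sqrt (T * (P * Q))" using T0 P0 Q(2) by (intro mult_right_mono h(2)) simp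
 finally have "T\<^sup>2 <= (H * sqrt (T * (P * Q)))^2" using T0 by (intro power_mono)
 then have "T * T <= (P * Q * H\<^sup>2) * T" using T0 P0 Q(2) by (simp add: power_mult_distrib power2_eq_square algebra_simps)
 then have "T <= P * Q * H\<^sup>2" using T0 P0 Q(2) by (cases "T = 0") (auto simp: mult_le_cancel_right)
 then show ?thesis unfolding T_def t_def .
qed

text \<open>The weight may vanish; the second hypothesis on \<open>w\<close> makes the integrand on
  the left vanish there, and the quotient by 0 is 0, so nothing is lost.\<close>

lemma weighted_Cauchy_Schwarz:
 fixes u v w :: "'z => real"
 assumes [measurable]: "u \<in> borel_measurable M" "v \<in> borel_measurable M" "w \<in> borel_measurable M"
  and w: "!!x. 0 <= w x" "!!x. u x * v x ~= 0 ==> w x ~= 0"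
 shows "ennreal ((\<integral>x. u x * v x \<partial>M)^2) <= (\<integral>\<^sup>+ x. ennreal ((u x)^2 * w x) \<partial>M) * (\<integral>\<^sup>+ x. ennreal ((v x)^2 / w x) \<partial>M)"
proof -
 have "ennreal \<bar>\<integral>x. u x * v x \<partial>M\<bar> <= (\<integral>\<^sup>+ x. ennreal \<bar>u x * v x\<bar> \<partial>M)"
  using integral_norm_bound_ennreal[of M "%x. u x * v x"] by (cases "integrable M (%x. u x * v x)") (simp_all add: not_integrable_integral_eq)
 also have "\<dots> = (\<integral>\<^sup>+ x. ennreal (\<bar>u x\<bar> * sqrt (w x)) * ennreal (\<bar>v x\<bar> / sqrt (w x)) \<partial>M)"
 proof (rule nn_integral_cong)
  fix x
  have "\<bar>u x * v x\<bar> = (\<bar>u x\<bar> * sqrt (w x)) * (\<bar>v x\<bar> / sqrt (w x))"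
   using w(2)[of x] by (cases "u x * v x = 0") (auto simp: abs_mult)
  then show "ennreal \<bar>u x * v x\<bar> = ennreal (\<bar>u x\<bar> * sqrt (w x)) * ennreal (\<bar>v x\<bar> / sqrt (w x))"
   using w(1)[of x] by (simp only: ennreal_mult'[symmetric] mult_nonneg_nonneg abs_ge_zero real_sqrt_ge_zero)
 qed
 finally have "(ennreal \<bar>\<integral>x. u x * v x \<partial>M\<bar>)^2 <= (\<integral>\<^sup>+ x. ennreal (\<bar>u x\<bar> * sqrt (w x)) * ennreal (\<bar>v x\<bar> / sqrt (w x)) \<partial>M)^2"
  by (intro power_mono) simp_all
 also have "\<dots> <= (\<integral>\<^sup>+ x. (ennreal (\<bar>u x\<bar> * sqrt (w x)))^2 \<partial>M) * (\<integral>\<^sup>+ x. (ennreal (\<bar>v x\<bar> / sqrt (w x)))^2 \<partial>M)"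
  by (rule Cauchy_Schwarz_nn_integral) measurable
 also have "\<dots> = (\<integral>\<^sup>+ x. ennreal ((u x)^2 * w x) \<partial>M) * (\<integral>\<^sup>+ x. ennreal ((v x)^2 / w x) \<partial>M)"
  using w(1) by (simp add: ennreal_power power_mult_distrib power_divide)
 finally show ?thesis by (simp add: ennreal_power)
qed

context log_kernel
begin

lemma weight_pos: "0 < u ==> u < \<eta> ==> 0 < weight u"
 unfolding weight_def using eta_props(1) eta_lt by simp

lemma weight_antimono: "0 < s ==> s <= t ==> t < \<eta> ==> weight t <= weight s"
proof -
 assume st: "0 < s" "s <= t" "t < \<eta>"
 have e: "0 < \<eta>" "\<eta> < 1" using eta_props(1) eta_lt by auto
 have L: "6 * \<alpha> + 6 <= - ln \<eta>" "6 * \<alpha> + 6 <= - ln s" "6 * \<alpha> + 6 <= - ln t" using ln_ge[of \<eta>] ln_ge[of s] ln_ge[of t] e st by auto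
 have inv: "weight u = 1 / (u powr 2 * (- ln u) powr (\<alpha> - 1))" if "0 < u" "0 < - ln u" for u
  using that powr_minus_divide[of "- ln u" "\<alpha> - 1"] by (simp add: weight_def powr_numeral)
 have "s powr 2 * (- ln s) powr (\<alpha> - 1) <= t powr 2 * (- ln t) powr (\<alpha> - 1)"
  by (rule powr_ln_powr_mono[OF e]) (use L st alpha in auto)
 moreover have p: "0 < - ln s" "0 < - ln t" using L alpha by linarith+
 moreover have "0 < s powr 2 * (- ln s) powr (\<alpha> - 1)" using st p by simp
 ultimately show ?thesis unfolding inv[OF st(1) p(1)] inv[OF less_le_trans[OF st(1,2)] p(2)] by (intro frac_le) simp_all
qed

text \<open>\<open>\<rho> r / weight r\<close> is \<open>1 / (r * (- ln r))\<close>: the powers of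
  the logarithm that depend on \<alpha> cancel.\<close>

lemma weighted_rho_square:
 assumes r: "0 < r" "r < \<eta>"
 shows "(\<rho> r / weight r)^2 * r = (- ln r) powr (- 2) / r"
proof -
 have L: "0 < - ln r" using r eta_lt eta_props(1) by simp
 define P W where "P = (- ln r) powr (- 1)" and "W = (- ln r) powr (1 - \<alpha>)"
 have "(- ln r) powr (- \<alpha>) = (- ln r) powr (- 1 + (1 - \<alpha>))" by simp
 also have "\<dots> = P * W" unfolding P_def W_def by (rule powr_add)
 finally have PW: "(- ln r) powr (- \<alpha>) = P * W" .
 have "(P * W / r ^ 3) / (W / r\<^sup>2) = P / r" using r L unfolding W_def by (simp add: power3_eq_cube power2_eq_square)
 then have "\<rho> r / weight r = P / r" unfolding \<rho>_def weight_def PW W_def .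
 moreover have "P\<^sup>2 = (- ln r) powr (- 2)"
 proof -
  have "(- ln r) powr (- 2) = (- ln r) powr (- 1 + - 1)" by simp
  also have "\<dots> = P * P" unfolding P_def by (rule powr_add)
  finally show ?thesis by (simp only: power2_eq_square)
 qed
 ultimately show ?thesis using r by (simp add: power_divide power2_eq_square)
qed

text \<open>Only windows containing \<open>p\<close> in their interior contribute, and there the
  double integral factors into \<open>\<phi>\<close>, which depends on \<open>f i\<close>, and
  \<open>cum (g i) (x + r)\<close>. Cauchy-Schwarz with the weight in \<open>p - x\<close> uses the
  Hardy bound for each \<open>f i\<close>. For fixed \<open>x\<close> the remaining factor is a
  bounded functional of \<open>g i\<close>, so its squares can be summed over the whole
  family.\<close>

lemma near_diagonal_bound:
 fixes m :: "real => real" and f g :: "nat => real => real"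
 assumes [measurable]: "m \<in> borel_measurable borel" and m: "!!r. 0 <= m r" "!!r. m r <= 3 * \<rho>\<eta> r"
  and f: "bessel (ip_norm (kernel_form B)) A f" "!!i. f i \<in> L2_on a p"
  and g: "bessel (ip_norm (kernel_form B)) A g" "!!i. g i \<in> L2_on p c"
  and I: "!!i. integrable lborel2 (%z. m (snd z) * ((cum (f i) (fst z + snd z) - cum (f i) (fst z)) * (cum (g i) (fst z + snd z) - cum (g i) (fst z))))"
 shows "(\<Sum>i\<in>A. (\<integral>z. m (snd z) * ((cum (f i) (fst z + snd z) - cum (f i) (fst z)) * (cum (g i) (fst z + snd z) - cum (g i) (fst z))) \<partial>lborel2)^2)
  <= (16 * (\<alpha> - 1))^2 * 9 / (- ln \<eta>)"
proof -
 interpret psd_form L2_bounded_support "kernel_form B" by (rule kernel_psd)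
 have A: "finite A" using f(1) unfolding bessel_def by blast
 have fm[measurable]: "f i \<in> borel_measurable borel" "g i \<in> borel_measurable borel" for i
  using L2_onD(1)[OF f(2)] L2_onD(1)[OF g(2)] by auto
 define \<beta> where "\<beta> = 16 * (\<alpha> - 1)"
 have \<beta>: "\<beta> > 0" unfolding \<beta>_def using alpha by simp
 have m0: "m r = 0" if "\<not> (0 < r & r < \<eta>)" for r using m(1)[of r] m(2)[of r] that unfolding \<rho>\<eta>_def by auto
 have m3: "(m r)^2 <= 9 * (\<rho>\<eta> r)^2" for r
  using power_mono[OF m(2) m(1), of r 2] by (simp add: power_mult_distrib)
 define G where "G = (%h x. \<integral>r. m r * cum h (x + r) \<partial>lborel)"
 \<comment> \<open>For a window with \<open>x < p < x + r\<close> the right end lies where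
   \<open>cum (f i)\<close> is constant and the left end where \<open>cum (g i)\<close> is 0, so the
   increments are \<open>\<phi> i x\<close> and \<open>cum (g i) (x + r)\<close>.\<close>
 define \<phi> where "\<phi> = (%i x. if x < p then cum (f i) p - cum (f i) x else 0)"
 have [measurable]: "\<phi> i \<in> borel_measurable borel" "(%x. G (g i) x) \<in> borel_measurable borel" for i
  unfolding \<phi>_def G_def by measurable
 have t: "(\<integral>z. m (snd z) * ((cum (f i) (fst z + snd z) - cum (f i) (fst z)) * (cum (g i) (fst z + snd z) - cum (g i) (fst z))) \<partial>lborel2)
   = (\<integral>x. \<phi> i x * G (g i) x \<partial>lborel)" for i
 proof -
  have "m r * ((cum (f i) (x + r) - cum (f i) x) * (cum (g i) (x + r) - cum (g i) x)) = \<phi> i x * (m r * cum (g i) (x + r))" for x r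
  proof (cases "0 < r")
   case True
   show ?thesis
   proof (cases "x < p")
    case x: True
    have "cum (g i) x = 0" by (rule cum_left[OF g(2)]) (use x in simp)
    moreover have "cum (f i) (x + r) = cum (f i) p \<or> cum (g i) (x + r) = 0"
     using cum_right[OF f(2), of p i] cum_right[OF f(2), of "x + r" i] cum_left[OF g(2), of "x + r" i] by linarith
    ultimately show ?thesis unfolding \<phi>_def using x by auto
   next
    case False
    then have "cum (f i) (x + r) = cum (f i) x"
     using cum_right[OF f(2), of x i] cum_right[OF f(2), of "x + r" i] True by simp
    then show ?thesis using False unfolding \<phi>_def by simp
   qed
  qed (use m0[of r] in simp)
  note eq = this
  show ?thesis
   by (subst lborel_pair.integral_fst'[OF I[of i], symmetric]) (simp only: fst_conv snd_conv eq G_def integral_mult_right_zero)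
 qed
 \<comment> \<open>Zero outside the \<open>\<eta>\<close>-neighbourhood on the left of
   \<open>p\<close>, where the product \<open>\<phi> i x * G (g i) x\<close> vanishes as well
   because \<open>m\<close> lives on widths below \<open>\<eta>\<close>.\<close>
 define w where "w = (%x. if p - \<eta> < x & x < p then weight (p - x) else 0)"
 have wm[measurable]: "w \<in> borel_measurable borel" unfolding w_def by measurable
 have w0: "0 <= w x" for x unfolding w_def using weight_pos[of "p - x"] by auto
 have Gz: "G (g i) x = 0" if "x <= p - \<eta>" for i x
 proof -
  have "m r * cum (g i) (x + r) = 0" for r
   using m0[of r] cum_left[OF g(2), of "x + r" i] that by (cases "r < \<eta>") auto
  note eq = this
  show ?thesis unfolding G_def eq by simp
 qed
 have wz: "w x ~= 0" if "\<phi> i x * G (g i) x ~= 0" for i x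
 proof -
  have "x < p" using that unfolding \<phi>_def by (auto split: if_splits)
  moreover have "p - \<eta> < x" using that Gz[of x i] by (cases "p - \<eta> < x") auto
  ultimately show ?thesis unfolding w_def using weight_pos[of "p - x"] by auto
 qed
 have F1: "(\<integral>\<^sup>+ x. ennreal ((\<phi> i x)^2 * w x) \<partial>lborel) <= ennreal \<beta>" if i: "i \<in> A" for i
 proof -
  have "(\<integral>\<^sup>+ x. ennreal ((\<phi> i x)^2 * w x) \<partial>lborel) = (\<integral>\<^sup>+ u. ennreal ((\<phi> i (p + - 1 * u))^2 * w (p + - 1 * u)) \<partial>lborel)"
   by (subst nn_integral_real_affine[where c = "-1" and t = p]) simp_all
  also have "\<dots> = (\<integral>\<^sup>+ u. ennreal ((cum (f i) p - cum (f i) (p - u))^2 * weight u) * indicator {0<..<\<eta>} u \<partial>lborel)"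
   by (intro nn_integral_cong) (auto simp: \<phi>_def w_def indicator_def)
  also have "\<dots> <= ennreal (\<beta> * kernel_form B (f i) (f i))"
   unfolding \<beta>_def by (rule hardy_weight[OF f(2) _ hardy_left[OF f(2)]]) simp_all
  also have "\<dots> <= ennreal (\<beta> * 1)"
   using bessel_member[OF f(1) _ i] f(2) L2_on_subset_bounded_support \<beta> by (intro ennreal_leI mult_left_mono) auto
  finally show ?thesis by simp
 qed
 \<comment> \<open>Integrating first in \<open>x\<close> turns the condition
   \<open>p - r < x < p\<close> into a factor \<open>r\<close>; the rest is the integral of
   \<open>(\<rho> / weight)^2 * r\<close>.\<close>
 define J where "J = (%x r. ennreal (9 * (\<rho>\<eta> r / weight r)^2) * indicator {p - r<..<p} x)"
 have Jm[measurable]: "case_prod J \<in> borel_measurable lborel2"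
  unfolding J_def greaterThanLessThan_iff indicator_def by measurable
 have F2: "(\<Sum>i\<in>A. ennreal ((G (g i) x)^2 / w x)) <= ennreal \<beta> * (\<integral>\<^sup>+ r. J x r \<partial>lborel)" for x
 proof (cases "p - \<eta> < x & x < p")
  case False
  then have "w x = 0" unfolding w_def by auto
  then show ?thesis by simp
 next
  case x: True
  define u where "u = p - x"
  have u: "0 < u" "u < \<eta>" "w x = weight u" "0 < weight u" using x weight_pos[of "p - x"] unfolding u_def w_def by auto
  \<comment> \<open>Bound of the functional at distance \<open>u\<close> from \<open>p\<close>,
    obtained by Cauchy-Schwarz in \<open>r\<close> against the weight in \<open>r - u\<close>, the
    distance of \<open>x + r\<close> from \<open>p\<close>; that weight is at least
    \<open>weight r\<close>.\<close>
  define \<kappa> where "\<kappa> = (\<integral>\<^sup>+ r. ennreal (9 * (\<rho>\<eta> r)^2 / weight r) * indicator {u<..<\<eta>} r \<partial>lborel)"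
  define v where "v = (%r. if u < r & r < \<eta> then weight (r - u) else 0)"
  have vm[measurable]: "v \<in> borel_measurable borel" unfolding v_def by measurable
  have G2: "ennreal ((G h x)^2) <= ennreal (\<beta> * kernel_form B h h) * \<kappa>" if h: "h \<in> L2_on p c" for h
  proof -
   note [measurable] = L2_onD(1)[OF h]
   have "ennreal ((\<integral>r. cum h (x + r) * m r \<partial>lborel)^2) <= (\<integral>\<^sup>+ r. ennreal ((cum h (x + r))^2 * v r) \<partial>lborel) * (\<integral>\<^sup>+ r. ennreal ((m r)^2 / v r) \<partial>lborel)"
   proof (rule weighted_Cauchy_Schwarz)
    show "0 <= v r" for r unfolding v_def using weight_pos[of "r - u"] u by auto
    show "v r ~= 0" if "cum h (x + r) * m r ~= 0" for r
    proof -
     have "r < \<eta>" using that m0[of r] by (cases "r < \<eta>") auto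
     moreover have "u < r" using that cum_left[OF h, of "x + r"] unfolding u_def by (cases "p < x + r") auto
     ultimately show ?thesis unfolding v_def using weight_pos[of "r - u"] u by auto
    qed
   qed simp_all
   also have "(\<integral>\<^sup>+ r. ennreal ((cum h (x + r))^2 * v r) \<partial>lborel) = (\<integral>\<^sup>+ s. ennreal ((cum h (x + (u + 1 * s)))^2 * v (u + 1 * s)) \<partial>lborel)"
    by (subst nn_integral_real_affine[where c = 1 and t = u]) simp_all
   also have "\<dots> <= (\<integral>\<^sup>+ s. ennreal ((cum h (p + s))^2 * weight s) * indicator {0<..<\<eta>} s \<partial>lborel)"
    using u by (intro nn_integral_mono) (auto simp: v_def indicator_def u_def)
   also have "\<dots> <= ennreal (\<beta> * kernel_form B h h)"
    unfolding \<beta>_def by (rule hardy_weight[OF h _ hardy_right[OF h]]) simp_all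
   also have "(\<integral>\<^sup>+ r. ennreal ((m r)^2 / v r) \<partial>lborel) <= \<kappa>"
    unfolding \<kappa>_def
   proof (rule nn_integral_mono)
    fix r
    show "ennreal ((m r)^2 / v r) <= ennreal (9 * (\<rho>\<eta> r)^2 / weight r) * indicator {u<..<\<eta>} r"
    proof (cases "u < r & r < \<eta>")
     case True
     have "weight r <= weight (r - u)" by (rule weight_antimono) (use True u in auto)
     then have "(m r)^2 / weight (r - u) <= 9 * (\<rho>\<eta> r)^2 / weight r"
      using m3[of r] weight_pos[of r] True u by (intro frac_le) auto
     then show ?thesis using True unfolding v_def by (simp add: ennreal_leI)
    next
     case False
     then have "v r = 0" unfolding v_def by auto
     then show ?thesis by simp
    qed
   qed
   finally show ?thesis unfolding G_def by (simp add: mult.commute mult_left_mono mult_right_mono)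
  qed
  \<comment> \<open>If \<open>\<kappa>\<close> is infinite the bound is trivial, as
    \<open>\<beta>\<close> is positive. Otherwise linearity of \<open>G\<close> is needed, hence
    integrability: the integrand lives on \<open>u <= r < \<eta>\<close>, away from the singularity
    of \<open>\<rho>\<close>.\<close>
  have "(\<Sum>i\<in>A. ennreal ((G (g i) x)^2)) <= ennreal \<beta> * \<kappa>"
  proof (cases "\<kappa> = top")
   case True
   then show ?thesis using \<beta> by (simp add: ennreal_mult_top)
  next
   case False
   then obtain k where k: "\<kappa> = ennreal k" "0 <= k" by (cases \<kappa>) auto
   have lin: "linear_map_on (L2_on p c) (%h. G h x)"
   proof -
    have int: "integrable lborel (%r. m r * cum h (x + r))" if h: "h \<in> L2_on p c" for h
    proof (rule Bochner_Integration.integrable_bound[where f = "%r. indicator {u..\<eta>} r *\<^sub>R (3 * \<rho> u * (\<integral>s. \<bar>h s\<bar> \<partial>lborel))"])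
     note [measurable] = L2_onD(1)[OF h]
     show "integrable lborel (%r. indicator {u..\<eta>} r *\<^sub>R (3 * \<rho> u * (\<integral>s. \<bar>h s\<bar> \<partial>lborel)))"
      by (rule integrable_scaleR_left, rule integrable_real_indicator) (simp_all add: emeasure_lborel_Icc_eq)
     show "(%r. m r * cum h (x + r)) \<in> borel_measurable lborel" by measurable
     show "AE r in lborel. norm (m r * cum h (x + r)) <= norm (indicator {u..\<eta>} r *\<^sub>R (3 * \<rho> u * (\<integral>s. \<bar>h s\<bar> \<partial>lborel)))"
     proof (rule AE_I2)
      fix r
      show "norm (m r * cum h (x + r)) <= norm (indicator {u..\<eta>} r *\<^sub>R (3 * \<rho> u * (\<integral>s. \<bar>h s\<bar> \<partial>lborel)))"
      proof (cases "u <= r & r < \<eta>")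
       case True
       have "m r <= 3 * \<rho> u" using m(2)[of r] rho_antimono[of u r] True u eta_props(1) unfolding \<rho>\<eta>_def by auto
       then have "m r * \<bar>cum h (x + r)\<bar> <= 3 * \<rho> u * (\<integral>s. \<bar>h s\<bar> \<partial>lborel)"
        using cum_bounded[OF L2_on_integrable[OF h], of "x + r"] B2_bounds(3)[of u] u m(1)[of r] by (intro mult_mono) auto
       moreover have "0 < \<rho> u" using B2_bounds(3)[OF u(1)] u(2) eta_props(1) by simp
       ultimately show ?thesis using True m(1)[of r] by (simp add: abs_mult)
      next
       case False
       then have "m r = 0 \<or> cum h (x + r) = 0"
        using m0[of r] cum_left[OF h, of "x + r"] unfolding u_def by (cases "r < \<eta>") auto
       then show ?thesis by auto
      qed
     qed
    qed
    show ?thesis unfolding linear_map_on_def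
    proof (intro conjI ballI allI)
     fix h k assume h: "h \<in> L2_on p c"
     show "G (k *\<^sub>R h) x = k *\<^sub>R G h x" for k
     proof -
      have "(%r. m r * (k * cum h (x + r))) = (%r. k * (m r * cum h (x + r)))" by auto
      then show ?thesis unfolding G_def cum_scale by (simp only: integral_mult_right_zero real_scaleR_def)
     qed
     fix h' assume h': "h' \<in> L2_on p c"
     show "G (h + h') x = G h x + G h' x" unfolding G_def cum_add[OF h h'] distrib_left
      by (rule Bochner_Integration.integral_add[OF int[OF h] int[OF h']])
    qed
   qed
   have "(\<Sum>i\<in>A. (G (g i) x)^2) <= \<beta> * k"
   proof (rule bessel_functional[OF L2_on_subspace L2_on_subset_bounded_support g(1) _ lin])
    fix h assume h: "h \<in> L2_on p c"
    then have K0: "0 <= kernel_form B h h" using nonneg L2_on_subset_bounded_support by blast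
    have "ennreal ((G h x)^2) <= ennreal (\<beta> * kernel_form B h h * k)"
     using G2[OF h] K0 k \<beta> by (simp add: ennreal_mult)
    then show "(G h x)^2 <= \<beta> * k * kernel_form B h h" using K0 k \<beta> by (simp add: ennreal_le_iff algebra_simps)
   qed (use g(2) \<beta> k in auto)
   then show ?thesis unfolding k using k \<beta> by (subst sum_ennreal) (auto simp: ennreal_mult[symmetric] ennreal_leI)
  qed
  then have "(\<Sum>i\<in>A. ennreal ((G (g i) x)^2)) * ennreal (1 / weight u) <= ennreal \<beta> * \<kappa> * ennreal (1 / weight u)"
   by (rule mult_right_mono) simp
  also have "\<dots> = ennreal \<beta> * (\<integral>\<^sup>+ r. ennreal (9 * (\<rho>\<eta> r)^2 / weight r) * indicator {u<..<\<eta>} r * ennreal (1 / weight u) \<partial>lborel)"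
   unfolding \<kappa>_def mult.assoc[symmetric] by (subst nn_integral_multc) (simp_all add: mult.assoc)
  also have "\<dots> <= ennreal \<beta> * (\<integral>\<^sup>+ r. J x r \<partial>lborel)"
  proof (intro mult_left_mono nn_integral_mono)
   fix r
   show "ennreal (9 * (\<rho>\<eta> r)^2 / weight r) * indicator {u<..<\<eta>} r * ennreal (1 / weight u) <= J x r"
   proof (cases "u < r & r < \<eta>")
    case True
    have p: "0 < weight r" "weight r <= weight u" using True u weight_pos[of r] weight_antimono[of u r] by auto
    have "9 * (\<rho>\<eta> r)^2 / weight r * (1 / weight u) <= 9 * (\<rho>\<eta> r)^2 / weight r * (1 / weight r)"
     using p by (intro mult_left_mono divide_left_mono) auto
    also have "\<dots> = 9 * (\<rho>\<eta> r / weight r)^2" by (simp add: power_divide power2_eq_square)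
    finally show ?thesis using True p u x unfolding J_def u_def
     by (simp add: ennreal_mult'[symmetric] ennreal_mult''[symmetric] ennreal_leI)
   qed auto
  qed simp
  finally show ?thesis unfolding u(3) using u(4) by (simp add: sum_distrib_right sum_divide_distrib ennreal_mult'[symmetric] ennreal_mult''[symmetric])
 qed
 \<comment> \<open>The integral over \<open>r\<close> from 0 to \<open>\<eta>\<close> of
   \<open>(- ln r) powr (-2) / r\<close> is \<open>1 / (- ln \<eta>)\<close>; the 9 is the square of
   the factor 3 in the bound of \<open>m\<close>.\<close>
 have F3: "(\<integral>\<^sup>+ x. (\<integral>\<^sup>+ r. J x r \<partial>lborel) \<partial>lborel) = ennreal (9 / (- ln \<eta>))"
 proof -
  have "(\<integral>\<^sup>+ x. (\<integral>\<^sup>+ r. J x r \<partial>lborel) \<partial>lborel) = (\<integral>\<^sup>+ r. (\<integral>\<^sup>+ x. J x r \<partial>lborel) \<partial>lborel)"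
   by (rule lborel_pair.Fubini'[symmetric]) simp
  also have "\<dots> = (\<integral>\<^sup>+ r. ennreal 9 * (ennreal ((- ln r) powr (- 2) / r) * indicator {0<..<\<eta>} r) \<partial>lborel)"
  proof (rule nn_integral_cong)
   fix r
   have e: "(\<integral>\<^sup>+ x. J x r \<partial>lborel) = ennreal (9 * (\<rho>\<eta> r / weight r)^2) * emeasure lborel {p - r<..<p}"
    unfolding J_def by (rule nn_integral_cmult_indicator) simp
   show "(\<integral>\<^sup>+ x. J x r \<partial>lborel) = ennreal 9 * (ennreal ((- ln r) powr (- 2) / r) * indicator {0<..<\<eta>} r)"
   proof (cases "0 < r & r < \<eta>")
    case True
    have "9 * (\<rho> r / weight r)^2 * r = 9 * ((- ln r) powr (- 2) / r)"
     using weighted_rho_square[of r] True by simp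
    moreover have "ennreal (9 * (\<rho> r / weight r)^2 * r) = ennreal (9 * (\<rho> r / weight r)^2) * ennreal r"
     "ennreal (9 * ((- ln r) powr (- 2) / r)) = ennreal 9 * ennreal ((- ln r) powr (- 2) / r)"
     by (rule ennreal_mult', simp)+
    moreover have "\<rho>\<eta> r = \<rho> r" "emeasure lborel {p - r<..<p} = ennreal r" using True unfolding \<rho>\<eta>_def by simp_all
    moreover have "indicator {0<..<\<eta>} r = (1 :: ennreal)" using True by simp
    ultimately show ?thesis unfolding e by (simp only: mult_1_right)
   next
    case False
    then have "\<rho>\<eta> r = 0" unfolding \<rho>\<eta>_def by auto
    then show ?thesis unfolding e using False by auto
   qed
  qed
  also have "\<dots> = ennreal 9 * ennreal ((- ln \<eta>) powr (1 - 2) / (2 - 1))"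
   using nn_integral_inverse_ln_powr(2)[of 2 \<eta>] eta_props(1) eta_lt by (subst nn_integral_cmult) auto
  also have "\<dots> = ennreal (9 / (- ln \<eta>))"
  proof -
   have L: "ln \<eta> < 0" using eta_props(1) eta_lt by simp
   have "(- ln \<eta>) powr (1 - 2) = (- ln \<eta>) powr (- 1)" by simp
   also have "\<dots> = 1 / (- ln \<eta>)" using L by (simp only: powr_minus_divide powr_one neg_0_le_iff_le less_imp_le)
   finally have "9 * ((- ln \<eta>) powr (1 - 2) / (2 - 1)) = 9 / (- ln \<eta>)" by simp
   moreover have "ennreal (9 * ((- ln \<eta>) powr (1 - 2) / (2 - 1))) = ennreal 9 * ennreal ((- ln \<eta>) powr (1 - 2) / (2 - 1))"
    by (rule ennreal_mult') simp
   ultimately show ?thesis by (simp only:)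
  qed
  finally show ?thesis .
 qed
 have "(\<Sum>i\<in>A. ennreal ((\<integral>x. \<phi> i x * G (g i) x \<partial>lborel)^2)) <= (\<Sum>i\<in>A. ennreal \<beta> * (\<integral>\<^sup>+ x. ennreal ((G (g i) x)^2 / w x) \<partial>lborel))"
 proof (rule sum_mono)
  fix i assume i: "i \<in> A"
  have "ennreal ((\<integral>x. \<phi> i x * G (g i) x \<partial>lborel)^2) <= (\<integral>\<^sup>+ x. ennreal ((\<phi> i x)^2 * w x) \<partial>lborel) * (\<integral>\<^sup>+ x. ennreal ((G (g i) x)^2 / w x) \<partial>lborel)"
   by (rule weighted_Cauchy_Schwarz[OF _ _ _ w0 wz]) simp_all
  also have "\<dots> <= ennreal \<beta> * (\<integral>\<^sup>+ x. ennreal ((G (g i) x)^2 / w x) \<partial>lborel)" by (intro mult_right_mono F1 i) simp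
  finally show "ennreal ((\<integral>x. \<phi> i x * G (g i) x \<partial>lborel)^2) <= ennreal \<beta> * (\<integral>\<^sup>+ x. ennreal ((G (g i) x)^2 / w x) \<partial>lborel)" .
 qed
 also have "\<dots> = ennreal \<beta> * (\<integral>\<^sup>+ x. (\<Sum>i\<in>A. ennreal ((G (g i) x)^2 / w x)) \<partial>lborel)"
  by (subst nn_integral_sum) (simp_all add: sum_distrib_left)
 also have "\<dots> <= ennreal \<beta> * (\<integral>\<^sup>+ x. ennreal \<beta> * (\<integral>\<^sup>+ r. J x r \<partial>lborel) \<partial>lborel)"
  by (intro mult_left_mono nn_integral_mono F2) simp
 also have "\<dots> = ennreal \<beta> * (ennreal \<beta> * ennreal (9 / (- ln \<eta>)))"
  by (subst nn_integral_cmult) (simp_all only: F3, measurable)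
 also have "\<dots> = ennreal (\<beta>\<^sup>2 * 9 / (- ln \<eta>))"
  using \<beta> ln_ge[of \<eta>] eta_props(1) alpha by (simp add: ennreal_mult'[symmetric] power2_eq_square mult.assoc)
 finally have "ennreal (\<Sum>i\<in>A. (\<integral>x. \<phi> i x * G (g i) x \<partial>lborel)^2) <= ennreal (\<beta>\<^sup>2 * 9 / (- ln \<eta>))"
  by (subst sum_ennreal[symmetric]) simp_all
 moreover have "0 <= \<beta>\<^sup>2 * 9 / (- ln \<eta>)"
  by (intro divide_nonneg_pos mult_nonneg_nonneg) (use eta_props(1) eta_lt in simp_all)
 ultimately have "(\<Sum>i\<in>A. (\<integral>x. \<phi> i x * G (g i) x \<partial>lborel)^2) <= \<beta>\<^sup>2 * 9 / (- ln \<eta>)"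
  by (simp only: ennreal_le_iff)
 then show ?thesis unfolding t \<beta>_def .
qed

end

section \<open>Hilbert-Schmidt bound between the two sides of a point\<close>

context log_kernel
begin

text \<open>The same constant bounds one increment of \<open>cum\<close> for a single function and
  the sum of its squares along a Bessel family; this is what the parts of the kernel away from the
  diagonal need.\<close>

lemma increment_bound:
 assumes ac: "a < c"
 obtains C where "0 <= C"
  "!!f x y. f \<in> L2_on a c ==> (cum f y - cum f x)\<^sup>2 <= C * kernel_form B f f"
  "!!A f x y. bessel (ip_norm (kernel_form B)) A f ==> f ` A <= L2_on a c ==> (\<Sum>i\<in>A. (cum (f i) y - cum (f i) x)^2) <= C"
proof -
 interpret psd_form L2_bounded_support "kernel_form B" by (rule kernel_psd)
 obtain C where C: "C \<ge> 0" "!!f x. f \<in> L2_on a c ==> (cum f x)\<^sup>2 <= C * kernel_form B f f"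
  using cum_bound[OF ac] by blast
 have le: "(cum f y - cum f x)^2 <= 4 * C * kernel_form B f f" if "f \<in> L2_on a c" for f x y
 proof -
  have "(cum f y - cum f x)^2 <= 2 * (cum f y)^2 + 2 * (cum f x)^2"
   using zero_le_power2[of "cum f y + cum f x"] by (simp add: power2_diff power2_sum)
  then show ?thesis using C(2)[OF that, of x] C(2)[OF that, of y] by linarith
 qed
 have "(\<Sum>i\<in>A. (cum (f i) y - cum (f i) x)^2) <= 4 * C"
  if "bessel (ip_norm (kernel_form B)) A f" "f ` A <= L2_on a c" for A f x y
  using bessel_functional[OF L2_on_subspace L2_on_subset_bounded_support that cum_increment_linear le] C(1) by simp
 note sum = this
 have "0 <= 4 * C" using C(1) by simp
 then show ?thesis by (rule that) (erule le, erule (1) sum)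
qed

text \<open>The window representation is split into four parts: the constant, the triangle of width
  \<open>R\<close>, widths below \<open>\<eta>\<close> and widths from \<open>\<eta>\<close> to
  \<open>R\<close>. Only the third is singular and needs the Hardy argument; the others have finite
  total mass on windows around \<open>p\<close>. All masses are bounded by values of
  \<open>B\<close>, so \<open>M\<close> does not depend on the smoothing.\<close>

lemma smoothed_cross_bound:
 assumes ap: "a < p" "p < c"
 shows "\<exists>M. \<forall>b b1 b2 A f g. c2_kernel b b1 b2 --> (\<forall>t>0. b t <= B t) --> (\<forall>r. 0 < r --> r < \<eta> --> b2 r <= 3 * \<rho> r) \<longrightarrow>
  bessel (ip_norm (kernel_form B)) A f --> bessel (ip_norm (kernel_form B)) A g \<longrightarrow>
  (\<forall>i. f i \<in> L2_on a p) --> (\<forall>i. g i \<in> L2_on p c) \<longrightarrow>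
  (\<Sum>i\<in>A. (kernel_form (%t. b \<bar>t\<bar>) (f i) (g i))^2) <= M"
proof -
 interpret psd_form L2_bounded_support "kernel_form B" by (rule kernel_psd)
 obtain C where C: "0 <= C" "!!f x y. f \<in> L2_on a c ==> (cum f y - cum f x)\<^sup>2 <= C * kernel_form B f f"
  "!!A f x y. bessel (ip_norm (kernel_form B)) A f ==> f ` A <= L2_on a c ==> (\<Sum>i\<in>A. (cum (f i) y - cum (f i) x)^2) <= C"
  by (rule increment_bound[OF less_trans[OF ap]]) (rule that)
 \<comment> \<open>Exceeds the diameter of the supports, as the window representation demands, and
   also \<open>\<eta>\<close>, so that the widths can be split there.\<close>
 define R where "R = c - a + \<eta>"
 have R: "0 < R" "c - a < R" "\<eta> < R" using ap eta_props(1) unfolding R_def by auto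
 define N where "N = (16 * (\<alpha> - 1))^2 * 9 / (- ln \<eta>)"
 have main: "(\<Sum>i\<in>A. (kernel_form (%t. b \<bar>t\<bar>) (f i) (g i))^2)
   <= 4 * (C * C * (B R)^2 + C * C * (2 * B (R / 2))^2 + N + C * C * (2 * B (\<eta> / 2))^2)"
  if b: "c2_kernel b b1 b2" "\<forall>t>0. b t <= B t" "\<forall>r. 0 < r --> r < \<eta> --> b2 r <= 3 * \<rho> r"
   and f: "bessel (ip_norm (kernel_form B)) A f" "\<forall>i. f i \<in> L2_on a p"
   and g: "bessel (ip_norm (kernel_form B)) A g" "\<forall>i. g i \<in> L2_on p c" for b b1 b2 A f g
 proof -
  interpret k: c2_kernel b b1 b2 by (rule b(1))
  have A: "finite A" using f(1) unfolding bessel_def by blast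
  have fa: "f i \<in> L2_on a c" "g i \<in> L2_on a c" for i
   using f(2) g(2) L2_on_mono[of a a p c] L2_on_mono[of a p c c] ap by auto
  have fs: "f ` A <= L2_on a c" "g ` A <= L2_on a c" "g ` A <= L2_bounded_support"
   using fa L2_on_subset_bounded_support[of a c] by auto
  have fm[measurable]: "f i \<in> borel_measurable borel" "g i \<in> borel_measurable borel" for i
   using L2_onD(1)[OF fa(1)] L2_onD(1)[OF fa(2)] by auto
  have P: "(\<Sum>i\<in>A. (cum (f i) y - cum (f i) x)^2) <= C" for x y by (rule C(3)[OF f(1) fs(1)])
  have Q: "(cum (g i) y - cum (g i) x)^2 <= C" if i: "i \<in> A" for i x y
  proof -
   have "C * kernel_form B (g i) (g i) <= C * 1" by (intro mult_left_mono bessel_member[OF g(1) fs(3) i] C(1))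
   then show ?thesis using C(2)[OF fa(2)[of i], of y x] by simp
  qed
  \<comment> \<open>Windows on one side of \<open>p\<close> do not contribute: left of
    \<open>p\<close> the function \<open>cum (g i)\<close> is 0, and right of \<open>p\<close> the
    function \<open>cum (f i)\<close> is constant.\<close>
  have z: "(cum (f i) (x + r) - cum (f i) x) * (cum (g i) (x + r) - cum (g i) x) = 0"
   if "0 < r" "\<not> (p - r < x & x < p)" for i x r
  proof (cases "x < p")
   case True
   then have "cum (g i) (x + r) = 0" "cum (g i) x = 0" using that by (auto intro!: cum_left[OF g(2)[rule_format]])
   then show ?thesis by simp
  next
   case False
   then have "cum (f i) (x + r) = cum (f i) x"
    using cum_right[OF f(2)[rule_format], of x i] cum_right[OF f(2)[rule_format], of "x + r" i] that by simp
   then show ?thesis by simp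
  qed
  define I where "I = (%i z. (cum (f i) (fst z + snd z) - cum (f i) (fst z)) * (cum (g i) (fst z + snd z) - cum (g i) (fst z)))"
  have Im[measurable]: "I i \<in> borel_measurable lborel2" for i unfolding I_def by measurable
  define T where "T = (%r. k.trunc2 R r - k.trunc2 \<eta> r)"
  have T: "T r = (if \<eta> <= r & r < R then b2 r else 0)" for r
   unfolding T_def k.trunc2_def using R eta_props(1) by auto
  have Tm[measurable]: "T \<in> borel_measurable borel" unfolding T_def by measurable
  have T0: "0 <= T r" for r unfolding T using k.nonneg2[of r] eta_props(1) by auto
  define h where "h = (%z :: real \<times> real. T (snd z) * indicator {p - snd z<..<p} (fst z))"
  have hm[measurable]: "h \<in> borel_measurable lborel2"
   unfolding h_def greaterThanLessThan_iff indicator_def by measurable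
  have h0: "0 <= h z" for z unfolding h_def using T0 by simp
  \<comment> \<open>The windows of width \<open>r\<close> around \<open>p\<close> have positions of
    total length \<open>r\<close>, and \<open>r <= 2 * (r - \<eta> / 2)\<close> for
    \<open>r >= \<eta>\<close>. So the mass is at most twice a Taylor remainder at
    \<open>\<eta> / 2\<close>, which is at most \<open>b (\<eta> / 2)\<close>.\<close>
  have hn: "(\<integral>\<^sup>+ z. ennreal (h z) \<partial>lborel2) <= ennreal (2 * B (\<eta> / 2))"
  proof -
   have "(\<integral>\<^sup>+ z. ennreal (h z) \<partial>lborel2) = (\<integral>\<^sup>+ r. (\<integral>\<^sup>+ x. ennreal (h (x, r)) \<partial>lborel) \<partial>lborel)"
    by (rule lborel_pair.nn_integral_snd[symmetric]) measurable
   also have "\<dots> <= (\<integral>\<^sup>+ r. ennreal 2 * ennreal (k.trunc2 R r * max 0 (r - \<eta> / 2)) \<partial>lborel)"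
   proof (rule nn_integral_mono)
    fix r
    have "(\<integral>\<^sup>+ x. ennreal (h (x, r)) \<partial>lborel) = (\<integral>\<^sup>+ x. ennreal (T r) * indicator {p - r<..<p} x \<partial>lborel)"
     unfolding h_def by (intro nn_integral_cong) (auto simp: indicator_def)
    also have "\<dots> = ennreal (T r) * emeasure lborel {p - r<..<p}" by (rule nn_integral_cmult_indicator) simp
    also have "\<dots> <= ennreal 2 * ennreal (k.trunc2 R r * max 0 (r - \<eta> / 2))"
    proof (cases "\<eta> <= r & r < R")
     case True
     have "b2 r * r <= b2 r * (2 * (r - \<eta> / 2))"
      using True k.nonneg2[of r] eta_props(1) by (intro mult_left_mono) auto
     then have "ennreal (b2 r * r) <= ennreal (2 * (b2 r * (r - \<eta> / 2)))" by (intro ennreal_leI) (simp add: algebra_simps)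
     moreover have "max 0 (r - \<eta> / 2) = r - \<eta> / 2" "0 < r" "0 <= b2 r" using True eta_props(1) k.nonneg2[of r] by auto
     moreover have "T r = b2 r" "k.trunc2 R r = b2 r" using True eta_props(1) unfolding T k.trunc2_def by auto
     moreover have "ennreal (2 * (b2 r * (r - \<eta> / 2))) = ennreal 2 * ennreal (b2 r * (r - \<eta> / 2))"
      by (rule ennreal_mult') simp
     moreover have "ennreal (b2 r) * emeasure lborel {p - r<..<p} = ennreal (b2 r * r)"
      using True eta_props(1) by (simp add: ennreal_mult'')
     ultimately show ?thesis by (simp only:)
    next
     case False
     then have "T r = 0" unfolding T by auto
     then show ?thesis by simp
    qed
    finally show "(\<integral>\<^sup>+ x. ennreal (h (x, r)) \<partial>lborel) <= ennreal 2 * ennreal (k.trunc2 R r * max 0 (r - \<eta> / 2))" .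
   qed
   also have "\<dots> = ennreal 2 * ennreal (b (\<eta> / 2) - b R - (R - \<eta> / 2) * - b1 R)"
    using k.taylor(1)[of "\<eta> / 2" R] eta_props(1) R by (subst nn_integral_cmult) auto
   also have "\<dots> <= ennreal 2 * ennreal (B (\<eta> / 2))"
   proof (intro mult_left_mono ennreal_leI)
    have "0 <= (R - \<eta> / 2) * - b1 R" using R eta_props(1) k.nonpos1[OF R(1)] by (intro mult_nonneg_nonneg) auto
    moreover have "b (\<eta> / 2) <= B (\<eta> / 2)" using b(2) eta_props(1) by simp
    ultimately show "b (\<eta> / 2) - b R - (R - \<eta> / 2) * - b1 R <= B (\<eta> / 2)" using k.nonneg0[OF R(1)] by linarith
   qed simp
   finally show ?thesis by (simp add: ennreal_mult')
  qed
  have hi: "integrable lborel2 h"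
   by (rule integrableI_nonneg) (use h0 le_less_trans[OF hn] in auto)
  have B0: "0 <= B (\<eta> / 2)" "0 <= B (R / 2)" "0 <= B R" using log_kernel.nonneg[OF log_kernel_axioms] eta_props(1) R by auto
  have hb: "(\<integral>z. h z \<partial>lborel2) <= 2 * B (\<eta> / 2)"
   using hn B0 unfolding nn_integral_eq_integral[OF hi AE_I2[OF h0]] by (simp add: ennreal_le_iff)
  define h' where "h' = (%x. - b1 R * indicator {p - R<..<p} x)"
  have hi': "integrable lborel h'" unfolding h'_def
   by (intro integrable_mult_right, rule integrable_real_indicator) (use R in simp_all)
  \<comment> \<open>Nonnegativity of the Taylor remainder at \<open>R / 2\<close> bounds the slope:
    \<open>R * - b1 R\<close> is at most \<open>2 * b (R / 2)\<close>.\<close>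
  have hb': "(\<integral>x. h' x \<partial>lborel) <= 2 * B (R / 2)"
  proof -
   have "(\<integral>x. h' x \<partial>lborel) = R * - b1 R" unfolding h'_def using R by simp
   moreover have "0 <= b (R / 2) - b R - (R - R / 2) * - b1 R" by (rule k.taylor(2)) (use R in auto)
   moreover have "b (R / 2) <= B (R / 2)" using b(2) R by simp
   ultimately show ?thesis using k.nonneg0[OF R(1)] by (simp add: algebra_simps)
  qed
  define c1 where "c1 = (%i. b R * (integral\<^sup>L lborel (f i) * integral\<^sup>L lborel (g i)))"
  define c2 where "c2 = (%i. \<integral>x. h' x * ((cum (f i) (x + R) - cum (f i) x) * (cum (g i) (x + R) - cum (g i) x)) \<partial>lborel)"
  define c3 where "c3 = (%i. \<integral>z. k.trunc2 \<eta> (snd z) * I i z \<partial>lborel2)"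
  define c4 where "c4 = (%i. \<integral>z. h z * I i z \<partial>lborel2)"
  have int: "integrable lborel2 (%z. k.trunc2 R (snd z) * I i z)" for i
   using k.kernel_form_windows(2)[OF fa R(1,2)] unfolding I_def .
  have int3: "integrable lborel2 (%z. k.trunc2 \<eta> (snd z) * I i z)" for i
  proof (rule Bochner_Integration.integrable_bound[OF int[of i]])
   have "\<bar>k.trunc2 \<eta> r\<bar> <= \<bar>k.trunc2 R r\<bar>" for r using R unfolding k.trunc2_def by auto
   then show "AE z in lborel2. norm (k.trunc2 \<eta> (snd z) * I i z) <= norm (k.trunc2 R (snd z) * I i z)"
    by (intro AE_I2) (simp add: abs_mult mult_right_mono)
  qed measurable
  have hI: "h z * I i z = k.trunc2 R (snd z) * I i z - k.trunc2 \<eta> (snd z) * I i z" for i z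
  proof -
   have "h z * I i z = T (snd z) * I i z"
    using z[of "snd z" "fst z" i] T[of "snd z"] eta_props(1) unfolding h_def I_def
    by (cases "\<eta> <= snd z & snd z < R") (auto simp: indicator_def)
   then show ?thesis unfolding T_def by (simp add: left_diff_distrib)
  qed
  have "kernel_form (%t. b \<bar>t\<bar>) (f i) (g i) = c1 i + c2 i + c3 i + c4 i" for i
  proof -
   have "c4 i = (\<integral>z. k.trunc2 R (snd z) * I i z \<partial>lborel2) - c3 i"
    unfolding c3_def c4_def hI by (rule Bochner_Integration.integral_diff[OF int int3])
   moreover have "c2 i = (- b1 R) * (\<integral>x. (cum (f i) (x + R) - cum (f i) x) * (cum (g i) (x + R) - cum (g i) x) \<partial>lborel)"
   proof -
    have "h' x * ((cum (f i) (x + R) - cum (f i) x) * (cum (g i) (x + R) - cum (g i) x))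
     = (- b1 R) * ((cum (f i) (x + R) - cum (f i) x) * (cum (g i) (x + R) - cum (g i) x))" for x
     using z[OF R(1), of x i] unfolding h'_def by (auto simp: indicator_def)
    note eq = this
    show ?thesis unfolding c2_def eq by (rule integral_mult_right_zero)
   qed
   ultimately show ?thesis using k.kernel_form_windows(1)[OF fa(1)[of i] fa(2)[of i] R(1,2)] unfolding c1_def I_def by simp
  qed
  note eq = this
  have s1: "(\<Sum>i\<in>A. (c1 i)^2) <= C * C * (B R)^2"
  proof -
   have "(c1 i)^2 <= (B R)^2 * (C * (integral\<^sup>L lborel (f i))^2)" if "i \<in> A" for i
   proof -
    have "(integral\<^sup>L lborel (g i))^2 <= C"
     using Q[OF that, of c a] cum_right[OF fa(2)[of i], of c] cum_left[OF fa(2)[of i], of a] by simp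
    moreover have "(b R)^2 <= (B R)^2" using b(2) k.nonneg0[OF R(1)] R by (intro power_mono) auto
    ultimately have "(b R)^2 * ((integral\<^sup>L lborel (g i))^2 * (integral\<^sup>L lborel (f i))^2) <= (B R)^2 * (C * (integral\<^sup>L lborel (f i))^2)"
     by (intro mult_mono mult_right_mono) auto
    then show ?thesis unfolding c1_def by (simp add: power_mult_distrib mult.commute)
   qed
   then have "(\<Sum>i\<in>A. (c1 i)^2) <= (B R)^2 * (C * (\<Sum>i\<in>A. (integral\<^sup>L lborel (f i))^2))"
    unfolding sum_distrib_left by (rule sum_mono)
   also have "\<dots> <= (B R)^2 * (C * C)"
   proof (intro mult_left_mono C(1))
    show "(\<Sum>i\<in>A. (integral\<^sup>L lborel (f i))^2) <= C"
     using P[of c a] cum_right[OF fa(1), of c] cum_left[OF fa(1), of a] by simp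
   qed simp
   finally show ?thesis by (simp only: mult.commute)
  qed
  have s2: "(\<Sum>i\<in>A. (c2 i)^2) <= C * C * (2 * B (R / 2))^2"
   unfolding c2_def
   by (rule bounded_mixture_sum[OF A hi' hb' _ _ _ P]) (use Q C(1) k.nonpos1[OF R(1)] in \<open>auto simp: h'_def mult_nonpos_nonneg\<close>)
  have s3: "(\<Sum>i\<in>A. (c3 i)^2) <= N"
   unfolding c3_def N_def I_def
  proof (rule near_diagonal_bound[OF _ _ _ f(1) f(2)[rule_format] g(1) g(2)[rule_format]])
   show "k.trunc2 \<eta> r <= 3 * \<rho>\<eta> r" for r using b(3) unfolding k.trunc2_def \<rho>\<eta>_def by auto
  qed (use int3 k.trunc2_nonneg in \<open>auto simp: I_def\<close>)
  have s4: "(\<Sum>i\<in>A. (c4 i)^2) <= C * C * (2 * B (\<eta> / 2))^2"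
   unfolding c4_def I_def
   by (rule bounded_mixture_sum[OF A hi hb h0 _ _ P]) (use Q C(1) in auto)
  have four: "(x + y + u + v)^2 <= 4 * (x\<^sup>2 + y\<^sup>2 + u\<^sup>2 + v\<^sup>2)" for x y u v :: real
  proof -
   have "0 <= (x - y)^2 + (x - u)^2 + (x - v)^2 + (y - u)^2 + (y - v)^2 + (u - v)^2" by (intro add_nonneg_nonneg) simp_all
   then show ?thesis by (simp add: power2_eq_square algebra_simps)
  qed
  have "(\<Sum>i\<in>A. (kernel_form (%t. b \<bar>t\<bar>) (f i) (g i))^2) <= (\<Sum>i\<in>A. 4 * ((c1 i)^2 + (c2 i)^2 + (c3 i)^2 + (c4 i)^2))"
   unfolding eq by (intro sum_mono four)
  also have "\<dots> = 4 * ((\<Sum>i\<in>A. (c1 i)^2) + (\<Sum>i\<in>A. (c2 i)^2) + (\<Sum>i\<in>A. (c3 i)^2) + (\<Sum>i\<in>A. (c4 i)^2))"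
   by (simp add: sum.distrib sum_distrib_left)
  also have "\<dots> <= 4 * (C * C * (B R)^2 + C * C * (2 * B (R / 2))^2 + N + C * C * (2 * B (\<eta> / 2))^2)"
   by (intro mult_left_mono add_mono s1 s2 s3 s4) simp
  finally show ?thesis .
 qed
 show ?thesis
  by (intro exI[of _ "4 * (C * C * (B R)^2 + C * C * (2 * B (R / 2))^2 + N + C * C * (2 * B (\<eta> / 2))^2)"] allI impI) (rule main)
qed

text \<open>The bound is uniform in the smoothing and the sum is finite, so the limit of the
  smoothed forms inherits it.\<close>

lemma cross_bound:
 assumes ap: "a < p" "p < c"
 obtains M where "!!A f g. bessel (ip_norm (kernel_form B)) A f ==> bessel (ip_norm (kernel_form B)) A g ==>
  (!!i. f i \<in> L2_on a p) ==> (!!i. g i \<in> L2_on p c) ==> (\<Sum>i\<in>A. (kernel_form B (f i) (g i))^2) <= M"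
proof -
 obtain M where M: "\<forall>b b1 b2 A f g. c2_kernel b b1 b2 --> (\<forall>t>0. b t <= B t) --> (\<forall>r. 0 < r --> r < \<eta> --> b2 r <= 3 * \<rho> r) \<longrightarrow>
  bessel (ip_norm (kernel_form B)) A f --> bessel (ip_norm (kernel_form B)) A g \<longrightarrow>
  (\<forall>i. f i \<in> L2_on a p) --> (\<forall>i. g i \<in> L2_on p c) \<longrightarrow>
  (\<Sum>i\<in>A. (kernel_form (%t. b \<bar>t\<bar>) (f i) (g i))^2) <= M" using smoothed_cross_bound[OF ap] by (rule exE)
 obtain b b1 b2 :: "nat => real => real" where b: "\<forall>n. c2_kernel (b n) (b1 n) (b2 n)" "\<forall>n. \<forall>t>0. b n t <= B t"
  "\<forall>t>0. (%n. b n t) ----> B t" "\<forall>n r. 0 < r --> r < \<eta> --> b2 n r <= 3 * \<rho> r"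
  using smoothing_exists by (elim exE conjE) (rule that)
 show ?thesis
 proof (rule that)
  fix A f g
  assume f: "bessel (ip_norm (kernel_form B)) A f" "bessel (ip_norm (kernel_form B)) A g"
   "!!i. f i \<in> L2_on a p" "!!i. g i \<in> L2_on p c"
  have lim: "(%n. kernel_form (%t. b n \<bar>t\<bar>) (f i) (g i)) ----> kernel_form B (f i) (g i)" for i
  proof (rule kernel_form_tendsto)
   show "f i \<in> L2_bounded_support" "g i \<in> L2_bounded_support" using f(3,4)[of i] L2_on_subset_bounded_support by blast+
   show "locally_integrable (%t. b n \<bar>t\<bar>)" for n by (rule c2_kernel.local[OF b(1)[rule_format]])
   show "0 <= b n t" if "t > 0" for n t by (rule c2_kernel.nonneg0[OF b(1)[rule_format] that])
  qed (use b in auto)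
  have sum: "(%n. \<Sum>i\<in>A. (kernel_form (%t. b n \<bar>t\<bar>) (f i) (g i))^2) ----> (\<Sum>i\<in>A. (kernel_form B (f i) (g i))^2)"
   by (intro tendsto_sum tendsto_power lim)
  have le: "(\<Sum>i\<in>A. (kernel_form (%t. b n \<bar>t\<bar>) (f i) (g i))^2) <= M" for n
   using M[rule_format, OF b(1)[rule_format, of n], of A f g] b(2,4) f by simp
  show "(\<Sum>i\<in>A. (kernel_form B (f i) (g i))^2) <= M" by (rule LIMSEQ_le_const2[OF sum]) (use le in blast)
 qed
qed

end

section \<open>Completions\<close>

text \<open>The closure \<open>K\<close> of the rational combinations of \<open>T\<close> is a
  complete subspace, and the component of a vector orthogonal to \<open>K\<close> is orthogonal to
  \<open>T\<close>, hence 0. That the countable set lies in the span of \<open>T\<close> is recorded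
  for later arguments by linearity.\<close>

lemma (in hilbert_form) total_dense:
 assumes T: "countable T" "T <= D" and total: "!!x. x \<in> D ==> (!!t. t \<in> T ==> ip x t = 0) ==> x = 0"
 obtains T' where "countable T'" "T' <= span T" "T' <= D" "!!x r. x \<in> D ==> r > 0 ==> \<exists>s\<in>T'. ip_norm ip (x - s) < r"
proof -
 \<comment> \<open>Lists of pairs make countability immediate and turn addition into
   concatenation.\<close>
 define comb where "comb = (%xs :: (rat \<times> 'a) list. sum_list (map (%(q, t). real_of_rat q *\<^sub>R t) xs))"
 define T' where "T' = comb ` lists (UNIV \<times> T)"
 have cT: "countable T'" unfolding T'_def by (intro countable_image countable_lists countable_SIGMA T(1)) simp_all
 have comb_span: "comb xs \<in> span T" if "xs \<in> lists (UNIV \<times> T)" for xs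
  using that by (induction xs) (auto simp: comb_def span_add span_scale span_base span_zero)
 have sp: "T' <= span T" unfolding T'_def using comb_span by auto
 have spD: "span T <= D" by (rule span_minimal[OF T(2) D])
 have T'D: "T' <= D" using sp spD by blast
 have T'add: "s + s' \<in> T'" if s: "s \<in> T'" "s' \<in> T'" for s s'
 proof -
  obtain xs ys where "xs \<in> lists (UNIV \<times> T)" "ys \<in> lists (UNIV \<times> T)" "s = comb xs" "s' = comb ys"
   using s unfolding T'_def by blast
  then show ?thesis unfolding T'_def by (intro image_eqI[of _ _ "xs @ ys"]) (auto simp: comb_def)
 qed
 have T'scale: "real_of_rat q *\<^sub>R s \<in> T'" if s: "s \<in> T'" for s q
 proof -
  obtain xs where xs: "xs \<in> lists (UNIV \<times> T)" "s = comb xs" using s unfolding T'_def by blast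
  have "real_of_rat q *\<^sub>R comb xs = comb (map (%(p, t). (q * p, t)) xs)" for xs
   by (induction xs) (auto simp: comb_def scaleR_right_distrib of_rat_mult)
  then show ?thesis unfolding T'_def using xs by (intro image_eqI[of _ _ "map (%(p, t). (q * p, t)) xs"]) auto
 qed
 have T'0: "0 \<in> T'" unfolding T'_def by (intro image_eqI[of _ _ "[]"]) (auto simp: comb_def)
 define K where "K = norm_closure T'"
 have K: "subspace K"
 proof (rule subspaceI)
  show "0 \<in> K" using subset_norm_closure[OF T'D] T'0 unfolding K_def by blast
  show "x + y \<in> K" if x: "x \<in> K" "y \<in> K" for x y
  proof -
   have D2: "x \<in> D" "y \<in> D" using x unfolding K_def norm_closure_def by auto
   have "\<exists>s\<in>T'. ip_norm ip (x + y - s) < r" if "r > 0" for r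
   proof -
    have "r / 2 > 0" using that by simp
    then obtain s s' where s: "s \<in> T'" "ip_norm ip (x - s) < r / 2" "s' \<in> T'" "ip_norm ip (y - s') < r / 2"
     using x unfolding K_def norm_closure_def by blast
    have "ip_norm ip ((x - s) + (y - s')) <= ip_norm ip (x - s) + ip_norm ip (y - s')"
     by (rule triangle) (use D2 s T'D in auto)
    moreover have "(x - s) + (y - s') = x + y - (s + s')" by simp
    ultimately have "ip_norm ip (x + y - (s + s')) < r" using s by simp
    then show ?thesis using T'add[OF s(1,3)] by blast
   qed
   then show ?thesis using D2 unfolding K_def norm_closure_def by simp
  qed
  show "c *\<^sub>R x \<in> K" if x: "x \<in> K" for c x
  proof -
   have xD: "x \<in> D" using x unfolding K_def norm_closure_def by auto
   have "\<exists>s\<in>T'. ip_norm ip (c *\<^sub>R x - s) < r" if r: "r > 0" for r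
   proof -
    have n0: "0 <= ip_norm ip x" using xD by simp
    have "r / (2 * (ip_norm ip x + 1)) > 0" using r n0 by simp
    then have "c < c + r / (2 * (ip_norm ip x + 1))" by simp
    from of_rat_dense[OF this] obtain q where q: "c < of_rat q" "of_rat q < c + r / (2 * (ip_norm ip x + 1))" by blast
    have "r / (2 * (\<bar>real_of_rat q\<bar> + 1)) > 0" using r by (simp add: add_nonneg_pos)
    then obtain s where s: "s \<in> T'" "ip_norm ip (x - s) < r / (2 * (\<bar>real_of_rat q\<bar> + 1))"
     using x unfolding K_def norm_closure_def by blast
    have sD: "s \<in> D" using s T'D by blast
    have "ip_norm ip ((c - of_rat q) *\<^sub>R x + of_rat q *\<^sub>R (x - s)) <= ip_norm ip ((c - of_rat q) *\<^sub>R x) + ip_norm ip (of_rat q *\<^sub>R (x - s))"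
     by (rule triangle) (use xD sD in auto)
    also have "\<dots> = \<bar>c - of_rat q\<bar> * ip_norm ip x + \<bar>of_rat q\<bar> * ip_norm ip (x - s)"
     using norm_scale[OF xD] norm_scale[of "x - s"] xD sD by simp
    also have "\<dots> < r / 2 + r / 2"
    proof (rule add_le_less_mono)
     have "\<bar>c - of_rat q\<bar> * ip_norm ip x <= r / (2 * (ip_norm ip x + 1)) * (ip_norm ip x + 1)"
      using q n0 by (intro mult_mono) auto
     also have "\<dots> = r / 2" using n0 by (simp add: field_simps)
     finally show "\<bar>c - of_rat q\<bar> * ip_norm ip x <= r / 2" .
     have "\<bar>real_of_rat q\<bar> * ip_norm ip (x - s) <= (\<bar>real_of_rat q\<bar> + 1) * ip_norm ip (x - s)"
      using xD sD by (intro mult_right_mono) auto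
     also have "\<dots> < (\<bar>real_of_rat q\<bar> + 1) * (r / (2 * (\<bar>real_of_rat q\<bar> + 1)))"
      by (intro mult_strict_left_mono s(2)) (simp add: add_nonneg_pos)
     also have "\<dots> = r / 2"
     proof -
      have k: "k * (r / (2 * k)) = r / 2" if "k > 0" for k :: real using that by simp
      show ?thesis by (rule k) (simp add: add_nonneg_pos)
     qed
     finally show "\<bar>real_of_rat q\<bar> * ip_norm ip (x - s) < r / 2" .
    qed
    also have "(c - of_rat q) *\<^sub>R x + of_rat q *\<^sub>R (x - s) = c *\<^sub>R x - of_rat q *\<^sub>R s"
     by (simp add: algebra_simps)
    finally show ?thesis using T'scale[OF s(1), of q] by (intro bexI[of _ "of_rat q *\<^sub>R s"]) simp_all
   qed
   then show ?thesis using xD unfolding K_def norm_closure_def by simp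
  qed
 qed
 have KD: "K <= D" unfolding K_def norm_closure_def by blast
 have Kh: "hilbert_form K ip"
 proof (rule closed_subspace_hilbert_form[OF K KD])
  fix f x assume f: "range f <= K" and x: "x \<in> D" and lim: "(%n. ip_norm ip (f n - x)) ----> 0"
  have "\<exists>s\<in>T'. ip_norm ip (x - s) < r" if r: "r > 0" for r
  proof -
   have r2: "r / 2 > 0" using r by simp
   obtain n where n: "norm (ip_norm ip (f n - x) - 0) < r / 2" using LIMSEQ_D[OF lim r2] by blast
   have fn: "f n \<in> K" "f n \<in> D" using f KD by auto
   obtain s where s: "s \<in> T'" "ip_norm ip (f n - s) < r / 2" using fn(1) r2 unfolding K_def norm_closure_def by blast
   have sD: "s \<in> D" using s T'D by blast
   have "ip_norm ip ((x - f n) + (f n - s)) <= ip_norm ip (x - f n) + ip_norm ip (f n - s)"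
    by (rule triangle) (use x fn sD in auto)
   then show ?thesis using s n norm_minus[OF x fn(2)] by (intro bexI[of _ s]) simp_all
  qed
  then show "x \<in> K" using x unfolding K_def norm_closure_def by simp
 qed
 have TK: "T <= K"
 proof
  fix t assume t: "t \<in> T"
  have "comb [(1, t)] \<in> T'" unfolding T'_def using t by (intro imageI) auto
  then have "t \<in> T'" by (simp add: comb_def)
  then show "t \<in> K" using subset_norm_closure[OF T'D] unfolding K_def by blast
 qed
 have "x \<in> K" if x: "x \<in> D" for x
 proof -
  obtain p where p: "p \<in> K" "\<forall>w\<in>K. ip (x - p) w = 0" using projection[OF Kh KD x] by blast
  have "x - p = 0" by (rule total) (use p TK KD x in auto)
  then show ?thesis using p(1) by simp
 qed
 then have "\<exists>s\<in>T'. ip_norm ip (x - s) < r" if "x \<in> D" "r > 0" for x r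
  using that unfolding K_def norm_closure_def by blast
 then show ?thesis by (rule that[OF cT sp T'D])
qed

context psd_form
begin

abbreviation embed :: "'a => 'a => real" where "embed x \<equiv> completion_point D ip (%_. x)"

lemma completion_ip_norm:
 "x \<in> ip_completion D ip D ==> ip_norm (norm_ip (completion_norm D ip)) x = completion_norm D ip x"
 unfolding ip_norm_def by (rule completion_norm_sq[symmetric])

lemma completion_inner_product_form:
 assumes S: "subspace S" "S <= D"
 shows "inner_product_form (ip_completion D ip S) (norm_ip (completion_norm D ip))"
 by (rule inner_product_form_of_inner_product[OF completion_subspace[OF S]
  inner_product_on_subset[OF completion_inner_product completion_mono[OF S(2)]]])

lemma completion_hilbert_form:
 assumes S: "subspace S" "S <= D"
 shows "hilbert_form (ip_completion D ip S) (norm_ip (completion_norm D ip))"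
proof -
 let ?H = "ip_completion D ip S" and ?i = "norm_ip (completion_norm D ip)"
 interpret H: inner_product_form ?H ?i by (rule completion_inner_product_form[OF S])
 have "norm_dist ?H (completion_norm D ip) = norm_dist ?H (ip_norm ?i)"
  by (rule norm_dist_cong[OF completion_subspace[OF S]]) (use completion_ip_norm completion_mono[OF S(2)] in auto)
 then have "Metric_space.mcomplete ?H (norm_dist ?H (ip_norm ?i))"
  using completion_complete[OF S] by simp
 then show ?thesis
  unfolding H.mcomplete_iff hilbert_form_def hilbert_form_axioms_def using H.psd_form_axioms H.definite by blast
qed

text \<open>A point of the completion is stored as a functional; its value at \<open>g\<close> is
  the scalar product with the embedded \<open>g\<close>. Vanishing on functions and orthogonality to
  their embeddings are thus the same.\<close>

lemma completion_apply:
 assumes x: "x \<in> ip_completion D ip D" and g: "g \<in> D"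
 shows "x g = norm_ip (completion_norm D ip) x (embed g)"
proof -
 obtain f where f: "range f <= D" "ip_Cauchy ip f" "x = completion_point D ip f"
  using completionE[OF x subset_refl] by metis
 have gr: "range (%_ :: nat. g) <= D" using g by auto
 show ?thesis unfolding f(3)
  by (rule LIMSEQ_unique[OF completion_point_lim[OF f(1,2) g] completion_ip_lim[OF f(1,2) gr Cauchy_const[OF g]]])
qed

lemma completion_ext:
 assumes x: "x \<in> ip_completion D ip D" and z: "!!g. g \<in> D ==> x g = 0"
 shows "x = 0"
proof
 fix g
 obtain f where "x = completion_point D ip f" using completionE[OF x subset_refl] by metis
 then have "x g = 0" if "g \<notin> D" using that by (simp add: completion_point_def)
 then show "x g = 0 g" using z by (cases "g \<in> D") simp_all
qed

lemma completion_approx_sequence: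
 assumes "x \<in> ip_completion D ip S" "S <= D"
 obtains f where "!!n. f n \<in> S" "(%n. completion_norm D ip (x - embed (f n))) ----> 0"
proof -
 obtain f where f: "range f <= S" "range f <= D" "ip_Cauchy ip f" "x = completion_point D ip f"
  using completionE[OF assms] by metis
 show ?thesis by (rule that[of f]) (use f(1) completion_approx[OF f(2,3)] in \<open>auto simp: f(4)\<close>)
qed

lemma embed_sum:
 assumes "!!i. i \<in> A ==> f i \<in> D"
 shows "embed (\<Sum>i\<in>A. c i *\<^sub>R f i) = (\<Sum>i\<in>A. c i *\<^sub>R embed (f i))"
 by (rule linear_map_on_sum[OF completion_embed_linear D]) (use assms in auto)

lemma completion_linear:
 assumes x: "x \<in> ip_completion D ip D" shows "linear_map_on D x"
proof -
 interpret H: hilbert_form "ip_completion D ip D" "norm_ip (completion_norm D ip)"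
  by (rule completion_hilbert_form[OF D subset_refl])
 have e: "embed g \<in> ip_completion D ip D" if "g \<in> D" for g by (rule completion_embed_in[OF subset_refl that])
 show ?thesis unfolding linear_map_on_def
 proof (intro conjI ballI allI)
  fix g c assume g: "g \<in> D"
  show "x (c *\<^sub>R g) = c *\<^sub>R x g" for c
   using completion_embed_linear g H.scale_right[OF e[OF g] x] completion_apply[OF x]
   unfolding linear_map_on_def by simp
  fix h assume h: "h \<in> D"
  show "x (g + h) = x g + x h"
   using completion_embed_linear g h H.add_right[OF e[OF g] e[OF h] x] completion_apply[OF x]
   unfolding linear_map_on_def by simp
 qed
qed

lemma completion_apply_bound:
 assumes x: "x \<in> ip_completion D ip D" and g: "g \<in> D"
 shows "\<bar>x g\<bar> <= completion_norm D ip x * ip_norm ip g"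
proof -
 interpret H: hilbert_form "ip_completion D ip D" "norm_ip (completion_norm D ip)"
  by (rule completion_hilbert_form[OF D subset_refl])
 have e: "embed g \<in> ip_completion D ip D" by (rule completion_embed_in[OF subset_refl g])
 show ?thesis
  using H.Cauchy_Schwarz[OF x e] completion_apply[OF x g] completion_ip_norm[OF x] completion_ip_norm[OF e] completion_embed_norm[OF g]
  by simp
qed

text \<open>With approximants \<open>h n\<close> from \<open>S\<close>, the squared norm of
  \<open>x\<close> is the limit of the scalar products of \<open>x\<close> with the embedded
  \<open>h n\<close>, that is, of the values \<open>x (h n) = 0\<close>.\<close>

lemma completion_zero:
 assumes S: "S <= D" and x: "x \<in> ip_completion D ip S" and z: "!!g. g \<in> S ==> x g = 0"
 shows "x = 0"
proof -
 interpret H: hilbert_form "ip_completion D ip D" "norm_ip (completion_norm D ip)"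
  by (rule completion_hilbert_form[OF D subset_refl])
 have xD: "x \<in> ip_completion D ip D" using completion_mono[OF S] x by blast
 obtain f where f: "range f <= S" "range f <= D" "ip_Cauchy ip f" "x = completion_point D ip f"
  using completionE[OF x S] by metis
 have "x g = 0" if g: "g \<in> D" for g
 proof -
  obtain h where h: "!!n. h n \<in> S" "(%n. completion_norm D ip (x - embed (h n))) ----> 0"
   using completion_approx_sequence[OF x S] by metis
  have e: "embed (h n) \<in> ip_completion D ip D" for n by (rule completion_embed_in[OF subset_refl]) (use h S in auto)
  have d: "x - embed (h n) \<in> ip_completion D ip D" for n using xD e by simp
  have hn: "ip_norm (norm_ip (completion_norm D ip)) (embed (h n) - x) = completion_norm D ip (x - embed (h n))" for n
   using H.norm_minus[OF e xD] completion_ip_norm[OF d] by simp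
  have "(%n. norm_ip (completion_norm D ip) x (embed (h n))) ----> norm_ip (completion_norm D ip) x x"
   by (rule H.tendsto_ip) (use xD e h(2) in \<open>auto simp: hn H.norm_zero\<close>)
  moreover have "norm_ip (completion_norm D ip) x (embed (h n)) = 0" for n
   using completion_apply[OF xD, of "h n"] h(1)[of n] S z by auto
  ultimately have "norm_ip (completion_norm D ip) x x = 0" by (simp add: LIMSEQ_const_iff)
  then have "x = 0" by (rule H.definite[OF xD])
  then show ?thesis by simp
 qed
 then show ?thesis by (rule completion_ext[OF xD])
qed

text \<open>Approximating the members of the family spoils the Bessel bound by at most the total
  error \<open>\<delta> n\<close>; division by \<open>1 + \<delta> n\<close> restores it and is
  harmless in the limit.\<close>

lemma bessel_approx:
 assumes x: "bessel (completion_norm D ip) A x" "x ` A <= ip_completion D ip S" and S: "subspace S" "S <= D"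
 obtains f where "!!n i. f n i \<in> S" "!!n. bessel (ip_norm ip) A (f n)"
  "!!i. i \<in> A ==> (%n. ip_norm (norm_ip (completion_norm D ip)) (embed (f n i) - x i)) ----> 0"
proof -
 let ?i = "norm_ip (completion_norm D ip)"
 interpret H: hilbert_form "ip_completion D ip D" ?i by (rule completion_hilbert_form[OF D subset_refl])
 have A: "finite A" using x(1) unfolding bessel_def by blast
 have xD: "x i \<in> ip_completion D ip D" if "i \<in> A" for i using x(2) that completion_mono[OF S(2)] by blast
 \<comment> \<open>Membership in \<open>S\<close> is required for all indices; outside
   \<open>A\<close> the zero sequence is taken.\<close>
 have "\<exists>h. (\<forall>n. h n \<in> S) & (i \<in> A --> (%n. completion_norm D ip (x i - embed (h n))) ----> 0)" for i
 proof (cases "i \<in> A")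
  case True
  then have "x i \<in> ip_completion D ip S" using x(2) by blast
  from completion_approx_sequence[OF this S(2)] show ?thesis by metis
 next
  case False
  then show ?thesis using subspace_0[OF S(1)] by (intro exI[of _ "%_. 0"]) simp
 qed
 then obtain h where h: "!!i n. h i n \<in> S" "!!i. i \<in> A ==> (%n. completion_norm D ip (x i - embed (h i n))) ----> 0"
  by metis
 have hD: "h i n \<in> D" for i n using h(1) S(2) by blast
 have e: "embed (h i n) \<in> ip_completion D ip D" for i n by (rule completion_embed_in[OF subset_refl hD])
 define d where "d = (%i n. ip_norm ?i (embed (h i n) - x i))"
 have dlim: "d i ----> 0" if i: "i \<in> A" for i
 proof -
  have "d i n = completion_norm D ip (x i - embed (h i n))" for n
   unfolding d_def using H.norm_minus[OF e xD[OF i], of i n] completion_ip_norm[of "x i - embed (h i n)"] xD[OF i] e by simp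
  then have "d i = (%n. completion_norm D ip (x i - embed (h i n)))" by (rule ext)
  then show ?thesis using h(2)[OF i] by simp
 qed
 have d0: "0 <= d i n" if "i \<in> A" for i n unfolding d_def using xD[OF that] e by simp
 define \<delta> where "\<delta> = (%n. \<Sum>i\<in>A. d i n)"
 have \<delta>0: "0 <= \<delta> n" for n unfolding \<delta>_def by (intro sum_nonneg d0)
 have \<delta>lim: "\<delta> ----> 0" unfolding \<delta>_def using tendsto_sum[of A d "%_. 0", OF dlim] by simp
 define f where "f = (%n i. (1 / (1 + \<delta> n)) *\<^sub>R h i n)"
 have ef: "embed (f n i) = (1 / (1 + \<delta> n)) *\<^sub>R embed (h i n)" for n i
  using completion_embed_linear hD unfolding f_def linear_map_on_def by blast
 have fS: "f n i \<in> S" for n i unfolding f_def by (intro subspace_scale[OF S(1)] h(1))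
 show ?thesis
 proof (rule that)
  show "f n i \<in> S" for n i by (rule fS)
  show "bessel (ip_norm ip) A (f n)" for n unfolding bessel_def
  proof (intro conjI allI A)
   fix c :: "nat => real"
   define s where "s = sqrt (\<Sum>i\<in>A. (c i)^2)"
   have s0: "0 <= s" unfolding s_def by (simp add: sum_nonneg)
   have cs: "\<bar>c i\<bar> <= s" if "i \<in> A" for i
    unfolding s_def by (rule real_le_rsqrt) (use A that member_le_sum[of i A "%i. (c i)^2"] in auto)
   have sums: "(\<Sum>i\<in>A. c i *\<^sub>R x i) \<in> ip_completion D ip D" "(\<Sum>i\<in>A. c i *\<^sub>R (embed (h i n) - x i)) \<in> ip_completion D ip D"
    by (intro H.sum_in, use xD e in auto)+
   have tri: "ip_norm ?i (\<Sum>i\<in>B. c i *\<^sub>R (embed (h i n) - x i)) <= (\<Sum>i\<in>B. \<bar>c i\<bar> * d i n)" if "finite B" "B <= A" for B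
    using that
   proof (induction B rule: finite_induct)
    case empty
    show ?case unfolding sum.empty H.norm_zero by simp
   next
    case (insert j B)
    have j: "embed (h j n) - x j \<in> ip_completion D ip D" using e xD insert by simp
    have B: "(\<Sum>i\<in>B. c i *\<^sub>R (embed (h i n) - x i)) \<in> ip_completion D ip D"
     by (intro H.sum_in) (use xD e insert in auto)
    have "ip_norm ?i (c j *\<^sub>R (embed (h j n) - x j) + (\<Sum>i\<in>B. c i *\<^sub>R (embed (h i n) - x i)))
     <= ip_norm ?i (c j *\<^sub>R (embed (h j n) - x j)) + ip_norm ?i (\<Sum>i\<in>B. c i *\<^sub>R (embed (h i n) - x i))"
     by (rule H.triangle[OF _ B]) (use j in simp)
    also have "ip_norm ?i (c j *\<^sub>R (embed (h j n) - x j)) = \<bar>c j\<bar> * d j n"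
     unfolding d_def by (rule H.norm_scale[OF j])
    finally show ?case using insert by simp
   qed
   have "ip_norm ?i ((\<Sum>i\<in>A. c i *\<^sub>R x i) + (\<Sum>i\<in>A. c i *\<^sub>R (embed (h i n) - x i)))
    <= ip_norm ?i (\<Sum>i\<in>A. c i *\<^sub>R x i) + ip_norm ?i (\<Sum>i\<in>A. c i *\<^sub>R (embed (h i n) - x i))"
    by (rule H.triangle[OF sums])
   also have "ip_norm ?i (\<Sum>i\<in>A. c i *\<^sub>R x i) <= s"
    unfolding completion_ip_norm[OF sums(1)] s_def by (rule real_le_rsqrt) (use x(1) in \<open>auto simp: bessel_def\<close>)
   also have "ip_norm ?i (\<Sum>i\<in>A. c i *\<^sub>R (embed (h i n) - x i)) <= s * \<delta> n"
   proof -
    have "(\<Sum>i\<in>A. \<bar>c i\<bar> * d i n) <= (\<Sum>i\<in>A. s * d i n)" by (intro sum_mono mult_right_mono cs d0)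
    then show ?thesis using tri[OF A subset_refl] unfolding \<delta>_def sum_distrib_left by linarith
   qed
   also have "(\<Sum>i\<in>A. c i *\<^sub>R x i) + (\<Sum>i\<in>A. c i *\<^sub>R (embed (h i n) - x i)) = (\<Sum>i\<in>A. c i *\<^sub>R embed (h i n))"
    by (simp add: sum.distrib[symmetric] scaleR_right_diff_distrib)
   finally have le: "ip_norm ?i (\<Sum>i\<in>A. c i *\<^sub>R embed (h i n)) <= s * (1 + \<delta> n)" by (simp add: distrib_left)
   have hs: "(\<Sum>i\<in>A. c i *\<^sub>R h i n) \<in> D" by (intro sum_in hD)
   have "ip_norm ip (\<Sum>i\<in>A. c i *\<^sub>R h i n) = ip_norm ?i (\<Sum>i\<in>A. c i *\<^sub>R embed (h i n))"
    using completion_embed_norm[OF hs] completion_ip_norm[OF completion_embed_in[OF subset_refl hs]] embed_sum[where A = A and c = c and f = "%i. h i n", OF hD]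
    by simp
   with le have le': "ip_norm ip (\<Sum>i\<in>A. c i *\<^sub>R h i n) <= s * (1 + \<delta> n)" by simp
   have "(\<Sum>i\<in>A. c i *\<^sub>R f n i) = (1 / (1 + \<delta> n)) *\<^sub>R (\<Sum>i\<in>A. c i *\<^sub>R h i n)"
    unfolding f_def scaleR_sum_right by (intro sum.cong) (simp_all add: mult.commute)
   then have "ip_norm ip (\<Sum>i\<in>A. c i *\<^sub>R f n i) = 1 / (1 + \<delta> n) * ip_norm ip (\<Sum>i\<in>A. c i *\<^sub>R h i n)"
    using norm_scale[OF hs, of "1 / (1 + \<delta> n)"] \<delta>0[of n] by simp
   also have "\<dots> <= s" using le' \<delta>0[of n] by (simp add: pos_divide_le_eq mult.commute)
   finally have "(ip_norm ip (\<Sum>i\<in>A. c i *\<^sub>R f n i))^2 <= s\<^sup>2"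
    by (intro power_mono norm_nonneg sum_in) (use fS S(2) in auto)
   then show "(ip_norm ip (\<Sum>i\<in>A. c i *\<^sub>R f n i))^2 <= (\<Sum>i\<in>A. (c i)^2)"
    unfolding s_def by (simp add: sum_nonneg)
  qed
  fix i assume i: "i \<in> A"
  have n0: "0 <= ip_norm ?i (x i)" using xD[OF i] by simp
  have le: "ip_norm ?i (embed (f n i) - x i) <= d i n + \<delta> n * ip_norm ?i (x i)" for n
  proof -
   have k: "1 / (1 + \<delta> n) <= 1" "0 <= 1 / (1 + \<delta> n)" using \<delta>0[of n] by auto
   have "embed (f n i) - x i = (1 / (1 + \<delta> n)) *\<^sub>R (embed (h i n) - x i) + (1 / (1 + \<delta> n) - 1) *\<^sub>R x i"
    unfolding ef by (simp only: scaleR_right_diff_distrib scaleR_left_diff_distrib scaleR_one) simp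
   then have "ip_norm ?i (embed (f n i) - x i) <= ip_norm ?i ((1 / (1 + \<delta> n)) *\<^sub>R (embed (h i n) - x i)) + ip_norm ?i ((1 / (1 + \<delta> n) - 1) *\<^sub>R x i)"
    using H.triangle[of "(1 / (1 + \<delta> n)) *\<^sub>R (embed (h i n) - x i)" "(1 / (1 + \<delta> n) - 1) *\<^sub>R x i"] e xD[OF i] by simp
   also have "\<dots> = (1 / (1 + \<delta> n)) * d i n + \<bar>1 / (1 + \<delta> n) - 1\<bar> * ip_norm ?i (x i)"
    using H.norm_scale[of "embed (h i n) - x i" "1 / (1 + \<delta> n)"] H.norm_scale[OF xD[OF i]] e xD[OF i] k unfolding d_def by simp
   also have "\<dots> <= 1 * d i n + \<delta> n * ip_norm ?i (x i)"
   proof (intro add_mono mult_right_mono d0 i n0 k)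
    have "1 - 1 / (1 + \<delta> n) = \<delta> n / (1 + \<delta> n)" using \<delta>0[of n] by (simp add: field_simps)
    also have "\<dots> <= \<delta> n" using \<delta>0[of n] by (simp add: pos_divide_le_eq algebra_simps)
    finally show "\<bar>1 / (1 + \<delta> n) - 1\<bar> <= \<delta> n" using k by simp
   qed
   finally show ?thesis by simp
  qed
  have lim: "(%n. d i n + \<delta> n * ip_norm ?i (x i)) ----> 0"
   using tendsto_add[OF dlim[OF i] tendsto_mult_right[OF \<delta>lim]] by simp
  show "(%n. ip_norm ?i (embed (f n i) - x i)) ----> 0"
  proof (rule tendsto_sandwich[OF _ _ tendsto_const lim])
   have "embed (f n i) \<in> ip_completion D ip D" for n
    by (rule completion_embed_in[OF subset_refl]) (use fS S(2) in auto)
   then show "\<forall>\<^sub>F n in sequentially. 0 <= ip_norm ?i (embed (f n i) - x i)"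
    using xD[OF i] by (intro always_eventually allI) simp
   show "\<forall>\<^sub>F n in sequentially. ip_norm ?i (embed (f n i) - x i) <= d i n + \<delta> n * ip_norm ?i (x i)"
    by (rule always_eventually, rule allI, rule le)
  qed
 qed
qed

text \<open>Both families are approximated by Bessel families of functions, to which the hypothesis
  applies with the same \<open>M\<close>.\<close>

lemma completion_hs_bound:
 assumes S1: "subspace S1" "S1 <= D" and S2: "subspace S2" "S2 <= D"
  and hs: "!!A f g. bessel (ip_norm ip) A f ==> bessel (ip_norm ip) A g ==> (!!i. f i \<in> S1) ==> (!!i. g i \<in> S2) ==>
   (\<Sum>i\<in>A. (ip (f i) (g i))^2) <= M"
  and x: "bessel (completion_norm D ip) A x" "x ` A <= ip_completion D ip S1"
  and y: "bessel (completion_norm D ip) A y" "y ` A <= ip_completion D ip S2"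
 shows "(\<Sum>i\<in>A. (norm_ip (completion_norm D ip) (x i) (y i))^2) <= M"
proof -
 let ?i = "norm_ip (completion_norm D ip)"
 interpret H: hilbert_form "ip_completion D ip D" ?i by (rule completion_hilbert_form[OF D subset_refl])
 obtain f where f: "!!n i. f n i \<in> S1" "!!n. bessel (ip_norm ip) A (f n)"
  "!!i. i \<in> A ==> (%n. ip_norm ?i (embed (f n i) - x i)) ----> 0" using bessel_approx[OF x S1] by metis
 obtain g where g: "!!n i. g n i \<in> S2" "!!n. bessel (ip_norm ip) A (g n)"
  "!!i. i \<in> A ==> (%n. ip_norm ?i (embed (g n i) - y i)) ----> 0" using bessel_approx[OF y S2] by metis
 have fD: "f n i \<in> D" "g n i \<in> D" for n i using f(1) g(1) S1(2) S2(2) by auto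
 have e: "embed (f n i) \<in> ip_completion D ip D" "embed (g n i) \<in> ip_completion D ip D" for n i
  by (intro completion_embed_in[OF subset_refl] fD)+
 have "(%n. ip (f n i) (g n i)) ----> ?i (x i) (y i)" if i: "i \<in> A" for i
 proof -
  have xi: "x i \<in> ip_completion D ip D" "y i \<in> ip_completion D ip D"
   using x(2) y(2) i completion_mono[OF S1(2)] completion_mono[OF S2(2)] by auto
  have "ip (f n i) (g n i) = ?i (embed (f n i)) (embed (g n i))" for n
   using completion_apply[OF e(1) fD(2), of n i n i] completion_point_lim[of "%_. f n i", OF _ Cauchy_const[OF fD(1)] fD(2)] fD(1)
   by (simp add: LIMSEQ_const_iff)
  then show ?thesis using H.tendsto_ip[of "%n. embed (f n i)" "%n. embed (g n i)", OF _ _ xi f(3)[OF i] g(3)[OF i]] e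
   by (simp add: image_subset_iff)
 qed
 then have lim: "(%n. \<Sum>i\<in>A. (ip (f n i) (g n i))^2) ----> (\<Sum>i\<in>A. (?i (x i) (y i))^2)"
  by (intro tendsto_sum tendsto_power)
 have "(\<Sum>i\<in>A. (ip (f n i) (g n i))^2) <= M" for n by (rule hs[OF f(2) g(2) f(1) g(1)])
 then show ?thesis by (intro LIMSEQ_le_const2[OF lim]) blast
qed

end

section \<open>Trivial intersection of neighbouring spaces\<close>

lemma kernel_form_bounded:
 assumes k: "locally_integrable k" and ac: "a < c"
 obtains \<beta> where "0 <= \<beta>" "!!f. f \<in> L2_on a c ==> kernel_form k f f <= \<beta> * (\<integral>s. (f s)^2 \<partial>lborel)"
proof
 define l where "l = c - a"
 show "0 <= (\<integral>t. indicator {-l..l} t * \<bar>k t\<bar> \<partial>lborel)" by (intro Bochner_Integration.integral_nonneg) simp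
 fix f assume f: "f \<in> L2_on a c"
 have "\<bar>kernel_form k f f\<bar> <= ((\<integral>s. (f s)^2 \<partial>lborel) + (\<integral>s. (f s)^2 \<partial>lborel)) / 2 * (\<integral>t. indicator {-l..l} t * \<bar>k t\<bar> \<partial>lborel)"
  by (rule kernel_form_integrable(2)[OF k f f]) (auto simp: l_def)
 then show "kernel_form k f f <= (\<integral>t. indicator {-l..l} t * \<bar>k t\<bar> \<partial>lborel) * (\<integral>s. (f s)^2 \<partial>lborel)"
  by (simp add: mult.commute)
qed

lemma indicator_L2_on:
 assumes "S \<in> sets borel"
 shows "indicator (S \<inter> {a<..<c}) \<in> L2_on a c"
proof -
 have [measurable]: "S \<inter> {a<..<c} \<in> sets borel" using assms by simp
 have "emeasure lborel (S \<inter> {a<..<c}) <= emeasure lborel {a<..<c}" by (rule emeasure_mono) auto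
 also have "\<dots> < \<infinity>" by (cases "a <= c") simp_all
 finally have "integrable lborel (indicator (S \<inter> {a<..<c}) :: real => real)"
  by (intro integrable_real_indicator) simp_all
 moreover have "(%s. (indicator (S \<inter> {a<..<c}) s)^2) = (indicator (S \<inter> {a<..<c}) :: real => real)"
  by (auto simp: fun_eq_iff indicator_def)
 ultimately show ?thesis unfolding L2_on_def by simp
qed

lemma interval_L2_on: "a <= q ==> r <= c ==> indicator {q<..<r} \<in> L2_on a c"
proof -
 assume "a <= q" "r <= c"
 then have "{q<..<r} \<inter> {a<..<c} = {q<..<r}" by auto
 then show ?thesis using indicator_L2_on[of "{q<..<r}" a c] by simp
qed

text \<open>Substituting the difference as a variable and integrating over \<open>s\<close> first
  turns the form into the integral of \<open>h t\<close> times an increment of \<open>cum f\<close>.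
  Hence the form against an interval depends on \<open>f\<close> only through the supremum of its
  indefinite integral.\<close>

lemma kernel_form_interval_bound:
 assumes k: "locally_integrable k" and qr: "q < r"
 obtains C where "0 <= C" "!!f S. f \<in> L2_on a c ==> \<forall>y. \<bar>cum f y\<bar> <= S ==> \<bar>kernel_form k f (indicator {q<..<r})\<bar> <= C * S"
proof
 \<comment> \<open>A bound for the differences that occur, so that the kernel may be replaced by its
   integrable cutoff \<open>h\<close>.\<close>
 define l where "l = \<bar>a\<bar> + \<bar>c\<bar> + \<bar>q\<bar> + \<bar>r\<bar>"
 define h where "h = (%t. indicator {-l..l} t * k t)"
 have hi: "integrable lborel h" using k unfolding locally_integrable_def set_integrable_def h_def by simp
 note [measurable] = borel_measurable_integrable[OF hi]
 show "0 <= 2 * (\<integral>t. \<bar>h t\<bar> \<partial>lborel)" by (intro mult_nonneg_nonneg Bochner_Integration.integral_nonneg) simp_all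
 fix f S assume f: "f \<in> L2_on a c" and S: "\<forall>y. \<bar>cum f y\<bar> <= S"
 note fm[measurable] = L2_onD(1)[OF f]
 note fi = L2_on_integrable[OF f]
 let ?g = "indicator {q<..<r} :: real => real"
 have g: "?g \<in> L2_on q r" by (rule interval_L2_on) simp_all
 have km: "k \<in> borel_measurable borel" using k unfolding locally_integrable_def by blast
 have eq: "f s * ?g t * k (s - t) = f s * ?g t * h (s - t)" for s t
 proof (cases "f s = 0 \<or> ?g t = 0")
  case False
  then have "s \<in> {a<..<c}" "t \<in> {q<..<r}" using L2_onD(3)[OF f, of s] by (auto simp: indicator_def split: if_splits)
  then have "s - t \<in> {-l..l}" unfolding l_def by auto
  then show ?thesis unfolding h_def by simp
 qed auto
 have I: "integrable lborel2 (%p. f (fst p) * ?g (snd p) * h (fst p - snd p))"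
  using kernel_form_integrable(1)[OF k f g, of l] unfolding eq[symmetric] l_def by fastforce
 have J: "integrable lborel2 (%(s, t). f s * ?g (s - t) * h t)"
 proof (rule lborel_pair.Fubini_integrable)
  have b: "\<bar>f s * ?g (s - t) * h t\<bar> <= \<bar>f s\<bar> * \<bar>h t\<bar>" for s t by (auto simp: abs_mult indicator_def)
  show i: "AE s in lborel. integrable lborel (%t. case (s, t) of (s, t) => f s * ?g (s - t) * h t)"
  proof (rule AE_I2)
   fix s
   show "integrable lborel (%t. case (s, t) of (s, t) => f s * ?g (s - t) * h t)"
    by (rule Bochner_Integration.integrable_bound[where f = "%t. \<bar>f s\<bar> * \<bar>h t\<bar>"]) (use b hi in \<open>auto intro!: integrable_mult_right integrable_abs\<close>)
  qed
  have i': "integrable lborel (%t. \<bar>f s * ?g (s - t) * h t\<bar>)" for s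
   by (rule Bochner_Integration.integrable_bound[where f = "%t. \<bar>f s\<bar> * \<bar>h t\<bar>"]) (use b hi in \<open>auto intro!: integrable_mult_right integrable_abs\<close>)
  show "integrable lborel (%s. \<integral>t. norm (case (s, t) of (s, t) => f s * ?g (s - t) * h t) \<partial>lborel)"
  proof (rule Bochner_Integration.integrable_bound[where f = "%s. \<bar>f s\<bar> * (\<integral>t. \<bar>h t\<bar> \<partial>lborel)"])
   show "integrable lborel (%s. \<bar>f s\<bar> * (\<integral>t. \<bar>h t\<bar> \<partial>lborel))"
    by (rule integrable_mult_left, rule integrable_abs, rule fi)
   show "AE s in lborel. norm (\<integral>t. norm (case (s, t) of (s, t) => f s * ?g (s - t) * h t) \<partial>lborel) <= norm (\<bar>f s\<bar> * (\<integral>t. \<bar>h t\<bar> \<partial>lborel))"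
   proof (rule AE_I2)
    fix s
    have "(\<integral>t. \<bar>f s * ?g (s - t) * h t\<bar> \<partial>lborel) <= (\<integral>t. \<bar>f s\<bar> * \<bar>h t\<bar> \<partial>lborel)"
     by (rule integral_mono[OF i' _ b]) (use hi in \<open>auto intro!: integrable_mult_right integrable_abs\<close>)
    moreover have "0 <= (\<integral>t. \<bar>f s * ?g (s - t) * h t\<bar> \<partial>lborel)" by (intro Bochner_Integration.integral_nonneg) simp
    moreover have "0 <= (\<integral>t. \<bar>h t\<bar> \<partial>lborel)" by (intro Bochner_Integration.integral_nonneg) simp
    ultimately show "norm (\<integral>t. norm (case (s, t) of (s, t) => f s * ?g (s - t) * h t) \<partial>lborel) <= norm (\<bar>f s\<bar> * (\<integral>t. \<bar>h t\<bar> \<partial>lborel))"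
     by simp
   qed
  qed measurable
 qed measurable
 have inner: "(\<integral>s. f s * ?g (s - t) * h t \<partial>lborel) = h t * (cum f (r + t) - cum f (q + t))" for t
 proof -
  have "(\<integral>s. f s * ?g (s - t) \<partial>lborel) = (\<integral>s. f s * (if q + t < s & s <= r + t then 1 else 0) \<partial>lborel)"
  proof (rule integral_cong_AE)
   show "AE s in lborel. f s * ?g (s - t) = f s * (if q + t < s & s <= r + t then 1 else 0)"
    using AE_lborel_singleton[of "r + t"] by eventually_elim (auto simp: indicator_def)
  qed measurable
  also have "\<dots> = cum f (r + t) - cum f (q + t)" by (rule cum_diff[OF fi, symmetric]) (use qr in simp)
  finally have e: "(\<integral>s. f s * ?g (s - t) \<partial>lborel) = cum f (r + t) - cum f (q + t)" .
  have "(\<integral>s. f s * ?g (s - t) * h t \<partial>lborel) = (\<integral>s. f s * ?g (s - t) \<partial>lborel) * h t"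
   by (rule integral_mult_left_zero)
  then show ?thesis unfolding e by (simp only: mult.commute)
 qed
 have "kernel_form k f ?g = (\<integral>p. f (fst p) * ?g (snd p) * h (fst p - snd p) \<partial>lborel2)"
  unfolding kernel_form_def by (intro Bochner_Integration.integral_cong eq refl)
 also have "\<dots> = (\<integral>s. (\<integral>t. f s * ?g t * h (s - t) \<partial>lborel) \<partial>lborel)"
  using lborel_pair.integral_fst'[OF I] by simp
 also have "\<dots> = (\<integral>s. (\<integral>t. f s * ?g (s - t) * h t \<partial>lborel) \<partial>lborel)"
 proof (rule Bochner_Integration.integral_cong[OF refl])
  fix s
  show "(\<integral>t. f s * ?g t * h (s - t) \<partial>lborel) = (\<integral>t. f s * ?g (s - t) * h t \<partial>lborel)"
   using lborel_integral_real_affine[of "-1" "%t. f s * ?g t * h (s - t)" s] by simp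
 qed
 also have "\<dots> = (\<integral>t. (\<integral>s. f s * ?g (s - t) * h t \<partial>lborel) \<partial>lborel)"
  by (rule lborel_pair.Fubini_integral[symmetric, OF J])
 finally have K: "kernel_form k f ?g = (\<integral>t. h t * (cum f (r + t) - cum f (q + t)) \<partial>lborel)" unfolding inner .
 have le: "\<bar>h t * (cum f (r + t) - cum f (q + t))\<bar> <= \<bar>h t\<bar> * (2 * S)" for t
  unfolding abs_mult by (intro mult_left_mono) (use S[rule_format, of "r + t"] S[rule_format, of "q + t"] in auto)
 have "\<bar>kernel_form k f ?g\<bar> <= (\<integral>t. \<bar>h t\<bar> * (2 * S) \<partial>lborel)"
  unfolding K
 proof (rule order_trans[OF integral_abs_bound integral_mono])
  show "integrable lborel (%t. \<bar>h t\<bar> * (2 * S))" using hi by (intro integrable_mult_left integrable_abs)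
  then show "integrable lborel (%t. \<bar>h t * (cum f (r + t) - cum f (q + t))\<bar>)"
  proof (rule Bochner_Integration.integrable_bound)
   show "AE t in lborel. norm \<bar>h t * (cum f (r + t) - cum f (q + t))\<bar> <= norm (\<bar>h t\<bar> * (2 * S))"
    by (rule AE_I2) (use order_trans[OF le abs_ge_self] in simp)
  qed measurable
 qed (rule le)
 also have "\<dots> = 2 * (\<integral>t. \<bar>h t\<bar> \<partial>lborel) * S" by simp
 finally show "\<bar>kernel_form k f ?g\<bar> <= 2 * (\<integral>t. \<bar>h t\<bar> \<partial>lborel) * S" .
qed

lemma rational_intervals_exhaust:
 fixes q r :: real
 obtains u v :: "nat => real" where "!!n. u n \<in> \<rat>" "!!n. v n \<in> \<rat>" "!!n. q < u n" "!!n. v n < r" "u ----> q" "v ----> r"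
proof -
 have "\<exists>u\<in>\<rat>. q < u & u < q + inverse (real (Suc n))" for n by (rule Rats_dense_in_real) simp
 then obtain u where u: "!!n. u n \<in> \<rat>" "!!n. q < u n" "!!n. u n < q + inverse (real (Suc n))" by metis
 have "\<exists>v\<in>\<rat>. r - inverse (real (Suc n)) < v & v < r" for n by (rule Rats_dense_in_real) simp
 then obtain v where v: "!!n. v n \<in> \<rat>" "!!n. v n < r" "!!n. r - inverse (real (Suc n)) < v n" by metis
 have l1: "(%n. q + inverse (real (Suc n))) ----> q" using tendsto_add[OF tendsto_const[of q] LIMSEQ_inverse_real_of_nat] by simp
 have l2: "(%n. r - inverse (real (Suc n))) ----> r" using tendsto_diff[OF tendsto_const[of r] LIMSEQ_inverse_real_of_nat] by simp
 have "u ----> q"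
  by (rule tendsto_sandwich[OF always_eventually[OF allI] always_eventually[OF allI] tendsto_const l1]) (rule less_imp_le[OF u(2)], rule less_imp_le[OF u(3)])
 moreover have "v ----> r"
  by (rule tendsto_sandwich[OF always_eventually[OF allI] always_eventually[OF allI] l2 tendsto_const]) (rule less_imp_le[OF v(3)], rule less_imp_le[OF v(2)])
 ultimately show ?thesis by (rule that[OF u(1) v(1) u(2) v(2)])
qed

context log_kernel
begin

sublocale form: psd_form L2_bounded_support "kernel_form B" by (rule kernel_psd)

text \<open>The functional \<open>x\<close> is bounded for the \<open>L\<^sub>2\<close> norm; the sets on whose indicators it vanishes
  form a Dynkin system.\<close>

lemma vanishing_on_intervals:
 assumes x: "x \<in> ip_completion L2_bounded_support (kernel_form B) L2_bounded_support" and ac: "a < c"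
  and z: "!!q r. q \<in> \<rat> ==> r \<in> \<rat> ==> a < q ==> q < r ==> r < c ==> x (indicator {q<..<r}) = 0"
  and g: "g \<in> L2_on a c"
 shows "x g = 0"
proof -
 obtain \<beta> where \<beta>: "0 <= \<beta>" "!!f. f \<in> L2_on a c ==> kernel_form B f f <= \<beta> * (\<integral>s. (f s)^2 \<partial>lborel)"
  by (rule kernel_form_bounded[OF B_local ac]) (rule that)
 have LD: "h \<in> L2_bounded_support" if "h \<in> L2_on a c" for h using that L2_on_subset_bounded_support by blast
 have lin: "linear_map_on (L2_on a c) x"
  using form.completion_linear[OF x] LD unfolding linear_map_on_def by blast
 have neg: "x (h - h') = x h - x h'" if h: "h \<in> L2_on a c" "h' \<in> L2_on a c" for h h'
 proof -
  have "x (h + (-1) *\<^sub>R h') = x h + (-1) *\<^sub>R x h'"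
   using lin h subspace_scale[OF L2_on_subspace h(2), of "-1"] unfolding linear_map_on_def by metis
  then show ?thesis by simp
 qed
 have add: "x (h + h') = x h + x h'" if "h \<in> L2_on a c" "h' \<in> L2_on a c" for h h'
  using lin that unfolding linear_map_on_def by blast
 have x0: "x 0 = 0" using neg[OF subspace_0[OF L2_on_subspace] subspace_0[OF L2_on_subspace]] by simp
 \<comment> \<open>Pointwise convergence with a square integrable majorant is convergence in square
   mean, for which \<open>x\<close> is continuous because the form is bounded by the square
   mean.\<close>
 have conv: "(%n. x (h n)) ----> x h0"
  if h: "!!n. h n \<in> L2_on a c" "h0 \<in> L2_on a c" and w: "w \<in> L2_on a c" "!!n s. \<bar>h n s\<bar> <= w s" "!!s. \<bar>h0 s\<bar> <= w s"
   and lim: "!!s. (%n. h n s) ----> h0 s" for h h0 w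
 proof -
  note [measurable] = L2_onD(1)[OF h(1)] L2_onD(1)[OF h(2)] L2_onD(1)[OF w(1)]
  have d: "h n - h0 \<in> L2_on a c" for n using h by (intro subspace_diff[OF L2_on_subspace])
  have "(%n. \<integral>s. (h n s - h0 s)^2 \<partial>lborel) ----> (\<integral>s. 0 \<partial>(lborel :: real measure))"
  proof (rule integral_dominated_convergence[where w = "%s. 4 * (w s)^2"])
   show "AE s in lborel. (%n. (h n s - h0 s)^2) ----> 0"
    using lim by (intro AE_I2) (auto intro!: tendsto_eq_intros)
   show "AE s in lborel. norm ((h n s - h0 s)^2) <= 4 * (w s)^2" for n
   proof (rule AE_I2)
    fix s
    have "\<bar>h n s - h0 s\<bar> <= 2 * w s" using w(2)[of n s] w(3)[of s] by linarith
    then have "\<bar>h n s - h0 s\<bar>\<^sup>2 <= (2 * w s)^2" by (intro power_mono) simp_all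
    then show "norm ((h n s - h0 s)^2) <= 4 * (w s)^2" by (simp add: power_mult_distrib)
   qed
  qed (use L2_onD(2)[OF w(1)] in simp_all)
  then have l: "(%n. completion_norm L2_bounded_support (kernel_form B) x * sqrt (\<beta> * (\<integral>s. (h n s - h0 s)^2 \<partial>lborel))) ----> 0"
   by (auto intro!: tendsto_eq_intros)
  have le: "norm (x (h n) - x h0) <= completion_norm L2_bounded_support (kernel_form B) x * sqrt (\<beta> * (\<integral>s. (h n s - h0 s)^2 \<partial>lborel))" for n
  proof -
   have "ip_norm (kernel_form B) (h n - h0) <= sqrt (\<beta> * (\<integral>s. (h n s - h0 s)^2 \<partial>lborel))"
    unfolding ip_norm_def using \<beta>(2)[OF d[of n]] by (intro real_sqrt_le_mono) simp
   then have "completion_norm L2_bounded_support (kernel_form B) x * ip_norm (kernel_form B) (h n - h0)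
     <= completion_norm L2_bounded_support (kernel_form B) x * sqrt (\<beta> * (\<integral>s. (h n s - h0 s)^2 \<partial>lborel))"
    by (intro mult_left_mono form.completion_norm_nonneg[OF x])
   then show ?thesis using form.completion_apply_bound[OF x LD[OF d[of n]]] neg[OF h(1)[of n] h(2)] by simp
  qed
  have "(%n. x (h n) - x h0) ----> 0"
   by (rule Lim_null_comparison[OF always_eventually[OF allI] l]) (rule le)
  then show ?thesis by (simp add: LIM_zero_iff)
 qed
 have one: "indicator {a<..<c} \<in> L2_on a c" by (rule interval_L2_on) simp_all
 have conv_set: "(%n. x (indicator (T n \<inter> {a<..<c}))) ----> x (indicator (T0 \<inter> {a<..<c}))"
  if T: "!!n. T n \<in> sets borel" "T0 \<in> sets borel" "!!s. s \<in> {a<..<c} ==> \<forall>\<^sub>F n in sequentially. s \<in> T n \<longleftrightarrow> s \<in> T0" for T T0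
 proof (rule conv[OF indicator_L2_on[OF T(1)] indicator_L2_on[OF T(2)] one])
  fix s
  show "(%n. indicator (T n \<inter> {a<..<c}) s :: real) ----> indicator (T0 \<inter> {a<..<c}) s"
  proof (cases "s \<in> {a<..<c}")
   case True
   have "\<forall>\<^sub>F n in sequentially. indicator (T n \<inter> {a<..<c}) s = (indicator (T0 \<inter> {a<..<c}) s :: real)"
    using T(3)[OF True] by eventually_elim (auto simp: indicator_def)
   then show ?thesis by (rule tendsto_eventually)
  qed simp
 qed (auto simp: indicator_def)
 have emp: "x (indicator {}) = 0"
 proof -
  have "(indicator {} :: real => real) = 0" by (auto simp: fun_eq_iff)
  then show ?thesis using x0 by simp
 qed
 have emp': "x (%_. 0) = 0" using x0 by (simp add: zero_fun_def)
 \<comment> \<open>Intervals with rational end points increase to the part of the given one inside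
   \<open>{a<..<c}\<close>; only countably many intervals are tested, which also serves
   separability.\<close>
 have interval: "x (indicator ({q<..<r} \<inter> {a<..<c})) = 0" for q r
 proof -
  obtain u v :: "nat => real" where uv: "!!n. u n \<in> \<rat>" "!!n. v n \<in> \<rat>" "!!n. max q a < u n" "!!n. v n < min r c"
   "u ----> max q a" "v ----> min r c" by (rule rational_intervals_exhaust[of "max q a" "min r c"]) (rule that)
  have "(%n. x (indicator ({u n<..<v n} \<inter> {a<..<c}))) ----> x (indicator ({q<..<r} \<inter> {a<..<c}))"
  proof (rule conv_set)
   fix s assume s: "s \<in> {a<..<c}"
   show "\<forall>\<^sub>F n in sequentially. s \<in> {u n<..<v n} \<longleftrightarrow> s \<in> {q<..<r}"
   proof (cases "s \<in> {q<..<r}")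
    case True
    then have "max q a < s" "s < min r c" using s by auto
    then have "\<forall>\<^sub>F n in sequentially. u n < s" "\<forall>\<^sub>F n in sequentially. s < v n"
     using order_tendstoD(2)[OF uv(5)] order_tendstoD(1)[OF uv(6)] by auto
    then show ?thesis by eventually_elim (use True in auto)
   next
    case False
    have "s \<notin> {u n<..<v n}" for n using uv(3)[of n] uv(4)[of n] False by auto
    then have "s \<in> {u n<..<v n} \<longleftrightarrow> s \<in> {q<..<r}" for n using False by blast
    then show ?thesis by (intro always_eventually allI)
   qed
  qed simp_all
  moreover have "x (indicator ({u n<..<v n} \<inter> {a<..<c})) = 0" for n
  proof (cases "u n < v n")
   case True
   have "{u n<..<v n} \<inter> {a<..<c} = {u n<..<v n}" using uv(3)[of n] uv(4)[of n] by auto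
   then show ?thesis using z[OF uv(1,2)[of n] _ True] uv(3)[of n] uv(4)[of n] by simp
  qed (use emp in auto)
  ultimately show ?thesis by (simp add: LIMSEQ_const_iff)
 qed
 have borel: "x (indicator (T \<inter> {a<..<c})) = 0" if T: "T \<in> sets borel" for T
 proof -
  let ?G = "range (%(q, r). {q<..<r :: real})"
  have sb: "sets borel = sigma_sets UNIV ?G" unfolding borel_eq_box box_real by (rule sets_measure_of) simp
  have "Int_stable ?G"
  proof (rule Int_stableI)
   fix A A' assume "A \<in> ?G" "A' \<in> ?G"
   then obtain q r q' r' where "A = {q<..<r}" "A' = {q'<..<r'}" by auto
   then have "A \<inter> A' = (case (max q q', min r r') of (q, r) => {q<..<r})" by auto
   then show "A \<inter> A' \<in> ?G" by blast
  qed
  moreover have "?G <= Pow UNIV" by simp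
  moreover have "T \<in> sigma_sets UNIV ?G" using T sb by simp
  ultimately show ?thesis
  proof (induction rule: sigma_sets_induct_disjoint)
   case (basic A)
   then show ?case using interval by auto
  next
   case empty
   then show ?case by (simp only: Int_empty_left emp)
  next
   case (compl A)
   have A: "A \<in> sets borel" using compl sb by simp
   have e: "(indicator ((UNIV - A) \<inter> {a<..<c}) :: real => real) = indicator ({a<..<c} \<inter> {a<..<c}) - indicator (A \<inter> {a<..<c})"
    by (auto simp: fun_eq_iff indicator_def)
   have "x (indicator ({a<..<c} \<inter> {a<..<c}) - indicator (A \<inter> {a<..<c})) = x (indicator ({a<..<c} \<inter> {a<..<c})) - x (indicator (A \<inter> {a<..<c}))"
    by (rule neg[OF indicator_L2_on indicator_L2_on[OF A]]) simp
   then show ?case by (simp only: e compl(2) interval diff_self)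
  next
   case (union A)
   have A: "A n \<in> sets borel" for n unfolding sb using union(2) by blast
   have part: "x (indicator ((\<Union>i<n. A i) \<inter> {a<..<c})) = 0" for n
   proof (induction n)
    case (Suc n)
    have "A i \<inter> A n = {}" if "i < n" for i
     by (rule disjoint_family_onD[OF union(1)]) (use that in auto)
    then have "(\<Union>i<n. A i) \<inter> A n = {}" by blast
    then have e: "(indicator ((\<Union>i<Suc n. A i) \<inter> {a<..<c}) :: real => real) = indicator ((\<Union>i<n. A i) \<inter> {a<..<c}) + indicator (A n \<inter> {a<..<c})"
     unfolding lessThan_Suc by (auto simp: fun_eq_iff indicator_def)
    have "(\<Union>i<n. A i) \<in> sets borel" using A by (intro sets.finite_UN) simp_all
    then have "x (indicator ((\<Union>i<n. A i) \<inter> {a<..<c}) + indicator (A n \<inter> {a<..<c})) = x (indicator ((\<Union>i<n. A i) \<inter> {a<..<c})) + x (indicator (A n \<inter> {a<..<c}))"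
     by (intro add indicator_L2_on A)
    then show ?case by (simp only: e Suc union(3) add_0)
   qed (use emp' in simp)
   have "(%n. x (indicator ((\<Union>i<n. A i) \<inter> {a<..<c}))) ----> x (indicator ((\<Union>i. A i) \<inter> {a<..<c}))"
   proof (rule conv_set)
    fix s
    show "\<forall>\<^sub>F n in sequentially. s \<in> (\<Union>i<n. A i) \<longleftrightarrow> s \<in> (\<Union>i. A i)"
    proof (cases "s \<in> (\<Union>i. A i)")
     case True
     then obtain i where "s \<in> A i" by blast
     then show ?thesis by (intro eventually_sequentiallyI[of "Suc i"]) auto
    qed auto
   qed (use A in auto)
   then show ?case unfolding part by (simp add: LIMSEQ_const_iff)
  qed
 qed
 have gm: "g \<in> borel_measurable borel" by (rule L2_onD(1)[OF g])
 obtain F where F: "!!i. simple_function borel (F i)" "!!s. (%i. F i s) ----> g s" "!!i s. dist (F i s) 0 <= 2 * dist (g s) 0"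
  using borel_measurable_implies_sequence_metric[OF gm, of 0] by auto
 have Fb: "\<bar>F i s\<bar> <= 2 * \<bar>g s\<bar>" for i s using F(3)[of i s] by simp
 have F0: "F i s = 0" if "s \<notin> {a<..<c}" for i s using Fb[of i s] L2_onD(3)[OF g that] by simp
 have w: "(%s. 2 * \<bar>g s\<bar>) \<in> L2_on a c"
  unfolding L2_on_def using gm L2_onD(2,3)[OF g] by (auto simp: power_mult_distrib)
 have FL: "F i \<in> L2_on a c" for i
 proof -
  have m: "F i \<in> borel_measurable borel" by (rule borel_measurable_simple_function[OF F(1)])
  have "integrable lborel (%s. (F i s)^2)"
  proof (rule Bochner_Integration.integrable_bound)
   show "integrable lborel (%s. (2 * \<bar>g s\<bar>)^2)" by (rule L2_onD(2)[OF w])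
   show "AE s in lborel. norm ((F i s)^2) <= norm ((2 * \<bar>g s\<bar>)^2)"
   proof (rule AE_I2)
    fix s
    have "\<bar>F i s\<bar>\<^sup>2 <= (2 * \<bar>g s\<bar>)^2" by (rule power_mono[OF Fb]) simp
    then show "norm ((F i s)^2) <= norm ((2 * \<bar>g s\<bar>)^2)" by simp
   qed
  qed (use m in simp)
  then show ?thesis unfolding L2_on_def using m F0 by auto
 qed
 have Fz: "x (F i) = 0" for i
 proof -
  have fin: "finite (range (F i))" using F(1)[of i] unfolding simple_function_def by simp
  have sets: "F i -` {y} \<in> sets borel" for y
   using simple_functionD(2)[OF F(1), of i "{y}"] by simp
  have "F i = (\<Sum>y\<in>range (F i). y *\<^sub>R indicator (F i -` {y} \<inter> {a<..<c}))"
  proof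
   fix s
   have "(\<Sum>y\<in>range (F i). y * indicator (F i -` {y} \<inter> {a<..<c}) s) = (\<Sum>y\<in>range (F i). if y = F i s then F i s else 0)"
    by (intro sum.cong) (use F0[of s i] in \<open>auto simp: indicator_def\<close>)
   also have "\<dots> = F i s" using fin by simp
   finally show "F i s = (\<Sum>y\<in>range (F i). y *\<^sub>R indicator (F i -` {y} \<inter> {a<..<c})) s"
    unfolding fun_sum_apply by simp
  qed
  then have "x (F i) = x (\<Sum>y\<in>range (F i). y *\<^sub>R indicator (F i -` {y} \<inter> {a<..<c}))" by (rule arg_cong)
  also have "\<dots> = (\<Sum>y\<in>range (F i). y *\<^sub>R x (indicator (F i -` {y} \<inter> {a<..<c})))"
   by (rule linear_map_on_sum[OF lin L2_on_subspace]) (use indicator_L2_on[OF sets] in auto)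
  also have "\<dots> = 0" using borel[OF sets] by simp
  finally show ?thesis .
 qed
 have "(%i. x (F i)) ----> x g"
  by (rule conv[OF FL g w Fb _ F(2)]) simp
 then show ?thesis unfolding Fz by (simp add: LIMSEQ_const_iff)
qed

text \<open>The countable family of rational intervals separates points. This yields separability
  and reduces the proof that a point is 0 to testing it on intervals.\<close>

lemma kernel_space_total:
 assumes x: "x \<in> kernel_space B a c" and ac: "a < c"
  and z: "!!q r. q \<in> \<rat> ==> r \<in> \<rat> ==> a < q ==> q < r ==> r < c ==> x (indicator {q<..<r}) = 0"
 shows "x = 0"
proof (rule form.completion_zero[OF L2_on_subset_bounded_support x[unfolded kernel_space_def]])
 have xD: "x \<in> ip_completion L2_bounded_support (kernel_form B) L2_bounded_support"
  using x form.completion_mono[OF L2_on_subset_bounded_support] unfolding kernel_space_def by blast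
 show "x g = 0" if "g \<in> L2_on a c" for g by (rule vanishing_on_intervals[OF xD ac _ that]) (rule z)
qed

text \<open>Let \<open>f n\<close> from the left and \<open>g n\<close> from the right represent the
  same point. Their difference tends to 0 in norm, so \<open>cum (f n) - cum (g n)\<close> tends to
  0 uniformly. Up to \<open>p\<close> the second term is 0, and beyond \<open>p\<close> the first
  one is constant, so \<open>cum (f n)\<close> alone tends to 0 uniformly. Then the values on
  intervals tend to 0.\<close>

lemma kernel_space_disjoint:
 assumes ap: "a < p" "p < c" and x: "x \<in> kernel_space B a p" "x \<in> kernel_space B p c"
 shows "x = 0"
proof -
 have sub: "L2_on a p <= L2_on a c" "L2_on p c <= L2_on a c" using ap by (simp_all add: L2_on_mono)
 have xc: "x \<in> kernel_space B a c" using x(1) form.completion_mono[OF sub(1)] unfolding kernel_space_def by blast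
 obtain f where f: "range f <= L2_on a p" "range f <= L2_bounded_support" "ip_Cauchy (kernel_form B) f"
  "x = completion_point L2_bounded_support (kernel_form B) f"
  using form.completionE[OF x(1)[unfolded kernel_space_def] L2_on_subset_bounded_support] by metis
 obtain g where g: "range g <= L2_on p c" "range g <= L2_bounded_support" "ip_Cauchy (kernel_form B) g"
  "x = completion_point L2_bounded_support (kernel_form B) g"
  using form.completionE[OF x(2)[unfolded kernel_space_def] L2_on_subset_bounded_support] by metis
 have fn: "f n \<in> L2_on a p" "g n \<in> L2_on p c" "f n \<in> L2_on a c" "g n \<in> L2_on a c" for n using f(1) g(1) sub by auto
 obtain C where C: "0 <= C" "!!h u v. h \<in> L2_on a c ==> (cum h v - cum h u)\<^sup>2 <= C * kernel_form B h h"
  "!!A h u v. bessel (ip_norm (kernel_form B)) A h ==> h ` A <= L2_on a c ==> (\<Sum>i\<in>A. (cum (h i) v - cum (h i) u)^2) <= C"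
  by (rule increment_bound[OF less_trans[OF ap]]) (rule that)
 define d where "d = (%n. sqrt C * ip_norm (kernel_form B) (f n - g n))"
 have dlim: "d ----> 0"
 proof -
  have "(%n. ip_norm (kernel_form B) (f n - g n)) ----> 0"
   using form.completion_point_eq_iff[OF f(2,3) g(2,3)] f(4) g(4) by simp
  then show ?thesis unfolding d_def by (rule tendsto_mult_right_zero)
 qed
 have dn: "\<bar>cum (f n) y - cum (g n) y\<bar> <= d n" for n y
 proof -
  have h: "f n - g n \<in> L2_on a c" by (intro subspace_diff[OF L2_on_subspace] fn)
  have "cum (f n + (-1) *\<^sub>R g n) y = cum (f n) y - cum (g n) y"
   using cum_add[OF fn(3) subspace_scale[OF L2_on_subspace fn(4), of "-1" n], of n y] cum_scale[of "-1" "g n" y] by simp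
  then have "cum (f n - g n) y = cum (f n) y - cum (g n) y" by simp
  moreover have "cum (f n - g n) a = 0" by (rule cum_left[OF h]) simp
  ultimately have "(cum (f n) y - cum (g n) y)^2 <= C * kernel_form B (f n - g n) (f n - g n)" using C(2)[OF h, of y a] by simp
  then have "\<bar>cum (f n) y - cum (g n) y\<bar> <= sqrt (C * kernel_form B (f n - g n) (f n - g n))"
   using real_sqrt_le_mono by fastforce
  then show ?thesis unfolding d_def ip_norm_def by (simp add: real_sqrt_mult)
 qed
 \<comment> \<open>Beyond \<open>p\<close> the value of \<open>cum (f n)\<close> is the one at
   \<open>p\<close>, where the other integral still vanishes.\<close>
 have fd: "\<bar>cum (f n) y\<bar> <= d n" for n y
 proof -
  have le: "\<bar>cum (f n) v\<bar> <= d n" if "v <= p" for v using dn[of n v] cum_left[OF fn(2) that, of n] by simp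
  show ?thesis
  proof (cases "y <= p")
   case False
   then have "cum (f n) y = cum (f n) p" using cum_right[OF fn(1), of y n] cum_right[OF fn(1), of p n] by simp
   then show ?thesis using le[of p] by simp
  qed (rule le)
 qed
 show ?thesis
 proof (rule kernel_space_total[OF xc less_trans[OF ap]])
  fix q r assume qr: "a < q" "q < r" "r < c"
  obtain K where K: "0 <= K" "!!h S. h \<in> L2_on a c ==> \<forall>y. \<bar>cum h y\<bar> <= S ==> \<bar>kernel_form B h (indicator {q<..<r})\<bar> <= K * S"
   by (rule kernel_form_interval_bound[OF B_local qr(2), of a c]) (rule that)
  have iD: "indicator {q<..<r} \<in> L2_bounded_support"
   using interval_L2_on[of q q r r] L2_on_subset_bounded_support by auto
  have "(%n. kernel_form B (f n) (indicator {q<..<r})) ----> x (indicator {q<..<r})"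
   unfolding f(4) by (rule form.completion_point_lim[OF f(2,3) iD])
  moreover have "(%n. kernel_form B (f n) (indicator {q<..<r})) ----> 0"
  proof (rule Lim_null_comparison[OF always_eventually[OF allI] tendsto_mult_right_zero[OF dlim]])
   show "norm (kernel_form B (f n) (indicator {q<..<r})) <= K * d n" for n
    using K(2)[OF fn(3), of n "d n"] fd[of n] by simp
  qed
  ultimately show "x (indicator {q<..<r}) = 0" by (rule LIMSEQ_unique)
 qed
qed

end

context inner_product_form
begin

lemma convergent_Cauchy:
 assumes f: "range f <= D" and x: "x \<in> D" and lim: "(%n. ip_norm ip (f n - x)) ----> 0"
 shows "ip_Cauchy ip f"
 unfolding ip_Cauchy_def
proof (intro allI impI)
 fix e :: real assume "e > 0"
 then have "e / 2 > 0" by simp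
 then obtain M where M: "\<forall>n\<ge>M. norm (ip_norm ip (f n - x) - 0) < e / 2" using LIMSEQ_D[OF lim] by blast
 have "ip_norm ip (f m - f n) < e" if "m \<ge> M" "n \<ge> M" for m n
 proof -
  have fD: "f m \<in> D" "f n \<in> D" using f by auto
  have "ip_norm ip ((f m - x) + (x - f n)) <= ip_norm ip (f m - x) + ip_norm ip (x - f n)"
   by (rule triangle) (use fD x in auto)
  moreover have "ip_norm ip (f m - x) < e / 2" "ip_norm ip (f n - x) < e / 2"
   using M[rule_format, OF that(1)] M[rule_format, OF that(2)] by auto
  ultimately show ?thesis using norm_minus[OF x fD(2)] by simp
 qed
 then show "\<exists>M. \<forall>m\<ge>M. \<forall>n\<ge>M. ip_norm ip (f m - f n) < e" by blast
qed

lemma limit_unique: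
 assumes f: "range f <= D" and x: "x \<in> D" "y \<in> D"
  and lim: "(%n. ip_norm ip (f n - x)) ----> 0" "(%n. ip_norm ip (f n - y)) ----> 0"
 shows "x = y"
proof -
 have "ip_norm ip (x - y) <= ip_norm ip (f n - x) + ip_norm ip (f n - y)" for n
 proof -
  have fD: "f n \<in> D" using f by auto
  have "ip_norm ip ((x - f n) + (f n - y)) <= ip_norm ip (x - f n) + ip_norm ip (f n - y)"
   by (rule triangle) (use fD x in auto)
  then show ?thesis using norm_minus[OF x(1) fD] by simp
 qed
 moreover have "(%n. ip_norm ip (f n - x) + ip_norm ip (f n - y)) ----> 0" using tendsto_add[OF lim] by simp
 ultimately have "ip_norm ip (x - y) <= 0" by (intro LIMSEQ_le_const) auto
 moreover have d: "x - y \<in> D" using x by simp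
 ultimately have "ip_norm ip (x - y) = 0" using norm_nonneg[OF d] by linarith
 then have "ip (x - y) (x - y) = 0" using norm_sq[OF d] by simp
 then show ?thesis using definite[OF d] by simp
qed

lemma hilbert_subspace_closed:
 assumes K: "hilbert_form K ip" "K <= D"
  and f: "range f <= K" and x: "x \<in> D" and lim: "(%n. ip_norm ip (f n - x)) ----> 0"
 shows "x \<in> K"
proof -
 have fD: "range f <= D" using f K(2) by blast
 obtain y where y: "y \<in> K" "(%n. ip_norm ip (f n - y)) ----> 0"
  using hilbert_form.complete[OF K(1) f convergent_Cauchy[OF fD x lim]] by blast
 have "x = y" by (rule limit_unique[OF fD x _ lim y(2)]) (use y(1) K(2) in blast)
 then show ?thesis using y(1) by simp
qed

end

text \<open>A positive angle bounds each summand by \<open>1 / sqrt (1 - \<rho>)\<close> times the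
  norm of the sum, so the summands of a convergent sequence of sums are Cauchy in their own complete
  spaces.\<close>

lemma (in hilbert_form) angle_sum_closed:
 assumes H1: "hilbert_form H1 ip" "H1 <= D" and H2: "hilbert_form H2 ip" "H2 <= D"
  and \<rho>: "0 <= \<rho>" "\<rho> < 1" and angle: "!!u v. u \<in> H1 ==> v \<in> H2 ==> \<bar>ip u v\<bar> <= \<rho> * ip_norm ip u * ip_norm ip v"
  and x: "x \<in> D" and y: "!!n. y n \<in> H1" and z: "!!n. z n \<in> H2"
  and lim: "(%n. ip_norm ip (y n + z n - x)) ----> 0"
 shows "\<exists>x1\<in>H1. \<exists>x2\<in>H2. x = x1 + x2"
proof -
 interpret h1: hilbert_form H1 ip by (rule H1(1))
 interpret h2: hilbert_form H2 ip by (rule H2(1))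
 define k where "k = sqrt (1 - \<rho>)"
 have k: "k > 0" "k\<^sup>2 = 1 - \<rho>" unfolding k_def using \<rho> by auto
 have le: "k * ip_norm ip u <= ip_norm ip (u + v) & k * ip_norm ip v <= ip_norm ip (u + v)"
  if u: "u \<in> H1" "v \<in> H2" for u v
 proof -
  have uD: "u \<in> D" "v \<in> D" using u H1(2) H2(2) by auto
  have n0: "0 <= ip_norm ip u" "0 <= ip_norm ip v" using uD by auto
  have sq: "(ip_norm ip (u + v))^2 = (ip_norm ip u)^2 + 2 * ip u v + (ip_norm ip v)^2"
   using ip_sum_sq[OF uD, of 1] norm_sq[of "u + v"] norm_sq[OF uD(1)] norm_sq[OF uD(2)] uD by simp
  have a: "- ip u v <= \<rho> * (ip_norm ip u * ip_norm ip v)" using angle[OF u] by (simp add: mult.assoc)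
  have "2 * (ip_norm ip u * ip_norm ip v) <= (ip_norm ip u)^2 + (ip_norm ip v)^2"
   using zero_le_power2[of "ip_norm ip u - ip_norm ip v"] by (simp add: power2_diff)
  then have "\<rho> * (2 * (ip_norm ip u * ip_norm ip v)) <= \<rho> * ((ip_norm ip u)^2 + (ip_norm ip v)^2)"
   by (rule mult_left_mono[OF _ \<rho>(1)])
  with a have b: "k\<^sup>2 * (ip_norm ip u)^2 + k\<^sup>2 * (ip_norm ip v)^2 <= (ip_norm ip (u + v))^2"
   unfolding sq k(2) by (simp add: algebra_simps)
  have "(k * ip_norm ip u)^2 <= (ip_norm ip (u + v))^2" "(k * ip_norm ip v)^2 <= (ip_norm ip (u + v))^2"
   unfolding power_mult_distrib by (rule order_trans[OF _ b], simp)+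
  moreover have "0 <= ip_norm ip (u + v)" using uD by simp
  ultimately show ?thesis using power2_le_imp_le by blast
 qed
 have yD: "y n \<in> D" "z n \<in> D" for n using y z H1(2) H2(2) by auto
 have "ip_Cauchy ip (%n. y n + z n)" by (rule convergent_Cauchy[OF _ x lim]) (use yD in auto)
 then have C: "\<exists>M. \<forall>m\<ge>M. \<forall>n\<ge>M. ip_norm ip (y m + z m - (y n + z n)) < k * e" if "e > 0" for e
  using that k(1) unfolding ip_Cauchy_def by simp
 have le': "k * ip_norm ip (y m - y n) <= ip_norm ip (y m + z m - (y n + z n))"
  "k * ip_norm ip (z m - z n) <= ip_norm ip (y m + z m - (y n + z n))" for m n
 proof -
  have e: "y m + z m - (y n + z n) = (y m - y n) + (z m - z n)" by simp
  show "k * ip_norm ip (y m - y n) <= ip_norm ip (y m + z m - (y n + z n))"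
   "k * ip_norm ip (z m - z n) <= ip_norm ip (y m + z m - (y n + z n))"
   unfolding e using le[OF subspace_diff[OF h1.D y y] subspace_diff[OF h2.D z z], of m n m n] by blast+
 qed
 have "ip_Cauchy ip y" "ip_Cauchy ip z"
  unfolding ip_Cauchy_def
  using C order.strict_trans1[OF le'(1)] order.strict_trans1[OF le'(2)] k(1) by (meson mult_less_cancel_left_pos)+
 then obtain x1 x2 where x1: "x1 \<in> H1" "(%n. ip_norm ip (y n - x1)) ----> 0"
  and x2: "x2 \<in> H2" "(%n. ip_norm ip (z n - x2)) ----> 0"
  using h1.complete[of y] h2.complete[of z] y z by (metis image_subsetI)
 have xD: "x1 \<in> D" "x2 \<in> D" using x1 x2 H1(2) H2(2) by auto
 have "(%n. ip_norm ip (y n + z n - (x1 + x2))) ----> 0"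
 proof (rule tendsto_sandwich[OF always_eventually[OF allI] always_eventually[OF allI] tendsto_const])
  show "(%n. ip_norm ip (y n - x1) + ip_norm ip (z n - x2)) ----> 0" using tendsto_add[OF x1(2) x2(2)] by simp
  show "0 <= ip_norm ip (y n + z n - (x1 + x2))" for n using yD xD by simp
  have e: "y n + z n - (x1 + x2) = (y n - x1) + (z n - x2)" for n by simp
  show "ip_norm ip (y n + z n - (x1 + x2)) <= ip_norm ip (y n - x1) + ip_norm ip (z n - x2)" for n
   unfolding e by (rule triangle) (use yD xD in auto)
 qed
 then have "x = x1 + x2" by (intro limit_unique[OF _ x _ lim]) (use yD xD in auto)
 then show ?thesis using x1(1) x2(1) by blast
qed

lemma fhs_equiv_cong_first:
 assumes "separable_hilbert_norm H K" "(K', N) \<in> fhs_equiv H" "!!x. x \<in> H ==> K' x = K x"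
 shows "(K, N) \<in> fhs_equiv H"
 using fhs_equiv_pullback[OF assms(1), of id H K' N] assms(2,3) by (simp add: linear_map_on_def)

context psd_form
begin

lemma completion_map_in:
 assumes T: "linear_map_on D T" "T ` D <= D" "!!x. x \<in> D ==> ip_norm ip (T x) = ip_norm ip x"
  and S: "S <= D" "T ` S <= S'" and x: "x \<in> ip_completion D ip S"
 shows "completion_map D ip T x \<in> ip_completion D ip S'"
  and "completion_norm D ip (completion_map D ip T x) = completion_norm D ip x"
proof -
 obtain f where f: "range f <= S" "range f <= D" "ip_Cauchy ip f" "x = completion_point D ip f"
  using completionE[OF x S(1)] by metis
 have fD: "f n \<in> D" for n using f(2) by auto
 have "T (f m - f n) = T (f m) - T (f n)" for m n
 proof -
  have "T (f m + (-1) *\<^sub>R f n) = T (f m) + (-1) *\<^sub>R T (f n)"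
   using T(1) fD subspace_scale[OF D fD] unfolding linear_map_on_def by metis
  then show ?thesis by simp
 qed
 then have "ip_norm ip (T (f m) - T (f n)) = ip_norm ip (f m - f n)" for m n
  using T(3)[of "f m - f n"] fD by simp
 then have C: "ip_Cauchy ip (%n. T (f n))" using f(3) unfolding ip_Cauchy_def by simp
 have m: "completion_map D ip T x = completion_point D ip (%n. T (f n))"
  unfolding f(4) by (rule completion_map_point[OF T f(2,3)])
 have r: "range (%n. T (f n)) <= S'" "range (%n. T (f n)) <= D" using f(1) S(2) T(2) fD by auto
 show "completion_map D ip T x \<in> ip_completion D ip S'" unfolding m ip_completion_def using r(1) C by blast
 have "(%n. ip_norm ip (f n)) ----> completion_norm D ip (completion_map D ip T x)"
  using completion_norm_lim[OF r(2) C] T(3)[OF fD] unfolding m by simp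
 then show "completion_norm D ip (completion_map D ip T x) = completion_norm D ip x"
  using completion_norm_lim[OF f(2,3)] unfolding f(4) by (rule LIMSEQ_unique)
qed

lemma completion_map_linear:
 assumes T: "linear_map_on D T" "T ` D <= D" "!!x. x \<in> D ==> ip_norm ip (T x) = ip_norm ip x"
 shows "linear_map_on (ip_completion D ip D) (completion_map D ip T)"
proof -
 have TC: "range (%n. T (f n)) <= D" "ip_Cauchy ip (%n. T (f n))" if f: "range f <= D" "ip_Cauchy ip f" for f
 proof -
  have fD: "f n \<in> D" for n using f(1) by auto
  have "T (f m - f n) = T (f m) - T (f n)" for m n
  proof -
   have "T (f m + (-1) *\<^sub>R f n) = T (f m) + (-1) *\<^sub>R T (f n)"
    using T(1) fD subspace_scale[OF D fD] unfolding linear_map_on_def by metis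
   then show ?thesis by simp
  qed
  then have "ip_norm ip (T (f m) - T (f n)) = ip_norm ip (f m - f n)" for m n
   using T(3)[of "f m - f n"] fD by simp
  then show "ip_Cauchy ip (%n. T (f n))" using f(2) unfolding ip_Cauchy_def by simp
  show "range (%n. T (f n)) <= D" using T(2) fD by auto
 qed
 have mp: "completion_map D ip T (completion_point D ip f) = completion_point D ip (%n. T (f n))"
  if "range f <= D" "ip_Cauchy ip f" for f
  by (rule completion_map_point[OF T that])
 show ?thesis unfolding linear_map_on_def
 proof (intro conjI ballI allI)
  fix x c assume "x \<in> ip_completion D ip D"
  then obtain f where f: "range f <= D" "ip_Cauchy ip f" "x = completion_point D ip f" using completionE[OF _ subset_refl] by metis
  have fD: "f n \<in> D" for n using f(1) by auto
  have Ts: "(%n. T (c *\<^sub>R f n)) = (%n. c *\<^sub>R T (f n))" for c using T(1) fD unfolding linear_map_on_def by auto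
  show "completion_map D ip T (c *\<^sub>R x) = c *\<^sub>R completion_map D ip T x" for c
  proof -
   have "completion_map D ip T (c *\<^sub>R x) = completion_point D ip (%n. T (c *\<^sub>R f n))"
    unfolding f(3) point_scale[OF f(1,2), symmetric] by (rule mp) (use fD Cauchy_scale[OF f(1,2)] in auto)
   then show ?thesis unfolding Ts point_scale[OF TC[OF f(1,2)]] using mp[OF f(1,2)] f(3) by simp
  qed
  fix y assume "y \<in> ip_completion D ip D"
  then obtain g where g: "range g <= D" "ip_Cauchy ip g" "y = completion_point D ip g" using completionE[OF _ subset_refl] by metis
  have gD: "g n \<in> D" for n using g(1) by auto
  have Ta: "(%n. T (f n + g n)) = (%n. T (f n) + T (g n))" using T(1) fD gD unfolding linear_map_on_def by auto
  have "completion_map D ip T (x + y) = completion_point D ip (%n. T (f n + g n))"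
   unfolding f(3) g(3) point_add[OF f(1,2) g(1,2), symmetric]
   by (rule mp) (use fD gD Cauchy_add[OF f(1,2) g(1,2)] in auto)
  then show "completion_map D ip T (x + y) = completion_map D ip T x + completion_map D ip T y"
   unfolding Ta point_add[OF TC[OF f(1,2)] TC[OF g(1,2)]] using mp[OF f(1,2)] mp[OF g(1,2)] f(3) g(3) by simp
 qed
qed

end

section \<open>The sum system\<close>

lemma shift_L2_on: "f \<in> L2_on a b ==> (%s. f (s - t)) \<in> L2_on (a + t) (b + t)"
proof -
 assume f: "f \<in> L2_on a b"
 note [measurable] = L2_onD(1)[OF f]
 have "integrable lborel (%s. (f (- t + 1 * s))^2)"
  by (rule lborel_integrable_real_affine[OF L2_onD(2)[OF f]]) simp
 moreover have "(%s. f (s - t)) \<in> borel_measurable borel" by measurable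
 moreover have "f (s - t) = 0" if "s \<notin> {a + t<..<b + t}" for s by (rule L2_onD(3)[OF f]) (use that in auto)
 ultimately show ?thesis unfolding L2_on_def by auto
qed

lemma shift_linear: "linear_map_on D (%f s. f (s - t))"
 unfolding linear_map_on_def by auto

lemma shift_bounded_support: "(%f s. f (s - t)) ` L2_bounded_support <= L2_bounded_support"
proof safe
 fix f assume "f \<in> L2_bounded_support"
 then obtain R where "f \<in> L2_on (-R) R" by (rule L2_bounded_supportE)
 from shift_L2_on[OF this, of t] show "(%s. f (s - t)) \<in> L2_bounded_support"
  using L2_on_subset_bounded_support by blast
qed

lemma kernel_form_shift:
 assumes k: "locally_integrable k" and f: "f \<in> L2_bounded_support" "g \<in> L2_bounded_support"
 shows "kernel_form k (%s. f (s - t)) (%s. g (s - t)) = kernel_form k f g"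
proof -
 have f': "(%s. f (s - t)) \<in> L2_bounded_support" "(%s. g (s - t)) \<in> L2_bounded_support"
  using shift_bounded_support f by auto
 have "kernel_form k (%s. f (s - t)) (%s. g (s - t)) = (\<integral>x. (\<integral>y. f (x - t) * g (y - t) * k (x - y) \<partial>lborel) \<partial>lborel)"
  unfolding kernel_form_def using lborel_pair.integral_fst'[OF kernel_form_bounded_support_integrable[OF k f']] by simp
 also have "\<dots> = (\<integral>x. (\<integral>y. f x * g (y - t) * k (x + t - y) \<partial>lborel) \<partial>lborel)"
  using lborel_integral_real_affine[of 1 "%x. (\<integral>y. f (x - t) * g (y - t) * k (x - y) \<partial>lborel)" t] by (simp add: add.commute)
 also have "\<dots> = (\<integral>x. (\<integral>y. f x * g y * k (x - y) \<partial>lborel) \<partial>lborel)"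
 proof (rule Bochner_Integration.integral_cong[OF refl])
  fix x
  show "(\<integral>y. f x * g (y - t) * k (x + t - y) \<partial>lborel) = (\<integral>y. f x * g y * k (x - y) \<partial>lborel)"
   using lborel_integral_real_affine[of 1 "%y. f x * g (y - t) * k (x + t - y)" t] by simp
 qed
 also have "\<dots> = kernel_form k f g"
  unfolding kernel_form_def using lborel_pair.integral_fst'[OF kernel_form_bounded_support_integrable[OF k f]] by simp
 finally show ?thesis .
qed

context log_kernel
begin

abbreviation kip :: "((real => real) => real) => ((real => real) => real) => real" where
 "kip \<equiv> norm_ip (kernel_norm B)"

abbreviation total_space :: "((real => real) => real) set" where
 "total_space \<equiv> ip_completion L2_bounded_support (kernel_form B) L2_bounded_support"

sublocale total: hilbert_form total_space kip
 unfolding kernel_norm_def by (rule form.completion_hilbert_form[OF form.D subset_refl])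

lemma kernel_space_hilbert: "hilbert_form (kernel_space B a b) kip"
 unfolding kernel_space_def kernel_norm_def
 by (rule form.completion_hilbert_form[OF L2_on_subspace L2_on_subset_bounded_support])

lemma kernel_space_subspace: "subspace (kernel_space B a b)"
 using kernel_space_hilbert[of a b] unfolding hilbert_form_def psd_form_def by blast

lemma kernel_space_total_space: "kernel_space B a b <= total_space"
 unfolding kernel_space_def by (rule form.completion_mono[OF L2_on_subset_bounded_support])

lemma kernel_space_mono: "a' <= a ==> b <= b' ==> kernel_space B a b <= kernel_space B a' b'"
 unfolding kernel_space_def by (intro form.completion_mono L2_on_mono)

lemma ip_norm_kip: "x \<in> total_space ==> ip_norm kip x = kernel_norm B x"
 unfolding kernel_norm_def by (rule form.completion_ip_norm)

lemma embed_in: "f \<in> L2_on a b ==> form.embed f \<in> kernel_space B a b"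
 unfolding kernel_space_def by (rule form.completion_embed_in[OF L2_on_subset_bounded_support])

text \<open>Besides separability it records that the dense set consists of combinations of interval
  indicators, the vectors on which continuity of the shift is checked by hand.\<close>

lemma kernel_space_dense:
 assumes ac: "a < c"
 obtains T where "countable T" "T <= span {form.embed (indicator {q<..<r}) | q r. True}" "T <= kernel_space B a c"
  "!!x e. x \<in> kernel_space B a c ==> e > 0 ==> \<exists>s\<in>T. ip_norm kip (x - s) < e"
proof -
 interpret H: hilbert_form "kernel_space B a c" kip by (rule kernel_space_hilbert)
 define T0 where "T0 = (%(q, r). form.embed (indicator {q<..<r})) ` {(q, r). q \<in> \<rat> & r \<in> \<rat> & a < q & q < r & r < c}"
 have "countable ({(q, r). q \<in> \<rat> & r \<in> \<rat> & a < q & q < r & r < c})"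
  by (rule countable_subset[of _ "\<rat> \<times> \<rat>"]) (auto intro: countable_SIGMA countable_rat)
 then have c: "countable T0" unfolding T0_def by (rule countable_image)
 have sub: "T0 <= kernel_space B a c" unfolding T0_def by (auto intro!: embed_in interval_L2_on)
 have tot: "x = 0" if x: "x \<in> kernel_space B a c" and z: "!!t. t \<in> T0 ==> kip x t = 0" for x
 proof (rule kernel_space_total[OF x ac])
  fix q r :: real assume qr: "q \<in> \<rat>" "r \<in> \<rat>" "a < q" "q < r" "r < c"
  have i: "indicator {q<..<r} \<in> L2_bounded_support" using interval_L2_on[of q q r r] L2_on_subset_bounded_support by auto
  have "x (indicator {q<..<r}) = kip x (form.embed (indicator {q<..<r}))"
   unfolding kernel_norm_def by (rule form.completion_apply[OF _ i]) (use x kernel_space_total_space in blast)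
  also have "\<dots> = 0" by (rule z) (use qr in \<open>auto simp: T0_def\<close>)
  finally show "x (indicator {q<..<r}) = 0" .
 qed
 have sp: "span T0 <= span {form.embed (indicator {q<..<r}) | q r. True}"
  by (intro span_mono) (auto simp: T0_def)
 obtain T where T: "countable T" "T <= span T0" "T <= kernel_space B a c"
  "!!x e. x \<in> kernel_space B a c ==> e > 0 ==> \<exists>s\<in>T. ip_norm kip (x - s) < e"
 proof (rule H.total_dense[OF c sub])
  show "x = 0" if "x \<in> kernel_space B a c" "!!t. t \<in> T0 ==> kip x t = 0" for x by (rule tot[OF that])
 qed (rule that)
 show ?thesis by (rule that[OF T(1) order_trans[OF T(2) sp] T(3,4)])
qed

lemma kernel_space_separable:
 assumes ac: "a < c"
 shows "separable_hilbert_norm (kernel_space B a c) (kernel_norm B)"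
  and "separable_hilbert_norm (kernel_space B a c) (ip_norm kip)"
proof -
 obtain T where T: "countable T" "T <= span {form.embed (indicator {q<..<r}) | q r. True}" "T <= kernel_space B a c"
  "!!x e. x \<in> kernel_space B a c ==> e > 0 ==> \<exists>s\<in>T. ip_norm kip (x - s) < e"
  by (rule kernel_space_dense[OF ac]) (rule that)
 have e: "kernel_norm B x = ip_norm kip x" if "x \<in> kernel_space B a c" for x
  using ip_norm_kip kernel_space_total_space that by fastforce
 show "separable_hilbert_norm (kernel_space B a c) (kernel_norm B)"
  by (rule separable_hilbert_normI[OF kernel_space_hilbert e T(1,3,4)])
 show "separable_hilbert_norm (kernel_space B a c) (ip_norm kip)"
  by (rule separable_hilbert_normI[OF kernel_space_hilbert refl T(1,3,4)])
qed

lemma kernel_space_hs: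
 assumes ap: "a < p" "p < c"
 obtains M where "!!A x y. x ` A <= kernel_space B a p ==> y ` A <= kernel_space B p c ==>
  bessel (ip_norm kip) A x ==> bessel (ip_norm kip) A y ==> (\<Sum>i\<in>A. (kip (x i) (y i))^2) <= M"
proof -
 obtain M where M: "!!A f g. bessel (ip_norm (kernel_form B)) A f ==> bessel (ip_norm (kernel_form B)) A g ==>
  (!!i. f i \<in> L2_on a p) ==> (!!i. g i \<in> L2_on p c) ==> (\<Sum>i\<in>A. (kernel_form B (f i) (g i))^2) <= M"
  using cross_bound[OF ap] by blast
 have b: "bessel (kernel_norm B) A x" if "bessel (ip_norm kip) A x" "x ` A <= total_space" for A x
 proof -
  have "(\<Sum>i\<in>A. c i *\<^sub>R x i) \<in> total_space" for c by (intro total.sum_in) (use that(2) in auto)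
  then show ?thesis using that(1) ip_norm_kip unfolding bessel_def by simp
 qed
 show ?thesis
 proof (rule that)
  fix A x y assume x: "x ` A <= kernel_space B a p" "y ` A <= kernel_space B p c"
   "bessel (ip_norm kip) A x" "bessel (ip_norm kip) A y"
  have xt: "x ` A <= total_space" "y ` A <= total_space" using x kernel_space_total_space by blast+
  show "(\<Sum>i\<in>A. (kip (x i) (y i))^2) <= M"
   unfolding kernel_norm_def
   by (rule form.completion_hs_bound[OF L2_on_subspace L2_on_subset_bounded_support L2_on_subspace L2_on_subset_bounded_support M
    b[OF x(3) xt(1), unfolded kernel_norm_def] x(1)[unfolded kernel_space_def] b[OF x(4) xt(2), unfolded kernel_norm_def] x(2)[unfolded kernel_space_def]])
 qed
qed

text \<open>The two pieces add up to \<open>f\<close> except at the point \<open>p\<close>. The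
  difference is a null function and has norm 0 because the form is bounded by the square mean, so
  the points of the completion agree exactly. The identity is stated without any order between
  \<open>a\<close>, \<open>p\<close> and \<open>c\<close>.\<close>

lemma embed_split:
 assumes f: "f \<in> L2_on a c"
 shows "form.embed f = form.embed (%s. if s < p then f s else 0) + form.embed (%s. if p < s then f s else 0)"
  and "a <= p ==> p <= c ==> (%s. if s < p then f s else 0) \<in> L2_on a p"
  and "a <= p ==> p <= c ==> (%s. if p < s then f s else 0) \<in> L2_on p c"
proof -
 let ?f1 = "%s. if s < p then f s else 0" and ?f2 = "%s. if p < s then f s else 0"
 note [measurable] = L2_onD(1)[OF f]
 have i: "integrable lborel (%s. (?f1 s)^2)" "integrable lborel (%s. (?f2 s)^2)"
  by (rule Bochner_Integration.integrable_bound[OF L2_onD(2)[OF f]], auto)+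
 show p: "a <= p ==> p <= c ==> ?f1 \<in> L2_on a p" "a <= p ==> p <= c ==> ?f2 \<in> L2_on p c"
  unfolding L2_on_def using i L2_onD(3)[OF f] by auto
 define R where "R = \<bar>a\<bar> + \<bar>c\<bar> + 1"
 have fR: "f \<in> L2_on (-R) R" by (rule subsetD[OF L2_on_mono f]) (auto simp: R_def)
 have pR: "?f1 \<in> L2_on (-R) R" "?f2 \<in> L2_on (-R) R" unfolding L2_on_def using i L2_onD(3)[OF fR] by auto
 have "-R < R" unfolding R_def by simp
 then obtain \<beta> where \<beta>: "0 <= \<beta>" "!!f. f \<in> L2_on (-R) R ==> kernel_form B f f <= \<beta> * (\<integral>s. (f s)^2 \<partial>lborel)"
  using kernel_form_bounded[OF B_local] by blast
 have LD: "h \<in> L2_bounded_support" if "h \<in> L2_on (-R) R" for h using that L2_on_subset_bounded_support by blast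
 have s12: "?f1 + ?f2 \<in> L2_on (-R) R" by (rule L2_on_add[OF pR])
 have d: "f - (?f1 + ?f2) \<in> L2_on (-R) R" by (rule subspace_diff[OF L2_on_subspace fR s12])
 have "(\<integral>s. ((f - (?f1 + ?f2)) s)^2 \<partial>lborel) = (\<integral>s. 0 \<partial>(lborel :: real measure))"
 proof (rule integral_cong_AE)
  show "AE s in lborel. ((f - (?f1 + ?f2)) s)^2 = 0"
   using AE_lborel_singleton[of p] by eventually_elim auto
  show "(%s. ((f - (?f1 + ?f2)) s)^2) \<in> borel_measurable lborel" using L2_onD(1)[OF d] by measurable
 qed simp
 then have "kernel_form B (f - (?f1 + ?f2)) (f - (?f1 + ?f2)) = 0"
  using \<beta>(2)[OF d] form.nonneg[OF LD[OF d]] by simp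
 then have n: "ip_norm (kernel_form B) (f - (?f1 + ?f2)) = 0" unfolding ip_norm_def by simp
 have "form.embed f = form.embed (?f1 + ?f2)"
  by (subst form.completion_point_eq_iff) (use LD fR s12 form.Cauchy_const n in auto)
 also have "\<dots> = form.embed ?f1 + form.embed ?f2"
  using form.completion_embed_linear LD[OF pR(1)] LD[OF pR(2)] unfolding linear_map_on_def by blast
 finally show "form.embed f = form.embed ?f1 + form.embed ?f2" .
qed

section \<open>Admissible norms and direct sums of the spaces\<close>

lemma kernel_admissible_iff: "N \<in> kernel_admissible B a b \<longleftrightarrow> (kernel_norm B, N) \<in> fhs_equiv (kernel_space B a b)"
 unfolding kernel_admissible_def by simp

lemma kernel_space_closedin:
 assumes ac: "a < c" and sub: "kernel_space B a' c' <= kernel_space B a c" and N: "N \<in> kernel_admissible B a c"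
 shows "closedin (norm_topology (kernel_space B a c) N) (kernel_space B a' c')"
proof -
 interpret H: hilbert_form "kernel_space B a c" kip by (rule kernel_space_hilbert)
 have "norm_topology (kernel_space B a c) N = norm_topology (kernel_space B a c) (kernel_norm B)"
  using N unfolding kernel_admissible_iff fhs_equiv_def by simp
 also have "\<dots> = norm_topology (kernel_space B a c) (ip_norm kip)"
  by (rule norm_topology_cong[OF kernel_space_subspace]) (use ip_norm_kip kernel_space_total_space in fastforce)
 finally have e: "norm_topology (kernel_space B a c) N = norm_topology (kernel_space B a c) (ip_norm kip)" .
 show ?thesis unfolding e
  by (rule H.closedin_of_limits[OF sub]) (rule H.hilbert_subspace_closed[OF kernel_space_hilbert sub])
qed

text \<open>Trivial intersection and the Hilbert-Schmidt bound give a positive angle. Cutting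
  functions at \<open>p\<close> shows that the sum of the two spaces is dense, the angle shows that
  it is closed, and the norm without the mixed term is the admissible norm in which they are
  orthogonal.\<close>

lemma kernel_space_direct_sum:
 assumes ap: "a < p" "p < c"
 shows "fhs_direct_sum (kernel_space B a c) (kernel_admissible B a c) (kernel_space B a p) (kernel_space B p c)"
proof -
 let ?H = "kernel_space B a c" and ?H1 = "kernel_space B a p" and ?H2 = "kernel_space B p c"
 interpret H: hilbert_form ?H kip by (rule kernel_space_hilbert)
 have ac: "a < c" using ap by simp
 have sub: "?H1 <= ?H" "?H2 <= ?H" using ap by (simp_all add: kernel_space_mono)
 have e: "ip_norm kip x = kernel_norm B x" if "x \<in> ?H" for x using ip_norm_kip kernel_space_total_space that by blast
 obtain M where M: "!!A x y. x ` A <= ?H1 ==> y ` A <= ?H2 ==>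
  bessel (ip_norm kip) A x ==> bessel (ip_norm kip) A y ==> (\<Sum>i\<in>A. (kip (x i) (y i))^2) <= M"
  using kernel_space_hs[OF ap] by blast
 have "?H1 \<inter> ?H2 <= {0}" using kernel_space_disjoint[OF ap] by blast
 then have "\<exists>\<rho>\<ge>0. \<rho> < 1 & (\<forall>x\<in>?H1. \<forall>y\<in>?H2. \<bar>kip x y\<bar> <= \<rho> * ip_norm kip x * ip_norm kip y)"
  by (rule H.positive_angle[OF kernel_space_hilbert sub(1) kernel_space_hilbert sub(2) _ M])
 then obtain \<theta> where \<theta>: "0 <= \<theta>" "\<theta> < 1" "!!x y. x \<in> ?H1 ==> y \<in> ?H2 ==> \<bar>kip x y\<bar> <= \<theta> * ip_norm kip x * ip_norm kip y"
  by blast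
 have sum: "\<exists>x1\<in>?H1. \<exists>x2\<in>?H2. x = x1 + x2" if x: "x \<in> ?H" for x
 proof -
  obtain f where f: "!!n. f n \<in> L2_on a c" "(%n. completion_norm L2_bounded_support (kernel_form B) (x - form.embed (f n))) ----> 0"
   using form.completion_approx_sequence[OF x[unfolded kernel_space_def] L2_on_subset_bounded_support] by metis
  let ?y = "%n. form.embed (%s. if s < p then f n s else 0)" and ?z = "%n. form.embed (%s. if p < s then f n s else 0)"
  have yz: "?y n + ?z n = form.embed (f n)" for n by (rule embed_split(1)[OF f(1), symmetric])
  show ?thesis
  proof (rule H.angle_sum_closed[OF kernel_space_hilbert sub(1) kernel_space_hilbert sub(2) \<theta> x])
   show "?y n \<in> ?H1" "?z n \<in> ?H2" for n using embed_split(2,3)[OF f(1)] ap by (auto intro!: embed_in)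
   have "ip_norm kip (form.embed (f n) - x) = completion_norm L2_bounded_support (kernel_form B) (x - form.embed (f n))" for n
    using H.norm_minus[OF embed_in[OF f(1)] x] e[OF subspace_diff[OF kernel_space_subspace x embed_in[OF f(1)]]]
    by (simp add: kernel_norm_def)
   then show "(%n. ip_norm kip (?y n + ?z n - x)) ----> 0" unfolding yz using f(2) by simp
  qed
 qed
 obtain N where N: "(ip_norm kip, N) \<in> fhs_equiv ?H" "\<forall>x\<in>?H1. \<forall>y\<in>?H2. norm_ip N x y = 0"
  using H.orthogonal_sum_norm[OF kernel_space_separable(2)[OF ac] kernel_space_subspace sub(1) kernel_space_subspace sub(2) \<theta> sum M] by blast
 have "(kernel_norm B, N) \<in> fhs_equiv ?H"
  by (rule fhs_equiv_cong_first[OF kernel_space_separable(1)[OF ac] N(1) e])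
 then have NA: "N \<in> kernel_admissible B a c" unfolding kernel_admissible_iff .
 have "span (?H1 \<union> ?H2) = ?H"
 proof
  show "span (?H1 \<union> ?H2) <= ?H" by (rule span_minimal[OF _ kernel_space_subspace]) (use sub in blast)
  show "?H <= span (?H1 \<union> ?H2)"
  proof
   fix x assume "x \<in> ?H"
   then obtain x1 x2 where "x1 \<in> ?H1" "x2 \<in> ?H2" "x = x1 + x2" using sum by blast
   moreover from this have "x1 \<in> span (?H1 \<union> ?H2)" "x2 \<in> span (?H1 \<union> ?H2)" by (auto intro: span_base)
   ultimately show "x \<in> span (?H1 \<union> ?H2)" by (simp add: span_add)
  qed
 qed
 then show ?thesis
  unfolding fhs_direct_sum_def fhs_subspace_def
  using kernel_space_subspace sub kernel_space_closedin[OF ac sub(1)] kernel_space_closedin[OF ac sub(2)] N(2) NA by blast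
qed

text \<open>Every admissible norm of the smaller space must come from one of the larger space, which
  is the extension by the orthogonal complement; the converse is restriction.\<close>

lemma kernel_admissible_inherited:
 assumes ac: "a < c" "a' < c'" and sub: "kernel_space B a' c' <= kernel_space B a c"
 shows "kernel_admissible B a' c' = fhs_inherited (kernel_admissible B a c) (kernel_space B a' c')"
proof -
 let ?H = "kernel_space B a c" and ?K = "kernel_space B a' c'"
 interpret H: hilbert_form ?H kip by (rule kernel_space_hilbert)
 have e: "ip_norm kip x = kernel_norm B x" if "x \<in> total_space" for x using ip_norm_kip that by blast
 have eH: "ip_norm kip x = kernel_norm B x" if "x \<in> ?H" for x using e kernel_space_total_space that by blast
 have eK: "kernel_norm B x = ip_norm kip x" if "x \<in> ?K" for x using eH sub that by fastforce
 show ?thesis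
 proof (intro set_eqI iffI)
  fix M assume "M \<in> kernel_admissible B a' c'"
  then have "(ip_norm kip, M) \<in> fhs_equiv ?K"
   unfolding kernel_admissible_iff by (rule fhs_equiv_cong_first[OF kernel_space_separable(2)[OF ac(2)] _ eK])
  from H.fhs_equiv_extend[OF kernel_space_separable(2)[OF ac(1)] kernel_space_hilbert sub this]
  obtain N where N: "(ip_norm kip, N) \<in> fhs_equiv ?H" "\<forall>x\<in>?K. M x = N x" by blast
  have "(kernel_norm B, N) \<in> fhs_equiv ?H" by (rule fhs_equiv_cong_first[OF kernel_space_separable(1)[OF ac(1)] N(1) eH])
  then have "N \<in> kernel_admissible B a c" unfolding kernel_admissible_iff .
  then show "M \<in> fhs_inherited (kernel_admissible B a c) ?K" using N(2) unfolding fhs_inherited_def by blast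
 next
  fix M assume "M \<in> fhs_inherited (kernel_admissible B a c) ?K"
  then obtain N where "N \<in> kernel_admissible B a c" and eq: "\<forall>x\<in>?K. M x = N x"
   unfolding fhs_inherited_def by blast
  then have N: "(kernel_norm B, N) \<in> fhs_equiv ?H" unfolding kernel_admissible_iff by simp
  have "(kernel_norm B, M) \<in> fhs_equiv ?K"
   by (rule fhs_equiv_cong[OF fhs_equiv_restrict[OF N kernel_space_separable(1)[OF ac(2)] sub]]) (use eq in simp)
  then show "M \<in> kernel_admissible B a' c'" unfolding kernel_admissible_iff .
 qed
qed

section \<open>The shift group\<close>

lemma shift_isometry: "f \<in> L2_bounded_support ==> ip_norm (kernel_form B) (%s. f (s - t)) = ip_norm (kernel_form B) f"
 unfolding ip_norm_def by (simp add: kernel_form_shift[OF B_local])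

lemmas shift_facts = shift_linear shift_bounded_support shift_isometry

lemma kernel_shift_in: "x \<in> kernel_space B a b ==> kernel_shift B t x \<in> kernel_space B (a + t) (b + t)"
 unfolding kernel_shift_def kernel_space_def
 by (rule form.completion_map_in(1)[OF shift_facts L2_on_subset_bounded_support]) (use shift_L2_on in auto)

lemma kernel_shift_total: "x \<in> total_space ==> kernel_shift B t x \<in> total_space"
 unfolding kernel_shift_def
 by (rule form.completion_map_in(1)[OF shift_facts subset_refl shift_bounded_support])

lemma kernel_shift_norm: "x \<in> total_space ==> kernel_norm B (kernel_shift B t x) = kernel_norm B x"
 unfolding kernel_shift_def kernel_norm_def
 by (rule form.completion_map_in(2)[OF shift_facts subset_refl shift_bounded_support])

lemma kernel_shift_linear: "linear_map_on total_space (kernel_shift B t)"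
 unfolding kernel_shift_def by (rule form.completion_map_linear[OF shift_facts])

lemma kernel_shift_point:
 assumes "range f <= L2_bounded_support" "ip_Cauchy (kernel_form B) f"
 shows "kernel_shift B t (completion_point L2_bounded_support (kernel_form B) f)
   = completion_point L2_bounded_support (kernel_form B) (%n s. f n (s - t))"
 unfolding kernel_shift_def by (rule form.completion_map_point[OF shift_facts assms])

lemma kernel_shift_zero: "x \<in> total_space ==> kernel_shift B 0 x = x"
 by (erule form.completionE[OF _ subset_refl]) (simp add: kernel_shift_point)

lemma kernel_shift_add:
 assumes x: "x \<in> total_space" shows "kernel_shift B (s + t) x = kernel_shift B s (kernel_shift B t x)"
proof -
 obtain f where f: "range f <= L2_bounded_support" "ip_Cauchy (kernel_form B) f"
  "x = completion_point L2_bounded_support (kernel_form B) f" using form.completionE[OF x subset_refl] by metis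
 have fD: "f n \<in> L2_bounded_support" for n using f(1) by auto
 have r: "range (%n s. f n (s - t)) <= L2_bounded_support" using shift_bounded_support fD by blast
 have "(%s. f m (s - t)) - (%s. f n (s - t)) = (%s. (f m - f n) (s - t))" for m n by (rule ext) simp
 then have c: "ip_Cauchy (kernel_form B) (%n s. f n (s - t))"
  using f(2) shift_isometry[OF subspace_diff[OF form.D fD fD]] unfolding ip_Cauchy_def by simp
 show ?thesis unfolding f(3) kernel_shift_point[OF f(1,2)] kernel_shift_point[OF r c] by (simp add: algebra_simps)
qed

text \<open>Shifts preserve the norm that defines the admissible class, so pulling back along
  \<open>kernel_shift B t\<close> preserves admissibility; the converse is the pullback along the
  inverse shift.\<close>

lemma kernel_shift_isomorphism:
 assumes ab: "a < b"
 shows "fhs_isomorphism (kernel_space B a b) (kernel_admissible B a b)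
  (kernel_space B (a + t) (b + t)) (kernel_admissible B (a + t) (b + t)) (kernel_shift B t)"
proof -
 let ?H = "kernel_space B a b" and ?H' = "kernel_space B (a + t) (b + t)"
 have ab': "a + t < b + t" using ab by simp
 have tot: "x \<in> total_space" if "x \<in> kernel_space B p q" for x p q using that kernel_space_total_space by blast
 have lin: "linear_map_on (kernel_space B p q) (kernel_shift B u)" for p q u
  using kernel_shift_linear[of u] tot unfolding linear_map_on_def by blast
 have inv: "kernel_shift B (- u) (kernel_shift B u x) = x" if "x \<in> total_space" for x u
  using kernel_shift_add[OF that, of "- u" u] kernel_shift_zero[OF that] by simp
 have inv': "kernel_shift B u (kernel_shift B (- u) x) = x" if "x \<in> total_space" for x u
  using kernel_shift_add[OF that, of u "- u"] kernel_shift_zero[OF that] by simp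
 have shift_back: "kernel_shift B (- t) x \<in> ?H" if "x \<in> ?H'" for x using kernel_shift_in[OF that, of "- t"] by simp
 have "bij_betw (kernel_shift B t) ?H ?H'"
  by (rule bij_betw_byWitness[where f' = "kernel_shift B (- t)"])
   (use inv inv' tot shift_back kernel_shift_in in auto)
 moreover have "N \<in> kernel_admissible B (a + t) (b + t) \<longleftrightarrow> N \<circ> kernel_shift B t \<in> kernel_admissible B a b" for N
 proof
  assume "N \<in> kernel_admissible B (a + t) (b + t)"
  then show "N \<circ> kernel_shift B t \<in> kernel_admissible B a b"
   unfolding kernel_admissible_iff
   by (rule fhs_equiv_pullback[OF kernel_space_separable(1)[OF ab] lin, rotated 2])
    (use kernel_shift_in kernel_shift_norm tot in auto)
 next
  assume "N \<circ> kernel_shift B t \<in> kernel_admissible B a b"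
  then have "(kernel_norm B, N \<circ> kernel_shift B t \<circ> kernel_shift B (- t)) \<in> fhs_equiv ?H'"
   unfolding kernel_admissible_iff
   by (rule fhs_equiv_pullback[OF kernel_space_separable(1)[OF ab'] lin, rotated 2])
    (use shift_back kernel_shift_norm tot in auto)
  then show "N \<in> kernel_admissible B (a + t) (b + t)"
   unfolding kernel_admissible_iff by (rule fhs_equiv_cong) (use inv' tot in auto)
 qed
 ultimately show ?thesis unfolding fhs_isomorphism_def using lin by blast
qed

text \<open>The indicator and its translate differ only within distance \<open>\<bar>t\<bar>\<close>
  of the two end points, so the square integral of the difference is at most
  \<open>4 * \<bar>t\<bar>\<close>. Shifts by less than 1 stay in an interval on which one bound
  \<open>\<beta>\<close> of the form is valid.\<close>

lemma interval_shift_continuous: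
 assumes "q < r"
 shows "((%t. kernel_norm B (kernel_shift B t (form.embed (indicator {q<..<r})) - form.embed (indicator {q<..<r}))) \<longlongrightarrow> 0) (at 0)"
proof -
 let ?f = "indicator {q<..<r} :: real => real"
 have "q - 1 < r + 1" using assms by simp
 then obtain \<beta> where \<beta>: "0 <= \<beta>" "!!f. f \<in> L2_on (q - 1) (r + 1) ==> kernel_form B f f <= \<beta> * (\<integral>s. (f s)^2 \<partial>lborel)"
  using kernel_form_bounded[OF B_local] by blast
 have f: "?f \<in> L2_on (q - 1) (r + 1)" by (rule interval_L2_on) simp_all
 have LD: "h \<in> L2_bounded_support" if "h \<in> L2_on (q - 1) (r + 1)" for h using that L2_on_subset_bounded_support by blast
 have le: "\<bar>kernel_norm B (kernel_shift B t (form.embed ?f) - form.embed ?f)\<bar> <= sqrt (\<beta> * (4 * \<bar>t\<bar>))"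
  if t: "\<bar>t\<bar> < 1" for t
 proof -
  have g: "(%s. ?f (s - t)) \<in> L2_on (q - 1) (r + 1)"
   by (rule subsetD[OF L2_on_mono shift_L2_on[OF interval_L2_on[of q q r r]]]) (use t in auto)
  have d: "(%s. ?f (s - t)) - ?f \<in> L2_on (q - 1) (r + 1)" by (rule subspace_diff[OF L2_on_subspace g f])
  have "kernel_shift B t (form.embed ?f) = form.embed (%s. ?f (s - t))"
   by (rule kernel_shift_point[OF _ form.Cauchy_const]) (use LD[OF f] in auto)
  moreover have "form.embed ((%s. ?f (s - t)) - ?f) = form.embed (%s. ?f (s - t)) - form.embed ?f"
   by (rule form.point_diff(2)) (use LD[OF f] LD[OF g] form.Cauchy_const in auto)
  ultimately have n: "kernel_norm B (kernel_shift B t (form.embed ?f) - form.embed ?f) = ip_norm (kernel_form B) ((%s. ?f (s - t)) - ?f)"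
   using form.completion_embed_norm[OF LD[OF d]] unfolding kernel_norm_def by simp
  let ?w = "%s. indicator {q - \<bar>t\<bar>..q + \<bar>t\<bar>} s + indicator {r - \<bar>t\<bar>..r + \<bar>t\<bar>} s :: real"
  have I: "integrable lborel (%s. indicator {y - \<bar>t\<bar>..y + \<bar>t\<bar>} s :: real)" for y
   by (rule integrable_real_indicator) simp_all
  have "(\<integral>s. (((%s. ?f (s - t)) - ?f) s)^2 \<partial>lborel) <= (\<integral>s. ?w s \<partial>lborel)"
  proof (rule integral_mono)
   show "integrable lborel (%s. (((%s. ?f (s - t)) - ?f) s)^2)" by (rule L2_onD(2)[OF d])
   show "integrable lborel ?w" by (intro Bochner_Integration.integrable_add I)
   show "(((%s. ?f (s - t)) - ?f) s)^2 <= ?w s" for s by (auto simp: indicator_def)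
  qed
  also have "\<dots> = 4 * \<bar>t\<bar>"
   by (subst Bochner_Integration.integral_add[OF I I]) simp
  finally have "\<beta> * (\<integral>s. (((%s. ?f (s - t)) - ?f) s)^2 \<partial>lborel) <= \<beta> * (4 * \<bar>t\<bar>)" by (rule mult_left_mono[OF _ \<beta>(1)])
  then have "kernel_form B ((%s. ?f (s - t)) - ?f) ((%s. ?f (s - t)) - ?f) <= \<beta> * (4 * \<bar>t\<bar>)"
   by (rule order_trans[OF \<beta>(2)[OF d]])
  then have "ip_norm (kernel_form B) ((%s. ?f (s - t)) - ?f) <= sqrt (\<beta> * (4 * \<bar>t\<bar>))"
   unfolding ip_norm_def by (rule real_sqrt_le_mono)
  then show ?thesis unfolding n using form.norm_nonneg[OF LD[OF d]] by simp
 qed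
 have lim: "((%t. sqrt (\<beta> * (4 * \<bar>t\<bar>))) \<longlongrightarrow> 0) (at 0)" by (auto intro!: tendsto_eq_intros)
 have ev: "\<forall>\<^sub>F t in at (0::real). \<bar>t\<bar> < 1"
  unfolding eventually_at by (intro exI[of _ 1]) (simp add: dist_real_def)
 have ev': "\<forall>\<^sub>F t in at 0. norm (kernel_norm B (kernel_shift B t (form.embed ?f) - form.embed ?f)) <= sqrt (\<beta> * (4 * \<bar>t\<bar>))"
  using ev by eventually_elim (simp only: real_norm_def le)
 show ?thesis by (rule Lim_null_comparison[OF ev' lim])
qed

text \<open>The vectors on which the shift is continuous form a subspace containing the interval
  indicators. As shifts are isometries, approximating \<open>x\<close> by such a vector
  \<open>y\<close> costs the norm of \<open>x - y\<close> twice, uniformly in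
  \<open>t\<close>.\<close>

lemma shift_continuous:
 assumes bc: "b < c" and x: "x \<in> kernel_space B b c"
 shows "((%t. kernel_norm B (kernel_shift B t x - x)) \<longlongrightarrow> 0) (at 0)"
proof -
 let ?E = "{form.embed (indicator {q<..<r}) | q r. True}"
 let ?n = "%x t. kernel_norm B (kernel_shift B t x - x)"
 have diff: "kernel_shift B t y - y \<in> total_space" if "y \<in> total_space" for y t
  using kernel_shift_total[OF that] that by simp
 have tri: "kernel_norm B (u + v) <= kernel_norm B u + kernel_norm B v" if "u \<in> total_space" "v \<in> total_space" for u v
  unfolding kernel_norm_def by (rule form.completion_norm_triangle[OF that])
 have n0: "0 <= kernel_norm B u" if "u \<in> total_space" for u
  unfolding kernel_norm_def by (rule form.completion_norm_nonneg[OF that])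
 define P where "P = {y \<in> total_space. (?n y \<longlongrightarrow> 0) (at 0)}"
 have "subspace P"
 proof (rule subspaceI)
  have z: "kernel_shift B t 0 = 0" for t
   using kernel_shift_linear[of t] subspace_0[OF total.D] unfolding linear_map_on_def by (metis scaleR_zero_left)
  have "kernel_norm B 0 = 0" using ip_norm_kip[OF subspace_0[OF total.D]] total.norm_zero by simp
  then show "0 \<in> P" unfolding P_def using subspace_0[OF total.D] z by simp
  fix y assume y: "y \<in> P"
  then have yt: "y \<in> total_space" "(?n y \<longlongrightarrow> 0) (at 0)" unfolding P_def by auto
  show "k *\<^sub>R y \<in> P" for k
  proof -
   have "?n (k *\<^sub>R y) t = \<bar>k\<bar> * ?n y t" for t
   proof -
    have "kernel_shift B t (k *\<^sub>R y) - k *\<^sub>R y = k *\<^sub>R (kernel_shift B t y - y)"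
     using kernel_shift_linear[of t] yt(1) unfolding linear_map_on_def by (simp add: scaleR_right_diff_distrib)
    then show ?thesis using total.norm_scale[OF diff[OF yt(1)], of k t] ip_norm_kip[OF diff[OF yt(1)], of t]
      ip_norm_kip[of "k *\<^sub>R (kernel_shift B t y - y)"] diff[OF yt(1), of t] by simp
   qed
   then show ?thesis unfolding P_def using yt tendsto_mult_right_zero[OF yt(2)] by simp
  qed
  fix z assume "z \<in> P"
  then have zt: "z \<in> total_space" "(?n z \<longlongrightarrow> 0) (at 0)" unfolding P_def by auto
  have le: "norm (?n (y + z) t) <= ?n y t + ?n z t" for t
  proof -
   have e: "kernel_shift B t (y + z) - (y + z) = (kernel_shift B t y - y) + (kernel_shift B t z - z)"
    using kernel_shift_linear[of t] yt(1) zt(1) unfolding linear_map_on_def by simp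
   show ?thesis unfolding e using tri[OF diff[OF yt(1)] diff[OF zt(1)], of t t] n0[of "(kernel_shift B t y - y) + (kernel_shift B t z - z)"]
     diff[OF yt(1), of t] diff[OF zt(1), of t] by simp
  qed
  have "(?n (y + z) \<longlongrightarrow> 0) (at 0)"
   by (rule Lim_null_comparison[OF always_eventually[OF allI, OF le]]) (use tendsto_add[OF yt(2) zt(2)] in simp)
  then show "y + z \<in> P" unfolding P_def using yt(1) zt(1) by simp
 qed
 moreover have "?E <= P"
 proof safe
  fix q r :: real
  show "form.embed (indicator {q<..<r}) \<in> P"
  proof (cases "q < r")
   case True
   have "form.embed (indicator {q<..<r}) \<in> kernel_space B q r" by (rule embed_in[OF interval_L2_on]) simp_all
   then show ?thesis unfolding P_def using interval_shift_continuous[OF True] kernel_space_total_space by blast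
  next
   case False
   then have "(indicator {q<..<r} :: real => real) = 0" by (auto simp: fun_eq_iff)
   moreover have "form.embed 0 = 0"
    using form.completion_embed_linear subspace_0[OF form.D] unfolding linear_map_on_def by (metis scaleR_zero_left)
   ultimately show ?thesis using subspace_0[OF \<open>subspace P\<close>] by simp
  qed
 qed
 ultimately have span: "span ?E <= P" by (intro span_minimal)
 obtain T where T: "countable T" "T <= span ?E" "T <= kernel_space B b c"
  "!!x e. x \<in> kernel_space B b c ==> e > 0 ==> \<exists>s\<in>T. ip_norm kip (x - s) < e"
  by (rule kernel_space_dense[OF bc]) (rule that)
 have xt: "x \<in> total_space" using x kernel_space_total_space by blast
 show ?thesis unfolding tendsto_iff
 proof (intro allI impI)
  fix e :: real assume "e > 0"
  then have e3: "e / 3 > 0" by simp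
  then obtain y where y: "y \<in> T" "ip_norm kip (x - y) < e / 3" using T(4)[OF x] by blast
  have yP: "y \<in> total_space" "(?n y \<longlongrightarrow> 0) (at 0)" using y(1) T(2) span unfolding P_def by auto
  have xy: "x - y \<in> total_space" using xt yP(1) by simp
  then have xy': "kernel_norm B (x - y) < e / 3" "kernel_norm B (y - x) < e / 3"
   using y(2) ip_norm_kip[OF xy] ip_norm_kip[of "y - x"] total.norm_minus[OF xt yP(1)] xt yP(1) by simp_all
  have "\<forall>\<^sub>F t in at 0. dist (?n y t) 0 < e / 3" using yP(2) e3 unfolding tendsto_iff by blast
  then show "\<forall>\<^sub>F t in at 0. dist (?n x t) 0 < e"
  proof eventually_elim
   fix t assume t: "dist (?n y t) 0 < e / 3"
   have s: "kernel_shift B t (x - y) = kernel_shift B t x - kernel_shift B t y"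
   proof -
    have "kernel_shift B t (x + (-1) *\<^sub>R y) = kernel_shift B t x + (-1) *\<^sub>R kernel_shift B t y"
     using kernel_shift_linear[of t] xt yP(1) subspace_scale[OF total.D yP(1), of "-1"] unfolding linear_map_on_def by metis
    then show ?thesis by simp
   qed
   have eq: "kernel_shift B t x - x = (kernel_shift B t (x - y) + (kernel_shift B t y - y)) + (y - x)" unfolding s by simp
   have m: "kernel_shift B t (x - y) \<in> total_space" "kernel_shift B t y - y \<in> total_space" "y - x \<in> total_space"
    using kernel_shift_total[OF xy] diff[OF yP(1)] xt yP(1) by simp_all
   have "?n x t <= kernel_norm B (kernel_shift B t (x - y)) + ?n y t + kernel_norm B (y - x)"
    unfolding eq using tri[OF subspace_add[OF total.D m(1,2)] m(3)] tri[OF m(1,2)] by linarith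
   then have "?n x t < e" using kernel_shift_norm[OF xy, of t] xy' t n0[OF m(2)] by simp
   then show "dist (?n x t) 0 < e" using n0[OF diff[OF xt], of t] by simp
  qed
 qed
qed

lemma kernel_global_spaceE:
 assumes "x \<in> kernel_global_space B"
 obtains R where "R > 0" "x \<in> kernel_space B (-R) R"
proof -
 obtain a b where ab: "x \<in> kernel_space B a b" using assms unfolding kernel_global_space_def by blast
 have "x \<in> kernel_space B (- (\<bar>a\<bar> + \<bar>b\<bar> + 1)) (\<bar>a\<bar> + \<bar>b\<bar> + 1)"
  by (rule subsetD[OF kernel_space_mono ab]) auto
 then show ?thesis by (intro that[of "\<bar>a\<bar> + \<bar>b\<bar> + 1"]) auto
qed

lemma kernel_space_global: "a < b ==> kernel_space B a b <= kernel_global_space B"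
 unfolding kernel_global_space_def by blast

lemma kernel_global_total: "kernel_global_space B <= total_space"
 unfolding kernel_global_space_def using kernel_space_total_space by blast

lemma kernel_global_subspace: "subspace (kernel_global_space B)"
proof (rule subspaceI)
 show "0 \<in> kernel_global_space B" using subspace_0[OF kernel_space_subspace, of 0 1] kernel_space_global[of 0 1] by auto
 fix x assume "x \<in> kernel_global_space B"
 then obtain R where R: "R > 0" "x \<in> kernel_space B (-R) R" by (rule kernel_global_spaceE)
 show "k *\<^sub>R x \<in> kernel_global_space B" for k
  using subspace_scale[OF kernel_space_subspace R(2)] kernel_space_global[of "-R" R] R(1) by auto
 fix y assume "y \<in> kernel_global_space B"
 then obtain S where S: "S > 0" "y \<in> kernel_space B (-S) S" by (rule kernel_global_spaceE)
 have "x \<in> kernel_space B (- max R S) (max R S)" "y \<in> kernel_space B (- max R S) (max R S)"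
  using R(2) S(2) kernel_space_mono[of "- max R S" "-R" R "max R S"] kernel_space_mono[of "- max R S" "-S" S "max R S"] by auto
 then have "x + y \<in> kernel_space B (- max R S) (max R S)" by (rule subspace_add[OF kernel_space_subspace])
 moreover have "- max R S < max R S" using R(1) by simp
 ultimately show "x + y \<in> kernel_global_space B" using kernel_space_global by blast
qed

lemma kernel_shift_global: "kernel_shift B t ` kernel_global_space B <= kernel_global_space B"
proof safe
 fix x assume "x \<in> kernel_global_space B"
 then obtain R where R: "R > 0" "x \<in> kernel_space B (-R) R" by (rule kernel_global_spaceE)
 show "kernel_shift B t x \<in> kernel_global_space B"
  using kernel_shift_in[OF R(2), of t] kernel_space_global[of "- R + t" "R + t"] R(1) by auto
qed

text \<open>Every admissible norm is bounded by a multiple of the kernel norm. The margin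
  \<open>\<delta>\<close> keeps the shifted vector inside the space over \<open>(a, d)\<close>, the
  only place where \<open>N\<close> is meaningful.\<close>

lemma shift_strongly_continuous:
 assumes abcd: "a < b" "b < c" "c < d" and x: "x \<in> kernel_space B b c" and N: "N \<in> kernel_admissible B a d"
 shows "((%t. N (kernel_shift B t x - x)) \<longlongrightarrow> 0) (at 0)"
proof -
 have eq: "(kernel_norm B, N) \<in> fhs_equiv (kernel_space B a d)" using N unfolding kernel_admissible_iff .
 obtain C where C: "!!y. y \<in> kernel_space B a d ==> N y <= C * kernel_norm B y" using fhs_equivD(3)[OF eq] by blast
 obtain i where i: "inner_product_on (kernel_space B a d) i" "!!y. y \<in> kernel_space B a d ==> N y = sqrt (i y y)"
  using fhs_equivD(1)[OF eq] by blast
 have N0: "0 <= N y" if "y \<in> kernel_space B a d" for y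
  unfolding i(2)[OF that] using psd_form.nonneg[OF psd_form_inner_product[OF kernel_space_subspace i(1)] that] by simp
 define \<delta> where "\<delta> = min (b - a) (d - c)"
 have \<delta>: "\<delta> > 0" using abcd unfolding \<delta>_def by simp
 have in': "kernel_shift B t x - x \<in> kernel_space B a d" if "\<bar>t\<bar> < \<delta>" for t
 proof (rule subspace_diff[OF kernel_space_subspace])
  show "x \<in> kernel_space B a d" using x kernel_space_mono[of a b c d] abcd by auto
  show "kernel_shift B t x \<in> kernel_space B a d"
   by (rule subsetD[OF kernel_space_mono kernel_shift_in[OF x]]) (use that in \<open>auto simp: \<delta>_def\<close>)
 qed
 have "\<forall>\<^sub>F t in at (0::real). \<bar>t\<bar> < \<delta>"
  unfolding eventually_at using \<delta> by (intro exI[of _ \<delta>]) (simp add: dist_real_def)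
 then have ev: "\<forall>\<^sub>F t in at 0. norm (N (kernel_shift B t x - x)) <= C * kernel_norm B (kernel_shift B t x - x)"
 proof eventually_elim
  fix t assume "\<bar>t\<bar> < \<delta>"
  then show "norm (N (kernel_shift B t x - x)) <= C * kernel_norm B (kernel_shift B t x - x)"
   using C[OF in'] N0[OF in'] by simp
 qed
 show ?thesis by (rule Lim_null_comparison[OF ev tendsto_mult_right_zero[OF shift_continuous[OF abcd(2) x]]])
qed

theorem kernel_sum_system:
 "sum_system (kernel_global_space B) (kernel_space B) (kernel_admissible B) (kernel_shift B)"
 unfolding sum_system_def
proof (intro conjI allI impI ballI)
 show "subspace (kernel_global_space B)" by (rule kernel_global_subspace)
 show "fhs_space (kernel_space B a b) (kernel_admissible B a b)" if "a < b" for a b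
  unfolding fhs_space_def kernel_admissible_def by (intro quotientI CollectI kernel_space_separable(1)[OF that])
 show "kernel_space B a b <= kernel_global_space B" if "a < b" for a b by (rule kernel_space_global[OF that])
 show "linear_map_on (kernel_global_space B) (kernel_shift B t)" for t
  using kernel_shift_linear[of t] kernel_global_total unfolding linear_map_on_def by blast
 show "kernel_shift B t ` kernel_global_space B <= kernel_global_space B" for t by (rule kernel_shift_global)
 show "kernel_shift B 0 x = x" if "x \<in> kernel_global_space B" for x
  by (rule kernel_shift_zero) (use that kernel_global_total in blast)
 show "kernel_shift B (s + t) x = kernel_shift B s (kernel_shift B t x)" if "x \<in> kernel_global_space B" for s t x
  by (rule kernel_shift_add) (use that kernel_global_total in blast)
 show "fhs_isomorphism (kernel_space B a b) (kernel_admissible B a b) (kernel_space B (a + t) (b + t))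
  (kernel_admissible B (a + t) (b + t)) (kernel_shift B t)" if "a < b" for a b t
  by (rule kernel_shift_isomorphism[OF that])
 show "((%t. N (kernel_shift B t x - x)) \<longlongrightarrow> 0) (at 0)"
  if "a < b & b < c & c < d" "x \<in> kernel_space B b c" "N \<in> kernel_admissible B a d" for a b c d x N
  using shift_strongly_continuous that by blast
 fix a b c :: real assume abc: "a < b & b < c"
 show "fhs_direct_sum (kernel_space B a c) (kernel_admissible B a c) (kernel_space B a b) (kernel_space B b c)"
  using kernel_space_direct_sum abc by blast
 show "kernel_admissible B a b = fhs_inherited (kernel_admissible B a c) (kernel_space B a b)"
  by (rule kernel_admissible_inherited) (use abc kernel_space_mono[of a a b c] in auto)
 show "kernel_admissible B b c = fhs_inherited (kernel_admissible B a c) (kernel_space B b c)"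
  by (rule kernel_admissible_inherited) (use abc kernel_space_mono[of a b c c] in auto)
qed

end

theorem theorem9p11:
  fixes \<alpha> :: real and B :: "real \<Rightarrow> real"
  assumes "\<alpha> > 1"
    and "\<forall>t. t \<noteq> 0 \<longrightarrow> B (- t) = B t"
    and "\<forall>t>0. B t \<ge> 0"
    and "antimono_on {0<..} B"
    and "convex_on {0<..} B"
    and "\<exists>\<epsilon>>0. \<forall>t\<in>{0<..<\<epsilon>}. B t = 1 / (t * ln (1 / t) powr \<alpha>)"
  shows "sum_system (kernel_global_space B) (kernel_space B) (kernel_admissible B) (kernel_shift B)"
  by (rule log_kernel.kernel_sum_system[OF log_kernel.intro[OF assms]])

end
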